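(* Assume that the environment $(P_1,P_2,\ldots)$ of the first generation has the ${\rm GEM}(0,1)$ distribution, i.e. $P_r=W_1W_2\cdots W_{r-1}(1-W_r)$, $r\in\mathbb{N}$, where $W_1,W_2,\ldots$ are independent random variables with the uniform distribution on $[0,1]$. Let $(j_n)_{n\in\mathbb{N}}$ be a sequence of positive numbers satisfying $j_n\to\infty$ and $j_n=o(\log n)$ as $n\to\infty$. Then, as $n\to\infty$, the processes $$\Bigg(\frac{\lfloor j_n\rfloor^{1/2}(\lfloor j_n u\rfloor-1)!\,\big(K_n(\lfloor j_n u\rfloor)-(\log n)^{\lfloor j_n u\rfloor}/\lfloor j_n u\rfloor!\big)}{(\log n)^{\lfloor j_n u\rfloor-1/2}}\Bigg)_{u>0}$$ converge, in the sense of weak convergence of finite-dimensional distributions, to $$\Bigg(\int_{[0,\infty)}e^{-uy}\,{\rm d}B(y)\Bigg)_{u>0},$$ where $(B(v))_{v\ge 0}$ is a standard Brownian motion.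
   Context: Nested occupancy scheme. Let $\mathbb{V}=\bigcup_{k\ge 0}\mathbb{N}^k$ (with $\mathbb{N}^0=\{\varnothing\}$); for $v\in\mathbb{N}^k$ write $|v|=k$ (generation $k$), and for $v=v_1\ldots v_k$ and $r\in\mathbb{N}$ write $vr=v_1\ldots v_k r$. Let $(P_r)_{r\in\mathbb{N}}$ be a random sequence of positive numbers with $\sum_{r\ge1}P_r=1$ a.s. and let $((P_r(v))_{r\in\mathbb{N}})_{v\in\mathbb{V}}$ be independent copies of $(P_r)_{r\in\mathbb{N}}$. Define weights by $P(\varnothing)=1$ and $P(vr)=P(v)P_r(v)$; then $\sum_{|v|=j}P(v)=1$ a.s. for each $j\in\mathbb{N}$. Individuals $v\in\mathbb{V}$ are identified with boxes. There are $n$ balls, all in box $\varnothing$ at time $0$. Given all the weights, each ball located in a box $v$ of generation $k$ is placed, independently of the other balls, into the box $vr$ of generation $k+1$ with probability $P_r(v)=P(vr)/P(v)$. $K_n(j)$ denotes the number of boxes in generation $j$ that contain at least one of the $n$ balls. $\lfloor x\rfloor$ is the floor function. For each fixed $u>0$ the quantities above are well defined for all sufficiently large $n$ (when $\lfloor j_nu\rfloor\ge1$), which suffices for convergence of finite-dimensional distributions (joint convergence in distribution of the values at any finitely many points $u_1,\ldots,u_\ell>0$). The limit process is defined via integration by parts: $\int_{[0,\infty)}e^{-uy}\,{\rm d}B(y)=u\int_0^\infty e^{-uy}B(y)\,{\rm d}y$ for $u>0$. *)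

theory Defs
  imports "HOL-Probability.Probability" "HOL-Library.Landau_Symbols"
begin

text \<open>Individuals of the tree (boxes) are finite words, of type \<^typ>\<open>nat list\<close>; the root is
  \<^term>\<open>[]\<close>, the generation of \<open>v\<close> is \<^term>\<open>length v\<close> and the \<open>r\<close>-th child of \<open>v\<close> is
  \<open>v @ [r]\<close>. The letters start at \<open>0\<close> instead of \<open>1\<close>.\<close>

abbreviation seq_space :: "(nat \<Rightarrow> real) measure" where
  "seq_space \<equiv> PiM UNIV (\<lambda>_. borel)"

text \<open>The law of \<open>(W\<^sub>1 \<cdots> W\<^sub>r\<^sub>-\<^sub>1 (1 - W\<^sub>r))\<close>, \<open>r = 1, 2, \<dots>\<close>, shifted to indices starting at \<open>0\<close>.\<close>

definition GEM01 :: "(nat \<Rightarrow> real) measure" where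
  "GEM01 = distr (PiM UNIV (\<lambda>_. uniform_measure lborel {0..1})) seq_space
             (\<lambda>w r. (\<Prod>i<r. w i) * (1 - w r))"

text \<open>\<open>P v \<omega> r\<close> is the \<open>r\<close>-th term of the copy of \<open>(P\<^sub>r)\<close> attached to \<open>v\<close>, that is,
  the ratio \<open>P(vr) / P(v)\<close> of weights.\<close>

locale nested_environment = prob_space M
  for M :: "'a measure" +
  fixes law :: "(nat \<Rightarrow> real) measure"
    and P :: "nat list \<Rightarrow> 'a \<Rightarrow> nat \<Rightarrow> real"
  assumes law_positive: "AE p in law. \<forall>r. p r > 0"
    and law_sums: "AE p in law. p sums 1"
    and P_indep: "indep_vars (\<lambda>_. seq_space) P UNIV"
    and P_law: "distr M seq_space (P v) = law"

text \<open>The information carried by all weights and by the positions of the \<open>n\<close> balls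
  up to time \<open>k\<close>; \<open>X i l\<close> is the box of generation \<open>l\<close> which contains ball \<open>i\<close>.\<close>

definition history ::
  "'a measure \<Rightarrow> (nat list \<Rightarrow> 'a \<Rightarrow> nat \<Rightarrow> real) \<Rightarrow> nat \<Rightarrow> (nat \<Rightarrow> nat \<Rightarrow> 'a \<Rightarrow> nat list)
    \<Rightarrow> nat \<Rightarrow> 'a measure" where
  "history M P n X k = sigma (space M)
     ({P v -` A \<inter> space M | v A. A \<in> sets seq_space} \<union>
      {X i l -` B \<inter> space M | i l B. i < n \<and> l \<le> k})"

locale nested_occupancy = nested_environment M law P
  for M :: "'a measure" and law P +
  fixes n :: nat
    and X :: "nat \<Rightarrow> nat \<Rightarrow> 'a \<Rightarrow> nat list"
  assumes X_measurable: "i < n \<Longrightarrow> X i k \<in> measurable M (count_space UNIV)"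
    and X_root: "i < n \<Longrightarrow> \<omega> \<in> space M \<Longrightarrow> X i 0 \<omega> = []"
    and X_step: "AE \<omega> in M.
      real_cond_exp M (history M P n X k)
        (indicator {\<omega> \<in> space M. \<forall>i<n. X i (Suc k) \<omega> = X i k \<omega> @ [r i]}) \<omega>
      = (\<Prod>i<n. P (X i k \<omega>) \<omega> (r i))"

definition occupied :: "nat \<Rightarrow> (nat \<Rightarrow> nat \<Rightarrow> 'a \<Rightarrow> nat list) \<Rightarrow> nat \<Rightarrow> 'a \<Rightarrow> nat" where
  "occupied n X j \<omega> = card {v. length v = j \<and> (\<exists>i<n. X i j \<omega> = v)}"

text \<open>Continuity is required of all paths, which makes path integrals of \<open>B\<close> measurable
  without completeness of \<open>N\<close>.\<close>

locale standard_brownian_motion = prob_space N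
  for N :: "'b measure" +
  fixes B :: "real \<Rightarrow> 'b \<Rightarrow> real"
  assumes B_measurable: "t \<ge> 0 \<Longrightarrow> B t \<in> borel_measurable N"
    and B_zero: "AE \<omega> in N. B 0 \<omega> = 0"
    and B_indep_increments:
      "0 \<le> \<tau> 0 \<Longrightarrow> (\<And>i. i < m \<Longrightarrow> \<tau> i < \<tau> (Suc i)) \<Longrightarrow>
        indep_vars (\<lambda>_. borel) (\<lambda>i \<omega>. B (\<tau> (Suc i)) \<omega> - B (\<tau> i) \<omega>) {..<m :: nat}"
    and B_normal_increments:
      "0 \<le> s \<Longrightarrow> s < t \<Longrightarrow>
        distributed N lborel (\<lambda>\<omega>. B t \<omega> - B s \<omega>) (normal_density 0 (sqrt (t - s)))"
    and B_continuous: "\<omega> \<in> space N \<Longrightarrow> continuous_on {0..} (\<lambda>t. B t \<omega>)"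

text \<open>\<open>\<integral>\<^bsub>[0,\<infinity>)\<^esub> exp (-u y) dB(y)\<close>, defined through integration by parts.\<close>

definition exp_stieltjes :: "(real \<Rightarrow> 'b \<Rightarrow> real) \<Rightarrow> real \<Rightarrow> 'b \<Rightarrow> real" where
  "exp_stieltjes B u \<omega> = u * (LBINT y:{0..}. exp (- u * y) * B y \<omega>)"

text \<open>For finite \<open>U\<close>, the product topology over \<open>U\<close> is the Euclidean space with coordinates
  indexed by \<open>U\<close>; its points are the functions restricted to \<open>U\<close>.\<close>

definition fdd_converges ::
  "'i set \<Rightarrow> 'a measure \<Rightarrow> (nat \<Rightarrow> 'i \<Rightarrow> 'a \<Rightarrow> real) \<Rightarrow> 'b measure \<Rightarrow> ('i \<Rightarrow> 'b \<Rightarrow> real) \<Rightarrow> bool" where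
  "fdd_converges T M Z N Y \<longleftrightarrow>
     (\<forall>n. \<forall>u\<in>T. Z n u \<in> borel_measurable M) \<and> (\<forall>u\<in>T. Y u \<in> borel_measurable N) \<and>
     (\<forall>U f. finite U \<and> U \<subseteq> T \<and>
        continuous_map (product_topology (\<lambda>_. euclideanreal) U) euclideanreal f \<and>
        bounded (f ` (U \<rightarrow>\<^sub>E UNIV)) \<longrightarrow>
        (\<lambda>n. \<integral>\<omega>. f (\<lambda>u\<in>U. Z n u \<omega>) \<partial>M) \<longlonglongrightarrow> (\<integral>\<omega>. f (\<lambda>u\<in>U. Y u \<omega>) \<partial>N))"

text \<open>The normalisation is meaningful once \<open>m = \<lfloor>j\<^sub>n u\<rfloor> \<ge> 1\<close> and \<open>n \<ge> 2\<close>, hence for each fixed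
  \<open>u > 0\<close> for all large \<open>n\<close>; other values do not matter for the limit.\<close>

definition scaled_occupancy ::
  "(nat \<Rightarrow> real) \<Rightarrow> (nat \<Rightarrow> nat \<Rightarrow> nat \<Rightarrow> 'a \<Rightarrow> nat list) \<Rightarrow> nat \<Rightarrow> real \<Rightarrow> 'a \<Rightarrow> real" where
  "scaled_occupancy j X n u \<omega> =
     (let m = nat \<lfloor>j n * u\<rfloor> in
        sqrt (real_of_int \<lfloor>j n\<rfloor>) * fact (m - 1) *
        (real (occupied n (X n) m \<omega>) - ln (real n) ^ m / fact m)
        / ln (real n) powr (real m - 1 / 2))"

end

theory Submission imports Defs "HOL-Real_Asymp.Real_Asymp"
begin

text \<open>Put \<open>L = ln n\<close>, \<open>m = \<lfloor>j\<^sub>n u\<rfloor> = k + 1\<close> and \<open>\<alpha> = \<lfloor>j\<^sub>n\<rfloor>\<close>. The number of occupied boxes of generation \<open>m\<close>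
depends on far fewer sources of randomness than it seems: after scaling, only the environment of
the first generation survives in the limit. Four replacements show this, and each of them costs
\<open>O(sqrt (\<alpha> / L))\<close> in mean, which vanishes because \<open>j\<^sub>n = o(ln n)\<close>.

\<^item> Given the environment, the events that two distinct boxes of one generation are occupied are
  negatively correlated. So the conditional variance of \<open>K\<^sub>n(m)\<close> is at most its conditional mean,
  and \<open>K\<^sub>n(m)\<close> may be replaced by that mean (\<open>occupied_vs_conditional_mean\<close>).
\<^item> A box of weight \<open>P(v)\<close> is occupied with conditional probability \<open>1 - (1 - P(v))\<^sup>n\<close>, which is close
  to the indicator of \<open>n P(v) \<ge> 1\<close> unless \<open>n P(v)\<close> is of order one. So the conditional mean may be
  replaced by the number of boxes of weight at least \<open>1 / n\<close> (\<open>occupied_mean_vs_count\<close>).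
\<^item> Conditioning on the first generation turns that number into \<open>\<Sum>\<^sub>r (ln\<^sup>+ (n P\<^sub>r))\<^sup>k / k!\<close>. The
  variance that is lost is computed by Pythagoras, and only the diagonal parts of the two second
  moments differ (\<open>tree_sum_vs_first_gen_mean\<close>, \<open>count_vs_first_gen_mean\<close>).
\<^item> The weights \<open>P\<^sub>r = W\<^sub>1 \<cdots> W\<^sub>r\<^sub>-\<^sub>1 (1 - W\<^sub>r)\<close> may be replaced by the products \<open>W\<^sub>1 \<cdots> W\<^sub>r\<close>, as both sums
  have the same mean and are ordered up to one boundary term (\<open>nn_integral_gem_vs_renewal_sum\<close>).

The logarithms of the points \<open>n W\<^sub>1 \<cdots> W\<^sub>r\<close> form a Poisson process of rate one on \<open>(-\<infinity>, L)\<close>. Hence the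
characteristic function of a sum \<open>\<Sum>\<^sub>r H(n W\<^sub>1 \<cdots> W\<^sub>r)\<close> is exactly \<open>exp (\<integral> (exp (\<i> H(z)) - 1) dz / z)\<close>
over \<open>(0, n]\<close> (\<open>renewal_char_eq_poisson_char\<close>). For \<open>H\<close> a combination of the functions
\<open>(ln\<^sup>+ z)\<^sup>k / k!\<close>, the first-order term of the exponent is cancelled by the centring, the second-order
term is explicit, and the rest is of third order (\<open>poisson_exponent_approx\<close>). The normalisation
turns the second-order term for \<open>u\<close> and \<open>v\<close> into \<open>\<alpha> / (\<lfloor>j\<^sub>n u\<rfloor> + \<lfloor>j\<^sub>n v\<rfloor> - 1)\<close>, which tends to
\<open>1 / (u + v) = \<integral> exp (-u y) exp (-v y) dy\<close>, the covariance of the Gaussian limit process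
(\<open>char_exp_stieltjes\<close>). A theorem of Levy, Cramer and Wold finishes the proof
(\<open>fdd_converges_if_chars_converge\<close>).

Means over GEM sequences and over products of uniform variables are identified by recursion.
Splitting off the first uniform factor shows that they satisfy \<open>F = A + avg F\<close>, where \<open>avg F x\<close> is
the mean of \<open>F (x W)\<close> for a uniform \<open>W\<close>. Averaging contracts functions of linear growth, so such an
equation has only one solution of this kind (\<open>le_if_sub_and_super_solution\<close>); for sums over the
sequence it is an integral with respect to \<open>dz / z\<close>.\<close>

section \<open>From characteristic functions to finite-dimensional distributions\<close>

text \<open>These functions form an algebra, and their means under the law of a random vector are linear
combinations of values of its characteristic function.\<close>

inductive_set trig_polys :: "'i set \<Rightarrow> (('i \<Rightarrow> real) \<Rightarrow> real) set" for U where
  cos: "(\<lambda>x. a * cos (b + (\<Sum>u\<in>U. c u * x u))) \<in> trig_polys U"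
| add: "f \<in> trig_polys U \<Longrightarrow> g \<in> trig_polys U \<Longrightarrow> (\<lambda>x. f x + g x) \<in> trig_polys U"

lemma trig_polys_const: "(\<lambda>x. a) \<in> trig_polys U"
  using trig_polys.cos[of a 0 "\<lambda>_. 0" U] by simp

lemma trig_polys_mult:
  assumes "f \<in> trig_polys U" "g \<in> trig_polys U"
  shows "(\<lambda>x. f x * g x) \<in> trig_polys U"
  using assms(1)
proof induction
  case (cos a b c)
  show ?case using assms(2)
  proof induction
    case (cos a' b' c')
    let ?s = "\<lambda>c (x :: 'a \<Rightarrow> real). \<Sum>u\<in>U. c u * x u"
    have "(\<lambda>x. (a * cos (b + ?s c x)) * (a' * cos (b' + ?s c' x))) =
      (\<lambda>x. (a * a' / 2) * cos ((b - b') + ?s (\<lambda>u. c u - c' u) x)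
          + (a * a' / 2) * cos ((b + b') + ?s (\<lambda>u. c u + c' u) x))" (is "?l = ?r")
    proof
      fix x
      have "(b - b') + ?s (\<lambda>u. c u - c' u) x = (b + ?s c x) - (b' + ?s c' x)"
           "(b + b') + ?s (\<lambda>u. c u + c' u) x = (b + ?s c x) + (b' + ?s c' x)"
        by (simp_all add: algebra_simps sum.distrib sum_subtractf)
      thus "?l x = ?r x"
        by (simp only: cos_add[of "b + _"] cos_diff[of "b + _"]) (simp add: field_simps)
    qed
    show ?case unfolding \<open>?l = ?r\<close> by (intro trig_polys.add trig_polys.cos)
  next
    case (add f g)
    thus ?case by (simp add: ring_distribs trig_polys.add)
  qed
next
  case (add f g)
  thus ?case by (simp add: ring_distribs trig_polys.add)
qed

lemma trig_polys_sin:
  assumes "finite U" "u \<in> U"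
  shows "(\<lambda>x. sin (k * x u)) \<in> trig_polys U"
proof -
  have "(\<lambda>x. sin (k * x u)) = (\<lambda>x. 1 * cos (- (pi / 2) + (\<Sum>v\<in>U. (if v = u then k else 0) * x v)))"
  proof
    fix x :: "'a \<Rightarrow> real"
    have "(\<Sum>v\<in>U. (if v = u then k else 0) * x v) = (\<Sum>v\<in>U. if v = u then k * x v else 0)"
      by (intro sum.cong) auto
    also have "\<dots> = k * x u" using assms by simp
    finally show "sin (k * x u) = 1 * cos (- (pi / 2) + (\<Sum>v\<in>U. (if v = u then k else 0) * x v))"
      using cos_diff[of "k * x u" "pi / 2"] by simp
  qed
  thus ?thesis using trig_polys.cos[of 1 "- (pi/2)" "\<lambda>v. if v = u then k else 0" U] by simp
qed

inductive coordinate_poly :: "((nat \<Rightarrow> real) \<Rightarrow> real) \<Rightarrow> bool" where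
  const: "coordinate_poly (\<lambda>_. c)"
| coord: "coordinate_poly (\<lambda>s. s k)"
| add: "coordinate_poly f \<Longrightarrow> coordinate_poly g \<Longrightarrow> coordinate_poly (\<lambda>s. f s + g s)"
| mult: "coordinate_poly f \<Longrightarrow> coordinate_poly g \<Longrightarrow> coordinate_poly (\<lambda>s. f s * g s)"

lemma continuous_on_coordinate: "continuous_on S (\<lambda>s. s k)"
  by (rule continuous_on_subset[OF continuous_on_product_coordinates subset_UNIV])

lemma coordinate_poly_continuous: "coordinate_poly f \<Longrightarrow> continuous_on S f"
  by (induction rule: coordinate_poly.induct)
     (auto intro: continuous_on_const continuous_on_add continuous_on_mult continuous_on_coordinate)

text \<open>The substitution \<open>x\<^sub>u = l * arcsin s\<^sub>u\<close> with \<open>l = 2 K / \<pi>\<close> maps the cube of all \<open>s\<close> with entries in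
\<open>[-1, 1]\<close> onto the box \<open>[-K, K]\<^sup>U\<close>. The Stone-Weierstrass theorem on that compact cube gives a
polynomial \<open>p\<close>, and \<open>p\<close> evaluated at \<open>sin (x\<^sub>u / l)\<close> is a trigonometric polynomial. It is close to \<open>f\<close>
on the box, and its global bound comes for free: the sines never leave the cube.\<close>

lemma trig_polys_approx:
  fixes f :: "('i \<Rightarrow> real) \<Rightarrow> real"
  assumes U: "finite U"
    and f: "continuous_map (product_topology (\<lambda>_. euclideanreal) U) euclideanreal f"
    and B: "\<And>x. x \<in> U \<rightarrow>\<^sub>E UNIV \<Longrightarrow> \<bar>f x\<bar> \<le> B"
    and "K > 0" "\<epsilon> > 0"
  obtains g where "g \<in> trig_polys U" "\<And>x. \<bar>g x\<bar> \<le> B + \<epsilon>"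
    "\<And>x. (\<And>u. u \<in> U \<Longrightarrow> \<bar>x u\<bar> \<le> K) \<Longrightarrow> \<bar>f (restrict x U) - g x\<bar> \<le> \<epsilon>"
proof -
  define l where "l = 2 * K / pi"
  have l: "l > 0" using \<open>K > 0\<close> by (simp add: l_def)
  obtain idx :: "'i \<Rightarrow> nat" where idx: "inj_on idx U"
    using U finite_imp_inj_to_nat_seg by metis
  define S where "S = (PiE UNIV (\<lambda>_::nat. {-1..1::real}))"
  define \<phi> where "\<phi> = (\<lambda>s. f (\<lambda>u\<in>U. l * arcsin (s (idx u))))"
  have S: "compact S"
    using compactin_PiE[of "\<lambda>_. euclideanreal" "UNIV :: nat set" "\<lambda>_. {-1..1}"]
    by (simp add: euclidean_product_topology S_def)
  have "continuous_map (top_of_set S) (product_topology (\<lambda>_. euclideanreal) U)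
          (\<lambda>s. \<lambda>u\<in>U. l * arcsin (s (idx u)))"
    unfolding continuous_map_componentwise
  proof (safe, goal_cases)
    case (2 u)
    have "continuous_on S (\<lambda>s. l * arcsin (s (idx u)))"
      by (intro continuous_intros continuous_on_coordinate)
         (auto simp: S_def PiE_def Pi_def)
    thus ?case using 2 by simp
  qed auto
  from continuous_map_compose[OF this f] have cont: "continuous_on S \<phi>"
    by (simp add: \<phi>_def o_def)
  have "\<exists>p. coordinate_poly p \<and> (\<forall>s\<in>S. \<bar>\<phi> s - p s\<bar> < \<epsilon>)"
  proof (rule Stone_Weierstrass_HOL[OF S _ _ _ _ _ cont \<open>\<epsilon> > 0\<close>])
    fix s t :: "nat \<Rightarrow> real"
    assume "s \<in> S \<and> t \<in> S \<and> s \<noteq> t"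
    then obtain k where "s k \<noteq> t k" by auto
    thus "\<exists>p. coordinate_poly p \<and> p s \<noteq> p t" by (intro exI[of _ "\<lambda>s. s k"]) (auto intro: coordinate_poly.coord)
  qed (auto intro: coordinate_poly.intros coordinate_poly_continuous)
  then obtain p where p: "coordinate_poly p" "\<And>s. s \<in> S \<Longrightarrow> \<bar>\<phi> s - p s\<bar> < \<epsilon>" by blast
  define q where "q = (\<lambda>x k. if k \<in> idx ` U then sin ((1/l) * x (inv_into U idx k)) else (0::real))"
  have q: "q x \<in> S" for x by (auto simp: q_def S_def PiE_def Pi_def)
  have "(\<lambda>x. p (q x)) \<in> trig_polys U" using p(1)
  proof induction
    case (coord k)
    show ?case
    proof (cases "k \<in> idx ` U")
      case True
      hence "inv_into U idx k \<in> U" by (rule inv_into_into)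
      from trig_polys_sin[OF U this, of "1/l"] show ?thesis by (simp add: q_def True)
    next
      case False
      thus ?thesis using trig_polys_const[of 0 U] by (simp add: q_def)
    qed
  qed (auto intro: trig_polys_const trig_polys.add trig_polys_mult)
  moreover have "\<bar>p (q x)\<bar> \<le> B + \<epsilon>" for x
  proof -
    have "\<bar>\<phi> (q x)\<bar> \<le> B" unfolding \<phi>_def by (intro B) auto
    thus ?thesis using p(2)[OF q[of x]] by linarith
  qed
  moreover have "\<bar>f (restrict x U) - p (q x)\<bar> \<le> \<epsilon>" if x: "\<And>u. u \<in> U \<Longrightarrow> \<bar>x u\<bar> \<le> K" for x
  proof -
    have "l * arcsin (q x (idx u)) = x u" if "u \<in> U" for u
    proof -
      have "q x (idx u) = sin (x u / l)" using that idx by (simp add: q_def)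
      moreover have "\<bar>x u / l\<bar> \<le> pi / 2"
        using x[OF that] \<open>K > 0\<close> by (simp add: l_def field_simps abs_mult)
      hence "- (pi / 2) \<le> x u / l" "x u / l \<le> pi / 2" by linarith+
      ultimately show ?thesis using l by (simp add: arcsin_sin)
    qed
    hence "\<phi> (q x) = f (restrict x U)" unfolding \<phi>_def by (intro arg_cong[of _ _ f]) (auto simp: fun_eq_iff)
    thus ?thesis using p(2)[OF q[of x]] by simp
  qed
  ultimately show ?thesis using that by blast
qed

lemma trig_polys_integral_tendsto:
  fixes Z :: "nat \<Rightarrow> 'i \<Rightarrow> 'a \<Rightarrow> real" and Y :: "'i \<Rightarrow> 'b \<Rightarrow> real"
  assumes "prob_space M" "prob_space N"
    and Z [measurable]: "\<And>n u. u \<in> U \<Longrightarrow> Z n u \<in> borel_measurable M"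
    and Y [measurable]: "\<And>u. u \<in> U \<Longrightarrow> Y u \<in> borel_measurable N"
    and conv: "\<And>c. (\<lambda>n. \<integral>\<omega>. iexp (\<Sum>u\<in>U. c u * Z n u \<omega>) \<partial>M) \<longlonglongrightarrow> (\<integral>\<omega>. iexp (\<Sum>u\<in>U. c u * Y u \<omega>) \<partial>N)"
    and g: "g \<in> trig_polys U"
  shows "(\<lambda>n. \<integral>\<omega>. g (\<lambda>u. Z n u \<omega>) \<partial>M) \<longlonglongrightarrow> (\<integral>\<omega>. g (\<lambda>u. Y u \<omega>) \<partial>N)"
    and "\<And>n. integrable M (\<lambda>\<omega>. g (\<lambda>u. Z n u \<omega>))" and "integrable N (\<lambda>\<omega>. g (\<lambda>u. Y u \<omega>))"
proof -
  interpret M: prob_space M by fact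
  interpret N: prob_space N by fact
  have "(\<lambda>n. \<integral>\<omega>. g (\<lambda>u. Z n u \<omega>) \<partial>M) \<longlonglongrightarrow> (\<integral>\<omega>. g (\<lambda>u. Y u \<omega>) \<partial>N)
      \<and> (\<forall>n. integrable M (\<lambda>\<omega>. g (\<lambda>u. Z n u \<omega>))) \<and> integrable N (\<lambda>\<omega>. g (\<lambda>u. Y u \<omega>))"
    using g
  proof induction
    case (cos a b c)
    have Re: "a * cos (b + t) = Re (complex_of_real a * iexp b * iexp t)" for t
      by (simp add: cis_conv_exp[symmetric] cis_mult mult.assoc)
    have iM: "integrable M (\<lambda>\<omega>. iexp (\<Sum>u\<in>U. c u * Z n u \<omega>))" for n
      by (rule M.integrable_const_bound[where B = 1]) auto
    have iN: "integrable N (\<lambda>\<omega>. iexp (\<Sum>u\<in>U. c u * Y u \<omega>))"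
      by (rule N.integrable_const_bound[where B = 1]) auto
    have 1: "(\<integral>\<omega>. a * cos (b + (\<Sum>u\<in>U. c u * Z n u \<omega>)) \<partial>M)
      = Re (complex_of_real a * iexp b * (\<integral>\<omega>. iexp (\<Sum>u\<in>U. c u * Z n u \<omega>) \<partial>M))" for n
      unfolding Re using iM[of n] by (subst integral_Re) (auto intro!: integrable_mult_right)
    have 2: "(\<integral>\<omega>. a * cos (b + (\<Sum>u\<in>U. c u * Y u \<omega>)) \<partial>N)
      = Re (complex_of_real a * iexp b * (\<integral>\<omega>. iexp (\<Sum>u\<in>U. c u * Y u \<omega>) \<partial>N))"
      unfolding Re using iN by (subst integral_Re) (auto intro!: integrable_mult_right)
    have "integrable M (\<lambda>\<omega>. a * cos (b + (\<Sum>u\<in>U. c u * Z n u \<omega>)))" for n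
      by (rule M.integrable_const_bound[where B = "\<bar>a\<bar>"]) (auto simp: abs_mult mult_left_le)
    moreover have "integrable N (\<lambda>\<omega>. a * cos (b + (\<Sum>u\<in>U. c u * Y u \<omega>)))"
      by (rule N.integrable_const_bound[where B = "\<bar>a\<bar>"]) (auto simp: abs_mult mult_left_le)
    ultimately show ?case unfolding 1 2
      by (intro conjI allI tendsto_intros conv) auto
  next
    case (add f g)
    thus ?case by (auto intro!: tendsto_intros)
  qed
  thus "(\<lambda>n. \<integral>\<omega>. g (\<lambda>u. Z n u \<omega>) \<partial>M) \<longlonglongrightarrow> (\<integral>\<omega>. g (\<lambda>u. Y u \<omega>) \<partial>N)"
    and "\<And>n. integrable M (\<lambda>\<omega>. g (\<lambda>u. Z n u \<omega>))" and "integrable N (\<lambda>\<omega>. g (\<lambda>u. Y u \<omega>))"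
    by auto
qed

text \<open>Tightness of the one-dimensional marginals. Levy's continuity theorem gives weak convergence, which
is tested with the piecewise linear functions \<open>t K\<close> that vanish on \<open>\<bar>x\<bar> \<le> K - 1\<close> and equal \<open>1\<close> on
\<open>\<bar>x\<bar> \<ge> K\<close>.\<close>

lemma tails_vanish_if_chars_converge:
  fixes Z :: "nat \<Rightarrow> 'a \<Rightarrow> real" and Y :: "'b \<Rightarrow> real"
  assumes "prob_space M" "prob_space N"
    and Z [measurable]: "\<And>n. Z n \<in> borel_measurable M"
    and Y [measurable]: "Y \<in> borel_measurable N"
    and conv: "\<And>c. (\<lambda>n. \<integral>\<omega>. iexp (c * Z n \<omega>) \<partial>M) \<longlonglongrightarrow> (\<integral>\<omega>. iexp (c * Y \<omega>) \<partial>N)"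
    and "\<epsilon> > 0"
  shows "\<forall>\<^sub>F K in sequentially. (\<forall>\<^sub>F n in sequentially. measure M {\<omega>\<in>space M. \<bar>Z n \<omega>\<bar> > real K} < \<epsilon>)
            \<and> measure N {\<omega>\<in>space N. \<bar>Y \<omega>\<bar> > real K} < \<epsilon>"
proof -
  interpret M: prob_space M by fact
  interpret N: prob_space N by fact
  define t where "t = (\<lambda>(K::nat) x. max 0 (min 1 (\<bar>x\<bar> - real K + 1)))"
  have t_meas [measurable]: "t K \<in> borel_measurable borel" for K unfolding t_def by measurable
  have t01: "0 \<le> t K x" "t K x \<le> 1" for K x by (auto simp: t_def)
  have iM: "integrable M (\<lambda>\<omega>. t K (Z n \<omega>))" for K n
    by (rule M.integrable_const_bound[where B=1]) (use t01 in auto)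
  have iN: "integrable N (\<lambda>\<omega>. t K (Y \<omega>))" for K
    by (rule N.integrable_const_bound[where B=1]) (use t01 in auto)
  have w: "weak_conv_m (\<lambda>n. distr M borel (Z n)) (distr N borel Y)"
    using conv by (intro levy_continuity) (auto simp: char_def integral_distr)
  have rM: "real_distribution (distr M borel (Z n))" for n by simp
  have rN: "real_distribution (distr N borel Y)" by simp
  have conv_t: "(\<lambda>n. \<integral>\<omega>. t K (Z n \<omega>) \<partial>M) \<longlonglongrightarrow> (\<integral>\<omega>. t K (Y \<omega>) \<partial>N)" for K
  proof -
    have "(\<lambda>n. integral\<^sup>L (distr M borel (Z n)) (t K)) \<longlonglongrightarrow> integral\<^sup>L (distr N borel Y) (t K)"
      by (rule weak_conv_imp_integral_bdd_continuous_conv[OF rM rN w, where B=1])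
         (auto simp: t_def intro!: continuous_intros)
    thus ?thesis by (simp add: integral_distr)
  qed
  have lim0: "(\<lambda>K. \<integral>\<omega>. t K (Y \<omega>) \<partial>N) \<longlonglongrightarrow> (\<integral>\<omega>. 0 \<partial>N)"
  proof (rule integral_dominated_convergence[where w = "\<lambda>_. 1"])
    show "AE \<omega> in N. (\<lambda>K. t K (Y \<omega>)) \<longlonglongrightarrow> 0"
    proof (intro always_eventually allI)
      fix \<omega>
      obtain K0 where "real K0 > \<bar>Y \<omega>\<bar> + 1" using reals_Archimedean2 by blast
      hence "\<forall>\<^sub>F K in sequentially. t K (Y \<omega>) = 0"
        by (intro eventually_sequentiallyI[of K0]) (auto simp: t_def)
      thus "(\<lambda>K. t K (Y \<omega>)) \<longlonglongrightarrow> 0" by (rule tendsto_eventually)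
    qed
  qed (use t01 in auto)
  hence "\<forall>\<^sub>F K in sequentially. (\<integral>\<omega>. t K (Y \<omega>) \<partial>N) < \<epsilon>"
    using \<open>\<epsilon> > 0\<close> by (intro order_tendstoD(2)[OF lim0]) auto
  thus ?thesis
  proof eventually_elim
    case (elim K)
    have le: "indicator {\<omega>\<in>space M. \<bar>Z n \<omega>\<bar> > real K} \<omega> \<le> t K (Z n \<omega>)" for n \<omega>
      by (auto simp: indicator_def t_def)
    have le': "indicator {\<omega>\<in>space N. \<bar>Y \<omega>\<bar> > real K} \<omega> \<le> t K (Y \<omega>)" for \<omega>
      by (auto simp: indicator_def t_def)
    have "measure M {\<omega>\<in>space M. \<bar>Z n \<omega>\<bar> > real K} \<le> (\<integral>\<omega>. t K (Z n \<omega>) \<partial>M)" for n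
      using integral_mono[OF _ iM le, of n] by (auto simp: less_top[symmetric])
    moreover have "\<forall>\<^sub>F n in sequentially. (\<integral>\<omega>. t K (Z n \<omega>) \<partial>M) < \<epsilon>"
      using order_tendstoD(2)[OF conv_t elim] .
    ultimately have "\<forall>\<^sub>F n in sequentially. measure M {\<omega>\<in>space M. \<bar>Z n \<omega>\<bar> > real K} < \<epsilon>"
      by (elim eventually_mono) (meson le_less_trans)
    moreover have "measure N {\<omega>\<in>space N. \<bar>Y \<omega>\<bar> > real K} \<le> (\<integral>\<omega>. t K (Y \<omega>) \<partial>N)"
      using integral_mono[OF _ iN le'] by (auto simp: less_top[symmetric])
    ultimately show ?case using elim by auto
  qed
qed

lemma (in prob_space) integral_diff_le_off_box:
  fixes f g :: "'a \<Rightarrow> real" and Z :: "'i \<Rightarrow> 'a \<Rightarrow> real"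
  assumes "finite U" and [measurable]: "f \<in> borel_measurable M" "g \<in> borel_measurable M"
    "\<And>u. u \<in> U \<Longrightarrow> Z u \<in> borel_measurable M"
    and "\<And>\<omega>. \<bar>f \<omega>\<bar> \<le> B" "\<And>\<omega>. \<bar>g \<omega>\<bar> \<le> C" "\<epsilon> \<ge> 0"
    and close: "\<And>\<omega>. (\<And>u. u \<in> U \<Longrightarrow> \<bar>Z u \<omega>\<bar> \<le> K) \<Longrightarrow> \<bar>f \<omega> - g \<omega>\<bar> \<le> \<epsilon>"
  shows "\<bar>(\<integral>\<omega>. f \<omega> \<partial>M) - (\<integral>\<omega>. g \<omega> \<partial>M)\<bar> \<le> \<epsilon> + (B + C) * (\<Sum>u\<in>U. prob {\<omega>\<in>space M. \<bar>Z u \<omega>\<bar> > K})"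
proof -
  have [simp]: "integrable M f" "integrable M g"
    by (rule integrable_const_bound[where B=B], use assms in auto)
       (rule integrable_const_bound[where B=C], use assms in auto)
  have ind: "integrable M (\<lambda>\<omega>. indicator {\<omega>\<in>space M. \<bar>Z u \<omega>\<bar> > K} \<omega> :: real)" if "u \<in> U" for u
  proof -
    note [measurable] = assms(4)[OF that]
    have "{\<omega>\<in>space M. \<bar>Z u \<omega>\<bar> > K} \<in> events" by measurable
    thus ?thesis by (intro integrable_const_bound[where B=1] borel_measurable_indicator) auto
  qed
  have "B \<ge> 0" "C \<ge> 0" using assms(5,6) abs_ge_zero order_trans by blast+
  have pt: "\<bar>f \<omega> - g \<omega>\<bar> \<le> \<epsilon> + (B + C) * (\<Sum>u\<in>U. indicator {\<omega>\<in>space M. \<bar>Z u \<omega>\<bar> > K} \<omega>)"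
    if "\<omega> \<in> space M" for \<omega>
  proof (cases "\<forall>u\<in>U. \<bar>Z u \<omega>\<bar> \<le> K")
    case True
    hence "\<bar>f \<omega> - g \<omega>\<bar> \<le> \<epsilon>" by (intro close) auto
    moreover have "(B + C) * (\<Sum>u\<in>U. indicator {\<omega>\<in>space M. \<bar>Z u \<omega>\<bar> > K} \<omega>) \<ge> 0"
      using \<open>B \<ge> 0\<close> \<open>C \<ge> 0\<close> by (intro mult_nonneg_nonneg sum_nonneg) auto
    ultimately show ?thesis by linarith
  next
    case False
    then obtain u where u: "u \<in> U" "\<bar>Z u \<omega>\<bar> > K" by force
    have "(1::real) = indicator {\<omega>\<in>space M. \<bar>Z u \<omega>\<bar> > K} \<omega>" using u that by simp
    also have "\<dots> \<le> (\<Sum>u\<in>U. indicator {\<omega>\<in>space M. \<bar>Z u \<omega>\<bar> > K} \<omega>)"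
      using u \<open>finite U\<close> by (intro member_le_sum) auto
    finally have "B + C \<le> (B + C) * (\<Sum>u\<in>U. indicator {\<omega>\<in>space M. \<bar>Z u \<omega>\<bar> > K} \<omega>)"
      using \<open>B \<ge> 0\<close> \<open>C \<ge> 0\<close> by (simp add: mult_le_cancel_left1)
    moreover have "\<bar>f \<omega> - g \<omega>\<bar> \<le> B + C"
      using assms(5)[of \<omega>] assms(6)[of \<omega>] by linarith
    ultimately show ?thesis using \<open>\<epsilon> \<ge> 0\<close> by linarith
  qed
  have "\<bar>(\<integral>\<omega>. f \<omega> \<partial>M) - (\<integral>\<omega>. g \<omega> \<partial>M)\<bar> = \<bar>\<integral>\<omega>. f \<omega> - g \<omega> \<partial>M\<bar>" by simp
  also have "\<dots> \<le> (\<integral>\<omega>. \<bar>f \<omega> - g \<omega>\<bar> \<partial>M)" by (rule integral_abs_bound)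
  also have "\<dots> \<le> (\<integral>\<omega>. \<epsilon> + (B + C) * (\<Sum>u\<in>U. indicator {\<omega>\<in>space M. \<bar>Z u \<omega>\<bar> > K} \<omega>) \<partial>M)"
    using pt ind by (intro integral_mono) (auto intro!: integrable_add integrable_mult_right integrable_sum)
  also have "\<dots> = \<epsilon> + (B + C) * (\<Sum>u\<in>U. prob {\<omega>\<in>space M. \<bar>Z u \<omega>\<bar> > K})"
    using ind by (subst Bochner_Integration.integral_add) (auto simp: prob_space intro!: sum.cong)
  finally show ?thesis .
qed

text \<open>The domain of \<open>f\<close> is a topological space that is not a type, so measurability does not come from
continuity directly; but \<open>f\<close> is a pointwise limit of trigonometric polynomials that approximate it
on growing boxes.\<close>

lemma measurable_continuous_map_product:
  fixes Z :: "'i \<Rightarrow> 'a \<Rightarrow> real"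
  assumes U: "finite U" and Z [measurable]: "\<And>u. u \<in> U \<Longrightarrow> Z u \<in> borel_measurable M"
    and f: "continuous_map (product_topology (\<lambda>_. euclideanreal) U) euclideanreal f"
    and B: "\<And>x. x \<in> U \<rightarrow>\<^sub>E UNIV \<Longrightarrow> \<bar>f x\<bar> \<le> B"
  shows "(\<lambda>\<omega>. f (\<lambda>u\<in>U. Z u \<omega>)) \<in> borel_measurable M"
proof -
  have "\<exists>g\<in>trig_polys U. \<forall>x. (\<forall>u\<in>U. \<bar>x u\<bar> \<le> real (Suc k)) \<longrightarrow> \<bar>f (restrict x U) - g x\<bar> \<le> inverse (Suc k)" for k
    by (rule trig_polys_approx[OF U f B, of "real (Suc k)" "inverse (Suc k)"]) (simp, simp, simp, blast)
  then obtain g where g: "\<And>k. g k \<in> trig_polys U"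
    "\<And>k x. (\<forall>u\<in>U. \<bar>x u\<bar> \<le> real (Suc k)) \<Longrightarrow> \<bar>f (restrict x U) - g k x\<bar> \<le> inverse (Suc k)"
    by metis
  show ?thesis
  proof (rule borel_measurable_LIMSEQ_real)
    fix k
    show "(\<lambda>\<omega>. g k (\<lambda>u. Z u \<omega>)) \<in> borel_measurable M" using g(1)[of k]
      by induction measurable
  next
    fix \<omega>
    let ?x = "\<lambda>u. Z u \<omega>"
    obtain K where K: "real K > (\<Sum>u\<in>U. \<bar>?x u\<bar>)" using reals_Archimedean2 by blast
    have "\<forall>\<^sub>F k in sequentially. norm (g k ?x - f (restrict ?x U)) \<le> inverse (Suc k)"
    proof (rule eventually_sequentiallyI[of K])
      fix k assume "k \<ge> K"
      have "\<bar>?x u\<bar> \<le> real (Suc k)" if "u \<in> U" for u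
        using member_le_sum[OF that, of "\<lambda>u. \<bar>?x u\<bar>"] U K \<open>k \<ge> K\<close> by auto
      thus "norm (g k ?x - f (restrict ?x U)) \<le> inverse (Suc k)"
        using g(2)[of ?x k] by (simp add: abs_minus_commute)
    qed
    hence "(\<lambda>k. g k ?x - f (restrict ?x U)) \<longlonglongrightarrow> 0"
      by (rule Lim_null_comparison) (rule LIMSEQ_inverse_real_of_nat)
    thus "(\<lambda>k. g k ?x) \<longlonglongrightarrow> f (restrict ?x U)" by (rule LIM_zero_cancel)
  qed
qed

text \<open>The theorem of Levy, Cramer and Wold for the finite-dimensional distributions of processes. A test
function is replaced by a trigonometric polynomial on a large box, which changes its mean little
because the tails outside of the box are uniformly small.\<close>

theorem fdd_converges_if_chars_converge:
  fixes Z :: "nat \<Rightarrow> 'i \<Rightarrow> 'a \<Rightarrow> real" and Y :: "'i \<Rightarrow> 'b \<Rightarrow> real"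
  assumes "prob_space M" "prob_space N"
    and Z: "\<And>n u. u \<in> T \<Longrightarrow> Z n u \<in> borel_measurable M"
    and Y: "\<And>u. u \<in> T \<Longrightarrow> Y u \<in> borel_measurable N"
    and conv: "\<And>U c. finite U \<Longrightarrow> U \<subseteq> T \<Longrightarrow>
      (\<lambda>n. \<integral>\<omega>. iexp (\<Sum>u\<in>U. c u * Z n u \<omega>) \<partial>M) \<longlonglongrightarrow> (\<integral>\<omega>. iexp (\<Sum>u\<in>U. c u * Y u \<omega>) \<partial>N)"
  shows "fdd_converges T M Z N Y"
  unfolding fdd_converges_def
proof (intro conjI allI ballI impI; (elim conjE)?)
  fix U f assume U: "finite U" "U \<subseteq> T"
    and f: "continuous_map (product_topology (\<lambda>_. euclideanreal) U) euclideanreal f"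
    and "bounded (f ` (U \<rightarrow>\<^sub>E UNIV))"
  then obtain B0 where B0: "\<And>x. x \<in> U \<rightarrow>\<^sub>E UNIV \<Longrightarrow> \<bar>f x\<bar> \<le> B0"
    unfolding bounded_iff by auto
  define B where "B = \<bar>B0\<bar>"
  have B: "\<bar>f x\<bar> \<le> B" if "x \<in> U \<rightarrow>\<^sub>E UNIV" for x using B0[OF that] by (simp add: B_def)
  interpret M: prob_space M by fact
  interpret N: prob_space N by fact
  have Zm [measurable]: "Z n u \<in> borel_measurable M" if "u \<in> U" for n u using Z U that by auto
  have Ym [measurable]: "Y u \<in> borel_measurable N" if "u \<in> U" for u using Y U that by auto
  note meas [measurable] = measurable_continuous_map_product[OF U(1) Zm f B]
    measurable_continuous_map_product[OF U(1) Ym f B]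
  show "(\<lambda>n. \<integral>\<omega>. f (\<lambda>u\<in>U. Z n u \<omega>) \<partial>M) \<longlonglongrightarrow> (\<integral>\<omega>. f (\<lambda>u\<in>U. Y u \<omega>) \<partial>N)"
  proof (rule tendstoI)
    fix e :: real assume "e > 0"
    define \<epsilon> where "\<epsilon> = min 1 (e / 6)"
    \<comment> \<open>\<open>2 * B + 1\<close> bounds the test function plus its approximation, so tails below \<open>\<delta>\<close> in all \<open>card U\<close>
      coordinates contribute at most \<open>\<epsilon>\<close>\<close>
    define \<delta> where "\<delta> = \<epsilon> / ((2 * B + 1) * (real (card U) + 1))"
    have "\<epsilon> > 0" "\<epsilon> \<le> 1" "6 * \<epsilon> \<le> e" "B \<ge> 0" using \<open>e > 0\<close> by (auto simp: \<epsilon>_def B_def)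
    hence "\<delta> > 0" by (simp add: \<delta>_def)
    have \<delta>: "(2 * B + 1) * (real (card U) * \<delta>) \<le> \<epsilon>"
    proof -
      have "(2 * B + 1) * (real (card U) * \<delta>) = \<epsilon> * (real (card U) / (real (card U) + 1))"
        using \<open>B \<ge> 0\<close> by (simp add: \<delta>_def)
      also have "\<dots> \<le> \<epsilon> * 1" using \<open>\<epsilon> > 0\<close> by (intro mult_left_mono) auto
      finally show ?thesis by simp
    qed
    have "\<forall>u\<in>U. \<forall>\<^sub>F K in sequentially. (\<forall>\<^sub>F n in sequentially. measure M {\<omega>\<in>space M. \<bar>Z n u \<omega>\<bar> > real K} < \<delta>)
            \<and> measure N {\<omega>\<in>space N. \<bar>Y u \<omega>\<bar> > real K} < \<delta>"
    proof
      fix u assume u: "u \<in> U"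
      show "\<forall>\<^sub>F K in sequentially. (\<forall>\<^sub>F n in sequentially. measure M {\<omega>\<in>space M. \<bar>Z n u \<omega>\<bar> > real K} < \<delta>)
            \<and> measure N {\<omega>\<in>space N. \<bar>Y u \<omega>\<bar> > real K} < \<delta>"
        using conv[of "{u}" "\<lambda>_. _"] u U(2)
        by (intro tails_vanish_if_chars_converge \<open>\<delta> > 0\<close> assms(1,2)) auto
    qed
    hence "\<forall>\<^sub>F K in sequentially. \<forall>u\<in>U. (\<forall>\<^sub>F n in sequentially. measure M {\<omega>\<in>space M. \<bar>Z n u \<omega>\<bar> > real K} < \<delta>)
            \<and> measure N {\<omega>\<in>space N. \<bar>Y u \<omega>\<bar> > real K} < \<delta>"
      using U(1) by (simp add: eventually_ball_finite_distrib)
    from eventually_happens'[OF sequentially_bot eventually_conj[OF this eventually_gt_at_top[of 0]]] obtain K :: nat where K: "K > 0"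
      "\<And>u. u \<in> U \<Longrightarrow> \<forall>\<^sub>F n in sequentially. measure M {\<omega>\<in>space M. \<bar>Z n u \<omega>\<bar> > real K} < \<delta>"
      "\<And>u. u \<in> U \<Longrightarrow> measure N {\<omega>\<in>space N. \<bar>Y u \<omega>\<bar> > real K} < \<delta>"
      by blast
    obtain g where g: "g \<in> trig_polys U" "\<And>x. \<bar>g x\<bar> \<le> B + \<epsilon>"
      "\<And>x. (\<And>u. u \<in> U \<Longrightarrow> \<bar>x u\<bar> \<le> real K) \<Longrightarrow> \<bar>f (restrict x U) - g x\<bar> \<le> \<epsilon>"
      using trig_polys_approx[OF U(1) f B, of "real K" \<epsilon>] K(1) \<open>\<epsilon> > 0\<close> by (metis of_nat_0_less_iff)
    note T = trig_polys_integral_tendsto[OF assms(1,2) Zm Ym conv[OF U] g(1)]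
    have bound: "\<epsilon> + (B + (B + \<epsilon>)) * s \<le> 2 * \<epsilon>" if "s \<le> real (card U) * \<delta>" "0 \<le> s" for s
    proof -
      have "(B + (B + \<epsilon>)) * s \<le> (2 * B + 1) * (real (card U) * \<delta>)"
        using that \<open>B \<ge> 0\<close> \<open>\<epsilon> \<le> 1\<close> \<open>\<epsilon> > 0\<close> by (intro mult_mono) auto
      thus ?thesis using \<delta> by linarith
    qed
    have N: "\<bar>(\<integral>\<omega>. f (\<lambda>u\<in>U. Y u \<omega>) \<partial>N) - (\<integral>\<omega>. g (\<lambda>u. Y u \<omega>) \<partial>N)\<bar> \<le> 2 * \<epsilon>"
    proof (rule order.trans[OF N.integral_diff_le_off_box[where Z = Y and U = U and K = K and \<epsilon> = \<epsilon> and B = B and C = "B + \<epsilon>"]])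
      show "\<epsilon> + (B + (B + \<epsilon>)) * (\<Sum>u\<in>U. N.prob {\<omega>\<in>space N. \<bar>Y u \<omega>\<bar> > real K}) \<le> 2 * \<epsilon>"
        using K(3) by (intro bound sum_nonneg sum_bounded_above) (auto intro: less_imp_le)
    qed (use U B g borel_measurable_integrable[OF T(3)] \<open>\<epsilon> > 0\<close> meas Ym in auto)
    have "\<forall>\<^sub>F n in sequentially. \<forall>u\<in>U. measure M {\<omega>\<in>space M. \<bar>Z n u \<omega>\<bar> > real K} < \<delta>"
      using K(2) U(1) by (simp add: eventually_ball_finite_distrib)
    moreover have "\<forall>\<^sub>F n in sequentially. dist (\<integral>\<omega>. g (\<lambda>u. Z n u \<omega>) \<partial>M) (\<integral>\<omega>. g (\<lambda>u. Y u \<omega>) \<partial>N) < \<epsilon>"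
      using T(1) \<open>\<epsilon> > 0\<close> by (rule tendstoD)
    ultimately show "\<forall>\<^sub>F n in sequentially. dist (\<integral>\<omega>. f (\<lambda>u\<in>U. Z n u \<omega>) \<partial>M) (\<integral>\<omega>. f (\<lambda>u\<in>U. Y u \<omega>) \<partial>N) < e"
    proof eventually_elim
      case (elim n)
      have "\<bar>(\<integral>\<omega>. f (\<lambda>u\<in>U. Z n u \<omega>) \<partial>M) - (\<integral>\<omega>. g (\<lambda>u. Z n u \<omega>) \<partial>M)\<bar> \<le> 2 * \<epsilon>"
      proof (rule order.trans[OF M.integral_diff_le_off_box[where Z = "Z n" and U = U and K = K and \<epsilon> = \<epsilon> and B = B and C = "B + \<epsilon>"]])
        show "\<epsilon> + (B + (B + \<epsilon>)) * (\<Sum>u\<in>U. M.prob {\<omega>\<in>space M. \<bar>Z n u \<omega>\<bar> > real K}) \<le> 2 * \<epsilon>"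
          using elim(1) by (intro bound sum_nonneg sum_bounded_above) (auto intro: less_imp_le)
      qed (use U B g borel_measurable_integrable[OF T(2)] \<open>\<epsilon> > 0\<close> meas Zm in auto)
      thus ?case using N elim(2) \<open>6 * \<epsilon> \<le> e\<close> \<open>\<epsilon> > 0\<close> unfolding dist_real_def by linarith
    qed
  qed
qed (use Z Y in auto)

section \<open>The limit process\<close>

lemma telescope_up_to:
  fixes a :: "nat \<Rightarrow> real"
  shows "(\<Sum>k<K. (a (Suc k) - a k) * of_bool (k \<le> m)) = a (min (Suc m) K) - a 0"
proof -
  have "(\<Sum>k<K. (a (Suc k) - a k) * of_bool (k \<le> m)) = (\<Sum>k<min (Suc m) K. a (Suc k) - a k)"
    by (intro sum.mono_neutral_cong_right) auto
  thus ?thesis by (simp add: sum_lessThan_telescope)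
qed

text \<open>The sums run over a grid of mesh \<open>1 / (n + 1)\<close> up to time \<open>n + 1\<close>, the same grid on which Brownian
motion is discretised below.\<close>

lemma riemann_sum_exp_tendsto:
  assumes "(w::real) > 0"
  shows "(\<lambda>n. (\<Sum>k<(Suc n)^2. exp (- w * (real k / real (Suc n)))) / real (Suc n)) \<longlonglongrightarrow> 1 / w"
proof -
  have "(\<Sum>k<(Suc n)^2. exp (- w * (real k / real (Suc n)))) = (1 - exp (- w * real (Suc n))) / (1 - exp (- w / real (Suc n)))" for n
  proof -
    have "(\<Sum>k<(Suc n)^2. exp (- w * (real k / real (Suc n)))) = (\<Sum>k<(Suc n)^2. exp (- w / real (Suc n)) ^ k)"
      by (simp add: exp_of_nat_mult[symmetric] mult_ac)
    also have "\<dots> = (1 - exp (- w / real (Suc n)) ^ ((Suc n)^2)) / (1 - exp (- w / real (Suc n)))"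
      using assms by (subst sum_gp_strict) auto
    also have "exp (- w / real (Suc n)) ^ ((Suc n)^2) = exp (- w * real (Suc n))"
      by (subst exp_of_nat_mult[symmetric]) (simp add: power2_eq_square field_simps)
    finally show ?thesis .
  qed
  moreover have "(\<lambda>n. (1 - exp (- w * real (Suc n))) / (1 - exp (- w / real (Suc n))) / real (Suc n)) \<longlonglongrightarrow> 1 / w"
    using assms by (real_asymp simp: inverse_eq_divide)
  ultimately show ?thesis by (simp add: inverse_eq_divide)
qed

text \<open>Closeness in mean passes to characteristic functions because \<open>x \<mapsto> exp (\<i> x)\<close> is \<open>1\<close>-Lipschitz.\<close>

lemma (in prob_space) char_diff_le:
  assumes [measurable]: "f \<in> borel_measurable M" "g \<in> borel_measurable M"
  shows "ennreal (norm ((\<integral>\<omega>. iexp (f \<omega>) \<partial>M) - (\<integral>\<omega>. iexp (g \<omega>) \<partial>M))) \<le> (\<integral>\<^sup>+\<omega>. ennreal \<bar>f \<omega> - g \<omega>\<bar> \<partial>M)"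
proof -
  have i: "integrable M (\<lambda>\<omega>. iexp (f \<omega>))" "integrable M (\<lambda>\<omega>. iexp (g \<omega>))"
    by (rule integrable_const_bound[where B = 1]; simp)+
  have le: "norm (iexp x - iexp y) \<le> \<bar>x - y\<bar>" for x y
  proof -
    have "iexp x - iexp y = iexp y * (iexp (x - y) - 1)"
      by (simp add: algebra_simps mult_exp_exp)
    hence "norm (iexp x - iexp y) = norm (iexp (x - y) - 1)" by (simp add: norm_mult)
    also have "\<dots> \<le> \<bar>x - y\<bar>" using iexp_approx1[of "x - y" 0] by simp
    finally show ?thesis .
  qed
  have "ennreal (norm ((\<integral>\<omega>. iexp (f \<omega>) \<partial>M) - (\<integral>\<omega>. iexp (g \<omega>) \<partial>M))) = ennreal (norm (\<integral>\<omega>. iexp (f \<omega>) - iexp (g \<omega>) \<partial>M))"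
    using i by simp
  also have "\<dots> \<le> (\<integral>\<^sup>+\<omega>. norm (iexp (f \<omega>) - iexp (g \<omega>)) \<partial>M)"
    using i by (intro integral_norm_bound_ennreal) auto
  also have "\<dots> \<le> (\<integral>\<^sup>+\<omega>. ennreal \<bar>f \<omega> - g \<omega>\<bar> \<partial>M)"
    using le by (intro nn_integral_mono ennreal_leI) auto
  finally show ?thesis .
qed

lemma exp_decay_integrals:
  assumes "(u::real) > 0"
  shows "set_integrable lborel {0..} (\<lambda>y. exp (- u * y))"
    and "(LBINT y:{0..}. exp (- u * y)) = 1 / u"
    and "set_integrable lborel {0..} (\<lambda>y. y * exp (- u * y))"
proof -
  have 0: "has_bochner_integral lborel (\<lambda>y. (u * y) ^ k * exp (- (u * y)) * indicator {0..} y) (fact k / u)" for k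
  proof -
    have "has_bochner_integral lborel (\<lambda>y. (0 + u * y) ^ k * exp (- (0 + u * y)) * indicator {0..} (0 + u * y)) (fact k /\<^sub>R \<bar>u\<bar>)"
      using has_bochner_integral_I0i_power_exp_m'[of k] assms
      by (subst lborel_has_bochner_integral_real_affine_iff[symmetric]) auto
    moreover have "indicator {0..} (0 + u * y) = (indicator {0..} y :: real)" for y
      using assms by (auto simp: indicator_def zero_le_mult_iff)
    ultimately show ?thesis using assms by (simp add: divide_inverse mult.commute)
  qed
  have 1: "has_bochner_integral lborel (\<lambda>y. indicator {0..} y *\<^sub>R exp (- u * y)) (1 / u)"
    using 0[of 0] by (simp add: mult.commute)
  have 2: "has_bochner_integral lborel (\<lambda>y. indicator {0..} y *\<^sub>R (y * exp (- u * y))) (inverse u * (1 / u))"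
    using has_bochner_integral_mult_right[OF 0[of 1], of "inverse u"] assms by (simp add: mult_ac mult.assoc[symmetric, of u "inverse u"] mult.left_commute[of u "inverse u"])
  show "set_integrable lborel {0..} (\<lambda>y. exp (- u * y))" "(LBINT y:{0..}. exp (- u * y)) = 1 / u"
    using 1 unfolding set_integrable_def set_lebesgue_integral_def by (auto simp: has_bochner_integral_iff)
  show "set_integrable lborel {0..} (\<lambda>y. y * exp (- u * y))"
    using 2 unfolding set_integrable_def by (auto simp: has_bochner_integral_iff)
qed

lemma has_bochner_integral_exp_tail:
  assumes "(u::real) > 0"
  shows "has_bochner_integral lborel (\<lambda>y. indicator {a..} y * (u * exp (- u * y))) (exp (- u * a))"
proof -
  have "has_bochner_integral lborel (\<lambda>y. indicator {0..} y * exp (- u * y)) (1 / u)"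
    using exp_decay_integrals(1,2)[OF assms]
    unfolding set_integrable_def set_lebesgue_integral_def by (simp add: has_bochner_integral_iff)
  hence "has_bochner_integral lborel (\<lambda>y. indicator {0..} (- a + 1 * y) * exp (- u * (- a + 1 * y))) ((1 / u) /\<^sub>R \<bar>1\<bar>)"
    by (subst (asm) lborel_has_bochner_integral_real_affine_iff[of 1 _ _ "- a"]) auto
  hence "has_bochner_integral lborel (\<lambda>y. (u * exp (- u * a)) * (indicator {0..} (- a + 1 * y) * exp (- u * (- a + 1 * y)))) ((u * exp (- u * a)) * ((1 / u) /\<^sub>R \<bar>1\<bar>))"
    by (rule has_bochner_integral_mult_right)
  moreover have "(\<lambda>y. (u * exp (- u * a)) * (indicator {0..} (- a + 1 * y) * exp (- u * (- a + 1 * y)))) = (\<lambda>y. indicator {a..} y * (u * exp (- u * y)))"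
    by (auto simp: fun_eq_iff indicator_def mult_exp_exp algebra_simps)
  moreover have "(u * exp (- u * a)) * ((1 / u) /\<^sub>R \<bar>1\<bar>) = exp (- u * a)" using assms by simp
  ultimately show ?thesis by metis
qed

context standard_brownian_motion
begin

text \<open>A discretised path, written as a sum of increments so that an integral against it becomes a linear
combination of independent Gaussian variables.\<close>

definition stepB :: "nat \<Rightarrow> real \<Rightarrow> 'b \<Rightarrow> real" where
  "stepB n y \<omega> = B 0 \<omega> + (\<Sum>k<(Suc n)^2.
     (B (real (Suc k) / real (Suc n)) \<omega> - B (real k / real (Suc n)) \<omega>) * indicator {real k / real (Suc n)..} y)"

text \<open>The time at which \<open>stepB n\<close> reads the path: the right end point of the grid cell of \<open>y\<close>, but at most
\<open>n + 1\<close>.\<close>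

definition gridpoint :: "nat \<Rightarrow> real \<Rightarrow> real" where
  "gridpoint n y = real (min (Suc (nat \<lfloor>y * real (Suc n)\<rfloor>)) ((Suc n)^2)) / real (Suc n)"

lemma stepB_eq:
  assumes "y \<ge> 0"
  shows "stepB n y \<omega> = B (gridpoint n y) \<omega>"
proof -
  have "indicator {real k / real (Suc n)..} y = (of_bool (k \<le> nat \<lfloor>y * real (Suc n)\<rfloor>) :: real)" for k
  proof -
    have "real k / real (Suc n) \<le> y \<longleftrightarrow> real k \<le> y * real (Suc n)"
      by (simp add: pos_divide_le_eq del: of_nat_Suc)
    also have "\<dots> \<longleftrightarrow> k \<le> nat \<lfloor>y * real (Suc n)\<rfloor>"
      using assms by (subst le_nat_iff) (auto simp: le_floor_iff)
    finally show ?thesis by (auto simp: indicator_def)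
  qed
  thus ?thesis unfolding stepB_def gridpoint_def
    by (simp only: telescope_up_to[of "\<lambda>k. B (real k / real (Suc n)) \<omega>"]) simp
qed

lemma gridpoint_dist:
  assumes "y \<ge> 0"
  shows "gridpoint n y \<ge> 0" "\<bar>gridpoint n y - y\<bar> \<le> (if y < real (Suc n) then 1 / real (Suc n) else y)"
proof -
  define N where "N = real (Suc n)"
  have N: "N \<ge> 1" by (simp add: N_def)
  define f where "f = \<lfloor>y * N\<rfloor>"
  have f: "of_int f \<le> y * N" "y * N < of_int f + 1" "f \<ge> 0" using assms N by (auto simp: f_def)
  show "gridpoint n y \<ge> 0" by (simp add: gridpoint_def)
  have g: "gridpoint n y = min (of_int f + 1) (N * N) / N"
  proof -
    have "real (min a b) = min (real a) (real b)" for a b by (simp add: min_def)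
    moreover have "real (Suc (nat f)) = of_int f + 1" using f by simp
    ultimately show ?thesis by (simp only: gridpoint_def N_def f_def power2_eq_square of_nat_mult)
  qed
  show "\<bar>gridpoint n y - y\<bar> \<le> (if y < real (Suc n) then 1 / real (Suc n) else y)"
  proof (cases "y < N")
    case True
    hence "of_int f < N * N" using f N by (smt (verit) mult_strict_right_mono)
    hence "of_int f + 1 \<le> N * N"
      unfolding N_def by (metis (mono_tags) of_int_less_iff of_int_of_nat_eq of_nat_mult zless_imp_add1_zle of_int_1 of_int_add of_int_le_iff)
    hence "gridpoint n y = (of_int f + 1) / N" by (simp add: g)
    thus ?thesis using True f N unfolding N_def[symmetric] by (simp add: abs_if field_simps)
  next
    case False
    hence "N * N \<le> y * N" using N by (simp add: mult_right_mono)
    hence "N * N \<le> of_int f" unfolding f_def N_def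
      by (metis of_int_le_iff of_int_of_nat_eq of_nat_mult le_floor_iff)
    hence "gridpoint n y = N" using N by (simp add: g)
    thus ?thesis using False N unfolding N_def[symmetric] by auto
  qed
qed

lemma stepB_measurable [measurable]: "(\<lambda>(y, \<omega>). stepB n y \<omega>) \<in> borel_measurable (lborel \<Otimes>\<^sub>M N)"
proof -
  have [measurable]: "(\<lambda>p. B (real k / real m) (snd p)) \<in> borel_measurable (lborel \<Otimes>\<^sub>M N)" for k m
    using B_measurable[of "real k / real m"] by (intro measurable_compose[OF measurable_snd]) auto
  have [measurable]: "(\<lambda>p. B 0 (snd p)) \<in> borel_measurable (lborel \<Otimes>\<^sub>M N)"
    using B_measurable[of 0] by (intro measurable_compose[OF measurable_snd]) auto
  show ?thesis unfolding stepB_def split_beta by measurable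
qed

lemma stepB_tendsto:
  assumes "y \<ge> 0" "\<omega> \<in> space N"
  shows "(\<lambda>n. stepB n y \<omega>) \<longlonglongrightarrow> B y \<omega>"
proof -
  have g: "(\<lambda>n. gridpoint n y) \<longlonglongrightarrow> y"
  proof (rule LIM_zero_cancel, rule Lim_null_comparison)
    obtain n0 where "real n0 > y" using reals_Archimedean2 by blast
    note n0 = this
    show "\<forall>\<^sub>F n in sequentially. norm (gridpoint n y - y) \<le> inverse (real (Suc n))"
    proof (rule eventually_sequentiallyI[of n0])
      fix n assume "n0 \<le> n"
      hence "y < real (Suc n)" using n0 by simp
      thus "norm (gridpoint n y - y) \<le> inverse (real (Suc n))"
        using gridpoint_dist(2)[OF assms(1), of n] by (simp add: inverse_eq_divide)
    qed
    show "(\<lambda>n. inverse (real (Suc n))) \<longlonglongrightarrow> 0" by (rule LIMSEQ_inverse_real_of_nat)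
  qed
  have "(\<lambda>n. B (gridpoint n y) \<omega>) \<longlonglongrightarrow> B y \<omega>"
    using continuous_on_tendsto_compose[OF B_continuous[OF assms(2)] g] assms(1) gridpoint_dist(1)[OF assms(1)]
    by auto
  thus ?thesis by (simp add: stepB_eq[OF assms(1)])
qed

lemma B_jointly_measurable [measurable]:
  "(\<lambda>(y, \<omega>). indicator {0..} y * B y \<omega>) \<in> borel_measurable (lborel \<Otimes>\<^sub>M N)"
proof (rule borel_measurable_LIMSEQ_real)
  show "(\<lambda>p :: real \<times> 'b. indicator {0..} (fst p) * stepB n (fst p) (snd p)) \<in> borel_measurable (lborel \<Otimes>\<^sub>M N)" for n
    using stepB_measurable[of n] unfolding split_beta by measurable
next
  fix p :: "real \<times> 'b" assume "p \<in> space (lborel \<Otimes>\<^sub>M N)"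
  thus "(\<lambda>n. indicator {0..} (fst p) * stepB n (fst p) (snd p)) \<longlonglongrightarrow> (case p of (y, \<omega>) \<Rightarrow> indicator {0..} y * B y \<omega>)"
    using stepB_tendsto[of "fst p" "snd p"]
    by (cases "fst p \<ge> 0") (auto simp: space_pair_measure split_beta)
qed

lemma exp_stieltjes_measurable: "exp_stieltjes B u \<in> borel_measurable N"
proof -
  interpret P: pair_sigma_finite lborel N by standard
  have "(\<lambda>\<omega>. \<integral>y. exp (- u * y) * (indicator {0..} y * B y \<omega>) \<partial>lborel) \<in> borel_measurable N"
  proof (rule lborel.borel_measurable_lebesgue_integral)
    have "(\<lambda>p. case (snd p, fst p) of (y, \<omega>) \<Rightarrow> indicator {0..} y * B y \<omega>) \<in> borel_measurable (N \<Otimes>\<^sub>M lborel)"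
      by (rule measurable_compose[OF measurable_Pair[OF measurable_snd measurable_fst] B_jointly_measurable])
    thus "(\<lambda>(\<omega>, y). exp (- u * y) * (indicator {0..} y * B y \<omega>)) \<in> borel_measurable (N \<Otimes>\<^sub>M lborel)"
      unfolding split_beta by (auto simp: split_beta)
  qed
  thus ?thesis
    unfolding exp_stieltjes_def[abs_def] set_lebesgue_integral_def by (simp add: mult_ac)
qed

text \<open>The standard deviation of the increment bounds its mean absolute value.\<close>

lemma nn_integral_abs_increment_le:
  assumes "s \<ge> 0" "t \<ge> 0"
  shows "(\<integral>\<^sup>+\<omega>. ennreal \<bar>B t \<omega> - B s \<omega>\<bar> \<partial>N) \<le> ennreal (sqrt \<bar>t - s\<bar>)"
proof -
  have *: "(\<integral>\<^sup>+\<omega>. ennreal \<bar>B t \<omega> - B s \<omega>\<bar> \<partial>N) \<le> ennreal (sqrt (t - s))" if "0 \<le> s" "s < t" for s t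
  proof -
    define d where "d = sqrt (t - s)"
    have d: "d > 0" "d\<^sup>2 = t - s" using that by (auto simp: d_def)
    note D = B_normal_increments[OF that, folded d_def]
    let ?X = "\<lambda>\<omega>. B t \<omega> - B s \<omega>"
    have "integrable lborel (\<lambda>x. normal_density 0 d x * (x - 0) ^ 2)"
      using integrable_normal_moment[OF d(1), of 0 2] by simp
    hence i2: "integrable N (\<lambda>\<omega>. (?X \<omega>)\<^sup>2)"
      using distributed_integrable[OF D, of "\<lambda>x. x\<^sup>2"] by simp
    have v: "expectation (\<lambda>\<omega>. (?X \<omega>)\<^sup>2) = d\<^sup>2"
      using normal_distributed_variance[OF d(1) D] normal_distributed_expectation[OF d(1) D] by simp
    \<comment> \<open>the arithmetic-geometric mean inequality replaces Cauchy-Schwarz; it is sharp at \<open>\<bar>x\<bar> = d\<close>\<close>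
    have "\<bar>x\<bar> \<le> (d + x\<^sup>2 / d) / 2" for x :: real
    proof -
      have "0 \<le> (\<bar>x\<bar> - d)\<^sup>2" by simp
      hence "2 * d * \<bar>x\<bar> \<le> d\<^sup>2 + x\<^sup>2" by (simp add: power2_diff mult_ac)
      thus ?thesis using d(1) by (simp add: field_simps power2_eq_square)
    qed
    hence "(\<integral>\<^sup>+\<omega>. ennreal \<bar>?X \<omega>\<bar> \<partial>N) \<le> (\<integral>\<^sup>+\<omega>. ennreal ((d + (?X \<omega>)\<^sup>2 / d) / 2) \<partial>N)"
      by (intro nn_integral_mono ennreal_leI) auto
    also have "\<dots> = ennreal (\<integral>\<omega>. (d + (?X \<omega>)\<^sup>2 / d) / 2 \<partial>N)"
      using i2 d(1) by (intro nn_integral_eq_integral) auto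
    also have "(\<integral>\<omega>. (d + (?X \<omega>)\<^sup>2 / d) / 2 \<partial>N) = d"
      using i2 v d(1) by (simp add: prob_space power2_eq_square)
    finally show ?thesis by (simp add: d_def)
  qed
  consider "s < t" | "t < s" | "s = t" by linarith
  thus ?thesis
  proof cases
    case 2
    thus ?thesis using *[of t s] assms by (simp add: abs_minus_commute)
  qed (use *[of s t] assms in auto)
qed

lemma nn_integral_abs_B_le:
  assumes "t \<ge> 0"
  shows "(\<integral>\<^sup>+\<omega>. ennreal \<bar>B t \<omega>\<bar> \<partial>N) \<le> ennreal (1 + t)"
proof -
  have "(\<integral>\<^sup>+\<omega>. ennreal \<bar>B t \<omega>\<bar> \<partial>N) = (\<integral>\<^sup>+\<omega>. ennreal \<bar>B t \<omega> - B 0 \<omega>\<bar> \<partial>N)"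
    using B_zero by (intro nn_integral_cong_AE) auto
  also have "\<dots> \<le> ennreal (sqrt \<bar>t - 0\<bar>)" using assms by (intro nn_integral_abs_increment_le) auto
  also have "sqrt t \<le> 1 + t"
    using assms by (intro real_le_lsqrt) (auto simp: power2_eq_square algebra_simps)
  hence "ennreal (sqrt \<bar>t - 0\<bar>) \<le> ennreal (1 + t)" using assms by (intro ennreal_leI) auto
  finally show ?thesis .
qed

lemma exp_times_B_integrable:
  assumes "u > 0"
  shows "AE \<omega> in N. set_integrable lborel {0..} (\<lambda>y. exp (- u * y) * B y \<omega>)"
proof -
  interpret P: pair_sigma_finite lborel N by standard
  have m: "(\<lambda>(y, \<omega>). ennreal \<bar>exp (- u * y) * (indicator {0..} y * B y \<omega>)\<bar>) \<in> borel_measurable (lborel \<Otimes>\<^sub>M N)"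
    using B_jointly_measurable unfolding split_beta by measurable
  have "(\<integral>\<^sup>+\<omega>. (\<integral>\<^sup>+y. ennreal \<bar>exp (- u * y) * (indicator {0..} y * B y \<omega>)\<bar> \<partial>lborel) \<partial>N)
      = (\<integral>\<^sup>+y. (\<integral>\<^sup>+\<omega>. ennreal \<bar>exp (- u * y) * (indicator {0..} y * B y \<omega>)\<bar> \<partial>N) \<partial>lborel)"
    using P.Fubini'[OF m] by simp
  also have "\<dots> \<le> (\<integral>\<^sup>+y. ennreal (indicator {0..} y * (exp (- u * y) * (1 + y))) \<partial>lborel)"
  proof (rule nn_integral_mono)
    fix y :: real
    show "(\<integral>\<^sup>+\<omega>. ennreal \<bar>exp (- u * y) * (indicator {0..} y * B y \<omega>)\<bar> \<partial>N)
        \<le> ennreal (indicator {0..} y * (exp (- u * y) * (1 + y)))"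
    proof (cases "y \<ge> 0")
      case True
      have "(\<integral>\<^sup>+\<omega>. ennreal \<bar>exp (- u * y) * (indicator {0..} y * B y \<omega>)\<bar> \<partial>N) = ennreal (exp (- u * y)) * (\<integral>\<^sup>+\<omega>. ennreal \<bar>B y \<omega>\<bar> \<partial>N)"
        using True B_measurable[OF True] by (subst nn_integral_cmult[symmetric]) (auto simp: abs_mult ennreal_mult')
      also have "\<dots> \<le> ennreal (exp (- u * y)) * ennreal (1 + y)"
        using True by (intro mult_left_mono nn_integral_abs_B_le) auto
      also have "\<dots> = ennreal (exp (- u * y) * (1 + y))" using True by (intro ennreal_mult[symmetric]) auto
      finally show ?thesis using True by simp
    qed auto
  qed
  also have "\<dots> = ennreal (\<integral>y. indicator {0..} y * (exp (- u * y) * (1 + y)) \<partial>lborel)"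
  proof (rule nn_integral_eq_integral)
    have "set_integrable lborel {0..} (\<lambda>y. exp (- u * y) + y * exp (- u * y))"
      using exp_decay_integrals[OF assms] by (intro set_integral_add) auto
    thus "integrable lborel (\<lambda>y. indicator {0..} y * (exp (- u * y) * (1 + y)))"
      unfolding set_integrable_def by (simp add: algebra_simps)
  qed (auto simp: indicator_def)
  also have "\<dots> < \<infinity>" by simp
  finally have "AE \<omega> in N. (\<integral>\<^sup>+y. ennreal \<bar>exp (- u * y) * (indicator {0..} y * B y \<omega>)\<bar> \<partial>lborel) \<noteq> \<infinity>"
    by (intro nn_integral_PInf_AE) (use m in \<open>auto simp: split_beta\<close>)
  moreover have "(\<lambda>y. exp (- u * y) * (indicator {0..} y * B y \<omega>)) \<in> borel_measurable lborel" if "\<omega> \<in> space N" for \<omega>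
    using measurable_compose[OF measurable_Pair2'[OF that] B_jointly_measurable] by simp
  ultimately show ?thesis
    unfolding set_integrable_def
    by (auto simp: integrable_iff_bounded less_top mult_ac elim!: AE_mp intro!: AE_I2)
qed

lemma char_increment:
  assumes "0 \<le> s" "s < t"
  shows "char (distr N borel (\<lambda>\<omega>. g * (B t \<omega> - B s \<omega>))) 1 = exp (- (g\<^sup>2 * (t - s)) / 2)"
proof -
  define d where "d = sqrt (t - s)"
  have d: "d > 0" "d\<^sup>2 = t - s" using assms by (auto simp: d_def)
  have [measurable]: "(\<lambda>\<omega>. B t \<omega> - B s \<omega>) \<in> borel_measurable N"
    using B_measurable[of t] B_measurable[of s] assms by auto
  have D: "distributed N lborel (\<lambda>\<omega>. (B t \<omega> - B s \<omega>) / d) std_normal_density"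
    using B_normal_increments[OF assms, folded d_def] normal_standard_normal_convert[OF d(1), of _ 0] by simp
  hence D': "distr N borel (\<lambda>\<omega>. (B t \<omega> - B s \<omega>) / d) = std_normal_distribution"
    by (simp add: distributed_distr_eq_density[symmetric] cong: distr_cong)
  have "char (distr N borel (\<lambda>\<omega>. g * (B t \<omega> - B s \<omega>))) 1 = char (distr N borel (\<lambda>\<omega>. (B t \<omega> - B s \<omega>) / d)) (g * d)"
    using d by (simp add: char_def integral_distr)
  also have "\<dots> = exp (- ((g * d)\<^sup>2) / 2)"
    unfolding D' char_std_normal_distribution by simp
  finally show ?thesis using d by (simp add: power_mult_distrib)
qed

text \<open>With \<open>F(y) = \<Sum> c\<^sub>u u exp (-u y)\<close> and its tail integral \<open>G(a) = \<Sum> c\<^sub>u exp (-u a)\<close>, the variable in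
question is \<open>Y = \<integral> F(y) B(y) dy\<close>. If \<open>B\<close> is replaced by its discretisation, summation by parts turns
\<open>Y\<close> into \<open>A n = \<Sum>\<^sub>k G(t\<^sub>k) (B(t\<^sub>k\<^sub>+\<^sub>1) - B(t\<^sub>k))\<close>, a sum of independent Gaussian variables. Its variance is
a Riemann sum for \<open>\<integral> G\<^sup>2 = \<Sum>\<Sum> c\<^sub>u c\<^sub>v / (u + v)\<close>, and \<open>A n - Y\<close> tends to \<open>0\<close> in mean.\<close>

lemma char_exp_stieltjes:
  fixes c :: "real \<Rightarrow> real"
  assumes U: "finite U" "U \<subseteq> {0<..}"
  shows "(\<integral>\<omega>. iexp (\<Sum>u\<in>U. c u * exp_stieltjes B u \<omega>) \<partial>N)
    = exp (- (\<Sum>u\<in>U. \<Sum>v\<in>U. c u * c v / (u + v)) / 2)"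
proof -
  define F where "F = (\<lambda>y. \<Sum>u\<in>U. c u * u * exp (- u * y))"
  define G where "G = (\<lambda>y. \<Sum>u\<in>U. c u * exp (- u * y))"
  define Y where "Y = (\<lambda>\<omega>. \<Sum>u\<in>U. c u * exp_stieltjes B u \<omega>)"
  define N' where "N' = (\<lambda>n. real (Suc n))"
  define \<Delta> where "\<Delta> = (\<lambda>n k \<omega>. B (real (Suc k) / N' n) \<omega> - B (real k / N' n) \<omega>)"
  define A where "A = (\<lambda>n \<omega>. \<Sum>k<(Suc n)\<^sup>2. G (real k / N' n) * \<Delta> n k \<omega>)"
  have N': "N' n > 0" for n by (simp add: N'_def)
  have upos: "u > 0" if "u \<in> U" for u using U that by auto
  have [measurable]: "\<Delta> n k \<in> borel_measurable N" for n k
    unfolding \<Delta>_def using N'[of n] by (intro borel_measurable_diff B_measurable) (auto intro!: divide_nonneg_nonneg)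
  have [measurable]: "Y \<in> borel_measurable N"
    unfolding Y_def using exp_stieltjes_measurable by measurable
  have [measurable]: "A n \<in> borel_measurable N" for n unfolding A_def by measurable
  have [measurable]: "F \<in> borel_measurable borel" unfolding F_def by measurable

  have chA: "(\<integral>\<omega>. iexp (A n \<omega>) \<partial>N) = exp (- (\<Sum>k<(Suc n)\<^sup>2. (G (real k / N' n))\<^sup>2 / N' n) / 2)" for n
  proof -
    have "indep_vars (\<lambda>_. borel) (\<Delta> n) {..<(Suc n)\<^sup>2}"
      unfolding \<Delta>_def using N'[of n]
      by (intro B_indep_increments[where \<tau> = "\<lambda>k. real k / N' n"]) (auto simp: divide_strict_right_mono)
    hence ind: "indep_vars (\<lambda>_. borel) (\<lambda>k \<omega>. G (real k / N' n) * \<Delta> n k \<omega>) {..<(Suc n)\<^sup>2}"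
      by (rule indep_vars_compose2[where Y = "\<lambda>k x. G (real k / N' n) * x"]) auto
    have "(\<integral>\<omega>. iexp (A n \<omega>) \<partial>N) = char (distr N borel (A n)) 1"
      by (simp add: char_def integral_distr)
    also have "\<dots> = (\<Prod>k<(Suc n)\<^sup>2. char (distr N borel (\<lambda>\<omega>. G (real k / N' n) * \<Delta> n k \<omega>)) 1)"
      unfolding A_def by (rule char_distr_sum[OF ind])
    also have "\<dots> = (\<Prod>k<(Suc n)\<^sup>2. of_real (exp (- ((G (real k / N' n))\<^sup>2 / N' n) / 2)))"
    proof (rule prod.cong)
      fix k
      have "real (Suc k) / N' n - real k / N' n = 1 / N' n" by (simp add: diff_divide_distrib[symmetric])
      thus "char (distr N borel (\<lambda>\<omega>. G (real k / N' n) * \<Delta> n k \<omega>)) 1 = of_real (exp (- ((G (real k / N' n))\<^sup>2 / N' n) / 2))"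
        unfolding \<Delta>_def using N'[of n] by (subst char_increment) (auto simp: divide_strict_right_mono)
    qed simp
    also have "\<dots> = of_real (exp (\<Sum>k<(Suc n)\<^sup>2. - ((G (real k / N' n))\<^sup>2 / N' n) / 2))"
      by (subst exp_sum) auto
    finally show ?thesis by (simp add: sum_negf sum_divide_distrib)
  qed

  have "(\<lambda>n. \<Sum>k<(Suc n)\<^sup>2. (G (real k / N' n))\<^sup>2 / N' n) \<longlonglongrightarrow> (\<Sum>u\<in>U. \<Sum>v\<in>U. c u * c v * (1 / (u + v)))"
  proof -
    have "(G y)\<^sup>2 = (\<Sum>u\<in>U. \<Sum>v\<in>U. c u * c v * exp (- (u + v) * y))" for y
      unfolding G_def power2_eq_square sum_product
      by (intro sum.cong refl) (simp add: mult_exp_exp algebra_simps)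
    hence "(\<Sum>k<(Suc n)\<^sup>2. (G (real k / N' n))\<^sup>2 / N' n) =
      (\<Sum>k<(Suc n)\<^sup>2. \<Sum>u\<in>U. \<Sum>v\<in>U. c u * c v * (exp (- (u + v) * (real k / N' n)) / N' n))" for n
      by (simp add: sum_divide_distrib)
    also have "\<dots> n = (\<Sum>u\<in>U. \<Sum>v\<in>U. \<Sum>k<(Suc n)\<^sup>2. c u * c v * (exp (- (u + v) * (real k / N' n)) / N' n))" for n
      by (subst sum.swap, intro sum.cong refl, subst sum.swap) simp
    also have "\<dots> n = (\<Sum>u\<in>U. \<Sum>v\<in>U. c u * c v * ((\<Sum>k<(Suc n)\<^sup>2. exp (- (u + v) * (real k / N' n))) / N' n))" for n
      by (simp only: sum_distrib_left sum_divide_distrib)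
    finally have eq: "(\<Sum>k<(Suc n)\<^sup>2. (G (real k / N' n))\<^sup>2 / N' n) =
      (\<Sum>u\<in>U. \<Sum>v\<in>U. c u * c v * ((\<Sum>k<(Suc n)\<^sup>2. exp (- (u + v) * (real k / N' n))) / N' n))" for n .
    have "(\<lambda>n. (\<Sum>k<(Suc n)\<^sup>2. exp (- (u + v) * (real k / N' n))) / N' n) \<longlonglongrightarrow> 1 / (u + v)" if "u \<in> U" "v \<in> U" for u v
      using riemann_sum_exp_tendsto[of "u + v"] upos[OF that(1)] upos[OF that(2)] unfolding N'_def by simp
    thus ?thesis unfolding eq by (intro tendsto_sum tendsto_mult tendsto_const)
  qed
  hence lim1: "(\<lambda>n. \<integral>\<omega>. iexp (A n \<omega>) \<partial>N) \<longlonglongrightarrow> exp (- (\<Sum>u\<in>U. \<Sum>v\<in>U. c u * c v / (u + v)) / 2)"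
    unfolding chA by (intro tendsto_intros) auto

  have tail: "has_bochner_integral lborel (\<lambda>y. indicator {a..} y * F y) (G a)" for a
  proof -
    have "has_bochner_integral lborel (\<lambda>y. \<Sum>u\<in>U. c u * (indicator {a..} y * (u * exp (- u * y)))) (\<Sum>u\<in>U. c u * exp (- u * a))"
      using upos by (intro has_bochner_integral_sum has_bochner_integral_mult_right has_bochner_integral_exp_tail)
    thus ?thesis by (simp add: F_def G_def sum_distrib_left mult_ac)
  qed
  have A_eq: "has_bochner_integral lborel (\<lambda>y. indicator {0..} y * F y * stepB n y \<omega>) (A n \<omega>)" if "B 0 \<omega> = 0" for n \<omega>
  proof -
    have "has_bochner_integral lborel (\<lambda>y. \<Sum>k<(Suc n)\<^sup>2. \<Delta> n k \<omega> * (indicator {real k / N' n..} y * F y)) (\<Sum>k<(Suc n)\<^sup>2. \<Delta> n k \<omega> * G (real k / N' n))"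
      by (intro has_bochner_integral_sum has_bochner_integral_mult_right tail)
    moreover have "indicator {0..} y * F y * stepB n y \<omega> = (\<Sum>k<(Suc n)\<^sup>2. \<Delta> n k \<omega> * (indicator {real k / N' n..} y * F y))" for y
    proof (cases "y \<ge> 0")
      case True
      have "stepB n y \<omega> = (\<Sum>k<(Suc n)\<^sup>2. \<Delta> n k \<omega> * indicator {real k / N' n..} y)"
        unfolding stepB_def \<Delta>_def N'_def that by simp
      hence "indicator {0..} y * F y * stepB n y \<omega> = F y * (\<Sum>k<(Suc n)\<^sup>2. \<Delta> n k \<omega> * indicator {real k / N' n..} y)"
        using True by simp
      also have "\<dots> = (\<Sum>k<(Suc n)\<^sup>2. F y * (\<Delta> n k \<omega> * indicator {real k / N' n..} y))"
        by (rule sum_distrib_left)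
      finally show ?thesis by (simp only: mult_ac)
    next
      case False
      have "real k / N' n \<ge> 0" for k using N'[of n] by simp
      hence "\<not> real k / N' n \<le> y" for k using False by (meson order.trans)
      thus ?thesis using False by simp
    qed
    ultimately show ?thesis by (simp add: A_def mult.commute)
  qed
  have Y_eq: "AE \<omega> in N. has_bochner_integral lborel (\<lambda>y. indicator {0..} y * F y * B y \<omega>) (Y \<omega>)"
  proof -
    have "AE \<omega> in N. \<forall>u\<in>U. set_integrable lborel {0..} (\<lambda>y. exp (- u * y) * B y \<omega>)"
      using exp_times_B_integrable upos U(1) by (intro AE_finite_allI) auto
    thus ?thesis
    proof eventually_elim
      case (elim \<omega>)
      have "has_bochner_integral lborel (\<lambda>y. \<Sum>u\<in>U. c u * (u * (indicator {0..} y *\<^sub>R (exp (- u * y) * B y \<omega>)))) (Y \<omega>)"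
        unfolding Y_def exp_stieltjes_def set_lebesgue_integral_def using elim unfolding set_integrable_def
        by (intro has_bochner_integral_sum has_bochner_integral_mult_right has_bochner_integral_integrable) auto
      thus ?case by (simp add: F_def sum_distrib_left sum_distrib_right mult_ac)
    qed
  qed
  \<comment> \<open>\<open>\<rho> n y\<close> bounds the distance of \<open>y\<close> from its grid point, and \<open>sqrt (\<rho> n y) \<le> 2 + y\<close> is the
    dominating function\<close>
  define \<rho> where "\<rho> = (\<lambda>n y. if y < real (Suc n) then 1 / real (Suc n) else y)"
  have \<rho>: "0 \<le> \<rho> n y" "\<rho> n y \<le> 1 + y" if "y \<ge> 0" for n y
    using that by (auto simp: \<rho>_def field_simps)
  have [measurable]: "\<rho> n \<in> borel_measurable borel" for n unfolding \<rho>_def by measurable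
  have dominated: "norm (indicator {0..} y * (\<bar>F y\<bar> * sqrt (\<rho> n y))) \<le> indicator {0..} y * (\<bar>F y\<bar> * (2 + y))" for n and y :: real
  proof (cases "y \<ge> 0")
    case True
    have "sqrt (\<rho> n y) \<le> 2 + y"
    proof (rule real_le_lsqrt)
      have "0 \<le> y * y" using True by simp
      hence "1 + y \<le> (2 + y)\<^sup>2" using True by (simp add: power2_eq_square algebra_simps)
      thus "\<rho> n y \<le> (2 + y)\<^sup>2" using \<rho>[OF True, of n] by linarith
    qed (use True \<rho> in auto)
    thus ?thesis using True \<rho>[OF True, of n] by (simp add: abs_mult mult_left_mono)
  qed auto
  have bound: "(\<integral>\<^sup>+\<omega>. ennreal \<bar>A n \<omega> - Y \<omega>\<bar> \<partial>N) \<le> ennreal (\<integral>y. indicator {0..} y * (\<bar>F y\<bar> * sqrt (\<rho> n y)) \<partial>lborel)"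
    and dom: "integrable lborel (\<lambda>y. indicator {0..} y * (\<bar>F y\<bar> * (2 + y)))" for n
  proof -
    interpret P: pair_sigma_finite lborel N by standard
    have "integrable lborel (\<lambda>y. \<Sum>u\<in>U. \<bar>c u\<bar> * u * (indicator {0..} y *\<^sub>R (2 * exp (- u * y) + y * exp (- u * y))))"
    proof (intro Bochner_Integration.integrable_sum integrable_mult_right)
      fix u assume "u \<in> U"
      hence "set_integrable lborel {0..} (\<lambda>y. 2 * exp (- u * y) + y * exp (- u * y))"
        using exp_decay_integrals(1,3)[OF upos, of u]
        by (intro set_integral_add(1) set_integrable_mult_right) auto
      thus "integrable lborel (\<lambda>y. indicator {0..} y *\<^sub>R (2 * exp (- u * y) + y * exp (- u * y)))"
        unfolding set_integrable_def .
    qed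
    thus dom: "integrable lborel (\<lambda>y. indicator {0..} y * (\<bar>F y\<bar> * (2 + y)))"
    proof (rule Bochner_Integration.integrable_bound)
      show "AE y in lborel. norm (indicator {0..} y * (\<bar>F y\<bar> * (2 + y))) \<le>
        norm (\<Sum>u\<in>U. \<bar>c u\<bar> * u * (indicator {0..} y *\<^sub>R (2 * exp (- u * y) + y * exp (- u * y))))"
      proof (rule AE_I2)
        fix y :: real
        have "\<bar>F y\<bar> * (2 + y) \<le> (\<Sum>u\<in>U. \<bar>c u\<bar> * u * (2 * exp (- u * y) + y * exp (- u * y)))" if "y \<ge> 0"
        proof -
          have "\<bar>F y\<bar> \<le> (\<Sum>u\<in>U. \<bar>c u * u * exp (- u * y)\<bar>)" unfolding F_def by (rule sum_abs)
          hence "\<bar>F y\<bar> * (2 + y) \<le> (\<Sum>u\<in>U. \<bar>c u * u * exp (- u * y)\<bar>) * (2 + y)"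
            using that by (intro mult_right_mono) auto
          also have "\<dots> = (\<Sum>u\<in>U. \<bar>c u\<bar> * u * (2 * exp (- u * y) + y * exp (- u * y)))"
            unfolding sum_distrib_right by (intro sum.cong refl) (use upos in \<open>auto simp: abs_mult algebra_simps less_imp_le\<close>)
          finally show ?thesis .
        qed
        moreover have "0 \<le> \<bar>F y\<bar> * (2 + y)" if "y \<ge> 0" using that by simp
        ultimately show "norm (indicator {0..} y * (\<bar>F y\<bar> * (2 + y))) \<le>
          norm (\<Sum>u\<in>U. \<bar>c u\<bar> * u * (indicator {0..} y *\<^sub>R (2 * exp (- u * y) + y * exp (- u * y))))"
          by (cases "y \<ge> 0") auto
      qed
    qed measurable
    have m: "(\<lambda>(y, \<omega>). ennreal \<bar>indicator {0..} y * F y * stepB n y \<omega> - F y * (indicator {0..} y * B y \<omega>)\<bar>) \<in> borel_measurable (lborel \<Otimes>\<^sub>M N)"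
      using B_jointly_measurable stepB_measurable[of n] unfolding split_beta by measurable
    have "(\<integral>\<^sup>+\<omega>. ennreal \<bar>A n \<omega> - Y \<omega>\<bar> \<partial>N) \<le>
      (\<integral>\<^sup>+\<omega>. (\<integral>\<^sup>+y. ennreal \<bar>indicator {0..} y * F y * stepB n y \<omega> - F y * (indicator {0..} y * B y \<omega>)\<bar> \<partial>lborel) \<partial>N)"
    proof (rule nn_integral_mono_AE)
      show "AE \<omega> in N. ennreal \<bar>A n \<omega> - Y \<omega>\<bar> \<le> (\<integral>\<^sup>+y. ennreal \<bar>indicator {0..} y * F y * stepB n y \<omega> - F y * (indicator {0..} y * B y \<omega>)\<bar> \<partial>lborel)"
        using Y_eq B_zero
      proof eventually_elim
        case (elim \<omega>)
        from has_bochner_integral_diff[OF A_eq[OF elim(2), of n] elim(1)]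
        have "has_bochner_integral lborel (\<lambda>y. indicator {0..} y * F y * stepB n y \<omega> - F y * (indicator {0..} y * B y \<omega>)) (A n \<omega> - Y \<omega>)"
          by (simp add: mult_ac)
        thus ?case
          using integral_norm_bound_ennreal[of lborel "\<lambda>y. indicator {0..} y * F y * stepB n y \<omega> - F y * (indicator {0..} y * B y \<omega>)"]
          by (auto simp: has_bochner_integral_iff)
      qed
    qed
    also have "\<dots> = (\<integral>\<^sup>+y. (\<integral>\<^sup>+\<omega>. ennreal \<bar>indicator {0..} y * F y * stepB n y \<omega> - F y * (indicator {0..} y * B y \<omega>)\<bar> \<partial>N) \<partial>lborel)"
      using P.Fubini'[OF m] by simp
    also have "\<dots> \<le> (\<integral>\<^sup>+y. ennreal (indicator {0..} y * (\<bar>F y\<bar> * sqrt (\<rho> n y))) \<partial>lborel)"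
    proof (rule nn_integral_mono)
      fix y :: real
      show "(\<integral>\<^sup>+\<omega>. ennreal \<bar>indicator {0..} y * F y * stepB n y \<omega> - F y * (indicator {0..} y * B y \<omega>)\<bar> \<partial>N)
        \<le> ennreal (indicator {0..} y * (\<bar>F y\<bar> * sqrt (\<rho> n y)))"
      proof (cases "y \<ge> 0")
        case True
        note g = gridpoint_dist[OF True, of n]
        have "(\<integral>\<^sup>+\<omega>. ennreal \<bar>indicator {0..} y * F y * stepB n y \<omega> - F y * (indicator {0..} y * B y \<omega>)\<bar> \<partial>N)
          = (\<integral>\<^sup>+\<omega>. ennreal \<bar>F y\<bar> * ennreal \<bar>B (gridpoint n y) \<omega> - B y \<omega>\<bar> \<partial>N)"
          using True by (simp add: stepB_eq right_diff_distrib[symmetric] abs_mult ennreal_mult')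
        also have "\<dots> = ennreal \<bar>F y\<bar> * (\<integral>\<^sup>+\<omega>. ennreal \<bar>B (gridpoint n y) \<omega> - B y \<omega>\<bar> \<partial>N)"
          using B_measurable[OF True] B_measurable[OF g(1)] by (intro nn_integral_cmult) auto
        also have "\<dots> \<le> ennreal \<bar>F y\<bar> * ennreal (sqrt \<bar>gridpoint n y - y\<bar>)"
          by (intro mult_left_mono nn_integral_abs_increment_le True g(1)) auto
        also have "\<dots> \<le> ennreal \<bar>F y\<bar> * ennreal (sqrt (\<rho> n y))"
          using g(2) unfolding \<rho>_def by (intro mult_left_mono ennreal_leI) auto
        also have "\<dots> = ennreal (\<bar>F y\<bar> * sqrt (\<rho> n y))"
          using \<rho>[OF True] by (intro ennreal_mult[symmetric]) auto
        finally show ?thesis using True by simp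
      qed auto
    qed
    also have "\<dots> = ennreal (\<integral>y. indicator {0..} y * (\<bar>F y\<bar> * sqrt (\<rho> n y)) \<partial>lborel)"
    proof (rule nn_integral_eq_integral)
      show "integrable lborel (\<lambda>y. indicator {0..} y * (\<bar>F y\<bar> * sqrt (\<rho> n y)))"
      proof (rule Bochner_Integration.integrable_bound[OF dom])
        show "AE y in lborel. norm (indicator {0..} y * (\<bar>F y\<bar> * sqrt (\<rho> n y))) \<le> norm (indicator {0..} y * (\<bar>F y\<bar> * (2 + y)))"
          by (intro AE_I2) (rule order.trans[OF dominated], simp only: real_norm_def abs_ge_self)
      qed measurable
    qed (use \<rho> in \<open>auto simp: indicator_def\<close>)
    finally show "(\<integral>\<^sup>+\<omega>. ennreal \<bar>A n \<omega> - Y \<omega>\<bar> \<partial>N) \<le> ennreal (\<integral>y. indicator {0..} y * (\<bar>F y\<bar> * sqrt (\<rho> n y)) \<partial>lborel)" .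
  qed
  have "(\<lambda>n. \<integral>y. indicator {0..} y * (\<bar>F y\<bar> * sqrt (\<rho> n y)) \<partial>lborel) \<longlonglongrightarrow> (\<integral>y. 0 \<partial>(lborel :: real measure))"
  proof (rule integral_dominated_convergence[where w = "\<lambda>y. indicator {0..} y * (\<bar>F y\<bar> * (2 + y))"])
    show "integrable lborel (\<lambda>y. indicator {0..} y * (\<bar>F y\<bar> * (2 + y)))" by (rule dom)
    show "AE y in lborel. (\<lambda>n. indicator {0..} y * (\<bar>F y\<bar> * sqrt (\<rho> n y))) \<longlonglongrightarrow> 0"
    proof (rule AE_I2)
      fix y :: real
      obtain n0 where n0: "real n0 > y" using reals_Archimedean2 by blast
      have "\<forall>\<^sub>F n in sequentially. \<rho> n y = inverse (real (Suc n))"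
        using n0 by (intro eventually_sequentiallyI[of n0]) (auto simp: \<rho>_def inverse_eq_divide)
      hence "(\<lambda>n. \<rho> n y) \<longlonglongrightarrow> 0"
        using LIMSEQ_inverse_real_of_nat by (simp add: tendsto_cong)
      hence "(\<lambda>n. indicator {0..} y * (\<bar>F y\<bar> * sqrt (\<rho> n y))) \<longlonglongrightarrow> indicator {0..} y * (\<bar>F y\<bar> * sqrt 0)"
        by (intro tendsto_intros)
      thus "(\<lambda>n. indicator {0..} y * (\<bar>F y\<bar> * sqrt (\<rho> n y))) \<longlonglongrightarrow> 0" by simp
    qed
    show "AE y in lborel. norm (indicator {0..} y * (\<bar>F y\<bar> * sqrt (\<rho> n y))) \<le> indicator {0..} y * (\<bar>F y\<bar> * (2 + y))" for n
      by (intro AE_I2 dominated)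
  qed measurable
  hence lim0: "(\<lambda>n. \<integral>y. indicator {0..} y * (\<bar>F y\<bar> * sqrt (\<rho> n y)) \<partial>lborel) \<longlonglongrightarrow> 0" by simp
  have "(\<lambda>n. (\<integral>\<omega>. iexp (A n \<omega>) \<partial>N) - (\<integral>\<omega>. iexp (Y \<omega>) \<partial>N)) \<longlonglongrightarrow> 0"
  proof (rule Lim_null_comparison[OF always_eventually lim0], rule allI)
    fix n
    have "0 \<le> (\<integral>y. indicator {0..} y * (\<bar>F y\<bar> * sqrt (\<rho> n y)) \<partial>lborel)"
      using \<rho> by (intro integral_nonneg_AE AE_I2) (auto simp: indicator_def)
    thus "norm ((\<integral>\<omega>. iexp (A n \<omega>) \<partial>N) - (\<integral>\<omega>. iexp (Y \<omega>) \<partial>N)) \<le> (\<integral>y. indicator {0..} y * (\<bar>F y\<bar> * sqrt (\<rho> n y)) \<partial>lborel)"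
      using order.trans[OF char_diff_le[of "A n" Y] bound[of n]] by (simp add: ennreal_le_iff)
  qed
  from tendsto_diff[OF lim1 this] have "(\<lambda>n. (\<integral>\<omega>. iexp (Y \<omega>) \<partial>N)) \<longlonglongrightarrow> exp (- (\<Sum>u\<in>U. \<Sum>v\<in>U. c u * c v / (u + v)) / 2)"
    by simp
  from LIMSEQ_unique[OF this tendsto_const] show ?thesis by (simp add: Y_def)
qed

end

section \<open>Averaging over a uniform factor\<close>

abbreviation unif :: "real measure" where "unif \<equiv> uniform_measure lborel {0..1}"

lemma prob_space_unif: "prob_space unif" by (rule prob_space_uniform_measure) auto

lemma nn_integral_unif:
  assumes [measurable]: "f \<in> borel_measurable borel"
  shows "(\<integral>\<^sup>+w. f w \<partial>unif) = (\<integral>\<^sup>+w. f w * indicator {0..1} w \<partial>lborel)"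
  by (subst nn_integral_uniform_measure) (auto simp: divide_ennreal_def)

lemma AE_unif: "AE w in unif. 0 < w \<and> w < 1"
proof -
  have "AE w in lborel. w \<noteq> 0" "AE w in lborel. w \<noteq> (1::real)" by (rule AE_lborel_singleton)+
  hence "AE w in lborel. w \<in> {0..1} \<longrightarrow> 0 < w \<and> w < (1::real)" by eventually_elim auto
  thus ?thesis by (subst AE_uniform_measure) auto
qed

interpretation unif: prob_space unif by (rule prob_space_unif)

definition avg :: "(real \<Rightarrow> ennreal) \<Rightarrow> real \<Rightarrow> ennreal" where
  "avg F x = (\<integral>\<^sup>+w. F (x * w) \<partial>unif)"

text \<open>The measure \<open>dz / z\<close> on \<open>(0, x]\<close> is the mean number of points \<open>x W\<^sub>1 \<cdots> W\<^sub>r\<close>, \<open>r \<ge> 1\<close>, and also of points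
\<open>x P\<^sub>r\<close> for a \<open>GEM(0,1)\<close> sequence \<open>(P\<^sub>r)\<close>.\<close>

definition logint :: "(real \<Rightarrow> ennreal) \<Rightarrow> real \<Rightarrow> ennreal" where
  "logint f x = (\<integral>\<^sup>+z. f z * ennreal (1 / z) * indicator {0<..x} z \<partial>lborel)"

lemma nn_integral_scale:
  assumes [measurable]: "F \<in> borel_measurable borel" and "x > 0"
  shows "(\<integral>\<^sup>+w. F (x * w) \<partial>lborel) = ennreal (1 / x) * (\<integral>\<^sup>+z. F z \<partial>lborel)"
proof -
  have "(\<integral>\<^sup>+z. F z \<partial>lborel) = ennreal x * (\<integral>\<^sup>+w. F (x * w) \<partial>lborel)"
    using nn_integral_real_affine[of F x 0] assms by simp
  hence "ennreal (1 / x) * (\<integral>\<^sup>+z. F z \<partial>lborel) = (ennreal (1 / x) * ennreal x) * (\<integral>\<^sup>+w. F (x * w) \<partial>lborel)"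
    by (simp add: mult.assoc)
  also have "ennreal (1 / x) * ennreal x = 1" using assms by (simp add: ennreal_mult[symmetric])
  finally show ?thesis by simp
qed

lemma avg_eq:
  assumes [measurable]: "F \<in> borel_measurable borel" and x: "x > 0"
  shows "avg F x = ennreal (1 / x) * (\<integral>\<^sup>+z. F z * indicator {0<..x} z \<partial>lborel)"
proof -
  have "avg F x = (\<integral>\<^sup>+w. F (x * w) * indicator {0..1} w \<partial>lborel)"
    unfolding avg_def by (rule nn_integral_unif) measurable
  also have "\<dots> = (\<integral>\<^sup>+w. F (x * w) * indicator {0<..x} (x * w) \<partial>lborel)"
  proof (rule nn_integral_cong_AE)
    have "AE w in lborel. w \<noteq> (0::real)" by (rule AE_lborel_singleton)
    thus "AE w in lborel. F (x * w) * indicator {0..1} w = F (x * w) * indicator {0<..x} (x * w)"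
      by eventually_elim (use x in \<open>auto simp: indicator_def zero_less_mult_iff\<close>)
  qed
  also have "\<dots> = ennreal (1 / x) * (\<integral>\<^sup>+z. F z * indicator {0<..x} z \<partial>lborel)"
    using nn_integral_scale[of "\<lambda>z. F z * indicator {0<..x} z" x] x by simp
  finally show ?thesis .
qed

lemma avg_mono:
  assumes "\<And>y. y > 0 \<Longrightarrow> F y \<le> G y" "x > 0"
  shows "avg F x \<le> avg G x"
proof -
  have "AE w in unif. F (x * w) \<le> G (x * w)"
    using AE_unif by eventually_elim (use assms in auto)
  thus ?thesis unfolding avg_def by (rule nn_integral_mono_AE)
qed

lemma avg_power:
  assumes "x \<ge> 0"
  shows "avg (\<lambda>x. ennreal (x ^ k)) x = ennreal (x ^ k / (real k + 1))"
proof -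
  have "avg (\<lambda>x. ennreal (x ^ k)) x = (\<integral>\<^sup>+w. ennreal ((x * w) ^ k) * indicator {0..1} w \<partial>lborel)"
    unfolding avg_def by (rule nn_integral_unif) measurable
  also have "\<dots> = (\<integral>\<^sup>+w. ennreal (x ^ k) * (ennreal (w ^ k) * indicator {0..1} w) \<partial>lborel)"
    using assms by (intro nn_integral_cong) (auto simp: indicator_def power_mult_distrib ennreal_mult)
  also have "\<dots> = ennreal (x ^ k) * (\<integral>\<^sup>+w. ennreal (w ^ k) * indicator {0..1} w \<partial>lborel)"
    by (rule nn_integral_cmult) measurable
  also have "(\<integral>\<^sup>+w. ennreal (w ^ k) * indicator {0..1} w \<partial>lborel) = ennreal (1 ^ Suc k / real (Suc k) - 0 ^ Suc k / real (Suc k))"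
  proof (rule nn_integral_FTC_Icc)
    fix w :: real
    show "((\<lambda>w. w ^ Suc k / real (Suc k)) has_real_derivative w ^ k) (at w)"
      using DERIV_cdivide[OF DERIV_pow[of "Suc k" w UNIV], of "real (Suc k)"] by (simp del: of_nat_Suc)
  qed auto
  finally show ?thesis using assms by (simp add: ennreal_mult[symmetric] add.commute)
qed

text \<open>Averaging at least halves the function \<open>Bd\<close> (in applications \<open>x\<close> or \<open>x\<^sup>2\<close>). Iterating the inequality
for \<open>F\<close> and comparing with \<open>D\<close> after each step leaves the error \<open>(C / 2\<^sup>n) Bd x\<close>. Applied in both
directions, this comparison shows that solutions of \<open>F = A + avg F\<close> are unique.\<close>

lemma le_if_sub_and_super_solution:
  assumes [measurable]: "F \<in> borel_measurable borel" "D \<in> borel_measurable borel" "Bd \<in> borel_measurable borel"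
    and F: "\<And>x. x > 0 \<Longrightarrow> F x \<le> A x + avg F x"
    and D: "\<And>x. x > 0 \<Longrightarrow> A x + avg D x \<le> D x"
    and FB: "\<And>x. x > 0 \<Longrightarrow> F x \<le> ennreal (C * Bd x)"
    and B0: "\<And>x. x > 0 \<Longrightarrow> 0 \<le> Bd x" and "C \<ge> 0"
    and BB: "\<And>x. x > 0 \<Longrightarrow> avg (\<lambda>x. ennreal (Bd x)) x \<le> ennreal (Bd x / 2)"
    and x: "x > 0"
  shows "F x \<le> D x"
proof -
  have le: "F x \<le> D x + ennreal (C / 2 ^ n) * ennreal (Bd x)" if "x > 0" for x n
    using that
  proof (induction n arbitrary: x)
    case 0
    have "F x \<le> ennreal C * ennreal (Bd x)" using FB[OF 0] B0[OF 0] \<open>C \<ge> 0\<close> by (simp add: ennreal_mult)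
    also have "\<dots> \<le> D x + ennreal C * ennreal (Bd x)" by simp
    finally show ?case by simp
  next
    case (Suc n)
    have "F x \<le> A x + avg F x" by (rule F) fact
    also have "avg F x \<le> avg (\<lambda>y. D y + ennreal (C / 2 ^ n) * ennreal (Bd y)) x"
      using Suc.IH Suc.prems by (rule avg_mono)
    also have "\<dots> = avg D x + ennreal (C / 2 ^ n) * avg (\<lambda>y. ennreal (Bd y)) x"
      unfolding avg_def by (subst nn_integral_add) (auto simp: nn_integral_cmult)
    also have "\<dots> \<le> avg D x + ennreal (C / 2 ^ n) * ennreal (Bd x / 2)"
      using BB[OF Suc.prems] by (intro add_left_mono mult_left_mono) auto
    also have "ennreal (C / 2 ^ n) * ennreal (Bd x / 2) = ennreal (C / 2 ^ Suc n) * ennreal (Bd x)"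
      using B0[OF Suc.prems] \<open>C \<ge> 0\<close> by (simp add: ennreal_mult[symmetric])
    also have "A x + (avg D x + ennreal (C / 2 ^ Suc n) * ennreal (Bd x)) = (A x + avg D x) + ennreal (C / 2 ^ Suc n) * ennreal (Bd x)"
      by (simp add: add.assoc)
    also have "\<dots> \<le> D x + ennreal (C / 2 ^ Suc n) * ennreal (Bd x)"
      using D[OF Suc.prems] by (intro add_right_mono)
    finally show ?case by (simp add: add_left_mono)
  qed
  have "(\<lambda>n. C / 2 ^ n) \<longlonglongrightarrow> 0"
    using LIMSEQ_divide_realpow_zero[of 2 C] by simp
  hence "(\<lambda>n. D x + ennreal (Bd x) * ennreal (C / 2 ^ n)) \<longlonglongrightarrow> D x + ennreal (Bd x) * ennreal 0"
    by (intro tendsto_add ennreal_tendsto_cmult tendsto_const tendsto_ennrealI) auto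
  hence "(\<lambda>n. D x + ennreal (C / 2 ^ n) * ennreal (Bd x)) \<longlonglongrightarrow> D x" by (simp add: mult.commute)
  thus ?thesis using le[OF x] by (intro LIMSEQ_le_const) auto
qed

lemma logint_measurable [measurable]:
  assumes [measurable]: "f \<in> borel_measurable borel"
  shows "logint f \<in> borel_measurable borel"
proof -
  have "(\<lambda>(x, z). f z * ennreal (1 / z) * indicator {0<..x} z) \<in> borel_measurable (borel \<Otimes>\<^sub>M lborel)"
    unfolding indicator_def greaterThanAtMost_iff split_beta by measurable
  thus ?thesis unfolding logint_def[abs_def] by (rule lborel.borel_measurable_nn_integral)
qed

lemma avg_measurable [measurable]:
  assumes [measurable]: "f \<in> borel_measurable borel"
  shows "avg f \<in> borel_measurable borel"
  unfolding avg_def[abs_def] by (rule unif.borel_measurable_nn_integral) (simp add: split_beta, measurable)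

lemma logint_mono: "(\<And>z. 0 < z \<Longrightarrow> z \<le> x \<Longrightarrow> f z \<le> g z) \<Longrightarrow> logint f x \<le> logint g x"
  unfolding logint_def by (intro nn_integral_mono) (auto simp: indicator_def intro!: mult_right_mono)

lemma logint_linear:
  assumes "c \<ge> 0" "x > 0"
  shows "logint (\<lambda>z. ennreal (c * z)) x = ennreal (c * x)"
proof -
  have "logint (\<lambda>z. ennreal (c * z)) x = (\<integral>\<^sup>+z. ennreal c * indicator {0<..x} z \<partial>lborel)"
    unfolding logint_def using assms
    by (intro nn_integral_cong) (auto simp: indicator_def ennreal_mult[symmetric])
  also have "\<dots> = ennreal c * ennreal x" using assms by (simp add: nn_integral_cmult)
  finally show ?thesis using assms by (simp add: ennreal_mult)
qed

lemma lborel_pair_swap: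
  assumes "(\<lambda>(x, y). f x y) \<in> borel_measurable (lborel \<Otimes>\<^sub>M lborel)"
  shows "(\<integral>\<^sup>+y. (\<integral>\<^sup>+x. f x y \<partial>lborel) \<partial>lborel) = (\<integral>\<^sup>+x. (\<integral>\<^sup>+y. f x y \<partial>lborel) \<partial>(lborel :: real measure))"
  using lborel_pair.Fubini'[OF assms] by simp

text \<open>By Fubini, \<open>avg (logint f) x\<close> is the integral of \<open>f(z) (1 / z) (x - z) / x\<close>, and the missing part
\<open>f(z) / x\<close> is \<open>avg f x\<close>.\<close>

lemma logint_recursion:
  assumes [measurable]: "f \<in> borel_measurable borel" and x: "x > 0"
  shows "logint f x = avg f x + avg (logint f) x"
proof -
  let ?g = "\<lambda>z. f z * ennreal (1 / z)"
  have "(\<integral>\<^sup>+y. logint f y * indicator {0<..x} y \<partial>lborel)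
     = (\<integral>\<^sup>+y. (\<integral>\<^sup>+z. ?g z * indicator {0<..y} z * indicator {0<..x} y \<partial>lborel) \<partial>lborel)"
    unfolding logint_def by (intro nn_integral_cong nn_integral_multc[symmetric]) measurable
  also have "\<dots> = (\<integral>\<^sup>+z. (\<integral>\<^sup>+y. ?g z * indicator {0<..y} z * indicator {0<..x} y \<partial>lborel) \<partial>lborel)"
    by (rule lborel_pair_swap) (unfold indicator_def greaterThanAtMost_iff split_beta, measurable)
  also have "\<dots> = (\<integral>\<^sup>+z. ?g z * ennreal (x - z) * indicator {0<..x} z \<partial>lborel)"
  proof (rule nn_integral_cong)
    fix z :: real
    have "(\<integral>\<^sup>+y. ?g z * indicator {0<..y} z * indicator {0<..x} y \<partial>lborel)
       = (\<integral>\<^sup>+y. (?g z * indicator {0<..x} z) * indicator {z..x} y \<partial>lborel)"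
      by (intro nn_integral_cong) (auto simp: indicator_def)
    also have "\<dots> = (?g z * indicator {0<..x} z) * emeasure lborel {z..x}"
      by (simp add: nn_integral_cmult)
    also have "\<dots> = ?g z * ennreal (x - z) * indicator {0<..x} z"
      by (auto simp: indicator_def)
    finally show "(\<integral>\<^sup>+y. ?g z * indicator {0<..y} z * indicator {0<..x} y \<partial>lborel) = ?g z * ennreal (x - z) * indicator {0<..x} z" .
  qed
  finally have "avg (logint f) x = ennreal (1 / x) * (\<integral>\<^sup>+z. ?g z * ennreal (x - z) * indicator {0<..x} z \<partial>lborel)"
    using x by (subst avg_eq) auto
  hence "avg f x + avg (logint f) x = ennreal (1 / x) * ((\<integral>\<^sup>+z. f z * indicator {0<..x} z \<partial>lborel) + (\<integral>\<^sup>+z. ?g z * ennreal (x - z) * indicator {0<..x} z \<partial>lborel))"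
    using x by (simp add: avg_eq distrib_left)
  also have "\<dots> = (\<integral>\<^sup>+z. ennreal (1 / x) * (f z * indicator {0<..x} z + ?g z * ennreal (x - z) * indicator {0<..x} z) \<partial>lborel)"
    by (simp add: nn_integral_add nn_integral_cmult)
  also have "\<dots> = logint f x" unfolding logint_def
  proof (rule nn_integral_cong)
    fix z :: real
    show "ennreal (1 / x) * (f z * indicator {0<..x} z + ?g z * ennreal (x - z) * indicator {0<..x} z) = ?g z * indicator {0<..x} z"
    proof (cases "0 < z \<and> z \<le> x")
      case True
      have "ennreal (1 / x) * (f z * 1 + ?g z * ennreal (x - z)) = f z * (ennreal (1 / x) * (1 + ennreal (1 / z) * ennreal (x - z)))"
        by (simp add: algebra_simps)
      also have "ennreal (1 / x) * (1 + ennreal (1 / z) * ennreal (x - z)) = ennreal (1 / x * (1 + 1 / z * (x - z)))"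
        using True x by (simp add: ennreal_mult[symmetric] ennreal_plus[symmetric] flip: ennreal_1 del: ennreal_plus ennreal_1)
      also have "1 / x * (1 + 1 / z * (x - z)) = 1 / z" using True x by (simp add: field_simps)
      finally show ?thesis using True by simp
    qed auto
  qed
  finally show ?thesis ..
qed

section \<open>Sums over a GEM sequence\<close>

abbreviation unif_seq :: "(nat \<Rightarrow> real) measure" where "unif_seq \<equiv> PiM UNIV (\<lambda>_. unif)"

interpretation unif_seq: sequence_space unif by unfold_locales

definition gem :: "(nat \<Rightarrow> real) \<Rightarrow> nat \<Rightarrow> real" where
  "gem w r = (\<Prod>i<r. w i) * (1 - w r)"

lemma sets_unif_seq [measurable_cong]: "sets unif_seq = sets seq_space"
  by (intro sets_PiM_cong) auto

lemma sets_GEM01 [measurable_cong]: "sets GEM01 = sets seq_space"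
  by (simp add: GEM01_def)

lemma space_GEM01 [simp]: "space GEM01 = UNIV"
  by (simp add: GEM01_def space_PiM)

lemma gem_measurable [measurable]: "gem \<in> measurable seq_space seq_space"
proof (rule measurable_PiM_single')
  show "(\<lambda>w. gem w r) \<in> borel_measurable seq_space" for r
    unfolding gem_def by measurable
qed (auto simp: space_PiM)

lemma GEM01_eq: "GEM01 = distr unif_seq seq_space gem"
  unfolding GEM01_def gem_def[abs_def] ..

lemma gem_measurable' [measurable]: "gem \<in> measurable unif_seq seq_space"
  using gem_measurable by (simp cong: measurable_cong_sets sets_unif_seq)

lemma prob_space_GEM01: "prob_space GEM01"
  unfolding GEM01_eq by (rule unif_seq.prob_space_distr) measurable

interpretation GEM01: prob_space GEM01 by (rule prob_space_GEM01)

lemma emeasure_GEM01 [simp]: "emeasure GEM01 UNIV = 1"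
  using GEM01.emeasure_space_1 by simp

lemma nn_integral_GEM01:
  assumes [measurable]: "F \<in> borel_measurable seq_space"
  shows "(\<integral>\<^sup>+p. F p \<partial>GEM01) = (\<integral>\<^sup>+w. F (gem w) \<partial>unif_seq)"
  unfolding GEM01_eq by (rule nn_integral_distr) measurable

lemma nn_integral_unif_seq_iter:
  assumes [measurable]: "F \<in> borel_measurable seq_space"
  shows "(\<integral>\<^sup>+w. F w \<partial>unif_seq) = (\<integral>\<^sup>+s. (\<integral>\<^sup>+w. F (case_nat s w) \<partial>unif_seq) \<partial>unif)"
proof -
  have m: "(\<lambda>(s, w). case_nat s w) \<in> measurable (unif \<Otimes>\<^sub>M unif_seq) unif_seq"
    by measurable
  have F: "F \<in> borel_measurable unif_seq" by measurable
  have "(\<integral>\<^sup>+w. F w \<partial>unif_seq) = (\<integral>\<^sup>+w. F w \<partial>distr (unif \<Otimes>\<^sub>M unif_seq) unif_seq (\<lambda>(s, w). case_nat s w))"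
    by (simp add: unif_seq.PiM_iter)
  also have "\<dots> = (\<integral>\<^sup>+p. F (case p of (s, w) \<Rightarrow> case_nat s w) \<partial>(unif \<Otimes>\<^sub>M unif_seq))"
    using F by (intro nn_integral_distr[OF m]) simp
  also have "\<dots> = (\<integral>\<^sup>+s. (\<integral>\<^sup>+w. F (case_nat s w) \<partial>unif_seq) \<partial>unif)"
    using unif_seq.nn_integral_fst[OF measurable_compose[OF m F]] by simp
  finally show ?thesis .
qed

lemma gem_case_nat: "gem (case_nat s w) = case_nat (1 - s) (\<lambda>r. s * gem w r)"
proof
  fix r show "gem (case_nat s w) r = case_nat (1 - s) (\<lambda>r. s * gem w r) r"
    by (cases r) (simp_all add: gem_def prod.lessThan_Suc_shift mult.assoc del: prod.lessThan_Suc)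
qed

lemma case_nat_measurable [measurable]:
  "(\<lambda>p. case_nat (f p) (\<lambda>r. g p r)) \<in> measurable M seq_space"
  if [measurable]: "f \<in> borel_measurable M" "\<And>r. (\<lambda>p. g p r) \<in> borel_measurable M"
proof (rule measurable_PiM_single')
  show "(\<lambda>p. case_nat (f p) (\<lambda>r. g p r) r) \<in> borel_measurable M" for r
    by (cases r) auto
qed (auto simp: space_PiM)

text \<open>Self-similarity of stick breaking: the first term is \<open>1 - s\<close>, and the others are an independent GEM
sequence scaled by \<open>s\<close>.\<close>

lemma nn_integral_GEM01_iter:
  assumes [measurable]: "F \<in> borel_measurable seq_space"
  shows "(\<integral>\<^sup>+p. F p \<partial>GEM01) = (\<integral>\<^sup>+s. (\<integral>\<^sup>+p. F (case_nat (1 - s) (\<lambda>r. s * p r)) \<partial>GEM01) \<partial>unif)"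
proof -
  have "(\<integral>\<^sup>+p. F p \<partial>GEM01) = (\<integral>\<^sup>+s. (\<integral>\<^sup>+w. F (gem (case_nat s w)) \<partial>unif_seq) \<partial>unif)"
    by (subst nn_integral_GEM01, measurable) (rule nn_integral_unif_seq_iter, measurable)
  also have "\<dots> = (\<integral>\<^sup>+s. (\<integral>\<^sup>+p. F (case_nat (1 - s) (\<lambda>r. s * p r)) \<partial>GEM01) \<partial>unif)"
    unfolding gem_case_nat by (intro nn_integral_cong nn_integral_GEM01[symmetric]) measurable
  finally show ?thesis .
qed

lemma AE_unif_seq: "AE w in unif_seq. \<forall>i. 0 < w i \<and> w i < 1"
  using AE_unif by (subst AE_all_countable) (intro allI AE_PiM_component, auto intro: prob_space_unif)

lemma gem_sum: "(\<Sum>i<n. gem w i) = 1 - (\<Prod>i<n. w i)"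
  by (induction n) (auto simp: gem_def algebra_simps)

lemma gem_pos: "(\<And>i. 0 < w i \<and> w i < 1) \<Longrightarrow> gem w r > 0"
  unfolding gem_def by (auto intro!: mult_pos_pos prod_pos)

lemma AE_GEM01: "AE p in GEM01. (\<forall>r. 0 < p r) \<and> (\<forall>n. (\<Sum>i<n. p i) \<le> 1)"
  unfolding GEM01_eq
proof (subst AE_distr_iff)
  show "AE w in unif_seq. (\<forall>r. 0 < gem w r) \<and> (\<forall>n. (\<Sum>i<n. gem w i) \<le> 1)"
    using AE_unif_seq
  proof eventually_elim
    case (elim w)
    thus ?case by (auto intro!: gem_pos prod_nonneg simp: gem_sum less_imp_le)
  qed
qed measurable

lemma suminf_le_if_partial_sums:
  fixes p :: "nat \<Rightarrow> real"
  assumes "\<And>r. 0 \<le> p r" "\<And>n. (\<Sum>i<n. p i) \<le> 1"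
  shows "(\<Sum>r. ennreal (p r)) \<le> 1"
proof (rule suminf_le_const)
  show "(\<Sum>i<n. ennreal (p i)) \<le> 1" for n
    using assms(2)[of n] assms(1) by (simp add: sum_ennreal ennreal_le_1)
qed auto

lemma suminf_head:
  fixes f :: "nat \<Rightarrow> ennreal"
  shows "(\<Sum>n. f n) = f 0 + (\<Sum>n. f (Suc n))"
  using sums_Suc[OF summable_sums[OF summableI[of "\<lambda>n. f (Suc n)"]]] by (simp add: sums_iff add.commute)

lemma nn_integral_unif_reflect:
  assumes [measurable]: "f \<in> borel_measurable borel"
  shows "(\<integral>\<^sup>+s. f (1 - s) \<partial>unif) = (\<integral>\<^sup>+s. f s \<partial>unif)"
proof -
  have "(\<integral>\<^sup>+s. f s * indicator {0..1} s \<partial>lborel) = (\<integral>\<^sup>+s. f (1 + (-1) * s) * indicator {0..1} (1 + (-1) * s) \<partial>lborel)"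
    by (subst nn_integral_real_affine[of _ "-1" 1]) auto
  also have "\<dots> = (\<integral>\<^sup>+s. f (1 - s) * indicator {0..1} s \<partial>lborel)"
    by (intro nn_integral_cong) (auto simp: indicator_def)
  finally show ?thesis by (simp add: nn_integral_unif)
qed

definition gem_sum_mean :: "(real \<Rightarrow> ennreal) \<Rightarrow> real \<Rightarrow> ennreal" where
  "gem_sum_mean f x = (\<integral>\<^sup>+p. (\<Sum>r. f (x * p r)) \<partial>GEM01)"

lemma gem_sum_mean_measurable [measurable]:
  assumes [measurable]: "f \<in> borel_measurable borel"
  shows "gem_sum_mean f \<in> borel_measurable borel"
  unfolding gem_sum_mean_def[abs_def]
  by (rule GEM01.borel_measurable_nn_integral) (simp add: split_beta, measurable)

lemma suminf_linear_bound:
  assumes "\<And>z. z > 0 \<Longrightarrow> f z \<le> ennreal (c * z)" "c \<ge> 0" "x > 0"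
    and p: "\<And>r. 0 < p r" "\<And>n. (\<Sum>i<n. p i) \<le> (1::real)"
  shows "(\<Sum>r. f (x * p r)) \<le> ennreal (c * x)"
proof -
  have "(\<Sum>r. f (x * p r)) \<le> (\<Sum>r. ennreal (c * x) * ennreal (p r))"
  proof (intro suminf_le summableI)
    fix r
    have "f (x * p r) \<le> ennreal (c * (x * p r))" using assms p(1)[of r] by auto
    also have "c * (x * p r) = (c * x) * p r" by simp
    also have "ennreal \<dots> = ennreal (c * x) * ennreal (p r)"
      using assms less_imp_le[OF p(1)[of r]] by (intro ennreal_mult) auto
    finally show "f (x * p r) \<le> ennreal (c * x) * ennreal (p r)" .
  qed
  also have "\<dots> = ennreal (c * x) * (\<Sum>r. ennreal (p r))" by simp
  also have "\<dots> \<le> ennreal (c * x) * 1"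
    using p by (intro mult_left_mono suminf_le_if_partial_sums) (auto intro: less_imp_le)
  finally show ?thesis by simp
qed

lemma gem_sum_mean_linear_bound:
  assumes "\<And>z. z > 0 \<Longrightarrow> f z \<le> ennreal (c * z)" "c \<ge> 0" "x > 0"
  shows "gem_sum_mean f x \<le> ennreal (c * x)"
proof -
  have "gem_sum_mean f x \<le> (\<integral>\<^sup>+p. ennreal (c * x) \<partial>GEM01)"
    unfolding gem_sum_mean_def
  proof (rule nn_integral_mono_AE)
    show "AE p in GEM01. (\<Sum>r. f (x * p r)) \<le> ennreal (c * x)"
      using AE_GEM01 by eventually_elim (intro suminf_linear_bound assms, auto)
  qed
  thus ?thesis by simp
qed

lemma gem_sum_mean_recursion:
  assumes [measurable]: "f \<in> borel_measurable borel"
  shows "gem_sum_mean f x = avg f x + avg (gem_sum_mean f) x"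
proof -
  have "gem_sum_mean f x = (\<integral>\<^sup>+s. (\<integral>\<^sup>+p. (\<Sum>r. f (x * case_nat (1 - s) (\<lambda>r. s * p r) r)) \<partial>GEM01) \<partial>unif)"
    unfolding gem_sum_mean_def by (rule nn_integral_GEM01_iter) measurable
  also have "\<dots> = (\<integral>\<^sup>+s. (\<integral>\<^sup>+p. f (x * (1 - s)) + (\<Sum>r. f (x * s * p r)) \<partial>GEM01) \<partial>unif)"
    by (subst suminf_head) (simp add: mult.assoc)
  also have "\<dots> = (\<integral>\<^sup>+s. f (x * (1 - s)) + gem_sum_mean f (x * s) \<partial>unif)"
    unfolding gem_sum_mean_def
    by (intro nn_integral_cong) (subst nn_integral_add, auto)
  also have "\<dots> = (\<integral>\<^sup>+s. f (x * (1 - s)) \<partial>unif) + (\<integral>\<^sup>+s. gem_sum_mean f (x * s) \<partial>unif)"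
    by (rule nn_integral_add) measurable
  also have "(\<integral>\<^sup>+s. f (x * (1 - s)) \<partial>unif) = avg f x"
    unfolding avg_def by (rule nn_integral_unif_reflect) measurable
  finally show ?thesis by (simp add: avg_def)
qed

lemma avg_id_le_half: "x > 0 \<Longrightarrow> avg (\<lambda>x. ennreal x) x \<le> ennreal (x / 2)"
  using avg_power[of x 1] by simp

text \<open>Both sides solve the same averaging equation and have linear growth.\<close>

theorem gem_sum_mean_eq_logint:
  assumes [measurable]: "f \<in> borel_measurable borel"
    and f: "\<And>z. z > 0 \<Longrightarrow> f z \<le> ennreal (c * z)" and c: "c \<ge> 0" and x: "x > 0"
  shows "gem_sum_mean f x = logint f x"
proof (rule antisym)
  have li: "logint f x \<le> ennreal (c * x)" if "x > 0" for x
    using logint_mono[of x f "\<lambda>z. ennreal (c * z)"] f logint_linear[OF c that] by auto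
  show "gem_sum_mean f x \<le> logint f x"
    by (rule le_if_sub_and_super_solution[where A = "avg f" and C = c and Bd = "\<lambda>x. x"])
       (use x c f gem_sum_mean_linear_bound avg_id_le_half in
         \<open>auto simp: gem_sum_mean_recursion[symmetric] logint_recursion[symmetric]\<close>)
  show "logint f x \<le> gem_sum_mean f x"
    by (rule le_if_sub_and_super_solution[where A = "avg f" and C = c and Bd = "\<lambda>x. x"])
       (use x c f li avg_id_le_half in
         \<open>auto simp: gem_sum_mean_recursion[symmetric] logint_recursion[symmetric]\<close>)
qed

section \<open>Pairs in a GEM sequence\<close>

definition off_diagonal :: "(nat \<Rightarrow> ennreal) \<Rightarrow> ennreal" where
  "off_diagonal g = (\<Sum>r. \<Sum>s. if r = s then 0 else g r * g s)"

lemma off_diagonal_head: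
  "off_diagonal g = 2 * g 0 * (\<Sum>s. g (Suc s)) + off_diagonal (\<lambda>r. g (Suc r))"
proof -
  have 0: "(\<Sum>s. if 0 = s then 0 else g 0 * g s) = g 0 * (\<Sum>s. g (Suc s))"
    by (subst suminf_head) simp
  have S: "(\<Sum>s. if Suc r = s then 0 else g (Suc r) * g s) = g 0 * g (Suc r) + (\<Sum>s. if r = s then 0 else g (Suc r) * g (Suc s))" for r
    by (subst suminf_head) (simp add: mult.commute)
  have "off_diagonal g = g 0 * (\<Sum>s. g (Suc s)) + (\<Sum>r. g 0 * g (Suc r) + (\<Sum>s. if r = s then 0 else g (Suc r) * g (Suc s)))"
    unfolding off_diagonal_def by (subst suminf_head) (simp only: 0 S)
  also have "(\<Sum>r. g 0 * g (Suc r) + (\<Sum>s. if r = s then 0 else g (Suc r) * g (Suc s))) =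
      g 0 * (\<Sum>s. g (Suc s)) + off_diagonal (\<lambda>r. g (Suc r))"
    unfolding off_diagonal_def by (subst suminf_add[symmetric]) auto
  finally show ?thesis by (simp add: mult_2 distrib_right add.assoc)
qed

lemma square_suminf:
  fixes g :: "nat \<Rightarrow> ennreal"
  shows "(\<Sum>r. g r)\<^sup>2 = (\<Sum>r. (g r)\<^sup>2) + off_diagonal g"
proof -
  have "(\<Sum>r. g r)\<^sup>2 = (\<Sum>r. \<Sum>s. g r * g s)" by (simp add: power2_eq_square)
  also have "\<dots> = (\<Sum>r. (g r)\<^sup>2 + (\<Sum>s. if r = s then 0 else g r * g s))"
  proof (intro suminf_cong)
    fix r
    have "(\<Sum>s. g r * g s) = (\<Sum>s. (if s = r then g r * g s else 0) + (if r = s then 0 else g r * g s))"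
      by (intro suminf_cong) auto
    also have "\<dots> = (\<Sum>s. if s = r then g r * g s else 0) + (\<Sum>s. if r = s then 0 else g r * g s)"
      by (subst suminf_add) auto
    also have "(\<Sum>s. if s = r then g r * g s else 0) = (g r)\<^sup>2"
      by (subst suminf_finite[of "{r}"]) (auto simp: power2_eq_square)
    finally show "(\<Sum>s. g r * g s) = (g r)\<^sup>2 + (\<Sum>s. if r = s then 0 else g r * g s)" .
  qed
  also have "\<dots> = (\<Sum>r. (g r)\<^sup>2) + off_diagonal g"
    unfolding off_diagonal_def by (subst suminf_add) auto
  finally show ?thesis .
qed

definition gem_pair_mean :: "(real \<Rightarrow> ennreal) \<Rightarrow> real \<Rightarrow> ennreal" where
  "gem_pair_mean f x = (\<integral>\<^sup>+p. off_diagonal (\<lambda>r. f (x * p r)) \<partial>GEM01)"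

lemma gem_pair_mean_measurable [measurable]:
  assumes [measurable]: "f \<in> borel_measurable borel"
  shows "gem_pair_mean f \<in> borel_measurable borel"
  unfolding gem_pair_mean_def[abs_def] off_diagonal_def
  by (rule GEM01.borel_measurable_nn_integral) (simp add: split_beta, measurable)

lemma gem_pair_mean_recursion:
  assumes [measurable]: "f \<in> borel_measurable borel"
    and f: "\<And>z. z > 0 \<Longrightarrow> f z \<le> ennreal (c * z)" and c: "c \<ge> 0" and x: "x > 0"
  shows "gem_pair_mean f x = (\<integral>\<^sup>+s. 2 * f (x * (1 - s)) * logint f (x * s) \<partial>unif) + avg (gem_pair_mean f) x"
proof -
  have "gem_pair_mean f x = (\<integral>\<^sup>+s. (\<integral>\<^sup>+p. off_diagonal (\<lambda>r. f (x * case_nat (1 - s) (\<lambda>r. s * p r) r)) \<partial>GEM01) \<partial>unif)"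
    unfolding gem_pair_mean_def off_diagonal_def by (rule nn_integral_GEM01_iter) measurable
  also have "\<dots> = (\<integral>\<^sup>+s. (\<integral>\<^sup>+p. 2 * f (x * (1 - s)) * (\<Sum>r. f (x * s * p r)) + off_diagonal (\<lambda>r. f (x * s * p r)) \<partial>GEM01) \<partial>unif)"
    by (subst off_diagonal_head) (simp add: mult.assoc)
  also have "\<dots> = (\<integral>\<^sup>+s. 2 * f (x * (1 - s)) * gem_sum_mean f (x * s) + gem_pair_mean f (x * s) \<partial>unif)"
    unfolding gem_sum_mean_def gem_pair_mean_def off_diagonal_def
    by (intro nn_integral_cong) (subst nn_integral_add, auto simp: nn_integral_cmult)
  also have "\<dots> = (\<integral>\<^sup>+s. 2 * f (x * (1 - s)) * gem_sum_mean f (x * s) \<partial>unif) + avg (gem_pair_mean f) x"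
    unfolding avg_def by (rule nn_integral_add) measurable
  also have "(\<integral>\<^sup>+s. 2 * f (x * (1 - s)) * gem_sum_mean f (x * s) \<partial>unif) = (\<integral>\<^sup>+s. 2 * f (x * (1 - s)) * logint f (x * s) \<partial>unif)"
  proof (rule nn_integral_cong_AE)
    show "AE s in unif. 2 * f (x * (1 - s)) * gem_sum_mean f (x * s) = 2 * f (x * (1 - s)) * logint f (x * s)"
      using AE_unif
    proof eventually_elim
      case (elim s)
      have "gem_sum_mean f (x * s) = logint f (x * s)"
        by (rule gem_sum_mean_eq_logint[OF assms(1) f c]) (use elim x in auto)
      thus ?case by simp
    qed
  qed
  finally show ?thesis .
qed

text \<open>The function \<open>f(y) f(z)\<close> times the pair correlation density of the points \<open>x P\<^sub>r\<close>, which is that of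
a Poisson process with intensity \<open>dz / z\<close>, restricted to pairs with a sum of at most \<open>x\<close>.\<close>

definition simplex_pair :: "(real \<Rightarrow> ennreal) \<Rightarrow> real \<Rightarrow> real \<Rightarrow> real \<Rightarrow> ennreal" where
  "simplex_pair f x y z = f y * f z * ennreal (1 / (y * z)) * of_bool (0 < y \<and> 0 < z \<and> y + z \<le> x)"

lemma simplex_pair_measurable [measurable (raw)]:
  assumes [measurable]: "f \<in> borel_measurable borel" "X \<in> borel_measurable M" "Y \<in> borel_measurable M" "Z \<in> borel_measurable M"
  shows "(\<lambda>p. simplex_pair f (X p) (Y p) (Z p)) \<in> borel_measurable M"
  unfolding simplex_pair_def of_bool_def by measurable

text \<open>The three terms of \<open>1 = y / x + z / x + (x - y - z) / x\<close> correspond to the cases that the first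
broken piece of the stick is \<open>y\<close>, is \<open>z\<close>, or is neither. The first two contribute equally.\<close>

lemma simplex_pair_integral_recursion:
  assumes [measurable]: "f \<in> borel_measurable borel" and x: "x > 0"
  defines "D \<equiv> \<lambda>x. \<integral>\<^sup>+y. \<integral>\<^sup>+z. simplex_pair f x y z \<partial>lborel \<partial>lborel"
  shows "(\<integral>\<^sup>+s. 2 * f (x * (1 - s)) * logint f (x * s) \<partial>unif) + avg D x = D x"
proof -
  let ?k = "simplex_pair f x"
  have [measurable]: "D \<in> borel_measurable borel" unfolding D_def by measurable
  have "avg D x = ennreal (1 / x) * (\<integral>\<^sup>+t. D t * indicator {0<..x} t \<partial>lborel)"
    using x by (intro avg_eq) measurable
  also have "(\<integral>\<^sup>+t. D t * indicator {0<..x} t \<partial>lborel) =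
     (\<integral>\<^sup>+t. \<integral>\<^sup>+y. \<integral>\<^sup>+z. simplex_pair f t y z * indicator {0<..x} t \<partial>lborel \<partial>lborel \<partial>lborel)"
    unfolding D_def by (intro nn_integral_cong) (simp add: nn_integral_multc)
  also have "\<dots> = (\<integral>\<^sup>+y. \<integral>\<^sup>+t. \<integral>\<^sup>+z. simplex_pair f t y z * indicator {0<..x} t \<partial>lborel \<partial>lborel \<partial>lborel)"
    by (rule lborel_pair_swap) (simp add: split_beta, measurable)
  also have "\<dots> = (\<integral>\<^sup>+y. \<integral>\<^sup>+z. \<integral>\<^sup>+t. simplex_pair f t y z * indicator {0<..x} t \<partial>lborel \<partial>lborel \<partial>lborel)"
    by (intro nn_integral_cong lborel_pair_swap) (simp add: split_beta, measurable)
  also have "\<dots> = (\<integral>\<^sup>+y. \<integral>\<^sup>+z. ?k y z * ennreal (x - y - z) \<partial>lborel \<partial>lborel)"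
  proof (intro nn_integral_cong)
    fix y z :: real
    have "(\<integral>\<^sup>+t. simplex_pair f t y z * indicator {0<..x} t \<partial>lborel) = (\<integral>\<^sup>+t. ?k y z * indicator {y + z..x} t \<partial>lborel)"
      by (intro nn_integral_cong) (auto simp: simplex_pair_def indicator_def)
    also have "\<dots> = ?k y z * ennreal (x - y - z)"
      by (cases "y + z \<le> x") (auto simp: nn_integral_cmult simplex_pair_def algebra_simps)
    finally show "(\<integral>\<^sup>+t. simplex_pair f t y z * indicator {0<..x} t \<partial>lborel) = ?k y z * ennreal (x - y - z)" .
  qed
  also have "ennreal (1 / x) * \<dots> = (\<integral>\<^sup>+y. \<integral>\<^sup>+z. ?k y z * ennreal ((x - y - z) / x) \<partial>lborel \<partial>lborel)"
  proof -
    have "ennreal (1 / x) * (\<integral>\<^sup>+y. \<integral>\<^sup>+z. ?k y z * ennreal (x - y - z) \<partial>lborel \<partial>lborel)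
        = (\<integral>\<^sup>+y. \<integral>\<^sup>+z. ennreal (1 / x) * (?k y z * ennreal (x - y - z)) \<partial>lborel \<partial>lborel)"
      by (simp add: nn_integral_cmult)
    also have "\<dots> = (\<integral>\<^sup>+y. \<integral>\<^sup>+z. ?k y z * ennreal ((x - y - z) / x) \<partial>lborel \<partial>lborel)"
    proof (intro nn_integral_cong)
      fix y z :: real
      show "ennreal (1 / x) * (?k y z * ennreal (x - y - z)) = ?k y z * ennreal ((x - y - z) / x)"
      proof (cases "y + z \<le> x")
        case True
        hence "ennreal (1 / x) * ennreal (x - y - z) = ennreal ((x - y - z) / x)"
          using x by (simp add: ennreal_mult[symmetric])
        thus ?thesis by (simp add: mult.left_commute[of "ennreal (1/x)"])
      qed (simp add: simplex_pair_def)
    qed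
    finally show ?thesis .
  qed
  finally have 1: "avg D x = (\<integral>\<^sup>+y. \<integral>\<^sup>+z. ?k y z * ennreal ((x - y - z) / x) \<partial>lborel \<partial>lborel)" .

  have "(\<integral>\<^sup>+s. 2 * f (x * (1 - s)) * logint f (x * s) \<partial>unif) = (\<integral>\<^sup>+s. 2 * f (x * (1 - (1 - s))) * logint f (x * (1 - s)) \<partial>unif)"
    by (rule nn_integral_unif_reflect[symmetric]) measurable
  also have "\<dots> = avg (\<lambda>y. 2 * f y * logint f (x - y)) x"
    unfolding avg_def by (simp add: right_diff_distrib)
  also have "\<dots> = ennreal (1 / x) * (\<integral>\<^sup>+y. 2 * f y * logint f (x - y) * indicator {0<..x} y \<partial>lborel)"
    using x by (intro avg_eq) measurable
  also have "(\<integral>\<^sup>+y. 2 * f y * logint f (x - y) * indicator {0<..x} y \<partial>lborel) =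
     (\<integral>\<^sup>+y. \<integral>\<^sup>+z. 2 * f y * indicator {0<..x} y * (f z * ennreal (1 / z) * indicator {0<..x - y} z) \<partial>lborel \<partial>lborel)"
  proof (rule nn_integral_cong)
    fix y :: real
    have "(\<integral>\<^sup>+z. 2 * f y * indicator {0<..x} y * (f z * ennreal (1 / z) * indicator {0<..x - y} z) \<partial>lborel)
        = 2 * f y * indicator {0<..x} y * logint f (x - y)"
      unfolding logint_def by (rule nn_integral_cmult) measurable
    thus "2 * f y * logint f (x - y) * indicator {0<..x} y =
        (\<integral>\<^sup>+z. 2 * f y * indicator {0<..x} y * (f z * ennreal (1 / z) * indicator {0<..x - y} z) \<partial>lborel)"
      by (simp add: mult_ac)
  qed
  also have "\<dots> = (\<integral>\<^sup>+y. \<integral>\<^sup>+z. ?k y z * ennreal (2 * y) \<partial>lborel \<partial>lborel)"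
  proof (intro nn_integral_cong)
    fix y z :: real
    show "2 * f y * indicator {0<..x} y * (f z * ennreal (1 / z) * indicator {0<..x - y} z) = ?k y z * ennreal (2 * y)"
    proof (cases "0 < y \<and> 0 < z \<and> y + z \<le> x")
      case True
      have "2 * ennreal (1 / z) = ennreal (1 / (y * z)) * ennreal (2 * y)"
        using True by (simp add: ennreal_mult[symmetric] flip: ennreal_numeral)
      thus ?thesis using True
        by (simp add: simplex_pair_def indicator_def) (simp add: mult_ac)
    qed (auto simp: simplex_pair_def indicator_def)
  qed
  also have "ennreal (1 / x) * \<dots> = (\<integral>\<^sup>+y. \<integral>\<^sup>+z. ?k y z * ennreal (y / x) + ?k y z * ennreal (y / x) \<partial>lborel \<partial>lborel)"
  proof -
    have "ennreal (1 / x) * (\<integral>\<^sup>+y. \<integral>\<^sup>+z. ?k y z * ennreal (2 * y) \<partial>lborel \<partial>lborel)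
        = (\<integral>\<^sup>+y. \<integral>\<^sup>+z. ennreal (1 / x) * (?k y z * ennreal (2 * y)) \<partial>lborel \<partial>lborel)"
      by (simp add: nn_integral_cmult)
    also have "\<dots> = (\<integral>\<^sup>+y. \<integral>\<^sup>+z. ?k y z * ennreal (y / x) + ?k y z * ennreal (y / x) \<partial>lborel \<partial>lborel)"
    proof (intro nn_integral_cong)
      fix y z :: real
      show "ennreal (1 / x) * (?k y z * ennreal (2 * y)) = ?k y z * ennreal (y / x) + ?k y z * ennreal (y / x)"
      proof (cases "0 < y")
        case True
        have "ennreal (1 / x) * ennreal (2 * y) = ennreal (1 / x * (2 * y))"
          using True x by (intro ennreal_mult[symmetric]) auto
        also have "1 / x * (2 * y) = y / x + y / x" by simp
        also have "ennreal (y / x + y / x) = ennreal (y / x) + ennreal (y / x)"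
          using True x by (intro ennreal_plus) auto
        finally show ?thesis by (simp add: distrib_left[symmetric] mult.left_commute[of "ennreal (1/x)"])
      qed (simp add: simplex_pair_def)
    qed
    finally show ?thesis .
  qed
  also have "\<dots> = (\<integral>\<^sup>+y. \<integral>\<^sup>+z. ?k y z * ennreal (y / x) \<partial>lborel \<partial>lborel) + (\<integral>\<^sup>+y. \<integral>\<^sup>+z. ?k y z * ennreal (y / x) \<partial>lborel \<partial>lborel)"
    by (simp add: nn_integral_add)
  finally have twice: "(\<integral>\<^sup>+s. 2 * f (x * (1 - s)) * logint f (x * s) \<partial>unif) =
      (\<integral>\<^sup>+y. \<integral>\<^sup>+z. ?k y z * ennreal (y / x) \<partial>lborel \<partial>lborel) + (\<integral>\<^sup>+y. \<integral>\<^sup>+z. ?k y z * ennreal (y / x) \<partial>lborel \<partial>lborel)" .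
  have "(\<integral>\<^sup>+y. \<integral>\<^sup>+z. ?k y z * ennreal (y / x) \<partial>lborel \<partial>lborel) = (\<integral>\<^sup>+z. \<integral>\<^sup>+y. ?k y z * ennreal (y / x) \<partial>lborel \<partial>lborel)"
    by (rule lborel_pair_swap[symmetric]) (simp add: split_beta, measurable)
  also have "\<dots> = (\<integral>\<^sup>+y. \<integral>\<^sup>+z. ?k y z * ennreal (z / x) \<partial>lborel \<partial>lborel)"
    by (intro nn_integral_cong) (simp add: simplex_pair_def mult_ac add_ac conj_ac)
  finally have sw: "(\<integral>\<^sup>+y. \<integral>\<^sup>+z. ?k y z * ennreal (y / x) \<partial>lborel \<partial>lborel) = (\<integral>\<^sup>+y. \<integral>\<^sup>+z. ?k y z * ennreal (z / x) \<partial>lborel \<partial>lborel)" .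
  have 2: "(\<integral>\<^sup>+s. 2 * f (x * (1 - s)) * logint f (x * s) \<partial>unif) =
      (\<integral>\<^sup>+y. \<integral>\<^sup>+z. ?k y z * ennreal (z / x) \<partial>lborel \<partial>lborel) + (\<integral>\<^sup>+y. \<integral>\<^sup>+z. ?k y z * ennreal (y / x) \<partial>lborel \<partial>lborel)"
    using twice sw by metis
  have "(\<integral>\<^sup>+s. 2 * f (x * (1 - s)) * logint f (x * s) \<partial>unif) + avg D x =
    (\<integral>\<^sup>+y. \<integral>\<^sup>+z. ?k y z * ennreal (z / x) + ?k y z * ennreal (y / x) + ?k y z * ennreal ((x - y - z) / x) \<partial>lborel \<partial>lborel)"
    unfolding 1 2 by (simp add: nn_integral_add)
  also have "\<dots> = D x" unfolding D_def
  proof (intro nn_integral_cong)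
    fix y z :: real
    show "?k y z * ennreal (z / x) + ?k y z * ennreal (y / x) + ?k y z * ennreal ((x - y - z) / x) = ?k y z"
    proof (cases "0 < y \<and> 0 < z \<and> y + z \<le> x")
      case True
      have "ennreal (z / x) + ennreal (y / x) + ennreal ((x - y - z) / x) = ennreal (z / x + y / x + (x - y - z) / x)"
        using True x by simp
      also have "z / x + y / x + (x - y - z) / x = 1" using x by (simp add: field_simps)
      finally show ?thesis by (simp add: distrib_left[symmetric])
    qed (auto simp: simplex_pair_def)
  qed
  finally show ?thesis .
qed

text \<open>The integral of the pair correlation density solves the averaging equation of the pair mean;
enlarging its domain from the simplex to the square gives the square of the mean. So GEM weights are
negatively correlated in pairs.\<close>

theorem gem_pair_mean_le:
  assumes [measurable]: "f \<in> borel_measurable borel"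
    and f: "\<And>z. z > 0 \<Longrightarrow> f z \<le> ennreal (c * z)" and c: "c \<ge> 0" and x: "x > 0"
  shows "gem_pair_mean f x \<le> (logint f x)\<^sup>2"
proof -
  define D where "D = (\<lambda>x. \<integral>\<^sup>+y. \<integral>\<^sup>+z. simplex_pair f x y z \<partial>lborel \<partial>lborel)"
  have [measurable]: "D \<in> borel_measurable borel" unfolding D_def by measurable
  have bd: "gem_pair_mean f x \<le> ennreal (c\<^sup>2 * x\<^sup>2)" if x: "x > 0" for x
  proof -
    have "gem_pair_mean f x \<le> (\<integral>\<^sup>+p. ennreal (c\<^sup>2 * x\<^sup>2) \<partial>GEM01)"
      unfolding gem_pair_mean_def
    proof (rule nn_integral_mono_AE)
      show "AE p in GEM01. off_diagonal (\<lambda>r. f (x * p r)) \<le> ennreal (c\<^sup>2 * x\<^sup>2)"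
        using AE_GEM01
      proof eventually_elim
        case (elim p)
        have "off_diagonal (\<lambda>r. f (x * p r)) \<le> (\<Sum>r. f (x * p r))\<^sup>2" by (simp add: square_suminf)
        also have "\<dots> \<le> (ennreal (c * x))\<^sup>2"
          using elim by (intro power_mono suminf_linear_bound f c x) auto
        also have "\<dots> = ennreal (c\<^sup>2 * x\<^sup>2)" using c x by (simp add: ennreal_power power_mult_distrib)
        finally show ?case .
      qed
    qed
    thus ?thesis by simp
  qed
  have "gem_pair_mean f x \<le> D x"
  proof (rule le_if_sub_and_super_solution[where C = "c\<^sup>2" and Bd = "\<lambda>x. x\<^sup>2"
      and A = "\<lambda>x. \<integral>\<^sup>+s. 2 * f (x * (1 - s)) * logint f (x * s) \<partial>unif"])
    show "avg (\<lambda>x. ennreal (x\<^sup>2)) x \<le> ennreal (x\<^sup>2 / 2)" if "x > 0" for x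
    proof -
      have "avg (\<lambda>x. ennreal (x\<^sup>2)) x = ennreal (x\<^sup>2 / 3)" using avg_power[of x 2] that by simp
      also have "\<dots> \<le> ennreal (x\<^sup>2 / 2)" by (intro ennreal_leI) auto
      finally show ?thesis .
    qed
    show "gem_pair_mean f x \<le> (\<integral>\<^sup>+s. 2 * f (x * (1 - s)) * logint f (x * s) \<partial>unif) + avg (gem_pair_mean f) x" if "x > 0" for x
      using gem_pair_mean_recursion[OF assms(1) f c that] by simp
    show "(\<integral>\<^sup>+s. 2 * f (x * (1 - s)) * logint f (x * s) \<partial>unif) + avg D x \<le> D x" if "x > 0" for x
      using simplex_pair_integral_recursion[OF assms(1) that] unfolding D_def by simp
  qed (use bd x in auto)
  also have "D x \<le> (\<integral>\<^sup>+y. \<integral>\<^sup>+z. (f y * ennreal (1 / y) * indicator {0<..x} y) * (f z * ennreal (1 / z) * indicator {0<..x} z) \<partial>lborel \<partial>lborel)"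
    unfolding D_def
  proof (intro nn_integral_mono)
    fix y z :: real
    show "simplex_pair f x y z \<le> (f y * ennreal (1 / y) * indicator {0<..x} y) * (f z * ennreal (1 / z) * indicator {0<..x} z)"
    proof (cases "0 < y \<and> 0 < z \<and> y + z \<le> x")
      case True
      have "ennreal (1 / (y * z)) = ennreal (1 / y) * ennreal (1 / z)"
        using True by (simp add: ennreal_mult[symmetric])
      thus ?thesis using True by (simp add: simplex_pair_def mult_ac)
    qed (auto simp: simplex_pair_def)
  qed
  also have "\<dots> = (logint f x)\<^sup>2"
    unfolding logint_def power2_eq_square by (simp add: nn_integral_cmult nn_integral_multc)
  finally show ?thesis .
qed

section \<open>The renewal sum along products of uniform variables\<close>

lemma nn_integral_unif_prod: "(\<integral>\<^sup>+w. ennreal (\<Prod>i<r. w i) \<partial>unif_seq) = ennreal (1 / 2 ^ r)"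
proof (induction r)
  case 0
  show ?case using unif_seq.emeasure_space_1 by simp
next
  case (Suc r)
  have "(\<integral>\<^sup>+w. ennreal (\<Prod>i<Suc r. w i) \<partial>unif_seq) = (\<integral>\<^sup>+s. (\<integral>\<^sup>+w. ennreal (s * (\<Prod>i<r. w i)) \<partial>unif_seq) \<partial>unif)"
    by (subst nn_integral_unif_seq_iter) (measurable, simp add: prod.lessThan_Suc_shift del: prod.lessThan_Suc)
  also have "\<dots> = (\<integral>\<^sup>+s. ennreal s * ennreal (1 / 2 ^ r) \<partial>unif)"
  proof (rule nn_integral_cong_AE)
    show "AE s in unif. (\<integral>\<^sup>+w. ennreal (s * (\<Prod>i<r. w i)) \<partial>unif_seq) = ennreal s * ennreal (1 / 2 ^ r)"
      using AE_unif
    proof eventually_elim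
      case (elim s)
      have "(\<integral>\<^sup>+w. ennreal (s * (\<Prod>i<r. w i)) \<partial>unif_seq) = (\<integral>\<^sup>+w. ennreal s * ennreal (\<Prod>i<r. w i) \<partial>unif_seq)"
        using elim by (simp add: ennreal_mult')
      also have "\<dots> = ennreal s * (\<integral>\<^sup>+w. ennreal (\<Prod>i<r. w i) \<partial>unif_seq)"
        by (rule nn_integral_cmult) measurable
      finally show ?case by (simp only: Suc.IH)
    qed
  qed
  also have "\<dots> = avg (\<lambda>x. ennreal (x ^ 1)) 1 * ennreal (1 / 2 ^ r)"
    unfolding avg_def by (subst nn_integral_multc) auto
  also have "\<dots> = ennreal (1 / 2 ^ Suc r)"
  proof -
    have "avg (\<lambda>x. ennreal (x ^ 1)) 1 = ennreal (1 / 2)" using avg_power[of 1 1] by simp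
    hence "avg (\<lambda>x. ennreal (x ^ 1)) 1 * ennreal (1 / 2 ^ r) = ennreal (1 / 2 * (1 / 2 ^ r))"
      by (simp only:) (rule ennreal_mult[symmetric], auto)
    thus ?thesis by simp
  qed
  finally show ?case .
qed

definition renewal_sum_mean :: "(real \<Rightarrow> ennreal) \<Rightarrow> real \<Rightarrow> ennreal" where
  "renewal_sum_mean f x = (\<integral>\<^sup>+w. (\<Sum>r. f (x * (\<Prod>i<Suc r. w i))) \<partial>unif_seq)"

lemma renewal_sum_mean_measurable [measurable]:
  assumes [measurable]: "f \<in> borel_measurable borel"
  shows "renewal_sum_mean f \<in> borel_measurable borel"
  unfolding renewal_sum_mean_def[abs_def]
  by (rule unif_seq.borel_measurable_nn_integral) (simp add: split_beta del: prod.lessThan_Suc, measurable)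

lemma renewal_sum_mean_linear_bound:
  assumes [measurable]: "f \<in> borel_measurable borel"
    and f: "\<And>z. z > 0 \<Longrightarrow> f z \<le> ennreal (c * z)" and c: "c \<ge> 0" and x: "x > 0"
  shows "renewal_sum_mean f x \<le> ennreal (c * x)"
proof -
  have "renewal_sum_mean f x \<le> (\<integral>\<^sup>+w. (\<Sum>r. ennreal (c * x) * ennreal (\<Prod>i<Suc r. w i)) \<partial>unif_seq)"
    unfolding renewal_sum_mean_def
  proof (rule nn_integral_mono_AE)
    show "AE w in unif_seq. (\<Sum>r. f (x * (\<Prod>i<Suc r. w i))) \<le> (\<Sum>r. ennreal (c * x) * ennreal (\<Prod>i<Suc r. w i))"
      using AE_unif_seq
    proof eventually_elim
      case (elim w)
      have "f (x * (\<Prod>i<Suc r. w i)) \<le> ennreal (c * x) * ennreal (\<Prod>i<Suc r. w i)" for r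
      proof -
        have pos: "(\<Prod>i<Suc r. w i) > 0" using elim by (intro prod_pos) auto
        hence "f (x * (\<Prod>i<Suc r. w i)) \<le> ennreal (c * (x * (\<Prod>i<Suc r. w i)))" using x by (intro f mult_pos_pos)
        also have "c * (x * (\<Prod>i<Suc r. w i)) = (c * x) * (\<Prod>i<Suc r. w i)" by simp
        also have "ennreal \<dots> = ennreal (c * x) * ennreal (\<Prod>i<Suc r. w i)"
          using c x less_imp_le[OF pos] by (intro ennreal_mult) auto
        finally show ?thesis .
      qed
      thus ?case by (intro suminf_le summableI)
    qed
  qed
  also have "\<dots> = (\<integral>\<^sup>+w. ennreal (c * x) * (\<Sum>r. ennreal (\<Prod>i<Suc r. w i)) \<partial>unif_seq)"
    by (simp del: prod.lessThan_Suc)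
  also have "\<dots> = ennreal (c * x) * (\<integral>\<^sup>+w. (\<Sum>r. ennreal (\<Prod>i<Suc r. w i)) \<partial>unif_seq)"
    by (rule nn_integral_cmult) measurable
  also have "(\<integral>\<^sup>+w. (\<Sum>r. ennreal (\<Prod>i<Suc r. w i)) \<partial>unif_seq) = (\<Sum>r. \<integral>\<^sup>+w. ennreal (\<Prod>i<Suc r. w i) \<partial>unif_seq)"
    by (rule nn_integral_suminf) measurable
  also have "(\<Sum>r. \<integral>\<^sup>+w. ennreal (\<Prod>i<Suc r. w i) \<partial>unif_seq) = (\<Sum>r. ennreal ((1 / 2) ^ Suc r))"
    by (subst nn_integral_unif_prod) (simp add: power_divide)
  also have "\<dots> = ennreal 1" by (rule suminf_ennreal_eq[OF _ power_half_series]) auto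
  finally show ?thesis by simp
qed

lemma renewal_sum_mean_recursion:
  assumes [measurable]: "f \<in> borel_measurable borel"
  shows "renewal_sum_mean f x = avg f x + avg (renewal_sum_mean f) x"
proof -
  have "renewal_sum_mean f x = (\<integral>\<^sup>+s. (\<integral>\<^sup>+w. (\<Sum>r. f (x * (\<Prod>i<Suc r. case_nat s w i))) \<partial>unif_seq) \<partial>unif)"
    unfolding renewal_sum_mean_def by (rule nn_integral_unif_seq_iter) measurable
  also have "\<dots> = (\<integral>\<^sup>+s. (\<integral>\<^sup>+w. f (x * s) + (\<Sum>r. f (x * s * (\<Prod>i<Suc r. w i))) \<partial>unif_seq) \<partial>unif)"
    by (subst suminf_head) (simp add: prod.lessThan_Suc_shift mult.assoc del: prod.lessThan_Suc)
  also have "\<dots> = (\<integral>\<^sup>+s. f (x * s) + renewal_sum_mean f (x * s) \<partial>unif)"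
    unfolding renewal_sum_mean_def using unif_seq.emeasure_space_1
    by (intro nn_integral_cong) (subst nn_integral_add, auto)
  also have "\<dots> = avg f x + avg (renewal_sum_mean f) x"
    unfolding avg_def by (rule nn_integral_add) measurable
  finally show ?thesis .
qed

theorem renewal_sum_mean_eq_logint:
  assumes [measurable]: "f \<in> borel_measurable borel"
    and f: "\<And>z. z > 0 \<Longrightarrow> f z \<le> ennreal (c * z)" and c: "c \<ge> 0" and x: "x > 0"
  shows "renewal_sum_mean f x = logint f x"
proof (rule antisym)
  have li: "logint f x \<le> ennreal (c * x)" if "x > 0" for x
    using logint_mono[of x f "\<lambda>z. ennreal (c * z)"] f logint_linear[OF c that] by auto
  show "renewal_sum_mean f x \<le> logint f x"
    by (rule le_if_sub_and_super_solution[where A = "avg f" and C = c and Bd = "\<lambda>x. x"])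
       (use x c f renewal_sum_mean_linear_bound[OF assms(1)] avg_id_le_half in
         \<open>auto simp: renewal_sum_mean_recursion[symmetric] logint_recursion[symmetric]\<close>)
  show "logint f x \<le> renewal_sum_mean f x"
    by (rule le_if_sub_and_super_solution[where A = "avg f" and C = c and Bd = "\<lambda>x. x"])
       (use x c f li avg_id_le_half in
         \<open>auto simp: renewal_sum_mean_recursion[symmetric] logint_recursion[symmetric]\<close>)
qed

lemma AE_summable_prods: "AE w in unif_seq. summable (\<lambda>r. \<Prod>i<Suc r. w i)"
proof -
  have "(\<integral>\<^sup>+w. (\<Sum>r. ennreal (\<Prod>i<Suc r. w i)) \<partial>unif_seq) \<le> ennreal (1 * 1)"
    using renewal_sum_mean_linear_bound[of "\<lambda>z. ennreal z" 1 1] by (simp add: renewal_sum_mean_def)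
  hence fin: "(\<integral>\<^sup>+w. (\<Sum>r. ennreal (\<Prod>i<Suc r. w i)) \<partial>unif_seq) \<noteq> \<infinity>"
    by (auto simp: top_unique)
  have "(\<lambda>w. \<Sum>r. ennreal (\<Prod>i<Suc r. w i)) \<in> borel_measurable unif_seq" by measurable
  hence "AE w in unif_seq. (\<Sum>r. ennreal (\<Prod>i<Suc r. w i)) \<noteq> \<infinity>"
    using fin by (rule nn_integral_PInf_AE)
  thus ?thesis using AE_unif_seq
  proof eventually_elim
    case (elim w)
    have "0 \<le> (\<Prod>i<Suc r. w i)" for r using elim by (intro prod_nonneg) (auto intro: less_imp_le)
    thus ?case using elim by (intro summable_suminf_not_top) auto
  qed
qed

text \<open>The points \<open>x W\<^sub>1 \<cdots> W\<^sub>r\<close> form a Poisson process with intensity \<open>dz / z\<close> on \<open>(0, x)\<close>.\<close>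

definition renewal_sum :: "(real \<Rightarrow> real) \<Rightarrow> real \<Rightarrow> (nat \<Rightarrow> real) \<Rightarrow> real" where
  "renewal_sum H x w = (\<Sum>r. H (x * (\<Prod>i<Suc r. w i)))"

lemma renewal_sum_measurable [measurable]:
  assumes [measurable]: "H \<in> borel_measurable borel" "X \<in> borel_measurable M" "W \<in> measurable M seq_space"
  shows "(\<lambda>p. renewal_sum H (X p) (W p)) \<in> borel_measurable M"
  unfolding renewal_sum_def by measurable

lemma AE_summable_renewal_sum:
  assumes "\<And>z. z > 0 \<Longrightarrow> \<bar>H z\<bar> \<le> c * z" "x > 0"
  shows "AE w in unif_seq. summable (\<lambda>r. H (x * (\<Prod>i<Suc r. w i)))"
  using AE_summable_prods AE_unif_seq
proof eventually_elim
  case (elim w)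
  have "norm (H (x * (\<Prod>i<Suc r. w i))) \<le> (c * x) * (\<Prod>i<Suc r. w i)" for r
  proof -
    have "(\<Prod>i<Suc r. w i) > 0" using elim by (intro prod_pos) auto
    thus ?thesis using assms(1)[of "x * (\<Prod>i<Suc r. w i)"] \<open>x > 0\<close> by (simp add: mult.assoc del: prod.lessThan_Suc)
  qed
  thus ?case by (rule summable_comparison_test'[OF summable_mult[OF elim(1), of "c * x"], of 0])
qed

text \<open>Let \<open>a\<close> be the renewal sum and \<open>b\<close> the sum over the GEM weights. As \<open>P\<^sub>r \<le> W\<^sub>1 \<cdots> W\<^sub>r\<^sub>-\<^sub>1\<close> and \<open>h\<close> is
monotone, \<open>b \<le> h(x) + a\<close>. Since \<open>a\<close> and \<open>b\<close> have the same mean, the nonnegative variable \<open>h(x) + a - b\<close>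
has mean \<open>h(x)\<close>, and \<open>\<bar>a - b\<bar> \<le> h(x) + (h(x) + a - b)\<close>.\<close>

lemma nn_integral_gem_vs_renewal_sum:
  fixes h :: "real \<Rightarrow> real"
  assumes [measurable]: "h \<in> borel_measurable borel"
    and h0: "\<And>z. z > 0 \<Longrightarrow> 0 \<le> h z" and hc: "\<And>z. z > 0 \<Longrightarrow> h z \<le> c * z" and c: "c \<ge> 0"
    and mono: "\<And>y z. 0 < y \<Longrightarrow> y \<le> z \<Longrightarrow> h y \<le> h z" and x: "x > 0"
  shows "(\<integral>\<^sup>+w. ennreal \<bar>renewal_sum h x w - (\<Sum>r. h (x * gem w r))\<bar> \<partial>unif_seq) \<le> ennreal (2 * h x)"
proof -
  let ?a = "\<lambda>w. renewal_sum h x w" and ?b = "\<lambda>w. \<Sum>r. h (x * gem w r)"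
  have hc': "ennreal (h z) \<le> ennreal (c * z)" if "z > 0" for z using hc that by (intro ennreal_leI) auto
  have habs: "\<bar>h z\<bar> \<le> c * z" if "z > 0" for z using h0[OF that] hc[OF that] by simp
  have AEs: "AE w in unif_seq. summable (\<lambda>r. h (x * (\<Prod>i<Suc r. w i)))"
    by (rule AE_summable_renewal_sum[of h c]) (use habs x in auto)
  have pt: "AE w in unif_seq. ennreal (?a w) = (\<Sum>r. ennreal (h (x * (\<Prod>i<Suc r. w i)))) \<and>
      ennreal (?b w) = (\<Sum>r. ennreal (h (x * gem w r))) \<and> 0 \<le> ?a w \<and> 0 \<le> ?b w \<and> ?b w \<le> h x + ?a w"
    using AE_unif_seq AEs
  proof eventually_elim
    case (elim w)
    have w: "\<And>i. 0 < w i \<and> w i < 1" using elim(1) by blast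
    have Q: "(\<Prod>i<r. w i) > 0" for r using w by (intro prod_pos) auto
    have s: "summable (\<lambda>r. h (x * (\<Prod>i<Suc r. w i)))" by (rule elim(2))
    have s0: "summable (\<lambda>r. h (x * (\<Prod>i<r. w i)))" using s by (subst (asm) summable_Suc_iff)
    have le: "h (x * gem w r) \<le> h (x * (\<Prod>i<r. w i))" for r
    proof (rule mono)
      show "0 < x * gem w r" using gem_pos[of w, OF w] x by simp
      have "gem w r \<le> (\<Prod>i<r. w i) * 1" unfolding gem_def
        using w[of r] Q[of r] by (intro mult_left_mono) auto
      thus "x * gem w r \<le> x * (\<Prod>i<r. w i)" using x by simp
    qed
    have pos: "0 \<le> h (x * gem w r)" "0 \<le> h (x * (\<Prod>i<r. w i))" for r
      using gem_pos[of w, OF w] Q x by (auto intro!: h0)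
    have sb: "summable (\<lambda>r. h (x * gem w r))"
      by (rule summable_comparison_test'[OF s0, of 0]) (use le pos in simp)
    have "?b w \<le> (\<Sum>r. h (x * (\<Prod>i<r. w i)))" by (rule suminf_le[OF le sb s0])
    also have "\<dots> = h x + ?a w" using suminf_split_head[OF s0] by (simp add: renewal_sum_def)
    finally have "?b w \<le> h x + ?a w" .
    thus ?case unfolding renewal_sum_def
      using s sb pos suminf_nonneg[OF s] suminf_nonneg[OF sb]
      by (auto intro!: suminf_ennreal2[symmetric] simp del: prod.lessThan_Suc)
  qed
  have ia: "(\<integral>\<^sup>+w. ennreal (?a w) \<partial>unif_seq) = logint (\<lambda>z. ennreal (h z)) x"
  proof -
    have "(\<integral>\<^sup>+w. ennreal (?a w) \<partial>unif_seq) = renewal_sum_mean (\<lambda>z. ennreal (h z)) x"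
      unfolding renewal_sum_mean_def using pt by (intro nn_integral_cong_AE) auto
    thus ?thesis using renewal_sum_mean_eq_logint[OF _ hc' c x] by simp
  qed
  have ib: "(\<integral>\<^sup>+w. ennreal (?b w) \<partial>unif_seq) = logint (\<lambda>z. ennreal (h z)) x"
  proof -
    have "(\<integral>\<^sup>+w. ennreal (?b w) \<partial>unif_seq) = gem_sum_mean (\<lambda>z. ennreal (h z)) x"
      unfolding gem_sum_mean_def using pt
      by (subst nn_integral_GEM01) (measurable, auto intro!: nn_integral_cong_AE)
    thus ?thesis using gem_sum_mean_eq_logint[OF _ hc' c x] by simp
  qed
  have fin: "logint (\<lambda>z. ennreal (h z)) x \<noteq> \<top>"
  proof -
    have "logint (\<lambda>z. ennreal (h z)) x \<le> ennreal (c * x)"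
      using logint_mono[of x "\<lambda>z. ennreal (h z)" "\<lambda>z. ennreal (c * z)"] hc' logint_linear[OF c x] by auto
    thus ?thesis by (auto simp: top_unique)
  qed
  have "(\<integral>\<^sup>+w. ennreal (h x + ?a w - ?b w) \<partial>unif_seq) + logint (\<lambda>z. ennreal (h z)) x
     = (\<integral>\<^sup>+w. ennreal (h x + ?a w - ?b w) + ennreal (?b w) \<partial>unif_seq)"
    unfolding ib[symmetric] by (rule nn_integral_add[symmetric]) measurable
  also have "\<dots> = (\<integral>\<^sup>+w. ennreal (h x) + ennreal (?a w) \<partial>unif_seq)"
  proof (rule nn_integral_cong_AE)
    show "AE w in unif_seq. ennreal (h x + ?a w - ?b w) + ennreal (?b w) = ennreal (h x) + ennreal (?a w)"
      using pt
    proof eventually_elim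
      case (elim w)
      hence "ennreal (h x + ?a w - ?b w) + ennreal (?b w) = ennreal (h x + ?a w - ?b w + ?b w)"
        by (intro ennreal_plus[symmetric]) auto
      also have "h x + ?a w - ?b w + ?b w = h x + ?a w" by simp
      also have "ennreal (h x + ?a w) = ennreal (h x) + ennreal (?a w)"
        using h0[OF x] elim by (intro ennreal_plus) auto
      finally show ?case .
    qed
  qed
  also have "\<dots> = ennreal (h x) + logint (\<lambda>z. ennreal (h z)) x"
    unfolding ia[symmetric] using unif_seq.emeasure_space_1 by (subst nn_integral_add) auto
  finally have d: "(\<integral>\<^sup>+w. ennreal (h x + ?a w - ?b w) \<partial>unif_seq) = ennreal (h x)"
    using fin by (simp add: ennreal_add_left_cancel add.commute[of _ "logint _ _"])
  have "(\<integral>\<^sup>+w. ennreal \<bar>?a w - ?b w\<bar> \<partial>unif_seq) \<le> (\<integral>\<^sup>+w. ennreal (h x) + ennreal (h x + ?a w - ?b w) \<partial>unif_seq)"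
  proof (rule nn_integral_mono_AE)
    show "AE w in unif_seq. ennreal \<bar>?a w - ?b w\<bar> \<le> ennreal (h x) + ennreal (h x + ?a w - ?b w)"
      using pt
    proof eventually_elim
      case (elim w)
      hence "\<bar>?a w - ?b w\<bar> \<le> h x + (h x + ?a w - ?b w)" using h0[OF x] by linarith
      thus ?case using h0[OF x] elim by (subst ennreal_plus[symmetric]) (auto intro: ennreal_leI)
    qed
  qed
  also have "\<dots> = ennreal (h x) + ennreal (h x)"
    using unif_seq.emeasure_space_1 by (subst nn_integral_add) (auto simp: d)
  also have "\<dots> = ennreal (2 * h x)" using h0[OF x] by (simp flip: ennreal_plus)
  finally show ?thesis .
qed

section \<open>The characteristic function of the renewal sum\<close>

lemma integral_unif:
  fixes g :: "real \<Rightarrow> complex"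
  assumes [measurable]: "g \<in> borel_measurable borel"
  shows "(\<integral>s. g s \<partial>unif) = (LBINT s:{0..1}. g s)"
proof -
  have "unif = density lborel (\<lambda>s. ennreal (indicator {0..1} s))"
    unfolding uniform_measure_def
    by (intro density_cong AE_I2) (auto simp: divide_ennreal_def ennreal_indicator)
  thus ?thesis
    unfolding set_lebesgue_integral_def by (simp only:) (rule integral_density, auto)
qed

lemma renewal_sum_case_nat:
  assumes "summable (\<lambda>r. H (x * s * (\<Prod>i<Suc r. w i)))"
  shows "renewal_sum H x (case_nat s w) = H (x * s) + renewal_sum H (x * s) w"
proof -
  have 1: "H (x * (\<Prod>i<Suc (Suc r). case_nat s w i)) = H (x * s * (\<Prod>i<Suc r. w i))" for r
    by (simp add: prod.lessThan_Suc_shift mult.assoc del: prod.lessThan_Suc)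
  have "summable (\<lambda>r. H (x * (\<Prod>i<Suc r. case_nat s w i)))"
    using assms by (subst summable_Suc_iff[symmetric]) (simp only: 1)
  from suminf_split_head[OF this] show ?thesis
    unfolding renewal_sum_def by (simp only: 1) simp
qed

definition renewal_char :: "(real \<Rightarrow> real) \<Rightarrow> real \<Rightarrow> complex" where
  "renewal_char H x = (\<integral>w. iexp (renewal_sum H x w) \<partial>unif_seq)"

lemma renewal_char_measurable [measurable]:
  assumes [measurable]: "H \<in> borel_measurable borel"
  shows "renewal_char H \<in> borel_measurable borel"
  unfolding renewal_char_def[abs_def]
  by (rule unif_seq.borel_measurable_lebesgue_integral) (simp add: split_beta, measurable)

lemma norm_renewal_char_le: "norm (renewal_char H x) \<le> 1"
proof -
  have "norm (renewal_char H x) \<le> (\<integral>w. norm (iexp (renewal_sum H x w)) \<partial>unif_seq)"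
    unfolding renewal_char_def by (rule integral_norm_bound)
  thus ?thesis by (simp add: measure_def unif_seq.emeasure_space_1)
qed

lemma renewal_char_recursion:
  assumes [measurable]: "H \<in> borel_measurable borel"
    and H: "\<And>z. z > 0 \<Longrightarrow> \<bar>H z\<bar> \<le> c * z" and x: "x > 0"
  shows "renewal_char H x = (\<integral>s. iexp (H (x * s)) * renewal_char H (x * s) \<partial>unif)"
proof -
  interpret P: pair_prob_space unif unif_seq ..
  have m: "(\<lambda>(s, w). case_nat s w) \<in> measurable (unif \<Otimes>\<^sub>M unif_seq) unif_seq"
    by measurable
  have F: "(\<lambda>w. iexp (renewal_sum H x w)) \<in> borel_measurable unif_seq" by measurable
  have "renewal_char H x = (\<integral>w. iexp (renewal_sum H x w) \<partial>distr (unif \<Otimes>\<^sub>M unif_seq) unif_seq (\<lambda>(s, w). case_nat s w))"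
    by (simp add: unif_seq.PiM_iter renewal_char_def)
  also have "\<dots> = (\<integral>p. iexp (renewal_sum H x (case p of (s, w) \<Rightarrow> case_nat s w)) \<partial>(unif \<Otimes>\<^sub>M unif_seq))"
    by (rule integral_distr[OF m F])
  also have "\<dots> = (\<integral>s. (\<integral>w. iexp (renewal_sum H x (case_nat s w)) \<partial>unif_seq) \<partial>unif)"
  proof (subst P.integral_fst'[symmetric])
    show "integrable (unif \<Otimes>\<^sub>M unif_seq) (\<lambda>p. iexp (renewal_sum H x (case p of (s, w) \<Rightarrow> case_nat s w)))"
      using measurable_compose[OF m F] by (intro P.integrable_const_bound[where B=1]) auto
  qed simp
  also have "\<dots> = (\<integral>s. iexp (H (x * s)) * renewal_char H (x * s) \<partial>unif)"
  proof (rule integral_cong_AE)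
    have "(\<lambda>p. iexp (renewal_sum H x (case_nat (fst p) (snd p)))) \<in> borel_measurable (unif \<Otimes>\<^sub>M unif_seq)"
      using measurable_compose[OF m F] by (simp add: split_beta)
    thus "(\<lambda>s. \<integral>w. iexp (renewal_sum H x (case_nat s w)) \<partial>unif_seq) \<in> borel_measurable unif"
      by (intro unif_seq.borel_measurable_lebesgue_integral) (simp add: split_beta)
    show "AE s in unif. (\<integral>w. iexp (renewal_sum H x (case_nat s w)) \<partial>unif_seq) = iexp (H (x * s)) * renewal_char H (x * s)"
      using AE_unif
    proof eventually_elim
      case (elim s)
      have "AE w in unif_seq. summable (\<lambda>r. H (x * s * (\<Prod>i<Suc r. w i)))"
        by (rule AE_summable_renewal_sum[of H c]) (use H x elim in auto)
      hence "AE w in unif_seq. iexp (renewal_sum H x (case_nat s w)) = iexp (H (x * s)) * iexp (renewal_sum H (x * s) w)"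
        by eventually_elim (simp add: renewal_sum_case_nat distrib_left exp_add)
      hence "(\<integral>w. iexp (renewal_sum H x (case_nat s w)) \<partial>unif_seq) = (\<integral>w. iexp (H (x * s)) * iexp (renewal_sum H (x * s) w) \<partial>unif_seq)"
      proof (rule integral_cong_AE[rotated 2])
        have "(\<lambda>w. case_nat s w) \<in> measurable unif_seq unif_seq" by measurable
        thus "(\<lambda>w. iexp (renewal_sum H x (case_nat s w))) \<in> borel_measurable unif_seq"
          using F by (rule measurable_compose)
      qed measurable
      thus ?case by (simp add: renewal_char_def)
    qed
  qed measurable
  finally show ?thesis .
qed

text \<open>For \<open>H\<close> that vanishes on \<open>(-\<infinity>, 1]\<close>, this is the function \<open>(exp (\<i> H(z)) - 1) / z\<close> whose integral
is the logarithm of the characteristic function of a Poisson sum; \<open>max z 1\<close> instead of \<open>z\<close> makes it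
continuous at \<open>0\<close>.\<close>

definition char_exponent_density :: "(real \<Rightarrow> real) \<Rightarrow> real \<Rightarrow> complex" where
  "char_exponent_density H z = (iexp (H z) - 1) / of_real (max z 1)"

definition poisson_char :: "(real \<Rightarrow> real) \<Rightarrow> real \<Rightarrow> complex" where
  "poisson_char H x = exp (integral {0..x} (char_exponent_density H))"

context
  fixes H :: "real \<Rightarrow> real"
  assumes H_cont: "continuous_on UNIV H" and H0: "\<And>z. z \<le> 1 \<Longrightarrow> H z = 0"
begin

lemma char_exponent_density_continuous: "continuous_on S (char_exponent_density H)"
  unfolding char_exponent_density_def
  by (intro continuous_intros continuous_on_subset[OF H_cont]) auto

lemma char_exponent_has_derivative:
  assumes "0 \<le> y" "y \<le> x"
  shows "((\<lambda>y. integral {0..y} (char_exponent_density H)) has_vector_derivative char_exponent_density H y) (at y within {0..x})"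
  using assms char_exponent_density_continuous by (intro integral_has_vector_derivative) auto

lemma poisson_char_has_derivative:
  assumes "y \<in> {0..x}"
  shows "(poisson_char H has_vector_derivative (char_exponent_density H y * poisson_char H y)) (at y within {0..x})"
proof -
  have "((exp \<circ> (\<lambda>y. integral {0..y} (char_exponent_density H))) has_vector_derivative
      (char_exponent_density H y * exp (integral {0..y} (char_exponent_density H)))) (at y within {0..x})"
    using assms by (intro field_vector_diff_chain_within char_exponent_has_derivative has_field_derivative_at_within[OF DERIV_exp]) auto
  thus ?thesis by (simp add: poisson_char_def[abs_def] o_def)
qed

lemma poisson_char_continuous: "continuous_on UNIV (poisson_char H)"
proof -
  have "continuous (at y within {0..}) (poisson_char H)" if "y \<ge> 0" for y
  proof -
    have "continuous (at y within {0..y + 1}) (poisson_char H)"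
      using poisson_char_has_derivative[of y "y + 1"] that by (intro has_vector_derivative_continuous) auto
    moreover have "at y within {0..y + 1} = at y within {0..}"
      by (rule at_within_nhd[of _ "{..<y + 1}"]) auto
    ultimately show ?thesis by simp
  qed
  hence "continuous_on {0..} (poisson_char H)" by (simp add: continuous_on_eq_continuous_within)
  hence "continuous_on UNIV (\<lambda>y. poisson_char H (max 0 y))"
    by (rule continuous_on_compose2) (auto intro!: continuous_intros)
  moreover have "poisson_char H (max 0 y) = poisson_char H y" for y
    by (cases "y \<ge> 0") (auto simp: poisson_char_def max_def)
  ultimately show ?thesis by simp
qed

lemma poisson_char_measurable [measurable]: "poisson_char H \<in> borel_measurable borel"
  using poisson_char_continuous by (rule borel_measurable_continuous_onI)

lemma H_measurable: "H \<in> borel_measurable borel"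
  using H_cont by (rule borel_measurable_continuous_onI)

text \<open>If \<open>\<phi>\<close> is the Poisson characteristic function, \<open>s \<phi>(x s)\<close> has derivative \<open>exp (\<i> H(x s)) \<phi>(x s)\<close> in
\<open>s\<close>.\<close>

lemma poisson_char_recursion:
  assumes x: "x > 0"
  shows "poisson_char H x = (\<integral>s. iexp (H (x * s)) * poisson_char H (x * s) \<partial>unif)"
proof -
  note [measurable] = H_measurable
  let ?g = "char_exponent_density H"
  have der2: "((\<lambda>s. of_real s * poisson_char H (x * s)) has_vector_derivative (iexp (H (x * s)) * poisson_char H (x * s))) (at s within {0..1})"
    if s: "s \<in> {0..1}" for s
  proof -
    have xs: "x * s \<in> {0..x}" using s x by (auto simp: mult_left_le)
    have "(((\<lambda>y. poisson_char H y) \<circ> (\<lambda>s. x * s)) has_vector_derivative (x *\<^sub>R (?g (x * s) * poisson_char H (x * s)))) (at s within {0..1})"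
    proof (rule vector_diff_chain_within)
      show "((\<lambda>s. x * s) has_vector_derivative x) (at s within {0..1})"
        by (auto intro!: derivative_eq_intros simp flip: has_real_derivative_iff_has_vector_derivative)
      have sub: "(\<lambda>s. x * s) ` {0..1} \<subseteq> {0..x}" using x by (auto simp: mult_left_le)
      show "(poisson_char H has_vector_derivative ?g (x * s) * poisson_char H (x * s)) (at (x * s) within (\<lambda>s. x * s) ` {0..1})"
        by (rule has_vector_derivative_within_subset[OF poisson_char_has_derivative[OF xs] sub])
    qed
    hence 1: "((\<lambda>s. poisson_char H (x * s)) has_vector_derivative (x *\<^sub>R (?g (x * s) * poisson_char H (x * s)))) (at s within {0..1})"
      by (simp add: o_def)
    have 2: "((\<lambda>s. complex_of_real s) has_vector_derivative of_real 1) (at s within {0..1})"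
      by (rule has_vector_derivative_of_real) (auto intro!: derivative_eq_intros simp flip: has_real_derivative_iff_has_vector_derivative)
    have "of_real s * (x *\<^sub>R (?g (x * s) * poisson_char H (x * s))) + of_real 1 * poisson_char H (x * s) = iexp (H (x * s)) * poisson_char H (x * s)"
    proof (cases "x * s \<le> 1")
      case True
      thus ?thesis by (simp add: char_exponent_density_def H0)
    next
      case False
      hence "max (x * s) 1 = x * s" "s \<noteq> 0" by auto
      thus ?thesis using x by (simp add: char_exponent_density_def scaleR_conv_of_real field_simps)
    qed
    with has_vector_derivative_mult[OF 2 1] show ?thesis by simp
  qed
  have i: "((\<lambda>s. iexp (H (x * s)) * poisson_char H (x * s)) has_integral (of_real 1 * poisson_char H (x * 1) - of_real 0 * poisson_char H (x * 0))) {0..1}"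
    using der2 by (intro fundamental_theorem_of_calculus) auto
  have c: "continuous_on {0..1} (\<lambda>s. iexp (H (x * s)) * poisson_char H (x * s))"
    by (intro continuous_intros continuous_on_compose2[OF poisson_char_continuous] continuous_on_compose2[OF H_cont]) auto
  have "(\<integral>s. iexp (H (x * s)) * poisson_char H (x * s) \<partial>unif) = (LBINT s:{0..1}. iexp (H (x * s)) * poisson_char H (x * s))"
    by (rule integral_unif) measurable
  also have "\<dots> = integral {0..1} (\<lambda>s. iexp (H (x * s)) * poisson_char H (x * s))"
    using c by (intro set_borel_integral_eq_integral borel_integrable_atLeastAtMost')
  also have "\<dots> = poisson_char H x" using i by (simp add: integral_unique)
  finally show ?thesis ..
qed

lemma norm_poisson_char_le: "norm (poisson_char H x) \<le> 1"
proof -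
  have i: "char_exponent_density H integrable_on {0..x}"
    by (rule integrable_continuous_real[OF char_exponent_density_continuous])
  have "((\<lambda>z. Re (char_exponent_density H z)) has_integral Re (integral {0..x} (char_exponent_density H))) {0..x}"
    using has_integral_linear[OF integrable_integral[OF i] bounded_linear_Re] by (simp add: o_def)
  moreover have "((\<lambda>z::real. 0::real) has_integral 0) {0..x}" by (rule has_integral_0)
  moreover have "Re (char_exponent_density H z) \<le> 0" for z
    by (simp add: char_exponent_density_def Re_divide_of_real cis_conv_exp[symmetric] divide_nonpos_pos)
  ultimately have "Re (integral {0..x} (char_exponent_density H)) \<le> 0"
    by (rule has_integral_le)
  thus ?thesis by (simp add: poisson_char_def)
qed

text \<open>Both functions are averages of themselves multiplied by \<open>exp (\<i> H)\<close>, so the modulus of their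
difference is at most its own average. It is at most \<open>2 x\<close>, since both functions equal \<open>1\<close> for
\<open>x \<le> 1\<close> and have modulus at most \<open>1\<close>. By the comparison with \<open>D = 0\<close> it vanishes.\<close>

theorem renewal_char_eq_poisson_char:
  assumes Hc: "\<And>z. z > 0 \<Longrightarrow> \<bar>H z\<bar> \<le> c * z" and x: "x > 0"
  shows "renewal_char H x = poisson_char H x"
proof -
  note [measurable] = H_measurable
  define F where "F = (\<lambda>x. ennreal (norm (renewal_char H x - poisson_char H x)))"
  have [measurable]: "F \<in> borel_measurable borel" unfolding F_def by measurable
  have "F x \<le> 0"
  proof (rule le_if_sub_and_super_solution[where A = "\<lambda>_. 0" and D = "\<lambda>_. 0" and C = 2 and Bd = "\<lambda>x. x"])
    show "F x \<le> 0 + avg F x" if "x > 0" for x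
    proof -
      have int: "integrable unif (\<lambda>s. iexp (H (x * s)) * renewal_char H (x * s))"
          "integrable unif (\<lambda>s. iexp (H (x * s)) * poisson_char H (x * s))"
        using norm_renewal_char_le norm_poisson_char_le
        by (auto intro!: unif.integrable_const_bound[where B = 1] simp: norm_mult)
      have "renewal_char H x - poisson_char H x =
          (\<integral>s. iexp (H (x * s)) * renewal_char H (x * s) - iexp (H (x * s)) * poisson_char H (x * s) \<partial>unif)"
        using renewal_char_recursion[OF H_measurable Hc that] poisson_char_recursion[OF that] int by simp
      hence "F x = ennreal (norm (\<integral>s. iexp (H (x * s)) * renewal_char H (x * s) - iexp (H (x * s)) * poisson_char H (x * s) \<partial>unif))"
        by (simp add: F_def)
      also have "\<dots> \<le> (\<integral>\<^sup>+s. norm (iexp (H (x * s)) * renewal_char H (x * s) - iexp (H (x * s)) * poisson_char H (x * s)) \<partial>unif)"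
        using int by (intro integral_norm_bound_ennreal) auto
      also have "\<dots> = avg F x"
        unfolding avg_def F_def
        by (intro nn_integral_cong) (simp add: right_diff_distrib[symmetric] norm_mult)
      finally show ?thesis by simp
    qed
    show "F x \<le> ennreal (2 * x)" if "x > 0" for x
    proof (cases "x \<le> 1")
      case True
      have "renewal_sum H x w = 0" if w: "\<forall>i. 0 < w i \<and> w i < 1" for w
      proof -
        have "H (x * (\<Prod>i<Suc r. w i)) = 0" for r
        proof (rule H0)
          have "(\<Prod>i<Suc r. w i) \<le> 1" using w by (intro prod_le_1) (auto intro: less_imp_le)
          moreover have "0 \<le> (\<Prod>i<Suc r. w i)" using w by (intro prod_nonneg) (auto intro: less_imp_le)
          ultimately show "x * (\<Prod>i<Suc r. w i) \<le> 1" using True \<open>x > 0\<close> by (intro mult_le_one) auto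
        qed
        thus ?thesis by (simp only: renewal_sum_def) simp
      qed
      hence "AE w in unif_seq. iexp (renewal_sum H x w) = 1"
        using AE_unif_seq by (auto elim!: eventually_mono)
      hence "renewal_char H x = (\<integral>w. 1 \<partial>unif_seq)"
        unfolding renewal_char_def by (intro integral_cong_AE) auto
      hence 1: "renewal_char H x = 1" by (simp add: measure_def unif_seq.emeasure_space_1)
      have "integral {0..x} (char_exponent_density H) = integral {0..x} (\<lambda>_. 0)"
        using True by (intro Henstock_Kurzweil_Integration.integral_cong) (simp add: char_exponent_density_def H0)
      hence "poisson_char H x = 1" by (simp add: poisson_char_def)
      thus ?thesis using 1 by (simp add: F_def)
    next
      case False
      have "norm (renewal_char H x - poisson_char H x) \<le> 1 + 1"
        using norm_triangle_ineq4 norm_renewal_char_le[of H x] norm_poisson_char_le[of x] by (meson add_mono order_trans)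
      thus ?thesis using False unfolding F_def by (intro ennreal_leI) auto
    qed
    show "0 + avg (\<lambda>_. 0) x \<le> 0" for x by (simp add: avg_def)
  qed (use x avg_id_le_half in auto)
  thus ?thesis by (simp add: F_def)
qed

end

section \<open>Sums over a generation of the tree\<close>

abbreviation env_space :: "(nat list \<Rightarrow> nat \<Rightarrow> real) measure" where
  "env_space \<equiv> PiM UNIV (\<lambda>_. seq_space)"

abbreviation env_law :: "(nat list \<Rightarrow> nat \<Rightarrow> real) measure" where
  "env_law \<equiv> PiM UNIV (\<lambda>_. GEM01)"

lemma sets_env_law [measurable_cong]: "sets env_law = sets env_space"
  by (intro sets_PiM_cong) (auto simp: sets_GEM01)

interpretation env: prob_space env_law
  by (rule prob_space_PiM) (rule prob_space_GEM01)

text \<open>The environment of the subtree below the child \<open>r\<close> of the root.\<close>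

definition subenv :: "nat \<Rightarrow> (nat list \<Rightarrow> nat \<Rightarrow> real) \<Rightarrow> nat list \<Rightarrow> nat \<Rightarrow> real" where
  "subenv r e = (\<lambda>v. e (r # v))"

definition first_weights :: "(nat list \<Rightarrow> nat \<Rightarrow> real) \<Rightarrow> nat \<Rightarrow> real" where
  "first_weights e = e []"

lemma first_weights_measurable [measurable]: "first_weights \<in> measurable env_space seq_space"
  unfolding first_weights_def[abs_def] by (rule measurable_component_singleton) simp

lemma first_weights_measurable' [measurable]: "first_weights \<in> measurable env_law seq_space"
  using first_weights_measurable by (simp cong: measurable_cong_sets sets_env_law)

lemma subenv_measurable [measurable]: "subenv r \<in> measurable env_space env_space"
  unfolding subenv_def[abs_def] by (rule measurable_PiM_single') (auto simp: space_PiM)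

lemma subenv_measurable' [measurable]: "subenv r \<in> measurable env_law env_space"
  using subenv_measurable by (simp cong: measurable_cong_sets sets_env_law)

lemma distr_subenv: "distr env_law env_space (subenv r) = env_law"
proof -
  have "distr env_law env_law (\<lambda>\<omega>. \<lambda>n\<in>UNIV. \<omega> (r # n)) = env_law"
    by (rule distr_PiM_reindex) (auto intro: prob_space_GEM01)
  moreover have "distr env_law env_law (\<lambda>\<omega>. \<lambda>n\<in>UNIV. \<omega> (r # n)) = distr env_law env_space (subenv r)"
    by (intro distr_cong) (auto simp: subenv_def sets_env_law)
  ultimately show ?thesis by simp
qed

lemma distr_root: "distr env_law seq_space (\<lambda>e. e []) = GEM01"
proof -
  have "distr env_law GEM01 (\<lambda>e. e []) = GEM01"
    by (rule distr_PiM_component) (auto intro: prob_space_GEM01)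
  thus ?thesis by (simp add: sets_GEM01 cong: distr_cong)
qed

lemma indep_env: "env.indep_vars (\<lambda>_. seq_space) (\<lambda>v e. e v) UNIV"
proof (subst env.indep_vars_iff_distr_eq_PiM)
  have c: "distr env_law seq_space (\<lambda>e. e v) = GEM01" for v
  proof -
    have "distr env_law GEM01 (\<lambda>e. e v) = GEM01"
      by (rule distr_PiM_component) (auto intro: prob_space_GEM01)
    thus ?thesis by (simp add: sets_GEM01 cong: distr_cong)
  qed
  have "distr env_law env_space (\<lambda>e. \<lambda>v\<in>UNIV. e v) = distr env_law env_law (\<lambda>e. e)"
    by (intro distr_cong) (auto simp: sets_env_law)
  thus "distr env_law env_space (\<lambda>e. \<lambda>v\<in>UNIV. e v) = PiM UNIV (\<lambda>v. distr env_law seq_space (\<lambda>e. e v))"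
    by (simp add: c distr_id)
qed auto

lemma (in prob_space) distr_pair_of_indep_var:
  assumes ind: "indep_var S X T Y" and f [measurable]: "f \<in> measurable S S'" and g [measurable]: "g \<in> measurable T T'"
  shows "distr M (S' \<Otimes>\<^sub>M T') (\<lambda>\<omega>. (f (X \<omega>), g (Y \<omega>))) = distr M S' (\<lambda>\<omega>. f (X \<omega>)) \<Otimes>\<^sub>M distr M T' (\<lambda>\<omega>. g (Y \<omega>))"
proof -
  have X [measurable]: "random_variable S X" and Y [measurable]: "random_variable T Y"
    and XY: "distr M S X \<Otimes>\<^sub>M distr M T Y = distr M (S \<Otimes>\<^sub>M T) (\<lambda>x. (X x, Y x))"
    using ind unfolding indep_var_distribution_eq by auto
  interpret T': prob_space "distr (distr M T Y) T' g"
    by (intro prob_space.prob_space_distr prob_space_distr) measurable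
  have "distr M S' (\<lambda>\<omega>. f (X \<omega>)) \<Otimes>\<^sub>M distr M T' (\<lambda>\<omega>. g (Y \<omega>))
      = distr (distr M S X) S' f \<Otimes>\<^sub>M distr (distr M T Y) T' g"
    by (simp add: distr_distr o_def)
  also have "\<dots> = distr (distr M S X \<Otimes>\<^sub>M distr M T Y) (S' \<Otimes>\<^sub>M T') (\<lambda>(x, y). (f x, g y))"
    by (rule pair_measure_distr) (simp_all add: T'.sigma_finite_measure_axioms)
  also have "\<dots> = distr M (S' \<Otimes>\<^sub>M T') (\<lambda>\<omega>. (f (X \<omega>), g (Y \<omega>)))"
    unfolding XY by (subst distr_distr) (auto simp: o_def split_beta)
  finally show ?thesis ..
qed

text \<open>The root and the subtrees below two distinct children are disjoint sets of individuals.\<close>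

lemma indep_root_subenvs:
  assumes "r \<noteq> s"
  shows "distr env_law (seq_space \<Otimes>\<^sub>M (env_space \<Otimes>\<^sub>M env_space)) (\<lambda>e. (e [], (subenv r e, subenv s e)))
     = GEM01 \<Otimes>\<^sub>M (env_law \<Otimes>\<^sub>M env_law)"
proof -
  let ?R = "\<lambda>r. range (Cons r)"
  have ind1: "env.indep_var (PiM {[]} (\<lambda>_. seq_space)) (\<lambda>e. restrict (\<lambda>v. e v) {[]})
     (PiM (?R r \<union> ?R s) (\<lambda>_. seq_space)) (\<lambda>e. restrict (\<lambda>v. e v) (?R r \<union> ?R s))"
    by (rule env.indep_var_restrict[OF indep_env]) auto
  have ind2: "env.indep_var (PiM (?R r) (\<lambda>_. seq_space)) (\<lambda>e. restrict (\<lambda>v. e v) (?R r))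
     (PiM (?R s) (\<lambda>_. seq_space)) (\<lambda>e. restrict (\<lambda>v. e v) (?R s))"
    by (rule env.indep_var_restrict[OF indep_env]) (use assms in auto)
  have m: "subenv q \<in> measurable (PiM A (\<lambda>_. seq_space)) env_space" if "?R q \<subseteq> A" for q A
    unfolding subenv_def[abs_def] using that
    by (intro measurable_PiM_single' measurable_component_singleton) (auto simp: space_PiM)
  have e: "subenv q (restrict e A) = subenv q e" if "?R q \<subseteq> A" for q A e
    using that by (auto simp: subenv_def fun_eq_iff)
  have 2: "distr env_law (env_space \<Otimes>\<^sub>M env_space) (\<lambda>e. (subenv r e, subenv s e)) = env_law \<Otimes>\<^sub>M env_law"
    using env.distr_pair_of_indep_var[OF ind2 m[of r] m[of s]] by (simp add: e distr_subenv)
  have m1: "(\<lambda>z. z []) \<in> measurable (PiM {[]} (\<lambda>_. seq_space)) seq_space"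
    by (rule measurable_component_singleton) auto
  have m2: "(\<lambda>z. (subenv r z, subenv s z)) \<in> measurable (PiM (?R r \<union> ?R s) (\<lambda>_. seq_space)) (env_space \<Otimes>\<^sub>M env_space)"
    by (intro measurable_Pair m) auto
  show ?thesis
    using env.distr_pair_of_indep_var[OF ind1 m1 m2] by (simp add: e distr_root 2)
qed

lemma nn_integral_root_subenvs:
  assumes "r \<noteq> s" and [measurable]: "F \<in> borel_measurable (seq_space \<Otimes>\<^sub>M (env_space \<Otimes>\<^sub>M env_space))"
  shows "(\<integral>\<^sup>+e. F (first_weights e, (subenv r e, subenv s e)) \<partial>env_law) = (\<integral>\<^sup>+p. \<integral>\<^sup>+a. \<integral>\<^sup>+b. F (p, (a, b)) \<partial>env_law \<partial>env_law \<partial>GEM01)"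
proof -
  interpret P: pair_prob_space env_law env_law ..
  have [measurable]: "(\<lambda>e. (first_weights e, (subenv r e, subenv s e))) \<in> measurable env_law (seq_space \<Otimes>\<^sub>M (env_space \<Otimes>\<^sub>M env_space))"
    by measurable
  have F1: "F \<in> borel_measurable (GEM01 \<Otimes>\<^sub>M (env_law \<Otimes>\<^sub>M env_law))" by measurable
  have "(\<integral>\<^sup>+e. F (first_weights e, (subenv r e, subenv s e)) \<partial>env_law)
     = (\<integral>\<^sup>+q. F q \<partial>distr env_law (seq_space \<Otimes>\<^sub>M (env_space \<Otimes>\<^sub>M env_space)) (\<lambda>e. (first_weights e, (subenv r e, subenv s e))))"
    by (rule nn_integral_distr[symmetric]) measurable
  also have "\<dots> = (\<integral>\<^sup>+q. F q \<partial>(GEM01 \<Otimes>\<^sub>M (env_law \<Otimes>\<^sub>M env_law)))"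
    unfolding first_weights_def by (simp only: indep_root_subenvs[OF assms(1)])
  also have "\<dots> = (\<integral>\<^sup>+p. \<integral>\<^sup>+q. F (p, q) \<partial>(env_law \<Otimes>\<^sub>M env_law) \<partial>GEM01)"
    by (rule P.nn_integral_fst[OF F1, symmetric])
  also have "\<dots> = (\<integral>\<^sup>+p. \<integral>\<^sup>+a. \<integral>\<^sup>+b. F (p, (a, b)) \<partial>env_law \<partial>env_law \<partial>GEM01)"
  proof (intro nn_integral_cong)
    fix p
    have "(\<lambda>q. F (p, q)) \<in> borel_measurable (env_law \<Otimes>\<^sub>M env_law)"
      by (rule measurable_compose[OF measurable_Pair1' F1]) simp
    from env.nn_integral_fst[OF this]
    show "(\<integral>\<^sup>+q. F (p, q) \<partial>(env_law \<Otimes>\<^sub>M env_law)) = (\<integral>\<^sup>+a. \<integral>\<^sup>+b. F (p, (a, b)) \<partial>env_law \<partial>env_law)" by simp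
  qed
  finally show ?thesis .
qed

lemma nn_integral_root_subenv:
  assumes [measurable]: "(\<lambda>(p, a). F p a) \<in> borel_measurable (seq_space \<Otimes>\<^sub>M env_space)"
  shows "(\<integral>\<^sup>+e. F (first_weights e) (subenv r e) \<partial>env_law) = (\<integral>\<^sup>+p. \<integral>\<^sup>+a. F p a \<partial>env_law \<partial>GEM01)"
  using nn_integral_root_subenvs[of r "Suc r" "\<lambda>(p, (a, b)). F p a"] env.emeasure_space_1
  by (simp add: split_beta)

lemma nn_integral_root:
  assumes [measurable]: "F \<in> borel_measurable seq_space"
  shows "(\<integral>\<^sup>+e. F (first_weights e) \<partial>env_law) = (\<integral>\<^sup>+p. F p \<partial>GEM01)"
  using nn_integral_root_subenv[of "\<lambda>p a. F p" 0] env.emeasure_space_1 by simp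

text \<open>The sum of \<open>f(x P(v))\<close> over the individuals \<open>v\<close> of generation \<open>m\<close>. The recursion follows the first
letter of \<open>v\<close>, so that the subtrees below the first generation appear as independent copies.\<close>

primrec tree_sum :: "(real \<Rightarrow> ennreal) \<Rightarrow> nat \<Rightarrow> real \<Rightarrow> (nat list \<Rightarrow> nat \<Rightarrow> real) \<Rightarrow> ennreal" where
  "tree_sum f 0 x e = f x"
| "tree_sum f (Suc m) x e = (\<Sum>r. tree_sum f m (x * first_weights e r) (subenv r e))"

lemma tree_sum_measurable [measurable (raw)]:
  assumes [measurable]: "f \<in> borel_measurable borel"
  shows "X \<in> borel_measurable M \<Longrightarrow> E \<in> measurable M env_space \<Longrightarrow> (\<lambda>p. tree_sum f m (X p) (E p)) \<in> borel_measurable M"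
proof (induction m arbitrary: X E)
  case (Suc m)
  note [measurable] = Suc.prems
  have [measurable]: "(\<lambda>p. tree_sum f m (X p * first_weights (E p) r) (subenv r (E p))) \<in> borel_measurable M" for r
    by (rule Suc.IH) measurable
  show ?case by simp
qed simp

definition good_env :: "(nat list \<Rightarrow> nat \<Rightarrow> real) \<Rightarrow> bool" where
  "good_env e \<longleftrightarrow> (\<forall>v. (\<forall>r. 0 < e v r) \<and> (\<forall>n. (\<Sum>i<n. e v i) \<le> 1))"

lemma AE_good_env: "AE e in env_law. good_env e"
  unfolding good_env_def
  using AE_GEM01 by (subst AE_all_countable) (intro allI AE_PiM_component, auto intro: prob_space_GEM01)

lemma good_env_subenv: "good_env e \<Longrightarrow> good_env (subenv r e)"
  by (simp add: good_env_def subenv_def)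

lemma good_env_le_1:
  assumes "good_env e" shows "e v r \<le> 1"
proof -
  have "e v r \<le> (\<Sum>i<Suc r. e v i)"
    using assms unfolding good_env_def by (intro member_le_sum) (auto intro: less_imp_le)
  also have "\<dots> \<le> 1" using assms unfolding good_env_def by blast
  finally show ?thesis .
qed

lemma tree_sum_linear_bound:
  assumes "\<And>z. z > 0 \<Longrightarrow> f z \<le> ennreal (c * z)" "c \<ge> 0"
  shows "good_env e \<Longrightarrow> x > 0 \<Longrightarrow> tree_sum f m x e \<le> ennreal (c * x)"
proof (induction m arbitrary: x e)
  case (Suc m)
  have "(\<Sum>r. tree_sum f m (x * first_weights e r) (subenv r e)) \<le> (\<Sum>r. ennreal (c * (x * first_weights e r)))"
    using Suc.prems
    by (intro suminf_le summableI Suc.IH good_env_subenv) (auto simp: good_env_def first_weights_def)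
  also have "\<dots> \<le> ennreal (c * x)"
    by (rule suminf_linear_bound[where f = "\<lambda>z. ennreal (c * z)"]) (use Suc.prems assms(2) in \<open>auto simp: good_env_def first_weights_def\<close>)
  finally show ?case by simp
qed (use assms in auto)

lemma iterated_logint_measurable [measurable]:
  assumes "f \<in> borel_measurable borel"
  shows "(logint ^^ m) f \<in> borel_measurable borel"
  using assms by (induction m) auto

lemma logint_linear_bound:
  assumes "\<And>z. z > 0 \<Longrightarrow> f z \<le> ennreal (c * z)" "c \<ge> 0" "x > 0"
  shows "logint f x \<le> ennreal (c * x)"
  using logint_mono[of x f "\<lambda>z. ennreal (c * z)"] assms(1) logint_linear[OF assms(2,3)] by auto

lemma iterated_logint_linear_bound:
  assumes "\<And>z. z > 0 \<Longrightarrow> f z \<le> ennreal (c * z)" "c \<ge> 0"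
  shows "x > 0 \<Longrightarrow> (logint ^^ m) f x \<le> ennreal (c * x)"
  using assms by (induction m arbitrary: x) (auto intro: logint_linear_bound)

text \<open>Every generation contributes one integration with respect to \<open>dz / z\<close>.\<close>

theorem tree_sum_mean:
  assumes [measurable]: "f \<in> borel_measurable borel"
    and f: "\<And>z. z > 0 \<Longrightarrow> f z \<le> ennreal (c * z)" and c: "c \<ge> 0"
  shows "x > 0 \<Longrightarrow> (\<integral>\<^sup>+e. tree_sum f m x e \<partial>env_law) = (logint ^^ m) f x"
proof (induction m arbitrary: x)
  case 0
  thus ?case using env.emeasure_space_1 by simp
next
  case (Suc m)
  have "(\<integral>\<^sup>+e. tree_sum f (Suc m) x e \<partial>env_law) = (\<Sum>r. \<integral>\<^sup>+e. tree_sum f m (x * first_weights e r) (subenv r e) \<partial>env_law)"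
    unfolding tree_sum.simps by (rule nn_integral_suminf) measurable
  also have "\<dots> = (\<Sum>r. \<integral>\<^sup>+p. \<integral>\<^sup>+a. tree_sum f m (x * p r) a \<partial>env_law \<partial>GEM01)"
    by (intro suminf_cong nn_integral_root_subenv) (simp add: split_beta, measurable)
  also have "\<dots> = (\<Sum>r. \<integral>\<^sup>+p. (logint ^^ m) f (x * p r) \<partial>GEM01)"
  proof (intro suminf_cong nn_integral_cong_AE)
    fix r
    show "AE p in GEM01. (\<integral>\<^sup>+a. tree_sum f m (x * p r) a \<partial>env_law) = (logint ^^ m) f (x * p r)"
      using AE_GEM01 by eventually_elim (rule Suc.IH, use Suc.prems in auto)
  qed
  also have "\<dots> = gem_sum_mean ((logint ^^ m) f) x"
    unfolding gem_sum_mean_def by (rule nn_integral_suminf[symmetric]) measurable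
  also have "\<dots> = logint ((logint ^^ m) f) x"
    by (rule gem_sum_mean_eq_logint[where c = c]) (use Suc.prems c iterated_logint_linear_bound[OF f c] in auto)
  finally show ?case by simp
qed

text \<open>Second moments grow quadratically and obey a linear bound only on bounded sets, which is enough
because \<open>x P\<^sub>r \<le> x\<close>.\<close>

lemma gem_sum_mean_eq_logint_upto:
  assumes [measurable]: "f \<in> borel_measurable borel"
    and f: "\<And>z. 0 < z \<Longrightarrow> z \<le> x \<Longrightarrow> f z \<le> ennreal (c * z)" and c: "c \<ge> 0" and x: "x > 0"
  shows "gem_sum_mean f x = logint f x"
proof -
  let ?g = "\<lambda>z. f z * indicator {..x} z"
  have "gem_sum_mean f x = gem_sum_mean ?g x"
    unfolding gem_sum_mean_def
  proof (rule nn_integral_cong_AE)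
    show "AE p in GEM01. (\<Sum>r. f (x * p r)) = (\<Sum>r. ?g (x * p r))"
      using AE_GEM01
    proof eventually_elim
      case (elim p)
      have "p r \<le> 1" for r
      proof -
        have "p r \<le> (\<Sum>i<Suc r. p i)"
          using elim by (intro member_le_sum) (auto intro: less_imp_le)
        also have "\<dots> \<le> 1" using elim by blast
        finally show ?thesis .
      qed
      thus ?case using x by (intro suminf_cong) (auto simp: indicator_def mult_left_le)
    qed
  qed
  also have "\<dots> = logint ?g x"
    by (rule gem_sum_mean_eq_logint[where c = c]) (use f c x in \<open>auto simp: indicator_def\<close>)
  also have "\<dots> = logint f x"
    unfolding logint_def by (intro nn_integral_cong) (auto simp: indicator_def)
  finally show ?thesis .
qed

definition tree_square_mean :: "(real \<Rightarrow> ennreal) \<Rightarrow> nat \<Rightarrow> real \<Rightarrow> ennreal" where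
  "tree_square_mean f m x = (\<integral>\<^sup>+e. (tree_sum f m x e)\<^sup>2 \<partial>env_law)"

lemma tree_square_mean_measurable [measurable]:
  assumes [measurable]: "f \<in> borel_measurable borel"
  shows "tree_square_mean f m \<in> borel_measurable borel"
  unfolding tree_square_mean_def[abs_def]
  by (rule env.borel_measurable_nn_integral) (simp add: split_beta, measurable)

text \<open>The conditional mean of \<open>tree_sum f (Suc m) x\<close> when the first generation is \<open>p\<close>.\<close>

definition first_gen_mean :: "(real \<Rightarrow> ennreal) \<Rightarrow> nat \<Rightarrow> real \<Rightarrow> (nat \<Rightarrow> real) \<Rightarrow> ennreal" where
  "first_gen_mean f m x p = (\<Sum>r. (logint ^^ m) f (x * p r))"

lemma first_gen_mean_measurable [measurable (raw)]:
  assumes [measurable]: "f \<in> borel_measurable borel" "X \<in> borel_measurable M" "Q \<in> measurable M seq_space"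
  shows "(\<lambda>p. first_gen_mean f m (X p) (Q p)) \<in> borel_measurable M"
  unfolding first_gen_mean_def by measurable

context
  fixes f :: "real \<Rightarrow> ennreal" and c x :: real
  assumes fm [measurable]: "f \<in> borel_measurable borel"
    and f: "\<And>z. z > 0 \<Longrightarrow> f z \<le> ennreal (c * z)" and c: "c \<ge> 0" and x: "x > 0"
begin

lemma tree_square_mean_bound:
  assumes "0 < z" "z \<le> x"
  shows "tree_square_mean f m z \<le> ennreal ((c\<^sup>2 * x) * z)"
proof -
  have "tree_square_mean f m z \<le> (\<integral>\<^sup>+e. ennreal ((c\<^sup>2 * x) * z) \<partial>env_law)"
    unfolding tree_square_mean_def
  proof (rule nn_integral_mono_AE)
    show "AE e in env_law. (tree_sum f m z e)\<^sup>2 \<le> ennreal ((c\<^sup>2 * x) * z)"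
      using AE_good_env
    proof eventually_elim
      case (elim e)
      have "(tree_sum f m z e)\<^sup>2 \<le> (ennreal (c * z))\<^sup>2"
        using elim assms by (intro power_mono tree_sum_linear_bound f c) auto
      also have "\<dots> = ennreal ((c * z)\<^sup>2)" using c assms by (intro ennreal_power) auto
      also have "\<dots> \<le> ennreal ((c\<^sup>2 * x) * z)"
        using assms c by (intro ennreal_leI) (auto simp: power2_eq_square mult_ac intro!: mult_left_mono)
      finally show ?case .
    qed
  qed
  thus ?thesis using env.emeasure_space_1 by simp
qed

lemma gem_sum_mean_square_eq:
  "gem_sum_mean (tree_square_mean f m) x = logint (tree_square_mean f m) x"
  by (rule gem_sum_mean_eq_logint_upto[where c = "c\<^sup>2 * x", OF _ tree_square_mean_bound])
     (use x in simp_all)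

lemma iterated_square_bound:
  assumes "0 < z" "z \<le> x"
  shows "((logint ^^ m) f z)\<^sup>2 \<le> ennreal ((c\<^sup>2 * x) * z)"
proof -
  have "((logint ^^ m) f z)\<^sup>2 \<le> (ennreal (c * z))\<^sup>2"
    using assms by (intro power_mono iterated_logint_linear_bound f c) auto
  also have "\<dots> = ennreal ((c * z)\<^sup>2)" using c assms by (intro ennreal_power) auto
  also have "\<dots> \<le> ennreal ((c\<^sup>2 * x) * z)"
    using assms c by (intro ennreal_leI) (auto simp: power2_eq_square mult_ac intro!: mult_left_mono)
  finally show ?thesis .
qed

lemma tree_mean_at_child:
  "AE p in GEM01. \<forall>r. (\<integral>\<^sup>+a. tree_sum f m (x * p r) a \<partial>env_law) = (logint ^^ m) f (x * p r)"
  using AE_GEM01 by eventually_elim (auto intro!: tree_sum_mean[OF fm f c] mult_pos_pos x)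

text \<open>Two individuals have the same or distinct ancestors in the first generation; in the second case
their subtrees are independent.\<close>

lemma tree_square_mean_Suc:
  "tree_square_mean f (Suc m) x = logint (tree_square_mean f m) x + gem_pair_mean ((logint ^^ m) f) x"
proof -
  let ?T = "\<lambda>r e. tree_sum f m (x * first_weights e r) (subenv r e)"
  have "tree_square_mean f (Suc m) x = (\<integral>\<^sup>+e. (\<Sum>r. (?T r e)\<^sup>2) + off_diagonal (\<lambda>r. ?T r e) \<partial>env_law)"
    unfolding tree_square_mean_def tree_sum.simps square_suminf ..
  also have "\<dots> = (\<integral>\<^sup>+e. (\<Sum>r. (?T r e)\<^sup>2) \<partial>env_law) + (\<integral>\<^sup>+e. off_diagonal (\<lambda>r. ?T r e) \<partial>env_law)"
    unfolding off_diagonal_def by (rule nn_integral_add) measurable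
  also have "(\<integral>\<^sup>+e. (\<Sum>r. (?T r e)\<^sup>2) \<partial>env_law) = logint (tree_square_mean f m) x"
  proof -
    have "(\<integral>\<^sup>+e. (\<Sum>r. (?T r e)\<^sup>2) \<partial>env_law) = (\<Sum>r. \<integral>\<^sup>+e. (?T r e)\<^sup>2 \<partial>env_law)"
      by (rule nn_integral_suminf) measurable
    also have "\<dots> = (\<Sum>r. \<integral>\<^sup>+p. \<integral>\<^sup>+a. (tree_sum f m (x * p r) a)\<^sup>2 \<partial>env_law \<partial>GEM01)"
      by (intro suminf_cong nn_integral_root_subenv) (simp add: split_beta, measurable)
    also have "\<dots> = gem_sum_mean (tree_square_mean f m) x"
      unfolding gem_sum_mean_def tree_square_mean_def[symmetric]
      by (rule nn_integral_suminf[symmetric]) measurable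
    finally show ?thesis by (simp add: gem_sum_mean_square_eq)
  qed
  also have "(\<integral>\<^sup>+e. off_diagonal (\<lambda>r. ?T r e) \<partial>env_law) = gem_pair_mean ((logint ^^ m) f) x"
  proof -
    have pair: "(\<integral>\<^sup>+e. (if r = s then 0 else ?T r e * ?T s e) \<partial>env_law)
      = (\<integral>\<^sup>+p. (if r = s then 0 else (logint ^^ m) f (x * p r) * (logint ^^ m) f (x * p s)) \<partial>GEM01)" for r s
    proof (cases "r = s")
      case False
      have "(\<integral>\<^sup>+e. ?T r e * ?T s e \<partial>env_law)
        = (\<integral>\<^sup>+p. \<integral>\<^sup>+a. \<integral>\<^sup>+b. tree_sum f m (x * p r) a * tree_sum f m (x * p s) b \<partial>env_law \<partial>env_law \<partial>GEM01)"
        using nn_integral_root_subenvs[OF False, of "\<lambda>(p, (a, b)). tree_sum f m (x * p r) a * tree_sum f m (x * p s) b"]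
        by (simp add: split_beta)
      also have "\<dots> = (\<integral>\<^sup>+p. (\<integral>\<^sup>+a. tree_sum f m (x * p r) a \<partial>env_law) * (\<integral>\<^sup>+b. tree_sum f m (x * p s) b \<partial>env_law) \<partial>GEM01)"
        by (simp add: nn_integral_cmult nn_integral_multc)
      also have "\<dots> = (\<integral>\<^sup>+p. (logint ^^ m) f (x * p r) * (logint ^^ m) f (x * p s) \<partial>GEM01)"
        using tree_mean_at_child[of m] by (intro nn_integral_cong_AE) (auto elim!: eventually_mono)
      finally show ?thesis using False by simp
    qed simp
    have "(\<integral>\<^sup>+e. off_diagonal (\<lambda>r. ?T r e) \<partial>env_law) = (\<Sum>r. \<Sum>s. \<integral>\<^sup>+e. (if r = s then 0 else ?T r e * ?T s e) \<partial>env_law)"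
      unfolding off_diagonal_def
      by (subst nn_integral_suminf, measurable) (intro suminf_cong nn_integral_suminf, measurable)
    also have "\<dots> = gem_pair_mean ((logint ^^ m) f) x"
      unfolding gem_pair_mean_def off_diagonal_def pair
      by (subst nn_integral_suminf, measurable) (intro suminf_cong nn_integral_suminf[symmetric], measurable)
    finally show ?thesis .
  qed
  finally show ?thesis .
qed

lemma first_gen_mean_square:
  "(\<integral>\<^sup>+e. (first_gen_mean f m x (first_weights e))\<^sup>2 \<partial>env_law) = logint (\<lambda>z. ((logint ^^ m) f z)\<^sup>2) x + gem_pair_mean ((logint ^^ m) f) x"
proof -
  have "(\<integral>\<^sup>+e. (first_gen_mean f m x (first_weights e))\<^sup>2 \<partial>env_law) = (\<integral>\<^sup>+p. (first_gen_mean f m x p)\<^sup>2 \<partial>GEM01)"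
    by (rule nn_integral_root) measurable
  also have "\<dots> = (\<integral>\<^sup>+p. (\<Sum>r. ((logint ^^ m) f (x * p r))\<^sup>2) + off_diagonal (\<lambda>r. (logint ^^ m) f (x * p r)) \<partial>GEM01)"
    unfolding first_gen_mean_def square_suminf ..
  also have "\<dots> = (\<integral>\<^sup>+p. (\<Sum>r. ((logint ^^ m) f (x * p r))\<^sup>2) \<partial>GEM01) + gem_pair_mean ((logint ^^ m) f) x"
    unfolding gem_pair_mean_def off_diagonal_def by (rule nn_integral_add) measurable
  also have "(\<integral>\<^sup>+p. (\<Sum>r. ((logint ^^ m) f (x * p r))\<^sup>2) \<partial>GEM01) = gem_sum_mean (\<lambda>z. ((logint ^^ m) f z)\<^sup>2) x"
    by (simp add: gem_sum_mean_def)
  also have "\<dots> = logint (\<lambda>z. ((logint ^^ m) f z)\<^sup>2) x"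
    by (rule gem_sum_mean_eq_logint_upto[where c = "c\<^sup>2 * x", OF _ iterated_square_bound])
       (use x in simp_all)
  finally show ?thesis .
qed

text \<open>Orthogonality of a conditional mean to the error of the approximation by it.\<close>

lemma tree_times_first_gen_mean:
  "(\<integral>\<^sup>+e. tree_sum f (Suc m) x e * first_gen_mean f m x (first_weights e) \<partial>env_law) = (\<integral>\<^sup>+e. (first_gen_mean f m x (first_weights e))\<^sup>2 \<partial>env_law)"
proof -
  have "(\<integral>\<^sup>+e. tree_sum f (Suc m) x e * first_gen_mean f m x (first_weights e) \<partial>env_law)
    = (\<integral>\<^sup>+e. (\<Sum>r. tree_sum f m (x * first_weights e r) (subenv r e) * first_gen_mean f m x (first_weights e)) \<partial>env_law)"
    by simp
  also have "\<dots> = (\<Sum>r. \<integral>\<^sup>+e. tree_sum f m (x * first_weights e r) (subenv r e) * first_gen_mean f m x (first_weights e) \<partial>env_law)"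
    by (rule nn_integral_suminf) measurable
  also have "\<dots> = (\<Sum>r. \<integral>\<^sup>+p. \<integral>\<^sup>+a. tree_sum f m (x * p r) a * first_gen_mean f m x p \<partial>env_law \<partial>GEM01)"
    by (intro suminf_cong nn_integral_root_subenv) (simp add: split_beta, measurable)
  also have "\<dots> = (\<Sum>r. \<integral>\<^sup>+p. (\<integral>\<^sup>+a. tree_sum f m (x * p r) a \<partial>env_law) * first_gen_mean f m x p \<partial>GEM01)"
    by (simp add: nn_integral_multc)
  also have "\<dots> = (\<Sum>r. \<integral>\<^sup>+p. (logint ^^ m) f (x * p r) * first_gen_mean f m x p \<partial>GEM01)"
    using tree_mean_at_child[of m]
    by (intro suminf_cong nn_integral_cong_AE) (auto elim!: eventually_mono)
  also have "\<dots> = (\<integral>\<^sup>+p. (\<Sum>r. (logint ^^ m) f (x * p r) * first_gen_mean f m x p) \<partial>GEM01)"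
    by (rule nn_integral_suminf[symmetric]) measurable
  also have "\<dots> = (\<integral>\<^sup>+p. (first_gen_mean f m x p)\<^sup>2 \<partial>GEM01)"
    by (simp add: first_gen_mean_def power2_eq_square)
  also have "\<dots> = (\<integral>\<^sup>+e. (first_gen_mean f m x (first_weights e))\<^sup>2 \<partial>env_law)"
    by (rule nn_integral_root[symmetric]) measurable
  finally show ?thesis .
qed

text \<open>By Pythagoras the mean square error is the difference of the two second moments. Both contain the
same off-diagonal part, so only the diagonal parts remain. The equation is stated additively because
subtraction of extended nonnegative reals is truncated.\<close>

theorem tree_sum_vs_first_gen_mean:
  "(\<integral>\<^sup>+e. ennreal ((enn2real (tree_sum f (Suc m) x e) - enn2real (first_gen_mean f m x (first_weights e)))\<^sup>2) \<partial>env_law)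
     + logint (\<lambda>z. ((logint ^^ m) f z)\<^sup>2) x = logint (tree_square_mean f m) x"
proof -
  let ?T = "tree_sum f (Suc m) x" and ?Y = "\<lambda>e. first_gen_mean f m x (first_weights e)"
  define I where "I = (\<integral>\<^sup>+e. ennreal ((enn2real (?T e) - enn2real (?Y e))\<^sup>2) \<partial>env_law)"
  define SY where "SY = (\<integral>\<^sup>+e. (?Y e)\<^sup>2 \<partial>env_law)"
  have good: "AE e in env_law. ?T e \<le> ennreal (c * x) \<and> ?Y e \<le> ennreal (c * x)"
    using AE_good_env
  proof eventually_elim
    case (elim e)
    have "?Y e \<le> ennreal (c * x)"
      unfolding first_gen_mean_def
      by (rule suminf_linear_bound) (use elim c x iterated_logint_linear_bound[OF f c] in \<open>auto simp: good_env_def first_weights_def\<close>)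
    thus ?case using tree_sum_linear_bound[OF f c elim x, of "Suc m"] by blast
  qed
  have SYfin: "SY \<noteq> \<top>"
  proof -
    have "SY \<le> (\<integral>\<^sup>+e. (ennreal (c * x))\<^sup>2 \<partial>env_law)"
      unfolding SY_def
    proof (rule nn_integral_mono_AE)
      show "AE e in env_law. (?Y e)\<^sup>2 \<le> (ennreal (c * x))\<^sup>2"
        using good by eventually_elim (intro power_mono, auto)
    qed
    also have "\<dots> < \<top>" using env.emeasure_space_1 c x by (simp add: ennreal_power)
    finally show ?thesis by simp
  qed
  have "I + 2 * SY = (\<integral>\<^sup>+e. ennreal ((enn2real (?T e) - enn2real (?Y e))\<^sup>2) + 2 * (?T e * ?Y e) \<partial>env_law)"
    unfolding I_def SY_def tree_times_first_gen_mean[symmetric]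
    by (subst nn_integral_add, measurable) (subst nn_integral_cmult, measurable)
  also have "\<dots> = (\<integral>\<^sup>+e. (?T e)\<^sup>2 + (?Y e)\<^sup>2 \<partial>env_law)"
  proof (rule nn_integral_cong_AE)
    show "AE e in env_law. ennreal ((enn2real (?T e) - enn2real (?Y e))\<^sup>2) + 2 * (?T e * ?Y e) = (?T e)\<^sup>2 + (?Y e)\<^sup>2"
      using good
    proof eventually_elim
      case (elim e)
      define a where "a = enn2real (?T e)" define b where "b = enn2real (?Y e)"
      have ab: "?T e = ennreal a" "?Y e = ennreal b" "a \<ge> 0" "b \<ge> 0"
        using elim unfolding a_def b_def by (auto simp: ennreal_enn2real_if top_unique)
      have "ennreal ((a - b)\<^sup>2) + 2 * (ennreal a * ennreal b) = ennreal ((a - b)\<^sup>2 + 2 * (a * b))"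
        using ab(3,4) by (simp add: ennreal_mult ennreal_plus flip: ennreal_numeral)
      also have "(a - b)\<^sup>2 + 2 * (a * b) = a\<^sup>2 + b\<^sup>2" by (simp add: power2_diff)
      also have "ennreal (a\<^sup>2 + b\<^sup>2) = (ennreal a)\<^sup>2 + (ennreal b)\<^sup>2"
        using ab(3,4) by (simp add: ennreal_plus ennreal_power)
      finally show ?case by (simp only: ab(1,2) enn2real_ennreal[OF ab(3)] enn2real_ennreal[OF ab(4)])
    qed
  qed
  also have "\<dots> = tree_square_mean f (Suc m) x + SY"
    unfolding tree_square_mean_def SY_def by (rule nn_integral_add) measurable
  finally have "SY + (I + SY) = SY + tree_square_mean f (Suc m) x" by (simp add: mult_2 add_ac)
  hence "I + SY = tree_square_mean f (Suc m) x" using SYfin by (simp add: ennreal_add_left_cancel)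
  hence "gem_pair_mean ((logint ^^ m) f) x + (I + logint (\<lambda>z. ((logint ^^ m) f z)\<^sup>2) x)
      = gem_pair_mean ((logint ^^ m) f) x + logint (tree_square_mean f m) x"
    using first_gen_mean_square[of m] tree_square_mean_Suc[of m] unfolding SY_def by (simp add: add_ac)
  moreover have "gem_pair_mean ((logint ^^ m) f) x \<noteq> \<top>"
    using SYfin first_gen_mean_square[of m] unfolding SY_def by auto
  ultimately show ?thesis by (simp add: ennreal_add_left_cancel I_def)
qed

end

section \<open>Counting boxes by their weight\<close>

text \<open>The function \<open>(ln\<^sup>+ z)\<^sup>k / k!\<close>, where \<open>logpow 0\<close> is the indicator of \<open>z \<ge> 1\<close>. Integration with respect
to \<open>dz / z\<close> raises \<open>k\<close> by one, so the mean number of boxes of weight at least \<open>1 / x\<close> in generation \<open>m\<close>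
is \<open>logpow m x\<close>.\<close>

definition logpow :: "nat \<Rightarrow> real \<Rightarrow> real" where
  "logpow k z = (if z \<ge> 1 then ln z ^ k / fact k else 0)"

lemma logpow_measurable [measurable]: "logpow k \<in> borel_measurable borel"
  unfolding logpow_def by measurable

lemma logpow_nonneg: "0 \<le> logpow k z"
  by (auto simp: logpow_def)

lemma power_div_fact_le_exp:
  assumes "(t::real) \<ge> 0" shows "t ^ k / fact k \<le> exp t"
proof -
  have s: "(\<lambda>n. t ^ n /\<^sub>R fact n) sums exp t" by (rule exp_converges)
  have "(\<Sum>n\<in>{k}. t ^ n /\<^sub>R fact n) \<le> (\<Sum>n. t ^ n /\<^sub>R fact n)"
    using assms s by (intro sum_le_suminf) (auto simp: sums_iff)
  thus ?thesis using s by (simp add: sums_iff field_simps)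
qed

lemma logpow_le: "z > 0 \<Longrightarrow> logpow k z \<le> z"
  using power_div_fact_le_exp[of "ln z" k] by (auto simp: logpow_def)

lemma logpow_mono: "y \<le> z \<Longrightarrow> logpow k y \<le> logpow k z"
  by (auto simp: logpow_def intro!: divide_right_mono power_mono)

lemma logint_cong:
  assumes "\<And>z. 0 < z \<Longrightarrow> z \<le> x \<Longrightarrow> f z = g z" shows "logint f x = logint g x"
  unfolding logint_def by (intro nn_integral_cong) (auto simp: indicator_def assms)

lemma logint_logpow:
  assumes "x > 0"
  shows "logint (\<lambda>z. ennreal (logpow k z)) x = ennreal (logpow (Suc k) x)"
proof (cases "x \<ge> 1")
  case True
  have "logint (\<lambda>z. ennreal (logpow k z)) x = (\<integral>\<^sup>+z. ennreal (ln z ^ k / fact k * (1 / z)) * indicator {1..x} z \<partial>lborel)"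
    unfolding logint_def
    by (intro nn_integral_cong) (auto simp: indicator_def logpow_def ennreal_mult[symmetric])
  also have "\<dots> = ennreal (ln x ^ Suc k / fact (Suc k) - ln 1 ^ Suc k / fact (Suc k))"
  proof (rule nn_integral_FTC_Icc)
    fix z :: real assume z: "z \<in> {1..x}"
    have "((\<lambda>z. ln z ^ Suc k) has_real_derivative (real (Suc k) * (1 / z * ln z ^ k))) (at z)"
      using DERIV_chain2[OF DERIV_pow[of "Suc k" "ln z" UNIV] DERIV_ln_divide[of z]] z by simp
    from DERIV_cdivide[OF this, of "fact (Suc k)"]
    show "((\<lambda>z. ln z ^ Suc k / fact (Suc k)) has_real_derivative ln z ^ k / fact k * (1 / z)) (at z)"
      by (simp del: of_nat_Suc add: field_simps)
  qed (use True in auto)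
  finally show ?thesis using True by (simp add: logpow_def)
next
  case False
  have "logint (\<lambda>z. ennreal (logpow k z)) x = logint (\<lambda>z. 0) x"
    using False by (intro logint_cong) (auto simp: logpow_def)
  thus ?thesis using False by (simp add: logint_def logpow_def)
qed

abbreviation count_fn :: "real \<Rightarrow> ennreal" where
  "count_fn \<equiv> \<lambda>z. ennreal (logpow 0 z)"

lemma count_fn_linear_bound: "z > 0 \<Longrightarrow> count_fn z \<le> ennreal (1 * z)"
  using logpow_le[of z 0] by (simp add: ennreal_leI)

lemma iterated_logint_count_fn:
  "x > 0 \<Longrightarrow> (logint ^^ m) count_fn x = ennreal (logpow m x)"
proof (induction m arbitrary: x)
  case (Suc m)
  have "(logint ^^ Suc m) count_fn x = logint (\<lambda>z. ennreal (logpow m z)) x"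
    using Suc by (simp, intro logint_cong) auto
  thus ?case using logint_logpow[OF Suc.prems] by simp
qed simp

lemma logpow_square: "(logpow k z)\<^sup>2 = real ((2 * k) choose k) * logpow (2 * k) z"
proof -
  have "real ((2 * k) choose k) = fact (2 * k) / (fact k * fact k)"
    using binomial_fact[of k "2 * k"] by (simp add: mult_2)
  thus ?thesis by (auto simp: logpow_def power2_eq_square power_mult power_add mult_2)
qed

lemma logint_sum_logpow:
  assumes "x > 0" "\<And>i. i \<in> I \<Longrightarrow> 0 \<le> a i" "finite I"
  shows "logint (\<lambda>z. ennreal (\<Sum>i\<in>I. a i * logpow (k i) z)) x = ennreal (\<Sum>i\<in>I. a i * logpow (Suc (k i)) x)"
proof -
  have "logint (\<lambda>z. ennreal (\<Sum>i\<in>I. a i * logpow (k i) z)) x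
      = (\<integral>\<^sup>+z. (\<Sum>i\<in>I. ennreal (a i) * (ennreal (logpow (k i) z) * ennreal (1 / z) * indicator {0<..x} z)) \<partial>lborel)"
    unfolding logint_def using assms logpow_nonneg
    by (intro nn_integral_cong)
       (simp add: sum_ennreal[symmetric] sum_distrib_right ennreal_mult mult.assoc)
  also have "\<dots> = (\<Sum>i\<in>I. ennreal (a i) * logint (\<lambda>z. ennreal (logpow (k i) z)) x)"
    unfolding logint_def by (subst nn_integral_sum, measurable) (intro sum.cong refl nn_integral_cmult, measurable)
  also have "\<dots> = (\<Sum>i\<in>I. ennreal (a i * logpow (Suc (k i)) x))"
    using assms logpow_nonneg by (intro sum.cong refl) (simp add: logint_logpow ennreal_mult)
  also have "\<dots> = ennreal (\<Sum>i\<in>I. a i * logpow (Suc (k i)) x)"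
    using assms logpow_nonneg by (intro sum_ennreal) auto
  finally show ?thesis .
qed

text \<open>The summand for \<open>q\<close> accounts for pairs of boxes whose last common ancestor is \<open>q\<close> generations above
them; the binomial coefficient is the one of \<open>logpow_square\<close>.\<close>

lemma tree_square_mean_count_le:
  "x > 0 \<Longrightarrow> tree_square_mean count_fn m x \<le> ennreal (\<Sum>q\<le>m. real ((2 * q) choose q) * logpow (m + q) x)"
proof (induction m arbitrary: x)
  case 0
  have "tree_square_mean count_fn 0 x = (count_fn x)\<^sup>2"
    using env.emeasure_space_1 by (simp add: tree_square_mean_def)
  also have "\<dots> = ennreal ((logpow 0 x)\<^sup>2)" using logpow_nonneg by (rule ennreal_power)
  also have "\<dots> = ennreal (logpow 0 x)" by (simp add: logpow_square)
  finally show ?case by simp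
next
  case (Suc m)
  let ?b = "\<lambda>q. real ((2 * q) choose q)"
  have cf: "(logint ^^ m) count_fn \<in> borel_measurable borel" by measurable
  have "tree_square_mean count_fn (Suc m) x = logint (tree_square_mean count_fn m) x + gem_pair_mean ((logint ^^ m) count_fn) x"
    by (rule tree_square_mean_Suc[where c = 1]) (use count_fn_linear_bound Suc.prems in auto)
  also have "logint (tree_square_mean count_fn m) x \<le> logint (\<lambda>z. ennreal (\<Sum>q\<le>m. ?b q * logpow (m + q) z)) x"
    using Suc.IH by (intro logint_mono) auto
  also have "\<dots> = ennreal (\<Sum>q\<le>m. ?b q * logpow (Suc (m + q)) x)"
    using Suc.prems by (rule logint_sum_logpow) auto
  also have "gem_pair_mean ((logint ^^ m) count_fn) x \<le> (logint ((logint ^^ m) count_fn) x)\<^sup>2"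
    by (rule gem_pair_mean_le[OF cf, where c = 1])
       (use iterated_logint_linear_bound[OF count_fn_linear_bound] Suc.prems in auto)
  also have "logint ((logint ^^ m) count_fn) x = ennreal (logpow (Suc m) x)"
    using iterated_logint_count_fn[OF Suc.prems, of "Suc m"] by simp
  also have "(ennreal (logpow (Suc m) x))\<^sup>2 = ennreal (?b (Suc m) * logpow (Suc m + Suc m) x)"
    using logpow_nonneg by (simp add: ennreal_power logpow_square mult_2 del: binomial_Suc_Suc)
  finally have "tree_square_mean count_fn (Suc m) x \<le>
      ennreal (\<Sum>q\<le>m. ?b q * logpow (Suc (m + q)) x) + ennreal (?b (Suc m) * logpow (Suc m + Suc m) x)"
    by (simp add: add_mono)
  also have "\<dots> = ennreal (\<Sum>q\<le>Suc m. ?b q * logpow (Suc m + q) x)"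
    using logpow_nonneg by (subst ennreal_plus[symmetric]) (auto intro!: sum_nonneg mult_nonneg_nonneg)
  finally show ?case .
qed

text \<open>The summand for \<open>q = m\<close> of the second moment comes from pairs of boxes whose last common ancestor
lies in the first generation, and the diagonal part of the squared conditional mean cancels it.\<close>

theorem count_vs_first_gen_mean:
  assumes x: "x > 0"
  shows "(\<integral>\<^sup>+e. ennreal ((enn2real (tree_sum count_fn (Suc m) x e) - enn2real (first_gen_mean count_fn m x (first_weights e)))\<^sup>2) \<partial>env_law)
     \<le> ennreal (\<Sum>q<m. real ((2 * q) choose q) * logpow (Suc (m + q)) x)" (is "?I \<le> _")
proof -
  let ?b = "\<lambda>q. real ((2 * q) choose q)"
  have sq: "logint (\<lambda>z. ((logint ^^ m) count_fn z)\<^sup>2) x = ennreal (?b m * logpow (Suc (m + m)) x)"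
  proof -
    have "logint (\<lambda>z. ((logint ^^ m) count_fn z)\<^sup>2) x = logint (\<lambda>z. ennreal (\<Sum>i\<in>{m}. ?b i * logpow (i + i) z)) x"
      using logpow_nonneg by (intro logint_cong) (simp add: iterated_logint_count_fn ennreal_power logpow_square mult_2)
    also have "\<dots> = ennreal (\<Sum>i\<in>{m}. ?b i * logpow (Suc (i + i)) x)"
      by (rule logint_sum_logpow[OF x]) auto
    finally show ?thesis by simp
  qed
  have "?I + ennreal (?b m * logpow (Suc (m + m)) x) = logint (tree_square_mean count_fn m) x"
    unfolding sq[symmetric]
    by (rule tree_sum_vs_first_gen_mean[where c = 1]) (use count_fn_linear_bound x in auto)
  also have "\<dots> \<le> logint (\<lambda>z. ennreal (\<Sum>q\<le>m. ?b q * logpow (m + q) z)) x"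
    using tree_square_mean_count_le by (intro logint_mono) auto
  also have "\<dots> = ennreal (\<Sum>q\<le>m. ?b q * logpow (Suc (m + q)) x)"
    using x by (rule logint_sum_logpow) auto
  also have "\<dots> = ennreal (\<Sum>q<m. ?b q * logpow (Suc (m + q)) x) + ennreal (?b m * logpow (Suc (m + m)) x)"
    using logpow_nonneg
    by (subst ennreal_plus[symmetric]) (auto intro!: sum_nonneg mult_nonneg_nonneg simp: lessThan_Suc_atMost[symmetric])
  finally have "ennreal (?b m * logpow (Suc (m + m)) x) + ?I \<le>
      ennreal (?b m * logpow (Suc (m + m)) x) + ennreal (\<Sum>q<m. ?b q * logpow (Suc (m + q)) x)"
    by (simp add: add.commute)
  thus ?thesis by (simp only: ennreal_add_left_cancel_le) auto
qed

text \<open>The probability that at least one of \<open>n\<close> balls hits a box of weight \<open>z / n\<close>, for \<open>z \<le> n\<close>.\<close>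

definition occ :: "nat \<Rightarrow> real \<Rightarrow> real" where
  "occ n z = 1 - (1 - min 1 (z / real n)) ^ n"

text \<open>A bound for the distance of \<open>occ n z\<close> from the indicator of \<open>z \<ge> 1\<close> that is independent of \<open>n\<close> and
integrable with respect to \<open>dz / z\<close> at both ends.\<close>

definition occ_gap :: "real \<Rightarrow> real" where
  "occ_gap z = (if z < 1 then z else 1 / z)"

lemma occ_measurable [measurable]: "occ n \<in> borel_measurable borel"
  unfolding occ_def by measurable

lemma occ_gap_measurable [measurable]: "occ_gap \<in> borel_measurable borel"
  unfolding occ_gap_def by measurable

lemma occ_bounds:
  assumes "z > 0" "n > 0"
  shows "0 \<le> occ n z" "occ n z \<le> z" "\<bar>occ n z - logpow 0 z\<bar> \<le> occ_gap z"
proof -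
  have z: "0 \<le> min 1 (z / real n)" "min 1 (z / real n) \<le> 1" using assms by auto
  show 0: "0 \<le> occ n z" unfolding occ_def using z by (simp add: power_le_one)
  \<comment> \<open>Bernoulli's inequality for the small boxes; the large ones are treated by \<open>exp (-z) \<le> 1 / z\<close>\<close>
  have "1 + real n * (- min 1 (z / real n)) \<le> (1 + - min 1 (z / real n)) ^ n"
    using z by (intro Bernoulli_inequality) auto
  moreover have "real n * min 1 (z / real n) \<le> z" using assms by (auto simp: min_def field_simps)
  ultimately show 1: "occ n z \<le> z" unfolding occ_def by simp
  show "\<bar>occ n z - logpow 0 z\<bar> \<le> occ_gap z"
  proof (cases "z < 1")
    case True
    thus ?thesis using 0 1 by (simp add: occ_gap_def logpow_def)
  next
    case False
    have "(1 - min 1 (z / real n)) ^ n \<le> 1 / z"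
    proof (cases "z \<le> real n")
      case True
      hence "min 1 (z / real n) = z / real n" using assms by (simp add: min_def field_simps)
      hence "(1 - min 1 (z / real n)) ^ n \<le> exp (- (z / real n)) ^ n"
        using z exp_ge_add_one_self[of "- (z / real n)"] by (intro power_mono) auto
      also have "\<dots> = exp (- z)" using assms by (simp add: exp_of_nat_mult[symmetric])
      also have "\<dots> \<le> 1 / z"
      proof -
        have "z \<le> exp z" using exp_ge_add_one_self[of z] by linarith
        thus ?thesis using assms by (simp add: exp_minus field_simps)
      qed
      finally show ?thesis .
    next
      case False
      hence "min 1 (z / real n) = 1" using assms by (simp add: min_def field_simps)
      thus ?thesis using assms by (simp add: zero_power)
    qed
    moreover have "0 \<le> (1 - min 1 (z / real n)) ^ n" using z by simp
    ultimately show ?thesis using False by (simp add: occ_def occ_gap_def logpow_def)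
  qed
qed

lemma occ_gap_bounds:
  assumes "z > 0" shows "0 \<le> occ_gap z" "occ_gap z \<le> z"
proof -
  have "1 / z \<le> z" if "z \<ge> 1"
    using that by (intro order.trans[of "1 / z" 1 z]) auto
  thus "0 \<le> occ_gap z" "occ_gap z \<le> z" using assms by (auto simp: occ_gap_def)
qed

lemma tree_sum_mono:
  assumes "\<And>z. z > 0 \<Longrightarrow> f z \<le> g z"
  shows "good_env e \<Longrightarrow> x > 0 \<Longrightarrow> tree_sum f m x e \<le> tree_sum g m x e"
proof (induction m arbitrary: x e)
  case (Suc m)
  have "first_weights e r > 0" for r using Suc.prems(1) by (simp add: good_env_def first_weights_def)
  thus ?case using Suc by (auto intro!: suminf_le summableI Suc.IH good_env_subenv)
qed (use assms in auto)

lemma tree_sum_add: "tree_sum (\<lambda>z. f z + g z) m x e = tree_sum f m x e + tree_sum g m x e"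
  by (induction m arbitrary: x e) (auto simp: suminf_add)

text \<open>These functions are mapped to each other by \<open>logint\<close>, so they are suited to bound iterated integrals
of a function that is linear near \<open>0\<close> and integrable at infinity.\<close>

definition small_or_log :: "nat \<Rightarrow> real \<Rightarrow> real" where
  "small_or_log k z = (if z < 1 then z else 0) + (\<Sum>i\<le>k. logpow i z)"

lemma small_or_log_nonneg: "z > 0 \<Longrightarrow> 0 \<le> small_or_log k z"
  by (auto simp: small_or_log_def logpow_nonneg intro!: add_nonneg_nonneg sum_nonneg)

lemma small_or_log_measurable [measurable]: "small_or_log k \<in> borel_measurable borel"
  unfolding small_or_log_def by measurable

lemma logint_add:
  assumes [measurable]: "f \<in> borel_measurable borel" "g \<in> borel_measurable borel"
  shows "logint (\<lambda>z. f z + g z) x = logint f x + logint g x"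
  unfolding logint_def by (subst nn_integral_add[symmetric]) (auto simp: distrib_right)

lemma logint_small:
  assumes "x > 0"
  shows "logint (\<lambda>z. ennreal (if z < 1 then z else 0)) x = ennreal (min x 1)"
proof -
  have "logint (\<lambda>z. ennreal (if z < 1 then z else 0)) x = (\<integral>\<^sup>+z. indicator ({0<..x} \<inter> {..<1}) z \<partial>lborel)"
    unfolding logint_def
    by (intro nn_integral_cong) (auto simp: indicator_def ennreal_mult[symmetric])
  also have "\<dots> = emeasure lborel ({0<..x} \<inter> {..<1})" by simp
  also have "\<dots> = ennreal (min x 1)"
  proof (cases "x < 1")
    case True
    hence "{0<..x} \<inter> {..<1} = {0<..x}" by auto
    thus ?thesis using True assms by simp
  next
    case False
    hence "{0<..x} \<inter> {..<1} = {0<..<1}" by auto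
    thus ?thesis using False by simp
  qed
  finally show ?thesis .
qed

lemma logint_small_or_log:
  assumes "x > 0"
  shows "logint (\<lambda>z. ennreal (small_or_log k z)) x = ennreal (small_or_log (Suc k) x)"
proof -
  have "logint (\<lambda>z. ennreal (small_or_log k z)) x
      = logint (\<lambda>z. ennreal (if z < 1 then z else 0) + ennreal (\<Sum>i\<in>{..k}. 1 * logpow i z)) x"
    using logpow_nonneg by (intro logint_cong) (auto simp: small_or_log_def sum_nonneg)
  also have "\<dots> = ennreal (min x 1) + ennreal (\<Sum>i\<in>{..k}. 1 * logpow (Suc i) x)"
    using assms by (subst logint_add) (auto simp: logint_small logint_sum_logpow[of x "{..k}" "\<lambda>_. 1" "\<lambda>i. i", simplified])
  also have "\<dots> = ennreal (min x 1 + (\<Sum>i\<le>k. logpow (Suc i) x))"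
    using assms logpow_nonneg by (simp add: sum_nonneg)
  also have "min x 1 + (\<Sum>i\<le>k. logpow (Suc i) x) = small_or_log (Suc k) x"
    unfolding small_or_log_def sum.atMost_Suc_shift by (auto simp: logpow_def min_def)
  finally show ?thesis .
qed

lemma logint_occ_gap_le:
  assumes "x > 0"
  shows "logint (\<lambda>z. ennreal (occ_gap z)) x \<le> ennreal (2 * small_or_log 0 x)"
proof -
  have "logint (\<lambda>z. ennreal (occ_gap z)) x \<le> logint (\<lambda>z. ennreal (if z < 1 then z else 0) + ennreal (if z \<ge> 1 then 1 / z else 0)) x"
    by (intro logint_mono) (auto simp: occ_gap_def)
  also have "\<dots> = ennreal (min x 1) + logint (\<lambda>z. ennreal (if z \<ge> 1 then 1 / z else 0)) x"
    using assms by (subst logint_add) (auto simp: logint_small)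
  also have "logint (\<lambda>z. ennreal (if z \<ge> 1 then 1 / z else 0)) x \<le> ennreal (if x \<ge> 1 then 1 else 0)"
  proof (cases "x \<ge> 1")
    case True
    have "logint (\<lambda>z. ennreal (if z \<ge> 1 then 1 / z else 0)) x = (\<integral>\<^sup>+z. ennreal (1 / z\<^sup>2) * indicator {1..x} z \<partial>lborel)"
      unfolding logint_def
      by (intro nn_integral_cong) (auto simp: indicator_def ennreal_mult[symmetric] power2_eq_square)
    also have "\<dots> = ennreal (- (1 / x) - (- (1 / 1)))"
    proof (rule nn_integral_FTC_Icc)
      fix z :: real assume "z \<in> {1..x}"
      thus "((\<lambda>z. - (1 / z)) has_real_derivative 1 / z\<^sup>2) (at z)"
        by (auto intro!: derivative_eq_intros simp: power2_eq_square)
    qed (use True in auto)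
    also have "\<dots> \<le> ennreal 1" using True by (intro ennreal_leI) auto
    finally show ?thesis using True by simp
  next
    case False
    have "logint (\<lambda>z. ennreal (if z \<ge> 1 then 1 / z else 0)) x = logint (\<lambda>z. 0) x"
      using False by (intro logint_cong) auto
    thus ?thesis by (simp add: logint_def)
  qed
  finally have "logint (\<lambda>z. ennreal (occ_gap z)) x \<le> ennreal (min x 1) + ennreal (if x \<ge> 1 then 1 else 0)"
    by (simp add: add_left_mono)
  also have "\<dots> = ennreal (min x 1 + (if x \<ge> 1 then 1 else 0))"
    using assms by (intro ennreal_plus[symmetric]) auto
  also have "\<dots> \<le> ennreal (2 * small_or_log 0 x)"
    using assms by (intro ennreal_leI) (auto simp: small_or_log_def logpow_def)
  finally show ?thesis .
qed

lemma logint_cmult: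
  assumes [measurable]: "f \<in> borel_measurable borel"
  shows "logint (\<lambda>z. c * f z) x = c * logint f x"
  unfolding logint_def by (subst nn_integral_cmult[symmetric]) (auto simp: mult.assoc)

lemma iterated_logint_occ_gap_le:
  "x > 0 \<Longrightarrow> (logint ^^ Suc k) (\<lambda>z. ennreal (occ_gap z)) x \<le> ennreal (2 * small_or_log k x)"
proof (induction k arbitrary: x)
  case 0
  thus ?case using logint_occ_gap_le by simp
next
  case (Suc k)
  have "(logint ^^ Suc (Suc k)) (\<lambda>z. ennreal (occ_gap z)) x \<le> logint (\<lambda>z. ennreal (2 * small_or_log k z)) x"
    unfolding funpow.simps(2)[of "Suc k"] o_apply using Suc.IH by (intro logint_mono) auto
  also have "\<dots> = logint (\<lambda>z. ennreal 2 * ennreal (small_or_log k z)) x"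
    using small_or_log_nonneg by (intro logint_cong) (simp add: ennreal_mult)
  also have "\<dots> = ennreal 2 * ennreal (small_or_log (Suc k) x)"
    using Suc.prems by (subst logint_cmult) (auto simp: logint_small_or_log)
  also have "\<dots> = ennreal (2 * small_or_log (Suc k) x)"
    using small_or_log_nonneg Suc.prems by (intro ennreal_mult[symmetric]) auto
  finally show ?case .
qed

text \<open>The distance is at most the sum of \<open>occ_gap\<close> over the generation. Its mean is one integration short
of the mean number of boxes, because the first integration of \<open>occ_gap\<close> only yields a bounded
function.\<close>

theorem occupied_mean_vs_count:
  assumes n: "n > 0" and x: "x > 0"
  shows "(\<integral>\<^sup>+e. ennreal \<bar>enn2real (tree_sum (\<lambda>z. ennreal (occ n z)) (Suc k) x e) - enn2real (tree_sum count_fn (Suc k) x e)\<bar> \<partial>env_law)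
     \<le> ennreal (2 * small_or_log k x)"
    and "(\<integral>\<^sup>+e. tree_sum (\<lambda>z. ennreal (occ n z)) (Suc k) x e \<partial>env_law) \<le> ennreal (logpow (Suc k) x + 2 * small_or_log k x)"
proof -
  let ?R = "tree_sum (\<lambda>z. ennreal (occ n z)) (Suc k) x" and ?N = "tree_sum count_fn (Suc k) x"
    and ?D = "tree_sum (\<lambda>z. ennreal (occ_gap z)) (Suc k) x"
  have le: "?R e \<le> ?N e + ?D e" "?N e \<le> ?R e + ?D e" if "good_env e" for e
  proof -
    have 1: "ennreal (occ n z) \<le> count_fn z + ennreal (occ_gap z)" if "z > 0" for z
    proof -
      have "occ n z \<le> logpow 0 z + occ_gap z" using occ_bounds(3)[OF that n] by linarith
      hence "ennreal (occ n z) \<le> ennreal (logpow 0 z + occ_gap z)" by (rule ennreal_leI)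
      also have "\<dots> = count_fn z + ennreal (occ_gap z)"
        using logpow_nonneg occ_gap_bounds(1)[OF that] by (rule ennreal_plus)
      finally show ?thesis .
    qed
    have 2: "count_fn z \<le> ennreal (occ n z) + ennreal (occ_gap z)" if "z > 0" for z
    proof -
      have "logpow 0 z \<le> occ n z + occ_gap z" using occ_bounds(3)[OF that n] by linarith
      hence "count_fn z \<le> ennreal (occ n z + occ_gap z)" by (rule ennreal_leI)
      also have "\<dots> = ennreal (occ n z) + ennreal (occ_gap z)"
        using occ_bounds(1)[OF that n] occ_gap_bounds(1)[OF that] by (rule ennreal_plus)
      finally show ?thesis .
    qed
    show "?R e \<le> ?N e + ?D e"
      unfolding tree_sum_add[symmetric] by (rule tree_sum_mono[OF _ that x]) (rule 1)
    show "?N e \<le> ?R e + ?D e"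
      unfolding tree_sum_add[symmetric] by (rule tree_sum_mono[OF _ that x]) (rule 2)
  qed
  have lin: "ennreal (occ n z) \<le> ennreal (1 * z)" "ennreal (occ_gap z) \<le> ennreal (1 * z)" if "z > 0" for z
    using occ_bounds[OF that n] occ_gap_bounds[OF that] by (auto intro: ennreal_leI)
  have meanD: "(\<integral>\<^sup>+e. ?D e \<partial>env_law) \<le> ennreal (2 * small_or_log k x)"
    using iterated_logint_occ_gap_le[OF x, of k] by (subst tree_sum_mean[where c = 1]) (use lin x in auto)
  have "(\<integral>\<^sup>+e. ennreal \<bar>enn2real (?R e) - enn2real (?N e)\<bar> \<partial>env_law) \<le> (\<integral>\<^sup>+e. ?D e \<partial>env_law)"
  proof (rule nn_integral_mono_AE)
    show "AE e in env_law. ennreal \<bar>enn2real (?R e) - enn2real (?N e)\<bar> \<le> ?D e"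
      using AE_good_env
    proof eventually_elim
      case (elim e)
      have "?R e \<le> ennreal (1 * x)" "?N e \<le> ennreal (1 * x)" "?D e \<le> ennreal (1 * x)"
        by (rule tree_sum_linear_bound[OF _ zero_le_one elim x], erule lin count_fn_linear_bound)+
      hence "?R e < \<top>" "?N e < \<top>" "?D e < \<top>" by (auto simp: top_unique less_top[symmetric])
      then obtain a b d where abd: "?R e = ennreal a" "?N e = ennreal b" "?D e = ennreal d" "a \<ge> 0" "b \<ge> 0" "d \<ge> 0"
        by (metis less_top_ennreal)
      have "a \<le> b + d" "b \<le> a + d"
        using le[OF elim] abd(4-6) unfolding abd(1-3) by (simp_all flip: ennreal_plus)
      hence "ennreal \<bar>a - b\<bar> \<le> ennreal d" by (intro ennreal_leI) auto
      thus ?case unfolding abd(1-3) using abd(4,5) by (simp only: enn2real_ennreal)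
    qed
  qed
  thus "(\<integral>\<^sup>+e. ennreal \<bar>enn2real (?R e) - enn2real (?N e)\<bar> \<partial>env_law) \<le> ennreal (2 * small_or_log k x)"
    using meanD by (rule order.trans)
  have "(\<integral>\<^sup>+e. ?R e \<partial>env_law) \<le> (\<integral>\<^sup>+e. ?N e + ?D e \<partial>env_law)"
    by (rule nn_integral_mono_AE) (use AE_good_env in eventually_elim, rule le(1))
  also have "\<dots> = (\<integral>\<^sup>+e. ?N e \<partial>env_law) + (\<integral>\<^sup>+e. ?D e \<partial>env_law)"
    by (rule nn_integral_add) measurable
  also have "(\<integral>\<^sup>+e. ?N e \<partial>env_law) = ennreal (logpow (Suc k) x)"
    using tree_sum_mean[where f = count_fn and c = 1 and m = "Suc k", OF _ count_fn_linear_bound _ x]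
      iterated_logint_count_fn[OF x, of "Suc k"] by simp
  also have "ennreal (logpow (Suc k) x) + (\<integral>\<^sup>+e. ?D e \<partial>env_law) \<le> ennreal (logpow (Suc k) x) + ennreal (2 * small_or_log k x)"
    using meanD by (rule add_left_mono)
  also have "\<dots> = ennreal (logpow (Suc k) x + 2 * small_or_log k x)"
    using logpow_nonneg small_or_log_nonneg[OF x] by (intro ennreal_plus[symmetric]) auto
  finally show "(\<integral>\<^sup>+e. ?R e \<partial>env_law) \<le> ennreal (logpow (Suc k) x + 2 * small_or_log k x)" .
qed

section \<open>Balls in a given environment\<close>

text \<open>The weight \<open>P(v)\<close>. The recursion from the root matches the one of \<open>tree_sum\<close>.\<close>

fun weight :: "(nat list \<Rightarrow> nat \<Rightarrow> real) \<Rightarrow> nat list \<Rightarrow> real" where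
  "weight e [] = 1"
| "weight e (r # v) = first_weights e r * weight (subenv r e) v"

lemma weight_snoc: "weight e (v @ [r]) = weight e v * e v r"
  by (induction v arbitrary: e) (auto simp: first_weights_def subenv_def)

lemma weight_measurable [measurable (raw)]:
  "E \<in> measurable M env_space \<Longrightarrow> (\<lambda>p. weight (E p) v) \<in> borel_measurable M"
proof (induction v arbitrary: E)
  case (Cons r v)
  note [measurable] = Cons.prems
  have [measurable]: "(\<lambda>p. weight (subenv r (E p)) v) \<in> borel_measurable M"
    by (rule Cons.IH) measurable
  show ?case by simp
qed simp

lemma weight_bounds: "good_env e \<Longrightarrow> 0 < weight e v \<and> weight e v \<le> 1"
proof (induction v arbitrary: e)
  case (Cons r v)
  have "0 < first_weights e r" "first_weights e r \<le> 1"
    using Cons.prems good_env_le_1[OF Cons.prems] by (auto simp: first_weights_def good_env_def)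
  thus ?case using Cons.IH[OF good_env_subenv[OF Cons.prems, of r]] by (auto intro: mult_le_one)
qed simp

definition words :: "nat \<Rightarrow> nat list set" where
  "words m = {v. length v = m}"

lemma tree_sum_eq_words: "tree_sum f m x e = (\<integral>\<^sup>+v. f (x * weight e v) \<partial>count_space (words m))"
proof (induction m arbitrary: x e)
  case 0
  have "words 0 = {[]}" by (auto simp: words_def)
  thus ?case by (simp add: nn_integral_count_space_finite)
next
  case (Suc m)
  have bij: "bij_betw (\<lambda>(r, v). r # v) (UNIV \<times> words m) (words (Suc m))"
    unfolding bij_betw_def words_def by (auto simp: inj_on_def length_Suc_conv image_iff)
  have "tree_sum f (Suc m) x e = (\<Sum>r. \<integral>\<^sup>+v. f (x * first_weights e r * weight (subenv r e) v) \<partial>count_space (words m))"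
    by (simp add: Suc.IH)
  also have "\<dots> = (\<integral>\<^sup>+r. \<integral>\<^sup>+v. f (x * weight e (r # v)) * indicator (words m) v \<partial>count_space UNIV \<partial>count_space UNIV)"
    by (simp add: nn_integral_count_space_nat nn_integral_count_space_indicator mult.assoc)
  also have "\<dots> = (\<integral>\<^sup>+rv. f (x * weight e (fst rv # snd rv)) * indicator (words m) (snd rv) \<partial>count_space UNIV)"
    using nn_integral_fst_count_space[of "\<lambda>rv. f (x * weight e (fst rv # snd rv)) * indicator (words m) (snd rv)"] by simp
  also have "\<dots> = (\<integral>\<^sup>+rv. f (x * weight e ((\<lambda>(r, v). r # v) rv)) \<partial>count_space (UNIV \<times> words m))"
    by (subst nn_integral_count_space_indicator) (auto intro!: nn_integral_cong simp: indicator_def split_beta)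
  also have "\<dots> = (\<integral>\<^sup>+v. f (x * weight e v) \<partial>count_space (words (Suc m)))"
    by (rule nn_integral_bij_count_space[OF bij])
  finally show ?case .
qed

definition total_env :: "(nat list \<Rightarrow> nat \<Rightarrow> real) \<Rightarrow> bool" where
  "total_env e \<longleftrightarrow> good_env e \<and> (\<forall>v. e v sums 1)"

lemma tree_sum_total:
  "total_env e \<Longrightarrow> x > 0 \<Longrightarrow> tree_sum ennreal m x e = ennreal x"
proof (induction m arbitrary: x e)
  case (Suc m)
  have e: "first_weights e r > 0" "total_env (subenv r e)" "first_weights e sums 1" for r
    using Suc.prems by (auto simp: total_env_def good_env_def first_weights_def subenv_def)
  have "tree_sum ennreal (Suc m) x e = (\<Sum>r. ennreal (x * first_weights e r))"
    using e Suc by simp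
  also have "\<dots> = ennreal (x * 1)"
    using e(1) Suc.prems(2) by (intro suminf_ennreal_eq sums_mult e(3)) (auto intro: less_imp_le)
  finally show ?case by simp
qed simp

context nested_occupancy
begin

definition env :: "'a \<Rightarrow> nat list \<Rightarrow> nat \<Rightarrow> real" where
  "env \<omega> = (\<lambda>v. P v \<omega>)"

lemma P_measurable [measurable]: "P v \<in> measurable M seq_space"
  using P_indep by (simp add: indep_vars_def)

lemma X_measurable' [measurable]: "i < n \<Longrightarrow> X i k \<in> measurable M (count_space UNIV)"
  by (rule X_measurable)

lemma env_measurable [measurable]: "env \<in> measurable M env_space"
  unfolding env_def[abs_def] by (rule measurable_PiM_single') (auto simp: space_PiM)

lemma space_history: "space (history M P n X k) = space M"
  unfolding history_def by (rule space_measure_of) (use X_measurable in \<open>auto\<close>)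

lemma sets_history: "sets (history M P n X k) = sigma_sets (space M)
     ({P v -` A \<inter> space M | v A. A \<in> sets seq_space} \<union> {X i l -` B \<inter> space M | i l B. i < n \<and> l \<le> k})"
  unfolding history_def by (rule sets_measure_of) auto

lemma subalgebra_history: "subalgebra M (history M P n X k)"
  unfolding subalgebra_def
proof (intro conjI)
  show "sets (history M P n X k) \<subseteq> sets M"
    unfolding sets_history
  proof (rule sets.sigma_sets_subset, safe)
    fix v A assume "A \<in> sets seq_space"
    thus "P v -` A \<inter> space M \<in> sets M" by (rule measurable_sets[OF P_measurable])
  next
    fix i l B assume "i < n"
    thus "X i l -` B \<inter> space M \<in> sets M" by (intro measurable_sets[OF X_measurable]) auto
  qed
qed (rule space_history)

lemma P_history [measurable]: "P v \<in> measurable (history M P n X k) seq_space"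
proof (rule measurableI)
  fix A assume "A \<in> sets seq_space"
  thus "P v -` A \<inter> space (history M P n X k) \<in> sets (history M P n X k)"
    unfolding sets_history space_history by (intro sigma_sets.Basic) blast
qed (simp add: space_PiM)

lemma env_history [measurable]: "env \<in> measurable (history M P n X k) env_space"
  unfolding env_def[abs_def] by (rule measurable_PiM_single') (auto simp: space_PiM)

lemma X_history: "i < n \<Longrightarrow> l \<le> k \<Longrightarrow> X i l \<in> measurable (history M P n X k) (count_space UNIV)"
  by (rule measurableI) (auto simp: sets_history space_history)

sublocale history: sigma_finite_subalgebra M "history M P n X k" for k
  by (intro finite_measure_subalgebra_is_sigma_finite, unfold_locales) (rule subalgebra_history)

end

locale gem_occupancy = nested_occupancy M GEM01 P n X
  for M :: "'a measure" and P n X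
begin

lemma distr_env: "distr M env_space env = env_law"
proof -
  have "distr M env_space (\<lambda>\<omega>. \<lambda>v\<in>UNIV. P v \<omega>) = PiM UNIV (\<lambda>v. distr M seq_space (P v))"
    using P_indep by (subst (asm) indep_vars_iff_distr_eq_PiM) auto
  moreover have "(\<lambda>\<omega>. \<lambda>v\<in>UNIV. P v \<omega>) = env" by (simp add: fun_eq_iff env_def)
  ultimately show ?thesis by (simp add: P_law)
qed

lemma AE_total_env: "AE \<omega> in M. total_env (env \<omega>)"
proof -
  have "AE e in distr M env_space env. good_env e" unfolding distr_env by (rule AE_good_env)
  hence 1: "AE \<omega> in M. good_env (env \<omega>)" by (rule AE_distrD[OF env_measurable])
  have "AE \<omega> in M. P v \<omega> sums 1" for v
  proof -
    have "AE p in distr M seq_space (P v). p sums 1" unfolding P_law by (rule law_sums)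
    thus ?thesis by (rule AE_distrD[OF P_measurable])
  qed
  hence "AE \<omega> in M. \<forall>v. P v \<omega> sums 1" by (simp add: AE_all_countable)
  thus ?thesis using 1 by eventually_elim (simp add: total_env_def env_def)
qed

lemma nn_integral_env:
  assumes [measurable]: "F \<in> borel_measurable env_space"
  shows "(\<integral>\<^sup>+\<omega>. F (env \<omega>) \<partial>M) = (\<integral>\<^sup>+e. F e \<partial>env_law)"
  unfolding distr_env[symmetric] by (rule nn_integral_distr[symmetric]) measurable

text \<open>Given the environment, the balls move independently, and each of them follows a path with probability
equal to the weight of its end point. The hypothesis of the scheme speaks of one step only. In the
induction over the generations, the conditional probability of the last step is a function of the
environment and is absorbed into the test variable \<open>z\<close>, which is why \<open>z\<close> has to be arbitrary.\<close>

lemma paths_of_balls: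
  fixes z :: "(nat list \<Rightarrow> nat \<Rightarrow> real) \<Rightarrow> real"
  assumes "z \<in> borel_measurable env_space" "\<And>e. 0 \<le> z e" "\<And>e. z e \<le> 1"
    and "\<And>i. i < n \<Longrightarrow> length (x i) = k"
  shows "(\<integral>\<omega>. z (env \<omega>) * indicator {\<omega> \<in> space M. \<forall>i<n. \<forall>l\<le>k. X i l \<omega> = take l (x i)} \<omega> \<partial>M)
       = (\<integral>\<omega>. z (env \<omega>) * (\<Prod>i<n. weight (env \<omega>) (x i)) \<partial>M)"
  using assms
proof (induction k arbitrary: x z)
  case 0
  have "{\<omega> \<in> space M. \<forall>i<n. \<forall>l\<le>0. X i l \<omega> = take l (x i)} = space M" using X_root by auto
  moreover have "(\<Prod>i<n. weight (env \<omega>) (x i)) = 1" for \<omega> using 0 by (intro prod.neutral) auto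
  ultimately show ?case by (intro Bochner_Integration.integral_cong) auto
next
  case (Suc k)
  define y where "y = (\<lambda>i. take k (x i))"
  define r where "r = (\<lambda>i. last (x i))"
  have xy: "x i = y i @ [r i]" "length (y i) = k" if "i < n" for i
  proof -
    have "x i = take k (x i) @ [x i ! k]"
      using take_Suc_conv_app_nth[of k "x i"] Suc.prems(4)[OF that] by simp
    thus "x i = y i @ [r i]" unfolding y_def r_def by (metis last_snoc)
    show "length (y i) = k" using Suc.prems(4)[OF that] by (simp add: y_def)
  qed
  let ?Ey = "{\<omega> \<in> space M. \<forall>i<n. \<forall>l\<le>k. X i l \<omega> = take l (y i)}"
  let ?Ex = "{\<omega> \<in> space M. \<forall>i<n. \<forall>l\<le>Suc k. X i l \<omega> = take l (x i)}"
  let ?g = "indicator {\<omega> \<in> space M. \<forall>i<n. X i (Suc k) \<omega> = X i k \<omega> @ [r i]} :: 'a \<Rightarrow> real"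
  define f where "f = (\<lambda>\<omega>. z (env \<omega>) * indicator ?Ey \<omega>)"
  \<comment> \<open>the weights lie in \<open>[0, 1]\<close> only almost surely, but the new test variable has to be bounded
    everywhere\<close>
  define clamp :: "real \<Rightarrow> real" where "clamp = (\<lambda>t. max 0 (min 1 t))"
  define z' where "z' = (\<lambda>e. z e * (\<Prod>i<n. clamp (e (y i) (r i))))"
  have clamp_meas: "clamp \<in> borel_measurable borel" unfolding clamp_def by measurable
  have comp: "(\<lambda>e. e v s) \<in> borel_measurable env_space" for v :: "nat list" and s :: nat
  proof -
    have "(\<lambda>e. e v) \<in> measurable env_space seq_space" by (rule measurable_component_singleton) simp
    moreover have "(\<lambda>p. p s) \<in> borel_measurable seq_space" by (rule measurable_component_singleton) simp
    ultimately show ?thesis by (rule measurable_compose)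
  qed
  have z'_meas: "z' \<in> borel_measurable env_space"
    unfolding z'_def by (intro borel_measurable_times borel_measurable_prod measurable_compose[OF comp clamp_meas] Suc.prems(1))
  have c01: "0 \<le> clamp t" "clamp t \<le> 1" for t by (auto simp: clamp_def)
  have z'01: "0 \<le> z' e" "z' e \<le> 1" for e
  proof -
    have p: "0 \<le> (\<Prod>i<n. clamp (e (y i) (r i)))" "(\<Prod>i<n. clamp (e (y i) (r i))) \<le> 1"
      using c01 by (auto intro!: prod_nonneg prod_le_1)
    show "0 \<le> z' e" unfolding z'_def using p Suc.prems(2)[of e] by (intro mult_nonneg_nonneg)
    show "z' e \<le> 1" unfolding z'_def using p Suc.prems(2)[of e] Suc.prems(3)[of e] by (intro mult_le_one)
  qed
  have setH: "?Ey \<in> sets (history M P n X k)"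
  proof -
    have "{\<omega> \<in> space (history M P n X k). X i l \<omega> = take l (y i)} \<in> sets (history M P n X k)" if "i < n" "l \<le> k" for i l
      using measurable_sets[OF X_history[OF that], of "{take l (y i)}"] by (simp add: vimage_def Int_def conj_commute)
    hence "{\<omega> \<in> space (history M P n X k). \<forall>i\<in>{..<n}. \<forall>l\<in>{..k}. X i l \<omega> = take l (y i)} \<in> sets (history M P n X k)"
      by (intro sets.sets_Collect_finite_All) auto
    moreover have "{\<omega> \<in> space (history M P n X k). \<forall>i\<in>{..<n}. \<forall>l\<in>{..k}. X i l \<omega> = take l (y i)} = ?Ey"
      unfolding space_history by auto
    ultimately show ?thesis by (simp only:)
  qed
  have setM: "?Ey \<in> sets M"
    by (rule subsetD[OF conjunct2[OF subalgebra_history[unfolded subalgebra_def]] setH])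
  have zM: "(\<lambda>\<omega>. z (env \<omega>)) \<in> borel_measurable M" by (rule measurable_compose[OF env_measurable Suc.prems(1)])
  have fH: "f \<in> borel_measurable (history M P n X k)"
    unfolding f_def by (intro borel_measurable_times borel_measurable_indicator setH measurable_compose[OF env_history Suc.prems(1)])
  have gM: "?g \<in> borel_measurable M"
  proof -
    have "{\<omega> \<in> space M. X i (Suc k) \<omega> = X i k \<omega> @ [r i]} \<in> sets M" if "i < n" for i
    proof -
      have [measurable]: "X i k \<in> measurable M (count_space UNIV)" "X i (Suc k) \<in> measurable M (count_space UNIV)"
        using X_measurable[OF that] by auto
      show ?thesis by measurable
    qed
    hence "{\<omega> \<in> space M. \<forall>i\<in>{..<n}. X i (Suc k) \<omega> = X i k \<omega> @ [r i]} \<in> sets M"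
      by (intro sets.sets_Collect_finite_All) auto
    moreover have "{\<omega> \<in> space M. \<forall>i\<in>{..<n}. X i (Suc k) \<omega> = X i k \<omega> @ [r i]} = {\<omega> \<in> space M. \<forall>i<n. X i (Suc k) \<omega> = X i k \<omega> @ [r i]}"
      by auto
    ultimately show ?thesis by (intro borel_measurable_indicator) (simp only:)
  qed
  have f01: "0 \<le> f \<omega>" "f \<omega> \<le> 1" for \<omega> unfolding f_def using Suc.prems(2,3) by (auto simp: indicator_def)
  have fM: "f \<in> borel_measurable M" by (rule measurable_from_subalg[OF subalgebra_history fH])
  have int: "integrable M (\<lambda>\<omega>. f \<omega> * ?g \<omega>)"
  proof (rule integrable_const_bound[where B = 1])
    show "AE \<omega> in M. norm (f \<omega> * ?g \<omega>) \<le> 1"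
      using f01 by (intro AE_I2) (auto simp: indicator_def)
  qed (intro borel_measurable_times fM gM)
  have "(\<integral>\<omega>. z (env \<omega>) * indicator ?Ex \<omega> \<partial>M) = (\<integral>\<omega>. f \<omega> * ?g \<omega> \<partial>M)"
  proof (rule Bochner_Integration.integral_cong[OF refl])
    fix \<omega> assume \<omega>: "\<omega> \<in> space M"
    have "(\<forall>l\<le>Suc k. X i l \<omega> = take l (x i)) \<longleftrightarrow> (\<forall>l\<le>k. X i l \<omega> = take l (y i)) \<and> X i (Suc k) \<omega> = X i k \<omega> @ [r i]" if "i < n" for i
    proof -
      have "take l (x i) = take l (y i)" if "l \<le> k" for l using that by (simp add: y_def min_def)
      moreover have "take (Suc k) (x i) = y i @ [r i]" "take k (y i) = y i" using xy[OF that] by auto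
      ultimately show ?thesis by (auto simp: le_Suc_eq)
    qed
    hence "\<omega> \<in> ?Ex \<longleftrightarrow> \<omega> \<in> ?Ey \<and> (\<forall>i<n. X i (Suc k) \<omega> = X i k \<omega> @ [r i])" using \<omega> by blast
    thus "z (env \<omega>) * indicator ?Ex \<omega> = f \<omega> * ?g \<omega>" using \<omega> by (simp add: f_def indicator_def)
  qed
  also have "\<dots> = (\<integral>\<omega>. f \<omega> * real_cond_exp M (history M P n X k) ?g \<omega> \<partial>M)"
    by (rule history.real_cond_exp_intg(2)[OF int fH gM, symmetric])
  also have "\<dots> = (\<integral>\<omega>. z' (env \<omega>) * indicator ?Ey \<omega> \<partial>M)"
  proof (rule Bochner_Integration.integral_cong_AE)
    show "(\<lambda>\<omega>. z' (env \<omega>) * indicator ?Ey \<omega>) \<in> borel_measurable M"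
      by (intro borel_measurable_times borel_measurable_indicator setM measurable_compose[OF env_measurable z'_meas])
    show "AE \<omega> in M. f \<omega> * real_cond_exp M (history M P n X k) ?g \<omega> = z' (env \<omega>) * indicator ?Ey \<omega>"
      using X_step[of k r] AE_total_env
    proof eventually_elim
      case (elim \<omega>)
      show ?case
      proof (cases "\<omega> \<in> ?Ey")
        case True
        have "X i k \<omega> = y i" if "i < n" for i using True that xy(2)[OF that] by auto
        moreover have "clamp (env \<omega> (y i) (r i)) = P (y i) \<omega> (r i)" for i
        proof -
          have "good_env (env \<omega>)" using elim(2) by (simp add: total_env_def)
          hence "0 < env \<omega> (y i) (r i)" "env \<omega> (y i) (r i) \<le> 1"
            using good_env_le_1 by (auto simp: good_env_def)
          thus ?thesis by (simp add: clamp_def env_def)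
        qed
        ultimately have "real_cond_exp M (history M P n X k) ?g \<omega> = (\<Prod>i<n. clamp (env \<omega> (y i) (r i)))"
          unfolding elim(1) by (intro prod.cong) auto
        thus ?thesis using True by (simp add: f_def z'_def)
      qed (simp add: f_def)
    qed
  qed (intro borel_measurable_times fM borel_measurable_cond_exp2)
  also have "\<dots> = (\<integral>\<omega>. z' (env \<omega>) * (\<Prod>i<n. weight (env \<omega>) (y i)) \<partial>M)"
    using xy by (intro Suc.IH[OF z'_meas z'01]) auto
  also have "\<dots> = (\<integral>\<omega>. z (env \<omega>) * (\<Prod>i<n. weight (env \<omega>) (x i)) \<partial>M)"
  proof (rule Bochner_Integration.integral_cong_AE)
    have w: "(\<lambda>\<omega>. weight (env \<omega>) v) \<in> borel_measurable M" for v by measurable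
    show "(\<lambda>\<omega>. z' (env \<omega>) * (\<Prod>i<n. weight (env \<omega>) (y i))) \<in> borel_measurable M"
      by (intro borel_measurable_times borel_measurable_prod w measurable_compose[OF env_measurable z'_meas])
    show "(\<lambda>\<omega>. z (env \<omega>) * (\<Prod>i<n. weight (env \<omega>) (x i))) \<in> borel_measurable M"
      by (intro borel_measurable_times borel_measurable_prod w zM)
    show "AE \<omega> in M. z' (env \<omega>) * (\<Prod>i<n. weight (env \<omega>) (y i)) = z (env \<omega>) * (\<Prod>i<n. weight (env \<omega>) (x i))"
      using AE_total_env
    proof eventually_elim
      case (elim \<omega>)
      have "clamp (env \<omega> (y i) (r i)) * weight (env \<omega>) (y i) = weight (env \<omega>) (x i)" if "i < n" for i
      proof -
        have "good_env (env \<omega>)" using elim by (simp add: total_env_def)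
        hence "0 < env \<omega> (y i) (r i)" "env \<omega> (y i) (r i) \<le> 1"
          using good_env_le_1 by (auto simp: good_env_def)
        thus ?thesis by (simp add: clamp_def xy(1)[OF that] weight_snoc)
      qed
      hence "(\<Prod>i<n. clamp (env \<omega> (y i) (r i))) * (\<Prod>i<n. weight (env \<omega>) (y i)) = (\<Prod>i<n. weight (env \<omega>) (x i))"
        unfolding prod.distrib[symmetric] by (intro prod.cong) auto
      thus ?case by (simp add: z'_def mult.assoc)
    qed
  qed
  finally show ?case .
qed

end

lemma nn_integral_count_space_diff:
  assumes "B \<subseteq> A"
  shows "(\<integral>\<^sup>+v. f v \<partial>count_space A) = (\<integral>\<^sup>+v. f v \<partial>count_space (A - B)) + (\<integral>\<^sup>+v. f v \<partial>count_space B)"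
proof -
  have "(\<integral>\<^sup>+v. f v \<partial>count_space S) = (\<integral>\<^sup>+v. f v * indicator S v \<partial>count_space UNIV)" for S
    by (cases "S = UNIV") (auto simp: nn_integral_count_space_indicator)
  moreover have "f v * indicator A v = f v * indicator (A - B) v + f v * indicator B v" for v
    using assms by (auto simp: indicator_def)
  ultimately show ?thesis by (simp add: nn_integral_add)
qed

lemma prod_indicator_eq:
  "finite I \<Longrightarrow> (\<Prod>i\<in>I. indicator (S i) \<omega> :: ennreal) = indicator {\<omega>. \<forall>i\<in>I. \<omega> \<in> S i} \<omega>"
  by (induction I rule: finite_induct) (auto simp: indicator_def)

lemma sets_Collect_mem: "S \<in> sets M \<Longrightarrow> {\<omega> \<in> space M. \<omega> \<in> S} \<in> sets M"
  using sets.Int[OF sets.top, of S M] by (simp add: Int_def)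

lemma measurable_nn_integral_count_space:
  fixes f :: "'i :: countable \<Rightarrow> 'c \<Rightarrow> ennreal"
  assumes [measurable]: "\<And>v. f v \<in> borel_measurable M"
  shows "(\<lambda>\<omega>. \<integral>\<^sup>+v. f v \<omega> \<partial>count_space A) \<in> borel_measurable M"
proof -
  have "(\<integral>\<^sup>+v. f v \<omega> \<partial>count_space A) = (\<Sum>k. f (from_nat k) \<omega> * of_bool (from_nat k \<in> A \<and> k \<in> range (to_nat :: 'i \<Rightarrow> nat)))" for \<omega>
  proof -
    have "(\<integral>\<^sup>+v. f v \<omega> \<partial>count_space A) = (\<integral>\<^sup>+v. f v \<omega> * indicator A v \<partial>count_space UNIV)"
      by (cases "A = UNIV") (auto simp: nn_integral_count_space_indicator)
    also have "\<dots> = (\<integral>\<^sup>+v. f (from_nat (to_nat (v :: 'i))) \<omega> * indicator A (from_nat (to_nat v) :: 'i) \<partial>count_space UNIV)"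
      by simp
    also have "\<dots> = (\<integral>\<^sup>+k. f (from_nat k) \<omega> * indicator A (from_nat k) \<partial>count_space (range (to_nat :: 'i \<Rightarrow> nat)))"
      by (rule nn_integral_bij_count_space) (simp add: inj_on_imp_bij_betw)
    also have "\<dots> = (\<integral>\<^sup>+k. f (from_nat k) \<omega> * of_bool (from_nat k \<in> A \<and> k \<in> range (to_nat :: 'i \<Rightarrow> nat)) \<partial>count_space UNIV)"
      by (subst nn_integral_count_space_indicator, simp, rule nn_integral_cong)
         (simp add: indicator_def of_bool_conj mult.assoc)
    finally show ?thesis by (simp add: nn_integral_count_space_nat)
  qed
  thus ?thesis by simp
qed

context gem_occupancy
begin

text \<open>The whole path is prescribed, since almost surely, but not surely, a ball in \<open>v\<close> has visited the
ancestors of \<open>v\<close>.\<close>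

definition follows :: "nat \<Rightarrow> nat list \<Rightarrow> 'a set" where
  "follows i v = {\<omega> \<in> space M. \<forall>l\<le>length v. X i l \<omega> = take l v}"

definition hits :: "nat \<Rightarrow> nat list set \<Rightarrow> 'a set" where
  "hits i A = (\<Union>v\<in>A. follows i v)"

definition mass :: "nat list set \<Rightarrow> (nat list \<Rightarrow> nat \<Rightarrow> real) \<Rightarrow> ennreal" where
  "mass A e = (\<integral>\<^sup>+v. ennreal (weight e v) \<partial>count_space A)"

lemma follows_sets: "i < n \<Longrightarrow> follows i v \<in> sets M"
proof -
  assume i: "i < n"
  have "{\<omega> \<in> space M. X i l \<omega> = take l v} \<in> sets M" for l
    using measurable_sets[OF X_measurable[OF i], of "{take l v}"] by (simp add: vimage_def Int_def conj_commute)
  hence "{\<omega> \<in> space M. \<forall>l\<in>{..length v}. X i l \<omega> = take l v} \<in> sets M"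
    by (intro sets.sets_Collect_finite_All) auto
  moreover have "{\<omega> \<in> space M. \<forall>l\<in>{..length v}. X i l \<omega> = take l v} = follows i v"
    by (auto simp: follows_def)
  ultimately show ?thesis by (simp only:)
qed

lemma hits_sets: "i < n \<Longrightarrow> hits i A \<in> sets M"
  unfolding hits_def by (rule sets.countable_UN'[OF _ _]) (auto intro: countable_subset[OF subset_UNIV] follows_sets)

lemma mass_measurable [measurable (raw)]:
  assumes [measurable]: "E \<in> measurable M' env_space"
  shows "(\<lambda>p. mass A (E p)) \<in> borel_measurable M'"
  unfolding mass_def by (rule measurable_nn_integral_count_space) measurable

lemma indicator_hits:
  assumes "A \<subseteq> words m"
  shows "(indicator (hits i A) \<omega> :: ennreal) = (\<integral>\<^sup>+v. indicator (follows i v) \<omega> \<partial>count_space A)"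
proof -
  have eq: "v = X i m \<omega>" if "v \<in> A" "\<omega> \<in> follows i v" for v
    using that assms by (auto simp: follows_def words_def)
  show ?thesis
  proof (cases "\<omega> \<in> hits i A")
    case True
    then obtain v where v: "v \<in> A" "\<omega> \<in> follows i v" by (auto simp: hits_def)
    have "(\<integral>\<^sup>+u. indicator (follows i u) \<omega> \<partial>count_space A) = (\<integral>\<^sup>+u. indicator {v} u \<partial>count_space A)"
      using v eq by (intro nn_integral_cong) (auto simp: indicator_def)
    also have "\<dots> = 1" using v by simp
    finally show ?thesis using True by simp
  next
    case False
    hence "(\<integral>\<^sup>+u. indicator (follows i u) \<omega> \<partial>count_space A) = (\<integral>\<^sup>+u. 0 \<partial>count_space A)"
      by (intro nn_integral_cong) (auto simp: hits_def indicator_def)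
    thus ?thesis using False by simp
  qed
qed

text \<open>The balls are released one by one: summation over \<open>A\<close> replaces the prescribed end point of ball \<open>k\<close>
by the condition that it ends in \<open>A\<close>.\<close>

lemma balls_in_set_then_paths:
  fixes z :: "(nat list \<Rightarrow> nat \<Rightarrow> real) \<Rightarrow> real"
  assumes z: "z \<in> borel_measurable env_space" "\<And>e. 0 \<le> z e" "\<And>e. z e \<le> 1"
    and A: "A \<subseteq> words m"
  shows "k \<le> n \<Longrightarrow> (\<And>i. i < n \<Longrightarrow> x i \<in> words m) \<Longrightarrow>
    (\<integral>\<^sup>+\<omega>. ennreal (z (env \<omega>)) * (\<Prod>i<k. indicator (hits i A) \<omega>) * (\<Prod>i\<in>{k..<n}. indicator (follows i (x i)) \<omega>) \<partial>M)
    = (\<integral>\<^sup>+\<omega>. ennreal (z (env \<omega>)) * mass A (env \<omega>) ^ k * (\<Prod>i\<in>{k..<n}. ennreal (weight (env \<omega>) (x i))) \<partial>M)"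
proof (induction k arbitrary: x)
  case 0
  have zM: "(\<lambda>\<omega>. z (env \<omega>)) \<in> borel_measurable M" by (rule measurable_compose[OF env_measurable z(1)])
  have w: "(\<lambda>\<omega>. weight (env \<omega>) v) \<in> borel_measurable M" for v by measurable
  have E: "{\<omega> \<in> space M. \<forall>i<n. \<forall>l\<le>m. X i l \<omega> = take l (x i)} = {\<omega> \<in> space M. \<forall>i\<in>{..<n}. \<omega> \<in> follows i (x i)}" (is "?E = _")
    using 0 by (auto simp: follows_def words_def)
  have Es: "?E \<in> sets M"
    unfolding E by (intro sets.sets_Collect_finite_All) (auto intro!: sets_Collect_mem follows_sets)
  have pos: "AE \<omega> in M. \<forall>v. 0 \<le> weight (env \<omega>) v \<and> weight (env \<omega>) v \<le> 1"
    using AE_total_env by eventually_elim (auto simp: total_env_def dest: weight_bounds intro: less_imp_le)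
  have "(\<integral>\<^sup>+\<omega>. ennreal (z (env \<omega>)) * (\<Prod>i<0. indicator (hits i A) \<omega>) * (\<Prod>i\<in>{0..<n}. indicator (follows i (x i)) \<omega>) \<partial>M)
     = (\<integral>\<^sup>+\<omega>. ennreal (z (env \<omega>) * indicator ?E \<omega>) \<partial>M)"
    unfolding E by (intro nn_integral_cong) (auto simp: prod_indicator_eq indicator_def)
  also have "\<dots> = ennreal (\<integral>\<omega>. z (env \<omega>) * indicator ?E \<omega> \<partial>M)"
  proof (rule nn_integral_eq_integral)
    show "integrable M (\<lambda>\<omega>. z (env \<omega>) * indicator ?E \<omega>)"
      using z(2,3) Es by (intro integrable_const_bound[where B = 1] borel_measurable_times zM AE_I2) (auto simp: indicator_def)
  qed (use z(2) in auto)
  also have "(\<integral>\<omega>. z (env \<omega>) * indicator ?E \<omega> \<partial>M) = (\<integral>\<omega>. z (env \<omega>) * (\<Prod>i<n. weight (env \<omega>) (x i)) \<partial>M)"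
    using 0 by (intro paths_of_balls z) (auto simp: words_def)
  also have "ennreal \<dots> = (\<integral>\<^sup>+\<omega>. ennreal (z (env \<omega>) * (\<Prod>i<n. weight (env \<omega>) (x i))) \<partial>M)"
  proof (rule nn_integral_eq_integral[symmetric])
    show "integrable M (\<lambda>\<omega>. z (env \<omega>) * (\<Prod>i<n. weight (env \<omega>) (x i)))"
    proof (rule integrable_const_bound[where B = 1])
      show "AE \<omega> in M. norm (z (env \<omega>) * (\<Prod>i<n. weight (env \<omega>) (x i))) \<le> 1"
        using pos
      proof eventually_elim
        case (elim \<omega>)
        have "0 \<le> (\<Prod>i<n. weight (env \<omega>) (x i))" "(\<Prod>i<n. weight (env \<omega>) (x i)) \<le> 1"
          using elim by (auto intro!: prod_nonneg prod_le_1)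
        thus ?case using z(2,3)[of "env \<omega>"] by (simp add: abs_mult mult_le_one)
      qed
    qed (intro borel_measurable_times zM borel_measurable_prod w)
    show "AE \<omega> in M. 0 \<le> z (env \<omega>) * (\<Prod>i<n. weight (env \<omega>) (x i))"
      using pos by eventually_elim (use z(2) in \<open>auto intro!: mult_nonneg_nonneg prod_nonneg\<close>)
  qed
  also have "\<dots> = (\<integral>\<^sup>+\<omega>. ennreal (z (env \<omega>)) * mass A (env \<omega>) ^ 0 * (\<Prod>i\<in>{0..<n}. ennreal (weight (env \<omega>) (x i))) \<partial>M)"
  proof (rule nn_integral_cong_AE)
    show "AE \<omega> in M. ennreal (z (env \<omega>) * (\<Prod>i<n. weight (env \<omega>) (x i))) =
        ennreal (z (env \<omega>)) * mass A (env \<omega>) ^ 0 * (\<Prod>i\<in>{0..<n}. ennreal (weight (env \<omega>) (x i)))"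
      using pos
    proof eventually_elim
      case (elim \<omega>)
      thus ?case using z(2)[of "env \<omega>"]
        by (simp add: prod_ennreal atLeast0LessThan ennreal_mult prod_nonneg)
    qed
  qed
  finally show ?case .
next
  case (Suc k)
  have kn: "k < n" using Suc.prems(1) by simp
  have zM [measurable]: "(\<lambda>\<omega>. z (env \<omega>)) \<in> borel_measurable M" by (rule measurable_compose[OF env_measurable z(1)])
  have cA: "countable A" by (rule countable_subset[OF subset_UNIV]) simp
  let ?l = "\<lambda>\<omega>. ennreal (z (env \<omega>)) * (\<Prod>i<k. indicator (hits i A) \<omega>)"
  let ?r = "\<lambda>\<omega>. \<Prod>i\<in>{Suc k..<n}. indicator (follows i (x i)) \<omega> :: ennreal"
  let ?q = "\<lambda>\<omega>. \<Prod>i\<in>{Suc k..<n}. ennreal (weight (env \<omega>) (x i))"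
  have lm: "?l \<in> borel_measurable M"
    using kn by (intro borel_measurable_times_ennreal measurable_compose[OF zM measurable_ennreal] borel_measurable_prod_ennreal borel_measurable_indicator hits_sets) auto
  have rm: "?r \<in> borel_measurable M"
    by (intro borel_measurable_prod_ennreal borel_measurable_indicator follows_sets) auto
  have "(\<integral>\<^sup>+\<omega>. ennreal (z (env \<omega>)) * (\<Prod>i<Suc k. indicator (hits i A) \<omega>) * ?r \<omega> \<partial>M)
      = (\<integral>\<^sup>+\<omega>. (\<integral>\<^sup>+v. ?l \<omega> * indicator (follows k v) \<omega> * ?r \<omega> \<partial>count_space A) \<partial>M)"
    by (intro nn_integral_cong) (simp add: indicator_hits[OF A, of k] nn_integral_cmult nn_integral_multc mult.assoc)
  also have "\<dots> = (\<integral>\<^sup>+v. (\<integral>\<^sup>+\<omega>. ?l \<omega> * indicator (follows k v) \<omega> * ?r \<omega> \<partial>M) \<partial>count_space A)"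
    using kn by (intro nn_integral_count_space_nn_integral cA borel_measurable_times_ennreal lm rm borel_measurable_indicator follows_sets)
  also have "\<dots> = (\<integral>\<^sup>+v. (\<integral>\<^sup>+\<omega>. ennreal (z (env \<omega>)) * mass A (env \<omega>) ^ k * ennreal (weight (env \<omega>) v) * ?q \<omega> \<partial>M) \<partial>count_space A)"
  proof (rule nn_integral_cong)
    fix v assume "v \<in> space (count_space A)"
    hence v: "v \<in> words m" using A by auto
    have s: "(\<Prod>i\<in>{k..<n}. g i ((x(k := v)) i)) = g k v * (\<Prod>i\<in>{Suc k..<n}. g i (x i))" for g :: "nat \<Rightarrow> nat list \<Rightarrow> ennreal"
    proof -
      have "(\<Prod>i\<in>{Suc k..<n}. g i ((x(k := v)) i)) = (\<Prod>i\<in>{Suc k..<n}. g i (x i))" by (intro prod.cong) auto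
      thus ?thesis using kn by (simp add: prod.atLeast_Suc_lessThan)
    qed
    show "(\<integral>\<^sup>+\<omega>. ?l \<omega> * indicator (follows k v) \<omega> * ?r \<omega> \<partial>M) = (\<integral>\<^sup>+\<omega>. ennreal (z (env \<omega>)) * mass A (env \<omega>) ^ k * ennreal (weight (env \<omega>) v) * ?q \<omega> \<partial>M)"
      using Suc.IH[of "x(k := v)"] Suc.prems v kn
      unfolding s[of "\<lambda>i v. indicator (follows i v) _"] s[of "\<lambda>i v. ennreal (weight (env _) v)"]
      by (simp add: mult.assoc)
  qed
  also have "\<dots> = (\<integral>\<^sup>+\<omega>. (\<integral>\<^sup>+v. ennreal (z (env \<omega>)) * mass A (env \<omega>) ^ k * ennreal (weight (env \<omega>) v) * ?q \<omega> \<partial>count_space A) \<partial>M)"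
    by (intro nn_integral_count_space_nn_integral[symmetric] cA) measurable
  also have "\<dots> = (\<integral>\<^sup>+\<omega>. ennreal (z (env \<omega>)) * mass A (env \<omega>) ^ Suc k * ?q \<omega> \<partial>M)"
    by (intro nn_integral_cong) (simp add: mass_def nn_integral_cmult nn_integral_multc mult_ac)
  finally show ?case .
qed

lemma all_balls_in_set:
  fixes z :: "(nat list \<Rightarrow> nat \<Rightarrow> real) \<Rightarrow> real"
  assumes z: "z \<in> borel_measurable env_space" "\<And>e. 0 \<le> z e" "\<And>e. z e \<le> 1" and A: "A \<subseteq> words m"
  shows "(\<integral>\<^sup>+\<omega>. ennreal (z (env \<omega>)) * indicator {\<omega>. \<forall>i<n. \<omega> \<in> hits i A} \<omega> \<partial>M) = (\<integral>\<^sup>+\<omega>. ennreal (z (env \<omega>)) * mass A (env \<omega>) ^ n \<partial>M)"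
proof -
  have "replicate m 0 \<in> words m" by (simp add: words_def)
  from balls_in_set_then_paths[OF z A order.refl, of "\<lambda>_. replicate m 0"] this
  show ?thesis by (simp add: prod_indicator_eq Ball_def)
qed

lemma AE_mass_words: "AE \<omega> in M. mass (words m) (env \<omega>) = 1"
  using AE_total_env
proof eventually_elim
  case (elim \<omega>)
  have "mass (words m) (env \<omega>) = tree_sum ennreal m 1 (env \<omega>)"
    by (simp add: tree_sum_eq_words mass_def)
  thus ?case using tree_sum_total[OF elim, of 1 m] by simp
qed

text \<open>The weights of a generation add up to \<open>1\<close>, so no probability is left for balls that skip an ancestor.\<close>

lemma AE_hits_words: "AE \<omega> in M. \<forall>i<n. \<omega> \<in> hits i (words m)"
proof -
  let ?S = "{\<omega> \<in> space M. \<forall>i\<in>{..<n}. \<omega> \<in> hits i (words m)}"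
  have S: "?S \<in> sets M"
    by (intro sets.sets_Collect_finite_All) (auto intro!: sets_Collect_mem hits_sets)
  have "emeasure M ?S = (\<integral>\<^sup>+\<omega>. ennreal 1 * indicator {\<omega>. \<forall>i<n. \<omega> \<in> hits i (words m)} \<omega> \<partial>M)"
    using S by (simp only: nn_integral_indicator[symmetric] ennreal_1 mult_1) (rule nn_integral_cong, auto simp: indicator_def)
  also have "\<dots> = (\<integral>\<^sup>+\<omega>. ennreal 1 * mass (words m) (env \<omega>) ^ n \<partial>M)"
    by (rule all_balls_in_set[of "\<lambda>_. 1"]) auto
  also have "\<dots> = (\<integral>\<^sup>+\<omega>. 1 \<partial>M)"
  proof (rule nn_integral_cong_AE)
    show "AE \<omega> in M. ennreal 1 * mass (words m) (env \<omega>) ^ n = 1"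
      using AE_mass_words[of m] by eventually_elim simp
  qed
  also have "\<dots> = 1" by (simp add: emeasure_space_1)
  finally have "prob ?S = 1" by (simp add: measure_def)
  hence "AE \<omega> in M. \<omega> \<in> ?S" using S by (simp add: prob_eq_1)
  thus ?thesis by eventually_elim auto
qed

lemma balls_avoid:
  fixes z :: "(nat list \<Rightarrow> nat \<Rightarrow> real) \<Rightarrow> real"
  assumes z: "z \<in> borel_measurable env_space" "\<And>e. 0 \<le> z e" "\<And>e. z e \<le> 1" and B: "B \<subseteq> words m" "finite B"
  shows "(\<integral>\<^sup>+\<omega>. ennreal (z (env \<omega>)) * indicator {\<omega>. \<forall>i<n. X i m \<omega> \<notin> B} \<omega> \<partial>M)
    = (\<integral>\<^sup>+\<omega>. ennreal (z (env \<omega>)) * ennreal ((1 - (\<Sum>v\<in>B. weight (env \<omega>) v)) ^ n) \<partial>M)"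
    and "AE \<omega> in M. (\<Sum>v\<in>B. weight (env \<omega>) v) \<le> 1"
proof -
  have mB: "AE \<omega> in M. (\<Sum>v\<in>B. weight (env \<omega>) v) \<le> 1 \<and> mass (words m - B) (env \<omega>) = ennreal (1 - (\<Sum>v\<in>B. weight (env \<omega>) v))"
    using AE_mass_words[of m] AE_total_env
  proof eventually_elim
    case (elim \<omega>)
    have pos: "0 \<le> weight (env \<omega>) v" for v
      using elim(2) weight_bounds[of "env \<omega>" v] by (simp add: total_env_def)
    define b where "b = (\<Sum>v\<in>B. weight (env \<omega>) v)"
    have b: "b \<ge> 0" using pos by (auto simp: b_def intro: sum_nonneg)
    have "mass B (env \<omega>) = ennreal b"
      unfolding mass_def b_def using B(2) pos by (simp add: nn_integral_count_space_finite sum_ennreal)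
    hence eq: "1 = mass (words m - B) (env \<omega>) + ennreal b"
      using elim(1) nn_integral_count_space_diff[OF B(1), of "\<lambda>v. ennreal (weight (env \<omega>) v)"] by (simp add: mass_def)
    hence "mass (words m - B) (env \<omega>) \<noteq> \<top>" by auto
    then obtain a where a: "mass (words m - B) (env \<omega>) = ennreal a" "a \<ge> 0"
      by (metis ennreal_cases)
    have "ennreal 1 = ennreal (a + b)" using eq a b by simp
    hence "1 = a + b" using a b by (subst (asm) ennreal_inj) auto
    thus ?case using a unfolding b_def[symmetric] by auto
  qed
  thus "AE \<omega> in M. (\<Sum>v\<in>B. weight (env \<omega>) v) \<le> 1" by eventually_elim auto
  have "(\<integral>\<^sup>+\<omega>. ennreal (z (env \<omega>)) * indicator {\<omega>. \<forall>i<n. X i m \<omega> \<notin> B} \<omega> \<partial>M)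
     = (\<integral>\<^sup>+\<omega>. ennreal (z (env \<omega>)) * indicator {\<omega>. \<forall>i<n. \<omega> \<in> hits i (words m - B)} \<omega> \<partial>M)"
  proof (rule nn_integral_cong_AE)
    show "AE \<omega> in M. ennreal (z (env \<omega>)) * indicator {\<omega>. \<forall>i<n. X i m \<omega> \<notin> B} \<omega>
       = ennreal (z (env \<omega>)) * indicator {\<omega>. \<forall>i<n. \<omega> \<in> hits i (words m - B)} \<omega>"
      using AE_hits_words[of m]
    proof eventually_elim
      case (elim \<omega>)
      have "\<omega> \<in> hits i (words m - B) \<longleftrightarrow> X i m \<omega> \<notin> B" if hi: "i < n" for i
      proof -
        obtain v where v: "v \<in> words m" "\<omega> \<in> follows i v" using elim hi by (auto simp: hits_def)
        have X: "X i m \<omega> = u" if "u \<in> words m" "\<omega> \<in> follows i u" for u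
          using that by (auto simp: follows_def words_def)
        show ?thesis using v X by (auto simp: hits_def)
      qed
      thus ?case by (simp add: indicator_def)
    qed
  qed
  also have "\<dots> = (\<integral>\<^sup>+\<omega>. ennreal (z (env \<omega>)) * mass (words m - B) (env \<omega>) ^ n \<partial>M)"
    by (rule all_balls_in_set[OF z]) auto
  also have "\<dots> = (\<integral>\<^sup>+\<omega>. ennreal (z (env \<omega>)) * ennreal ((1 - (\<Sum>v\<in>B. weight (env \<omega>) v)) ^ n) \<partial>M)"
  proof (rule nn_integral_cong_AE)
    show "AE \<omega> in M. ennreal (z (env \<omega>)) * mass (words m - B) (env \<omega>) ^ n = ennreal (z (env \<omega>)) * ennreal ((1 - (\<Sum>v\<in>B. weight (env \<omega>) v)) ^ n)"
      using mB by eventually_elim (simp add: ennreal_power)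
  qed
  finally show "(\<integral>\<^sup>+\<omega>. ennreal (z (env \<omega>)) * indicator {\<omega>. \<forall>i<n. X i m \<omega> \<notin> B} \<omega> \<partial>M)
    = (\<integral>\<^sup>+\<omega>. ennreal (z (env \<omega>)) * ennreal ((1 - (\<Sum>v\<in>B. weight (env \<omega>) v)) ^ n) \<partial>M)" .
qed

end

context gem_occupancy
begin

definition occ_event :: "nat list \<Rightarrow> 'a set" where
  "occ_event v = {\<omega> \<in> space M. \<exists>i<n. X i (length v) \<omega> = v}"

text \<open>Truncation keeps this in \<open>[0, 1]\<close> for every environment, as is required of test variables.\<close>

definition occ_prob :: "nat list \<Rightarrow> (nat list \<Rightarrow> nat \<Rightarrow> real) \<Rightarrow> real" where
  "occ_prob v e = 1 - (1 - min 1 (max 0 (weight e v))) ^ n"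

lemma occ_event_sets [measurable]: "occ_event v \<in> sets M"
proof -
  have "{\<omega> \<in> space M. X i (length v) \<omega> = v} \<in> sets M" if "i < n" for i
    using measurable_sets[OF X_measurable[OF that], of "{v}"] by (simp add: vimage_def Int_def conj_commute)
  hence "{\<omega> \<in> space M. \<exists>i\<in>{..<n}. X i (length v) \<omega> = v} \<in> sets M"
    by (intro sets.sets_Collect_finite_Ex) auto
  moreover have "{\<omega> \<in> space M. \<exists>i\<in>{..<n}. X i (length v) \<omega> = v} = occ_event v" by (auto simp: occ_event_def)
  ultimately show ?thesis by (simp only:)
qed

lemma occ_prob_measurable [measurable (raw)]:
  assumes [measurable]: "E \<in> measurable M' env_space"
  shows "(\<lambda>p. occ_prob v (E p)) \<in> borel_measurable M'"
  unfolding occ_prob_def by measurable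

lemma occ_prob_bounds: "0 \<le> occ_prob v e" "occ_prob v e \<le> 1"
  unfolding occ_prob_def by (auto intro: power_le_one)

lemma AE_weight_bounds: "AE \<omega> in M. \<forall>v. 0 < weight (env \<omega>) v \<and> weight (env \<omega>) v \<le> 1"
  using AE_total_env by eventually_elim (auto simp: total_env_def dest: weight_bounds)

lemma AE_occ_prob: "AE \<omega> in M. \<forall>v. occ_prob v (env \<omega>) = 1 - (1 - weight (env \<omega>) v) ^ n"
  using AE_weight_bounds
proof eventually_elim
  case (elim \<omega>)
  hence "min 1 (max 0 (weight (env \<omega>) v)) = weight (env \<omega>) v" for v by (simp add: less_imp_le)
  thus ?case by (simp add: occ_prob_def)
qed

lemma finite_cmult_integral:
  fixes z :: "(nat list \<Rightarrow> nat \<Rightarrow> real) \<Rightarrow> real"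
  assumes "\<And>e. z e \<le> 1" "AE \<omega> in M. g \<omega> \<le> 1"
  shows "(\<integral>\<^sup>+\<omega>. ennreal (z (env \<omega>)) * g \<omega> \<partial>M) \<noteq> \<top>"
proof -
  have "(\<integral>\<^sup>+\<omega>. ennreal (z (env \<omega>)) * g \<omega> \<partial>M) \<le> (\<integral>\<^sup>+\<omega>. 1 * 1 \<partial>M)"
  proof (rule nn_integral_mono_AE)
    show "AE \<omega> in M. ennreal (z (env \<omega>)) * g \<omega> \<le> 1 * 1"
      using assms(2)
    proof eventually_elim
      case (elim \<omega>)
      have "ennreal (z (env \<omega>)) \<le> 1" using assms(1) by (simp add: ennreal_le_1)
      thus ?case using elim by (intro mult_mono) auto
    qed
  qed
  also have "\<dots> < \<top>" by (simp add: emeasure_space_1)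
  finally show ?thesis by simp
qed

lemma ball_in_box:
  fixes z :: "(nat list \<Rightarrow> nat \<Rightarrow> real) \<Rightarrow> real"
  assumes z: "z \<in> borel_measurable env_space" "\<And>e. 0 \<le> z e" "\<And>e. z e \<le> 1"
  shows "(\<integral>\<^sup>+\<omega>. ennreal (z (env \<omega>)) * indicator (occ_event v) \<omega> \<partial>M) = (\<integral>\<^sup>+\<omega>. ennreal (z (env \<omega>)) * ennreal (occ_prob v (env \<omega>)) \<partial>M)"
proof -
  have zM [measurable]: "(\<lambda>\<omega>. z (env \<omega>)) \<in> borel_measurable M" by (rule measurable_compose[OF env_measurable z(1)])
  define a where "a = (\<lambda>\<omega>. ennreal ((1 - weight (env \<omega>) v) ^ n))"
  have [measurable]: "a \<in> borel_measurable M" unfolding a_def by measurable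
  have av: "(\<integral>\<^sup>+\<omega>. ennreal (z (env \<omega>)) * indicator {\<omega>. \<forall>i<n. X i (length v) \<omega> \<notin> {v}} \<omega> \<partial>M) = (\<integral>\<^sup>+\<omega>. ennreal (z (env \<omega>)) * a \<omega> \<partial>M)"
    using balls_avoid(1)[OF z, of "{v}" "length v"] by (simp add: words_def a_def)
  have ind: "indicator {\<omega>. \<forall>i<n. X i (length v) \<omega> \<notin> {v}} \<omega> = (indicator (space M - occ_event v) \<omega> :: ennreal)" if "\<omega> \<in> space M" for \<omega>
    using that by (auto simp: indicator_def occ_event_def)
  have "(\<integral>\<^sup>+\<omega>. ennreal (z (env \<omega>)) * a \<omega> \<partial>M) + (\<integral>\<^sup>+\<omega>. ennreal (z (env \<omega>)) * indicator (occ_event v) \<omega> \<partial>M)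
      = (\<integral>\<^sup>+\<omega>. ennreal (z (env \<omega>)) * indicator (space M - occ_event v) \<omega> + ennreal (z (env \<omega>)) * indicator (occ_event v) \<omega> \<partial>M)"
    unfolding av[symmetric] using ind by (subst nn_integral_add) (auto intro!: arg_cong2[where f = "(+)"] nn_integral_cong)
  also have "\<dots> = (\<integral>\<^sup>+\<omega>. ennreal (z (env \<omega>)) \<partial>M)"
    by (intro nn_integral_cong) (auto simp: indicator_def)
  also have "\<dots> = (\<integral>\<^sup>+\<omega>. ennreal (z (env \<omega>)) * a \<omega> + ennreal (z (env \<omega>)) * ennreal (occ_prob v (env \<omega>)) \<partial>M)"
  proof (rule nn_integral_cong_AE)
    show "AE \<omega> in M. ennreal (z (env \<omega>)) = ennreal (z (env \<omega>)) * a \<omega> + ennreal (z (env \<omega>)) * ennreal (occ_prob v (env \<omega>))"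
      using AE_weight_bounds AE_occ_prob
    proof eventually_elim
      case (elim \<omega>)
      have "a \<omega> + ennreal (occ_prob v (env \<omega>)) = ennreal ((1 - weight (env \<omega>) v) ^ n + occ_prob v (env \<omega>))"
        unfolding a_def using elim(1) occ_prob_bounds by (intro ennreal_plus[symmetric] zero_le_power) auto
      also have "\<dots> = 1" using elim(2) by simp
      finally show ?case by (simp add: distrib_left[symmetric])
    qed
  qed
  also have "\<dots> = (\<integral>\<^sup>+\<omega>. ennreal (z (env \<omega>)) * a \<omega> \<partial>M) + (\<integral>\<^sup>+\<omega>. ennreal (z (env \<omega>)) * ennreal (occ_prob v (env \<omega>)) \<partial>M)"
    by (rule nn_integral_add) measurable
  finally have eq: "(\<integral>\<^sup>+\<omega>. ennreal (z (env \<omega>)) * a \<omega> \<partial>M) + (\<integral>\<^sup>+\<omega>. ennreal (z (env \<omega>)) * indicator (occ_event v) \<omega> \<partial>M)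
     = (\<integral>\<^sup>+\<omega>. ennreal (z (env \<omega>)) * a \<omega> \<partial>M) + (\<integral>\<^sup>+\<omega>. ennreal (z (env \<omega>)) * ennreal (occ_prob v (env \<omega>)) \<partial>M)" .
  have "(\<integral>\<^sup>+\<omega>. ennreal (z (env \<omega>)) * a \<omega> \<partial>M) \<noteq> \<top>"
  proof (rule finite_cmult_integral[OF z(3)])
    show "AE \<omega> in M. a \<omega> \<le> 1"
      using AE_weight_bounds
    proof eventually_elim
      case (elim \<omega>)
      hence "(1 - weight (env \<omega>) v) ^ n \<le> 1" by (intro power_le_one) (auto intro: less_imp_le)
      thus ?case by (simp add: a_def ennreal_le_1)
    qed
  qed
  thus ?thesis using eq by (simp add: ennreal_add_left_cancel)
qed

text \<open>Negative correlation: by inclusion and exclusion for the complementary events, this is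
\<open>(1 - p - q)\<^sup>n \<le> (1 - p)\<^sup>n (1 - q)\<^sup>n\<close>.\<close>

lemma balls_in_two_boxes:
  assumes "length v = length w" "v \<noteq> w"
  shows "(\<integral>\<^sup>+\<omega>. indicator (occ_event v) \<omega> * indicator (occ_event w) \<omega> \<partial>M)
      \<le> (\<integral>\<^sup>+\<omega>. ennreal (occ_prob v (env \<omega>)) * ennreal (occ_prob w (env \<omega>)) \<partial>M)"
proof -
  define a where "a = (\<lambda>u \<omega>. ennreal ((1 - weight (env \<omega>) u) ^ n))"
  define b where "b = (\<lambda>\<omega>. ennreal ((1 - (weight (env \<omega>) v + weight (env \<omega>) w)) ^ n))"
  have [measurable]: "a u \<in> borel_measurable M" "b \<in> borel_measurable M" for u unfolding a_def b_def by measurable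
  let ?A = "\<integral>\<^sup>+\<omega>. a v \<omega> \<partial>M" and ?A' = "\<integral>\<^sup>+\<omega>. a w \<omega> \<partial>M"
  have av: "(\<integral>\<^sup>+\<omega>. indicator (space M - occ_event u) \<omega> \<partial>M) = (\<integral>\<^sup>+\<omega>. a u \<omega> \<partial>M)" for u
  proof -
    have "(\<integral>\<^sup>+\<omega>. indicator (space M - occ_event u) \<omega> \<partial>M) = (\<integral>\<^sup>+\<omega>. ennreal 1 * indicator {\<omega>. \<forall>i<n. X i (length u) \<omega> \<notin> {u}} \<omega> \<partial>M)"
      by (intro nn_integral_cong) (auto simp: indicator_def occ_event_def)
    also have "\<dots> = (\<integral>\<^sup>+\<omega>. ennreal 1 * a u \<omega> \<partial>M)"
      using balls_avoid(1)[of "\<lambda>_. 1" "{u}" "length u"] by (simp add: words_def a_def)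
    finally show ?thesis by simp
  qed
  have bv: "(\<integral>\<^sup>+\<omega>. indicator (space M - (occ_event v \<union> occ_event w)) \<omega> \<partial>M) = (\<integral>\<^sup>+\<omega>. b \<omega> \<partial>M)"
  proof -
    have "(\<integral>\<^sup>+\<omega>. indicator (space M - (occ_event v \<union> occ_event w)) \<omega> \<partial>M) = (\<integral>\<^sup>+\<omega>. ennreal 1 * indicator {\<omega>. \<forall>i<n. X i (length v) \<omega> \<notin> {v, w}} \<omega> \<partial>M)"
      using assms(1) by (intro nn_integral_cong) (auto simp: indicator_def occ_event_def)
    also have "\<dots> = (\<integral>\<^sup>+\<omega>. ennreal 1 * b \<omega> \<partial>M)"
      using balls_avoid(1)[of "\<lambda>_. 1" "{v, w}" "length v"] assms by (simp add: words_def b_def)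
    finally show ?thesis by simp
  qed
  have le1: "AE \<omega> in M. weight (env \<omega>) v + weight (env \<omega>) w \<le> 1"
    using balls_avoid(2)[of "\<lambda>_. 1" "{v, w}" "length v"] assms by (simp add: words_def)
  have "(?A + ?A') + (\<integral>\<^sup>+\<omega>. indicator (occ_event v) \<omega> * indicator (occ_event w) \<omega> \<partial>M)
     = (\<integral>\<^sup>+\<omega>. (indicator (space M - occ_event v) \<omega> + indicator (space M - occ_event w) \<omega>) + indicator (occ_event v) \<omega> * indicator (occ_event w) \<omega> \<partial>M)"
    unfolding av[symmetric] by (simp add: nn_integral_add)
  also have "\<dots> = (\<integral>\<^sup>+\<omega>. 1 + indicator (space M - (occ_event v \<union> occ_event w)) \<omega> \<partial>M)"
    by (intro nn_integral_cong) (auto simp: indicator_def)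
  also have "\<dots> = (\<integral>\<^sup>+\<omega>. 1 + b \<omega> \<partial>M)"
    by (simp add: nn_integral_add bv)
  also have "\<dots> \<le> (\<integral>\<^sup>+\<omega>. (a v \<omega> + a w \<omega>) + ennreal (occ_prob v (env \<omega>)) * ennreal (occ_prob w (env \<omega>)) \<partial>M)"
  proof (rule nn_integral_mono_AE)
    show "AE \<omega> in M. 1 + b \<omega> \<le> (a v \<omega> + a w \<omega>) + ennreal (occ_prob v (env \<omega>)) * ennreal (occ_prob w (env \<omega>))"
      using AE_weight_bounds AE_occ_prob le1
    proof eventually_elim
      case (elim \<omega>)
      define p q where "p = weight (env \<omega>) v" and "q = weight (env \<omega>) w"
      have pq: "0 < p" "p \<le> 1" "0 < q" "q \<le> 1" "p + q \<le> 1" using elim(1,3) by (auto simp: p_def q_def)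
      have pw: "0 \<le> (1 - p) ^ n" "0 \<le> (1 - q) ^ n" "(1 - p) ^ n \<le> 1" "(1 - q) ^ n \<le> 1" "0 \<le> (1 - (p + q)) ^ n"
        using pq by (auto intro: power_le_one)
      have "(1 - (p + q)) ^ n \<le> ((1 - p) * (1 - q)) ^ n"
        using pq by (intro power_mono) (auto simp: algebra_simps)
      hence "(1 - (p + q)) ^ n \<le> (1 - p) ^ n * (1 - q) ^ n" by (simp only: power_mult_distrib)
      hence "1 + (1 - (p + q)) ^ n \<le> ((1 - p) ^ n + (1 - q) ^ n) + (1 - (1 - p) ^ n) * (1 - (1 - q) ^ n)"
        by (simp add: algebra_simps)
      hence "ennreal (1 + (1 - (p + q)) ^ n) \<le> ennreal (((1 - p) ^ n + (1 - q) ^ n) + (1 - (1 - p) ^ n) * (1 - (1 - q) ^ n))"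
        by (rule ennreal_leI)
      also have "\<dots> = (ennreal ((1 - p) ^ n) + ennreal ((1 - q) ^ n)) + ennreal (1 - (1 - p) ^ n) * ennreal (1 - (1 - q) ^ n)"
        using pw by (simp add: ennreal_mult)
      finally show ?case using elim(2) pw by (simp add: a_def b_def p_def q_def)
    qed
  qed
  also have "\<dots> = (?A + ?A') + (\<integral>\<^sup>+\<omega>. ennreal (occ_prob v (env \<omega>)) * ennreal (occ_prob w (env \<omega>)) \<partial>M)"
    by (simp add: nn_integral_add)
  finally have le: "(?A + ?A') + (\<integral>\<^sup>+\<omega>. indicator (occ_event v) \<omega> * indicator (occ_event w) \<omega> \<partial>M)
     \<le> (?A + ?A') + (\<integral>\<^sup>+\<omega>. ennreal (occ_prob v (env \<omega>)) * ennreal (occ_prob w (env \<omega>)) \<partial>M)" .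
  have fin: "(\<integral>\<^sup>+\<omega>. a u \<omega> \<partial>M) \<noteq> \<top>" for u
    unfolding av[symmetric] using emeasure_finite[of "space M - occ_event u"] by simp
  have "?A + ?A' \<noteq> \<top>" using fin by (simp add: ennreal_add_eq_top)
  thus ?thesis using le by (simp add: ennreal_add_left_cancel_le)
qed

lemma countable_words: "countable (words m)"
  by (rule countable_subset[OF subset_UNIV]) simp

lemma occupied_eq:
  assumes "\<omega> \<in> space M"
  shows "ennreal (real (occupied n X m \<omega>)) = (\<integral>\<^sup>+v. indicator (occ_event v) \<omega> \<partial>count_space (words m))"
proof -
  define S where "S = {v. length v = m \<and> (\<exists>i<n. X i m \<omega> = v)}"
  have "S \<subseteq> (\<lambda>i. X i m \<omega>) ` {..<n}"
  proof
    fix v assume "v \<in> S"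
    then obtain i where "i < n" "X i m \<omega> = v" by (auto simp: S_def)
    thus "v \<in> (\<lambda>i. X i m \<omega>) ` {..<n}" by (intro image_eqI[of _ _ i]) simp_all
  qed
  hence "finite S" by (rule finite_subset) simp
  have "(\<integral>\<^sup>+v. indicator (occ_event v) \<omega> \<partial>count_space (words m)) = (\<integral>\<^sup>+v. indicator S v \<partial>count_space (words m))"
    using assms by (intro nn_integral_cong) (auto simp: indicator_def S_def words_def occ_event_def)
  also have "\<dots> = emeasure (count_space (words m)) S"
    by (rule nn_integral_indicator) (auto simp: S_def words_def)
  also have "\<dots> = of_nat (card S)"
    using \<open>finite S\<close> by (intro emeasure_count_space_finite) (auto simp: S_def words_def)
  finally show ?thesis by (simp add: occupied_def S_def ennreal_of_nat_eq_real_of_nat)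
qed

lemma occupied_measurable: "(\<lambda>\<omega>. real (occupied n X m \<omega>)) \<in> borel_measurable M"
proof -
  have "(\<lambda>\<omega>. \<integral>\<^sup>+v. indicator (occ_event v) \<omega> \<partial>count_space (words m)) \<in> borel_measurable M"
    by (rule measurable_nn_integral_count_space) measurable
  hence "(\<lambda>\<omega>. ennreal (real (occupied n X m \<omega>))) \<in> borel_measurable M"
    using occupied_eq by (simp cong: measurable_cong)
  hence "(\<lambda>\<omega>. enn2real (ennreal (real (occupied n X m \<omega>)))) \<in> borel_measurable M" by measurable
  thus ?thesis by simp
qed

text \<open>The conditional mean of the number of occupied boxes given the environment.\<close>

abbreviation occ_mean :: "nat \<Rightarrow> (nat list \<Rightarrow> nat \<Rightarrow> real) \<Rightarrow> ennreal" where
  "occ_mean m \<equiv> tree_sum (\<lambda>z. ennreal (occ n z)) m (real n)"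

lemma AE_occ_mean_eq:
  assumes n: "n > 0"
  shows "AE \<omega> in M. occ_mean m (env \<omega>) = (\<integral>\<^sup>+v. ennreal (occ_prob v (env \<omega>)) \<partial>count_space (words m))"
  using AE_weight_bounds
proof eventually_elim
  case (elim \<omega>)
  have "occ n (real n * weight (env \<omega>) v) = occ_prob v (env \<omega>)" for v
    using elim n by (simp add: occ_def occ_prob_def less_imp_le)
  thus ?case by (simp add: tree_sum_eq_words)
qed

lemma AE_occ_mean_le:
  assumes n: "n > 0"
  shows "AE \<omega> in M. occ_mean m (env \<omega>) \<le> ennreal (real n)"
  using AE_total_env
proof eventually_elim
  case (elim \<omega>)
  have "occ_mean m (env \<omega>) \<le> ennreal (1 * real n)"
    by (rule tree_sum_linear_bound)
       (use elim n occ_bounds(2)[OF _ n] in \<open>auto simp: total_env_def intro: ennreal_leI\<close>)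
  thus ?case by simp
qed

text \<open>Expanding the square, the mixed term reduces to the second moment of the conditional mean. In the
second moment of the number of occupied boxes, pairs of distinct boxes contribute at most the same,
and the diagonal contributes the mean.\<close>

theorem occupied_vs_conditional_mean:
  assumes n: "n > 0"
  shows "(\<integral>\<^sup>+\<omega>. ennreal ((real (occupied n X m \<omega>) - enn2real (occ_mean m (env \<omega>)))\<^sup>2) \<partial>M)
     \<le> (\<integral>\<^sup>+e. occ_mean m e \<partial>env_law)"
proof -
  let ?W = "count_space (words m)"
  let ?O = "\<lambda>v \<omega>. indicator (occ_event v) \<omega> :: ennreal" and ?G = "\<lambda>v \<omega>. ennreal (occ_prob v (env \<omega>))"
  let ?K = "\<lambda>\<omega>. real (occupied n X m \<omega>)"
  define R where "R = (\<lambda>\<omega>. \<integral>\<^sup>+v. ?G v \<omega> \<partial>?W)"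
  note [measurable] = occupied_measurable
  have [measurable]: "R \<in> borel_measurable M"
    unfolding R_def by (rule measurable_nn_integral_count_space) measurable
  define ER where "ER = (\<integral>\<^sup>+\<omega>. R \<omega> \<partial>M)"
  define ER2 where "ER2 = (\<integral>\<^sup>+\<omega>. (R \<omega>)\<^sup>2 \<partial>M)"
  have swap: "(\<integral>\<^sup>+\<omega>. (\<integral>\<^sup>+v. f v \<omega> \<partial>?W) * (\<integral>\<^sup>+w. g w \<omega> \<partial>?W) \<partial>M) = (\<integral>\<^sup>+v. \<integral>\<^sup>+w. (\<integral>\<^sup>+\<omega>. f v \<omega> * g w \<omega> \<partial>M) \<partial>?W \<partial>?W)"
    if [measurable]: "\<And>v. f v \<in> borel_measurable M" "\<And>v. g v \<in> borel_measurable M" for f g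
  proof -
    have gm: "(\<lambda>\<omega>. \<integral>\<^sup>+w. g w \<omega> \<partial>?W) \<in> borel_measurable M"
      by (rule measurable_nn_integral_count_space) (rule that)
    have "(\<integral>\<^sup>+\<omega>. (\<integral>\<^sup>+v. f v \<omega> \<partial>?W) * (\<integral>\<^sup>+w. g w \<omega> \<partial>?W) \<partial>M) = (\<integral>\<^sup>+\<omega>. (\<integral>\<^sup>+v. f v \<omega> * (\<integral>\<^sup>+w. g w \<omega> \<partial>?W) \<partial>?W) \<partial>M)"
      by (simp add: nn_integral_multc)
    also have "\<dots> = (\<integral>\<^sup>+v. (\<integral>\<^sup>+\<omega>. f v \<omega> * (\<integral>\<^sup>+w. g w \<omega> \<partial>?W) \<partial>M) \<partial>?W)"
      by (intro nn_integral_count_space_nn_integral countable_words borel_measurable_times_ennreal gm that)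
    also have "\<dots> = (\<integral>\<^sup>+v. (\<integral>\<^sup>+\<omega>. (\<integral>\<^sup>+w. f v \<omega> * g w \<omega> \<partial>?W) \<partial>M) \<partial>?W)"
      by (simp add: nn_integral_cmult)
    also have "\<dots> = (\<integral>\<^sup>+v. \<integral>\<^sup>+w. (\<integral>\<^sup>+\<omega>. f v \<omega> * g w \<omega> \<partial>M) \<partial>?W \<partial>?W)"
      by (intro nn_integral_cong nn_integral_count_space_nn_integral countable_words borel_measurable_times_ennreal that)
    finally show ?thesis .
  qed
  have Gm: "?G v \<in> borel_measurable M" and Om: "?O v \<in> borel_measurable M" for v by measurable
  have Kint: "(\<integral>\<^sup>+\<omega>. ennreal (?K \<omega>) * F \<omega> \<partial>M) = (\<integral>\<^sup>+\<omega>. (\<integral>\<^sup>+v. ?O v \<omega> \<partial>?W) * F \<omega> \<partial>M)" for F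
    by (intro nn_integral_cong) (simp add: occupied_eq)
  have ER2_eq: "ER2 = (\<integral>\<^sup>+v. \<integral>\<^sup>+w. (\<integral>\<^sup>+\<omega>. ?G v \<omega> * ?G w \<omega> \<partial>M) \<partial>?W \<partial>?W)"
    unfolding ER2_def R_def power2_eq_square by (rule swap[OF Gm Gm])
  have OG: "(\<integral>\<^sup>+\<omega>. ?O v \<omega> * ?G w \<omega> \<partial>M) = (\<integral>\<^sup>+\<omega>. ?G v \<omega> * ?G w \<omega> \<partial>M)" for v w
    using ball_in_box[of "occ_prob w" v] occ_prob_bounds occ_prob_measurable[of "\<lambda>e. e" env_space w]
    by (simp add: mult.commute)
  have OO: "(\<integral>\<^sup>+\<omega>. ?O v \<omega> * ?O w \<omega> \<partial>M) \<le> (\<integral>\<^sup>+\<omega>. ?G v \<omega> * ?G w \<omega> \<partial>M) + (\<integral>\<^sup>+\<omega>. ?G v \<omega> \<partial>M) * indicator {v} w"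
    if "v \<in> words m" "w \<in> words m" for v w
  proof (cases "v = w")
    case True
    have "(\<integral>\<^sup>+\<omega>. ?O v \<omega> * ?O w \<omega> \<partial>M) = (\<integral>\<^sup>+\<omega>. ennreal 1 * ?O v \<omega> \<partial>M)"
      using True by (intro nn_integral_cong) (auto simp: indicator_def)
    also have "\<dots> = (\<integral>\<^sup>+\<omega>. ennreal 1 * ?G v \<omega> \<partial>M)" by (rule ball_in_box[of "\<lambda>_. 1"]) auto
    finally show ?thesis using True by simp
  next
    case False
    thus ?thesis using balls_in_two_boxes[of v w] that by (simp add: words_def)
  qed
  have KR: "(\<integral>\<^sup>+\<omega>. ennreal (?K \<omega>) * R \<omega> \<partial>M) = ER2"
    unfolding Kint R_def swap[OF Om Gm] OG ER2_eq ..
  have KK: "(\<integral>\<^sup>+\<omega>. (ennreal (?K \<omega>))\<^sup>2 \<partial>M) \<le> ER2 + ER"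
  proof -
    have "(\<integral>\<^sup>+\<omega>. (ennreal (?K \<omega>))\<^sup>2 \<partial>M) = (\<integral>\<^sup>+\<omega>. (\<integral>\<^sup>+v. ?O v \<omega> \<partial>?W) * (\<integral>\<^sup>+v. ?O v \<omega> \<partial>?W) \<partial>M)"
      by (intro nn_integral_cong) (simp add: occupied_eq power2_eq_square)
    also have "\<dots> = (\<integral>\<^sup>+v. \<integral>\<^sup>+w. (\<integral>\<^sup>+\<omega>. ?O v \<omega> * ?O w \<omega> \<partial>M) \<partial>?W \<partial>?W)" by (rule swap[OF Om Om])
    also have "\<dots> \<le> (\<integral>\<^sup>+v. \<integral>\<^sup>+w. (\<integral>\<^sup>+\<omega>. ?G v \<omega> * ?G w \<omega> \<partial>M) + (\<integral>\<^sup>+\<omega>. ?G v \<omega> \<partial>M) * indicator {v} w \<partial>?W \<partial>?W)"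
      by (intro nn_integral_mono OO) auto
    also have "\<dots> = ER2 + (\<integral>\<^sup>+v. \<integral>\<^sup>+w. (\<integral>\<^sup>+\<omega>. ?G v \<omega> \<partial>M) * indicator {v} w \<partial>?W \<partial>?W)"
      unfolding ER2_eq by (simp add: nn_integral_add)
    also have "(\<integral>\<^sup>+v. \<integral>\<^sup>+w. (\<integral>\<^sup>+\<omega>. ?G v \<omega> \<partial>M) * indicator {v} w \<partial>?W \<partial>?W) = (\<integral>\<^sup>+v. (\<integral>\<^sup>+\<omega>. ?G v \<omega> \<partial>M) \<partial>?W)"
      by (intro nn_integral_cong) (simp add: nn_integral_cmult)
    also have "\<dots> = ER"
      unfolding ER_def R_def
      by (intro nn_integral_count_space_nn_integral[symmetric] countable_words Gm)
    finally show ?thesis .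
  qed
  have ER: "ER = (\<integral>\<^sup>+e. occ_mean m e \<partial>env_law)"
  proof -
    have "ER = (\<integral>\<^sup>+\<omega>. occ_mean m (env \<omega>) \<partial>M)"
      unfolding ER_def R_def using AE_occ_mean_eq[OF n, of m] by (intro nn_integral_cong_AE) (auto elim!: eventually_mono)
    also have "\<dots> = (\<integral>\<^sup>+e. occ_mean m e \<partial>env_law)" by (rule nn_integral_env) measurable
    finally show ?thesis .
  qed
  have Rn: "AE \<omega> in M. R \<omega> = occ_mean m (env \<omega>) \<and> R \<omega> \<le> ennreal (real n)"
    using AE_occ_mean_eq[OF n, of m] AE_occ_mean_le[OF n, of m] unfolding R_def by eventually_elim auto
  have ER2fin: "ER2 \<noteq> \<top>"
  proof -
    have "ER2 \<le> (\<integral>\<^sup>+\<omega>. (ennreal (real n))\<^sup>2 \<partial>M)"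
      unfolding ER2_def
    proof (rule nn_integral_mono_AE)
      show "AE \<omega> in M. (R \<omega>)\<^sup>2 \<le> (ennreal (real n))\<^sup>2"
        using Rn by eventually_elim (intro power_mono, auto)
    qed
    also have "\<dots> < \<top>" by (simp add: emeasure_space_1 ennreal_power)
    finally show ?thesis by simp
  qed
  define I where "I = (\<integral>\<^sup>+\<omega>. ennreal ((?K \<omega> - enn2real (occ_mean m (env \<omega>)))\<^sup>2) \<partial>M)"
  have "I + 2 * ER2 = (\<integral>\<^sup>+\<omega>. ennreal ((?K \<omega> - enn2real (occ_mean m (env \<omega>)))\<^sup>2) + 2 * (ennreal (?K \<omega>) * R \<omega>) \<partial>M)"
    unfolding I_def KR[symmetric] by (subst nn_integral_add) (auto simp: nn_integral_cmult)
  also have "\<dots> = (\<integral>\<^sup>+\<omega>. (ennreal (?K \<omega>))\<^sup>2 + (R \<omega>)\<^sup>2 \<partial>M)"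
  proof (rule nn_integral_cong_AE)
    show "AE \<omega> in M. ennreal ((?K \<omega> - enn2real (occ_mean m (env \<omega>)))\<^sup>2) + 2 * (ennreal (?K \<omega>) * R \<omega>) = (ennreal (?K \<omega>))\<^sup>2 + (R \<omega>)\<^sup>2"
      using Rn
    proof eventually_elim
      case (elim \<omega>)
      define a where "a = ?K \<omega>"
      have "R \<omega> < \<top>" using elim by (auto intro: le_less_trans)
      then obtain b where b: "R \<omega> = ennreal b" "b \<ge> 0" by (metis less_top_ennreal)
      have "a \<ge> 0" by (simp add: a_def)
      have "ennreal ((a - b)\<^sup>2) + 2 * (ennreal a * ennreal b) = ennreal ((a - b)\<^sup>2 + 2 * (a * b))"
        using b(2) \<open>a \<ge> 0\<close> by (simp add: ennreal_mult flip: ennreal_numeral)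
      also have "(a - b)\<^sup>2 + 2 * (a * b) = a\<^sup>2 + b\<^sup>2" by (simp add: power2_diff)
      also have "ennreal (a\<^sup>2 + b\<^sup>2) = (ennreal a)\<^sup>2 + (ennreal b)\<^sup>2"
        using b(2) \<open>a \<ge> 0\<close> by (simp add: ennreal_power)
      finally have eq: "ennreal ((a - b)\<^sup>2) + 2 * (ennreal a * ennreal b) = (ennreal a)\<^sup>2 + (ennreal b)\<^sup>2" .
      have oeq: "occ_mean m (env \<omega>) = ennreal b"
        by (rule trans[OF conjunct1[OF elim, symmetric] b(1)])
      show ?case unfolding oeq b(1) enn2real_ennreal[OF b(2)] by (rule eq[unfolded a_def])
    qed
  qed
  also have "\<dots> = (\<integral>\<^sup>+\<omega>. (ennreal (?K \<omega>))\<^sup>2 \<partial>M) + ER2"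
    unfolding ER2_def by (rule nn_integral_add) measurable
  also have "\<dots> \<le> (ER2 + ER) + ER2" using KK by (rule add_right_mono)
  finally have "(ER2 + ER2) + I \<le> (ER2 + ER2) + ER" by (simp add: mult_2 add_ac)
  moreover have "ER2 + ER2 \<noteq> \<top>" using ER2fin by (simp add: ennreal_add_eq_top)
  ultimately have "I \<le> ER" by (simp add: ennreal_add_left_cancel_le)
  thus ?thesis by (simp add: I_def ER)
qed

end

section \<open>Asymptotics of the exponent and of the errors\<close>

lemma logpow_continuous:
  assumes "k > 0" shows "continuous_on S (logpow k)"
proof -
  have "logpow k = (\<lambda>z. ln (max z 1) ^ k / fact k)"
    using assms by (auto simp: logpow_def fun_eq_iff max_def zero_power)
  thus ?thesis by (simp only:) (intro continuous_intros, auto)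
qed

lemma logpow_mult: "logpow k z * logpow l z = real ((k + l) choose k) * logpow (k + l) z"
proof -
  have "real ((k + l) choose k) = fact (k + l) / (fact k * fact l)"
    using binomial_fact[of k "k + l"] by simp
  thus ?thesis by (simp add: logpow_def power_add)
qed

lemma logpow_has_integral:
  assumes "x \<ge> 0"
  shows "((\<lambda>z. logpow k z / max z 1) has_integral logpow (Suc k) x) {0..x}"
proof -
  have "((\<lambda>z. logpow k z / max z 1) has_integral (logpow (Suc k) x - logpow (Suc k) 0)) {0..x}"
  proof (rule fundamental_theorem_of_calculus_interior_strong[of "{1}"])
    fix z assume z: "z \<in> {0<..<x} - {1}"
    show "(logpow (Suc k) has_vector_derivative logpow k z / max z 1) (at z)"
    proof (cases "z < 1")
      case True
      have "((\<lambda>_. 0::real) has_vector_derivative 0) (at z)" by simp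
      hence "(logpow (Suc k) has_vector_derivative 0) (at z)"
        by (rule has_vector_derivative_transform_within_open[of _ _ _ "{..<1}"]) (use True in \<open>auto simp: logpow_def\<close>)
      thus ?thesis using True by (simp add: logpow_def)
    next
      case False
      hence z1: "z > 1" using z by auto
      have "((\<lambda>z. ln z ^ Suc k) has_real_derivative (real (Suc k) * (1 / z * ln z ^ k))) (at z)"
        using DERIV_chain2[OF DERIV_pow[of "Suc k" "ln z" UNIV] DERIV_ln_divide[of z]] z1 by simp
      from DERIV_cdivide[OF this, of "fact (Suc k)"]
      have "((\<lambda>z. ln z ^ Suc k / fact (Suc k)) has_vector_derivative ln z ^ k / fact k * (1 / z)) (at z)"
        by (simp del: of_nat_Suc add: field_simps has_real_derivative_iff_has_vector_derivative)
      hence "(logpow (Suc k) has_vector_derivative ln z ^ k / fact k * (1 / z)) (at z)"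
        by (rule has_vector_derivative_transform_within_open[of _ _ _ "{1<..}"]) (use z1 in \<open>auto simp: logpow_def\<close>)
      thus ?thesis using z1 by (simp add: logpow_def)
    qed
  qed (use assms in \<open>auto intro: logpow_continuous\<close>)
  thus ?thesis by (simp add: logpow_def)
qed

lemma iexp_third_order: "norm (iexp x - 1 - \<i> * of_real x + of_real (x\<^sup>2 / 2)) \<le> \<bar>x\<bar> ^ 3 / 6"
proof -
  have "(\<Sum>k\<le>2. (\<i> * of_real x) ^ k / fact k) = 1 + \<i> * of_real x - of_real (x\<^sup>2 / 2)"
    by (simp add: numeral_2_eq_2 power_mult_distrib)
  thus ?thesis using iexp_approx1[of x 2] by (simp add: algebra_simps fact_numeral eval_nat_numeral)
qed

text \<open>Taylor expansion of \<open>exp (\<i> H) - 1\<close> to second order under the integral. The remainder \<open>\<bar>H\<bar>\<^sup>3 / 6\<close> is at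
most \<open>B H\<^sup>2 / 6\<close>, so it is small compared with the second-order term when the largest jump \<open>B\<close> is.\<close>

lemma poisson_exponent_approx:
  fixes b :: "'i \<Rightarrow> real" and k :: "'i \<Rightarrow> nat"
  assumes I: "finite I" and k: "\<And>i. i \<in> I \<Longrightarrow> k i > 0" and x: "x \<ge> 1"
  defines "H \<equiv> \<lambda>z. \<Sum>i\<in>I. b i * logpow (k i) z"
  defines "S1 \<equiv> \<Sum>i\<in>I. b i * logpow (Suc (k i)) x"
  defines "S2 \<equiv> \<Sum>i\<in>I. \<Sum>l\<in>I. b i * b l * (real ((k i + k l) choose k i) * logpow (Suc (k i + k l)) x)"
  defines "B \<equiv> \<Sum>i\<in>I. \<bar>b i\<bar> * logpow (k i) x"
  shows "norm (integral {0..x} (char_exponent_density H) - \<i> * of_real S1 + of_real (S2 / 2)) \<le> B / 6 * S2"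
proof -
  have cont: "continuous_on S H" for S
    unfolding H_def using k by (intro continuous_intros logpow_continuous)
  have H0: "H z = 0" if "z \<le> 1" for z
    unfolding H_def using k that by (intro sum.neutral) (auto simp: logpow_def)
  have HB: "\<bar>H z\<bar> \<le> B" if "z \<le> x" for z
  proof -
    have "\<bar>H z\<bar> \<le> (\<Sum>i\<in>I. \<bar>b i * logpow (k i) z\<bar>)" unfolding H_def by (rule sum_abs)
    also have "\<dots> \<le> B" unfolding B_def
      using logpow_mono[OF that] logpow_nonneg by (intro sum_mono) (auto simp: abs_mult intro!: mult_left_mono)
    finally show ?thesis .
  qed
  have i0: "(char_exponent_density H has_integral integral {0..x} (char_exponent_density H)) {0..x}"
    by (rule integrable_integral, rule integrable_continuous_real, rule char_exponent_density_continuous)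
       (use cont H0 in auto)
  have i1: "((\<lambda>z. H z / max z 1) has_integral S1) {0..x}"
  proof -
    have "((\<lambda>z. \<Sum>i\<in>I. b i * (logpow (k i) z / max z 1)) has_integral S1) {0..x}"
      unfolding S1_def using x I by (intro has_integral_sum has_integral_mult_right logpow_has_integral) auto
    thus ?thesis by (simp add: H_def sum_divide_distrib)
  qed
  have i2: "((\<lambda>z. (H z)\<^sup>2 / max z 1) has_integral S2) {0..x}"
  proof -
    have "(H z)\<^sup>2 / max z 1 = (\<Sum>i\<in>I. \<Sum>l\<in>I. b i * b l * (real ((k i + k l) choose k i) * (logpow (k i + k l) z / max z 1)))" for z
    proof -
      have "(H z)\<^sup>2 = (\<Sum>i\<in>I. \<Sum>l\<in>I. (b i * logpow (k i) z) * (b l * logpow (k l) z))"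
        unfolding H_def power2_eq_square sum_product ..
      also have "\<dots> = (\<Sum>i\<in>I. \<Sum>l\<in>I. b i * b l * (real ((k i + k l) choose k i) * logpow (k i + k l) z))"
        by (intro sum.cong refl) (simp add: logpow_mult[symmetric])
      finally show ?thesis by (simp add: sum_divide_distrib)
    qed
    moreover have "((\<lambda>z. \<Sum>i\<in>I. \<Sum>l\<in>I. b i * b l * (real ((k i + k l) choose k i) * (logpow (k i + k l) z / max z 1))) has_integral S2) {0..x}"
      unfolding S2_def using x I by (intro has_integral_sum has_integral_mult_right logpow_has_integral) auto
    ultimately show ?thesis by simp
  qed
  have i1': "((\<lambda>z. \<i> * of_real (H z / max z 1)) has_integral \<i> * of_real S1) {0..x}"
    by (rule has_integral_mult_right, rule has_integral_linear[OF i1 bounded_linear_of_real, unfolded o_def])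
  have i2': "((\<lambda>z. of_real ((H z)\<^sup>2 / max z 1 / 2)) has_integral complex_of_real (S2 / 2)) {0..x}"
    by (rule has_integral_linear[OF has_integral_divide[OF i2, of 2] bounded_linear_of_real, unfolded o_def])
  note tot = has_integral_add[OF has_integral_diff[OF i0 i1'] i2']
  have bnd: "norm (char_exponent_density H z - \<i> * of_real (H z / max z 1) + of_real ((H z)\<^sup>2 / max z 1 / 2)) \<le> B / 6 * ((H z)\<^sup>2 / max z 1)"
    if "z \<in> {0..x}" for z
  proof -
    define d where "d = max z 1"
    have d: "d > 0" by (simp add: d_def)
    have "char_exponent_density H z - \<i> * of_real (H z / d) + of_real ((H z)\<^sup>2 / d / 2)
       = (iexp (H z) - 1 - \<i> * of_real (H z) + of_real ((H z)\<^sup>2 / 2)) / of_real d"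
      using d by (simp add: char_exponent_density_def d_def[symmetric] field_simps)
    hence "norm (char_exponent_density H z - \<i> * of_real (H z / d) + of_real ((H z)\<^sup>2 / d / 2))
       = norm (iexp (H z) - 1 - \<i> * of_real (H z) + of_real ((H z)\<^sup>2 / 2)) / d"
      using d by (simp add: norm_divide)
    also have "\<dots> \<le> (\<bar>H z\<bar> ^ 3 / 6) / d"
      using d by (intro divide_right_mono iexp_third_order) auto
    also have "\<bar>H z\<bar> ^ 3 = \<bar>H z\<bar> * (H z)\<^sup>2" by (simp add: power3_eq_cube power2_eq_square)
    also have "\<bar>H z\<bar> * (H z)\<^sup>2 / 6 / d \<le> B * (H z)\<^sup>2 / 6 / d"
      using HB that d by (intro divide_right_mono mult_right_mono) auto
    finally show ?thesis by (simp add: d_def)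
  qed
  have "norm (integral {0..x} (\<lambda>z. char_exponent_density H z - \<i> * of_real (H z / max z 1) + of_real ((H z)\<^sup>2 / max z 1 / 2)))
     \<le> integral {0..x} (\<lambda>z. B / 6 * ((H z)\<^sup>2 / max z 1))"
    by (rule integral_norm_bound_integral[OF has_integral_integrable[OF tot] has_integral_integrable[OF has_integral_mult_right[OF i2]] bnd])
  also have "\<dots> = B / 6 * S2" by (rule integral_unique[OF has_integral_mult_right[OF i2]])
  finally show ?thesis by (simp only: integral_unique[OF tot])
qed

text \<open>The factor in front of the centred number of boxes of generation \<open>k + 1\<close>, with \<open>\<alpha> = \<lfloor>j\<^sub>n\<rfloor>\<close> and
\<open>L = ln n\<close>.\<close>

definition normaliser :: "real \<Rightarrow> real \<Rightarrow> nat \<Rightarrow> real" where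
  "normaliser \<alpha> L k = sqrt \<alpha> * fact k / (L ^ k * sqrt L)"

context
  fixes \<alpha> L :: real and x :: real
  assumes \<alpha>: "\<alpha> > 0" and L: "L > 0" and x: "x \<ge> 1" "ln x = L"
begin

lemma normaliser_nonneg: "0 \<le> normaliser \<alpha> L k"
  using \<alpha> L by (simp add: normaliser_def)

lemma logpow_x: "logpow k x = L ^ k / fact k"
  using x by (simp add: logpow_def)

lemma logpow_x_Suc: "logpow k x = (real (Suc k) / L) * logpow (Suc k) x"
proof -
  have f: "fact (Suc k) = real (Suc k) * fact k" by simp
  have "P / F = (c / L) * (L * P / (c * F))" if "c > 0" "F > 0" for P F c :: real
    using that L by simp
  from this[of "real (Suc k)" "fact k" "L ^ k"] show ?thesis
    unfolding logpow_x f by simp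
qed

text \<open>The size of one jump after normalisation, and the scale of all errors.\<close>

lemma normaliser_logpow: "normaliser \<alpha> L k * logpow k x = sqrt (\<alpha> / L)"
  using \<alpha> L by (simp add: normaliser_def logpow_x real_sqrt_divide)

text \<open>This is the covariance of the normalised renewal sums. The binomial coefficient of the product
\<open>logpow k * logpow l\<close> and the factorials of both normalisers give \<open>(k + l)!\<close>, which is \<open>(k + l + 1)!\<close>
up to the factor that remains.\<close>

lemma normaliser_pair:
  "normaliser \<alpha> L k * normaliser \<alpha> L l * (real ((k + l) choose k) * logpow (Suc (k + l)) x) = \<alpha> / real (Suc (k + l))"
proof -
  have c: "real ((k + l) choose k) = fact (k + l) / (fact k * fact l)"
    using binomial_fact[of k "k + l"] by simp
  have f: "fact (Suc (k + l)) = real (Suc (k + l)) * fact (k + l)" by simp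
  have s: "sqrt \<alpha> * sqrt \<alpha> = \<alpha>" "sqrt L * sqrt L = L" using \<alpha> L by auto
  have "normaliser \<alpha> L k * normaliser \<alpha> L l = (sqrt \<alpha> * sqrt \<alpha>) * (fact k * fact l) / (L ^ k * L ^ l * (sqrt L * sqrt L))"
    by (simp only: normaliser_def times_divide_times_eq mult_ac)
  also have "\<dots> = \<alpha> * (fact k * fact l) / (L ^ Suc (k + l))" unfolding s by (simp add: power_add mult_ac)
  finally show ?thesis
    unfolding logpow_x c f using L by (simp del: of_nat_Suc add: field_simps)
qed

lemma normaliser_square: "(normaliser \<alpha> L k)\<^sup>2 = \<alpha> * (fact k)\<^sup>2 / (L ^ (2 * k) * L)"
  using \<alpha> L by (simp add: normaliser_def power_divide power_mult_distrib power_mult mult.commute[of 2])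

text \<open>As long as \<open>2 k \<le> L\<close>, consecutive terms \<open>L\<^sup>i / i!\<close> at least double, so a sum is at most twice its last
term.\<close>

lemma small_or_log_le:
  assumes "2 * real k \<le> L"
  shows "small_or_log k x \<le> 2 * logpow k x"
  using assms
proof (induction k)
  case 0
  thus ?case using x by (simp add: small_or_log_def logpow_def)
next
  case (Suc k)
  have "small_or_log (Suc k) x = small_or_log k x + logpow (Suc k) x" by (simp add: small_or_log_def)
  also have "small_or_log k x \<le> 2 * logpow k x" using Suc by auto
  also have "2 * logpow k x \<le> logpow (Suc k) x"
  proof -
    have "2 * logpow k x = (2 * real (Suc k) / L) * logpow (Suc k) x"
      using logpow_x_Suc[of k] by simp
    also have "\<dots> \<le> 1 * logpow (Suc k) x"
      using Suc.prems L logpow_nonneg by (intro mult_right_mono) auto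
    finally show ?thesis by simp
  qed
  finally show ?case by simp
qed

lemma fact_le_scaled:
  assumes "k > 0" "real k \<le> L"
  shows "fact k / L ^ k \<le> real k / L"
  using assms
proof (induction k rule: nat_induct_non_zero)
  case (Suc k)
  have "fact (Suc k) / L ^ Suc k = (real (Suc k) / L) * (fact k / L ^ k)" using L by simp
  also have "\<dots> \<le> (real (Suc k) / L) * 1"
  proof (rule mult_left_mono)
    have "fact k / L ^ k \<le> real k / L" using Suc by auto
    also have "\<dots> \<le> 1" using Suc.prems L by simp
    finally show "fact k / L ^ k \<le> 1" .
  qed (use L in auto)
  finally show ?case by simp
qed simp

lemma occ_mean_scaled:
  assumes "k > 0" "2 * real k \<le> L"
  shows "(normaliser \<alpha> L k)\<^sup>2 * (logpow (Suc k) x + 2 * small_or_log k x) \<le> 5 * (\<alpha> / L)"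
proof -
  have fk: "fact k / L ^ k \<le> real k / L" using assms L by (intro fact_le_scaled) auto
  have "(normaliser \<alpha> L k)\<^sup>2 * (logpow (Suc k) x + 2 * small_or_log k x) \<le> (normaliser \<alpha> L k)\<^sup>2 * (logpow (Suc k) x + 4 * logpow k x)"
    using small_or_log_le[OF assms(2)] by (intro mult_left_mono) auto
  also have "\<dots> = (\<alpha> / real (Suc k) + 4 * (\<alpha> / L)) * (fact k / L ^ k)"
    unfolding normaliser_square logpow_x using L
    by (simp add: field_simps power2_eq_square power_mult mult_2 power_add del: of_nat_Suc)
  also have "\<dots> \<le> (\<alpha> / real (Suc k) + 4 * (\<alpha> / L)) * (real k / L)"
    using \<alpha> L fk by (intro mult_left_mono add_nonneg_nonneg) auto
  also have "\<dots> = (\<alpha> / L) * (real k / real (Suc k) + 4 * (real k / L))"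
    by (simp add: field_simps)
  also have "\<dots> \<le> (\<alpha> / L) * (1 + 4 * 1)"
    using \<alpha> L assms by (intro mult_left_mono add_mono) auto
  finally show ?thesis by (simp add: mult.commute)
qed

lemma central_binomial_step: "2 * real ((2 * q) choose q) \<le> real ((2 * Suc q) choose Suc q)"
proof -
  have "(2 * Suc q) choose Suc q = ((2 * q + 1) choose q) + ((2 * q + 1) choose Suc q)" by simp
  also have "(2 * q + 1) choose Suc q = (2 * q + 1) choose q"
    using binomial_symmetric[of "Suc q" "2 * q + 1"] by simp
  finally have "(2 * Suc q) choose Suc q = 2 * ((2 * q + 1) choose q)" by simp
  moreover have "(2 * q) choose q \<le> (2 * q + 1) choose q"
    by (cases q) auto
  ultimately show ?thesis by (simp del: binomial_Suc_Suc)
qed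

text \<open>Again the terms at least double, now because the central binomial coefficients do.\<close>

lemma pair_sum_le:
  assumes "2 * real (k + q) \<le> L"
  shows "(\<Sum>i\<le>q. real ((2 * i) choose i) * logpow (Suc (k + i)) x) \<le> 2 * (real ((2 * q) choose q) * logpow (Suc (k + q)) x)"
  using assms
proof (induction q)
  case 0
  thus ?case using logpow_nonneg[of "Suc k" x] by simp
next
  case (Suc q)
  let ?T = "\<lambda>i. real ((2 * i) choose i) * logpow (Suc (k + i)) x"
  have "(\<Sum>i\<le>Suc q. ?T i) \<le> 2 * ?T q + ?T (Suc q)" using Suc by (simp del: binomial_Suc_Suc)
  also have "2 * ?T q \<le> ?T (Suc q)"
  proof -
    have "2 * ?T q \<le> real ((2 * Suc q) choose Suc q) * logpow (Suc (k + q)) x"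
      using mult_right_mono[OF central_binomial_step[of q] logpow_nonneg[of "Suc (k + q)" x]] by (simp add: mult.assoc del: binomial_Suc_Suc)
    also have "logpow (Suc (k + q)) x \<le> logpow (Suc (k + Suc q)) x"
    proof -
      have "logpow (Suc (k + q)) x = (real (Suc (k + Suc q)) / L) * logpow (Suc (k + Suc q)) x"
        using logpow_x_Suc[of "Suc (k + q)"] by simp
      also have "\<dots> \<le> 1 * logpow (Suc (k + Suc q)) x"
        using Suc.prems L logpow_nonneg by (intro mult_right_mono) auto
      finally show ?thesis by simp
    qed
    finally show ?thesis by (simp add: mult_left_mono del: binomial_Suc_Suc)
  qed
  finally show ?case by simp
qed

text \<open>The sum is dominated by its last term. There all factorials cancel up to
\<open>k\<^sup>2 / ((2 k) (2 k - 1)) \<le> 1\<close>.\<close>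

lemma first_gen_error_scaled:
  assumes "k > 0" "4 * real k \<le> L"
  shows "(normaliser \<alpha> L k)\<^sup>2 * (\<Sum>q<k. real ((2 * q) choose q) * logpow (Suc (k + q)) x) \<le> 2 * (\<alpha> / L)"
proof -
  obtain p where p: "k = Suc p" using assms(1) by (cases k) auto
  have c: "real ((2 * p) choose p) = fact (2 * p) / (fact p)\<^sup>2"
    using binomial_fact[of p "2 * p"] by (simp add: mult_2 power2_eq_square)
  have "(normaliser \<alpha> L k)\<^sup>2 * (\<Sum>q<k. real ((2 * q) choose q) * logpow (Suc (k + q)) x)
     \<le> (normaliser \<alpha> L k)\<^sup>2 * (2 * (real ((2 * p) choose p) * logpow (Suc (k + p)) x))"
    unfolding p lessThan_Suc_atMost using pair_sum_le[of "Suc p" p] assms by (intro mult_left_mono) (auto simp: p)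
  also have "Suc (k + p) = 2 * Suc p" by (simp add: p)
  also have "(normaliser \<alpha> L k)\<^sup>2 * (2 * (real ((2 * p) choose p) * logpow (2 * Suc p) x)) =
      2 * (\<alpha> / L) * ((real (Suc p))\<^sup>2 * fact (2 * p) / fact (2 * Suc p))"
    unfolding normaliser_square logpow_x c p using L by (simp add: field_simps power2_eq_square del: of_nat_Suc)
  finally have "(normaliser \<alpha> L k)\<^sup>2 * (\<Sum>q<k. real ((2 * q) choose q) * logpow (Suc (k + q)) x)
      \<le> 2 * (\<alpha> / L) * ((real (Suc p))\<^sup>2 * fact (2 * p) / fact (2 * Suc p))" .
  also have "\<dots> \<le> 2 * (\<alpha> / L) * 1"
  proof (rule mult_left_mono)
    have "fact (2 * Suc p) = real (2 * p + 2) * real (2 * p + 1) * fact (2 * p)" by (simp add: algebra_simps)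
    moreover have "(real (Suc p))\<^sup>2 \<le> real (2 * p + 2) * real (2 * p + 1)" by (simp add: power2_eq_square algebra_simps)
    ultimately have "(real (Suc p))\<^sup>2 * fact (2 * p) \<le> fact (2 * Suc p)" by (simp add: mult_right_mono del: of_nat_Suc)
    thus "(real (Suc p))\<^sup>2 * fact (2 * p) / fact (2 * Suc p) \<le> 1" by simp
  qed (use \<alpha> L in auto)
  finally show ?thesis by simp
qed

end

section \<open>Reduction to the first generation\<close>

lemma (in prob_space) nn_integral_abs_le_sqrt:
  assumes [measurable]: "f \<in> borel_measurable M" and "c > 0"
    and sq: "(\<integral>\<^sup>+\<omega>. ennreal ((f \<omega>)\<^sup>2) \<partial>M) \<le> ennreal c"
  shows "(\<integral>\<^sup>+\<omega>. ennreal \<bar>f \<omega>\<bar> \<partial>M) \<le> ennreal (sqrt c)"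
proof -
  define s where "s = sqrt c"
  have s: "s > 0" "s\<^sup>2 = c" using \<open>c > 0\<close> by (auto simp: s_def)
  have "\<bar>y\<bar> \<le> s / 2 + (1 / (2 * s)) * y\<^sup>2" for y :: real
  proof -
    have "0 \<le> (\<bar>y\<bar> - s)\<^sup>2" by simp
    hence "2 * s * \<bar>y\<bar> \<le> s\<^sup>2 + y\<^sup>2" by (simp add: power2_diff mult_ac)
    thus ?thesis using s(1) by (simp add: field_simps power2_eq_square)
  qed
  hence "(\<integral>\<^sup>+\<omega>. ennreal \<bar>f \<omega>\<bar> \<partial>M) \<le> (\<integral>\<^sup>+\<omega>. ennreal (s / 2 + (1 / (2 * s)) * (f \<omega>)\<^sup>2) \<partial>M)"
    by (intro nn_integral_mono ennreal_leI)
  also have "\<dots> = (\<integral>\<^sup>+\<omega>. ennreal (s / 2) + ennreal (1 / (2 * s)) * ennreal ((f \<omega>)\<^sup>2) \<partial>M)"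
    using s(1) by (intro nn_integral_cong) (subst ennreal_plus, auto simp: ennreal_mult[symmetric])
  also have "\<dots> = ennreal (s / 2) + ennreal (1 / (2 * s)) * (\<integral>\<^sup>+\<omega>. ennreal ((f \<omega>)\<^sup>2) \<partial>M)"
    by (subst nn_integral_add) (auto simp: nn_integral_cmult emeasure_space_1)
  also have "\<dots> \<le> ennreal (s / 2) + ennreal (1 / (2 * s)) * ennreal c"
    using sq by (intro add_left_mono mult_left_mono) auto
  also have "\<dots> = ennreal (s / 2 + 1 / (2 * s) * c)"
    using s(1) \<open>c > 0\<close> by (simp add: ennreal_mult[symmetric] flip: ennreal_plus)
  also have "s / 2 + 1 / (2 * s) * c = s" using s by (simp add: field_simps power2_eq_square)
  finally show ?thesis by (simp add: s_def)
qed

lemma nn_integral_abs_triangle: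
  fixes f g h :: "'a \<Rightarrow> real"
  assumes [measurable]: "f \<in> borel_measurable M" "g \<in> borel_measurable M" "h \<in> borel_measurable M"
    and "(\<integral>\<^sup>+\<omega>. ennreal \<bar>f \<omega> - g \<omega>\<bar> \<partial>M) \<le> ennreal a" "(\<integral>\<^sup>+\<omega>. ennreal \<bar>g \<omega> - h \<omega>\<bar> \<partial>M) \<le> ennreal b" "a \<ge> 0" "b \<ge> 0"
  shows "(\<integral>\<^sup>+\<omega>. ennreal \<bar>f \<omega> - h \<omega>\<bar> \<partial>M) \<le> ennreal (a + b)"
proof -
  have "(\<integral>\<^sup>+\<omega>. ennreal \<bar>f \<omega> - h \<omega>\<bar> \<partial>M) \<le> (\<integral>\<^sup>+\<omega>. ennreal \<bar>f \<omega> - g \<omega>\<bar> + ennreal \<bar>g \<omega> - h \<omega>\<bar> \<partial>M)"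
    by (intro nn_integral_mono) (simp add: ennreal_leI flip: ennreal_plus)
  also have "\<dots> = (\<integral>\<^sup>+\<omega>. ennreal \<bar>f \<omega> - g \<omega>\<bar> \<partial>M) + (\<integral>\<^sup>+\<omega>. ennreal \<bar>g \<omega> - h \<omega>\<bar> \<partial>M)"
    by (rule nn_integral_add) measurable
  also have "\<dots> \<le> ennreal a + ennreal b" using assms by (intro add_mono) auto
  also have "\<dots> = ennreal (a + b)" using assms by simp
  finally show ?thesis .
qed

definition first_gen_sum :: "nat \<Rightarrow> real \<Rightarrow> (nat \<Rightarrow> real) \<Rightarrow> real" where
  "first_gen_sum k x p = (\<Sum>r. logpow k (x * p r))"

lemma first_gen_sum_measurable [measurable]: "first_gen_sum k x \<in> borel_measurable seq_space"
  unfolding first_gen_sum_def by measurable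

lemma first_gen_mean_count_fn:
  assumes "good_env e" "x > 0"
  shows "enn2real (first_gen_mean count_fn k x (first_weights e)) = first_gen_sum k x (first_weights e)"
proof -
  have p: "0 < first_weights e r" "\<And>n. (\<Sum>i<n. first_weights e i) \<le> 1" for r
    using assms by (auto simp: good_env_def first_weights_def)
  have "first_gen_mean count_fn k x (first_weights e) = (\<Sum>r. ennreal (logpow k (x * first_weights e r)))"
    unfolding first_gen_mean_def using p assms by (simp add: iterated_logint_count_fn)
  moreover have sum: "summable (\<lambda>r. logpow k (x * first_weights e r))"
  proof -
    have "(\<Sum>r. ennreal (logpow k (x * first_weights e r))) \<le> ennreal (1 * x)"
      by (rule suminf_linear_bound[where f = "\<lambda>z. ennreal (logpow k z)"])
         (use p assms logpow_le in \<open>auto intro: ennreal_leI\<close>)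
    thus ?thesis by (intro summable_suminf_not_top) (use logpow_nonneg in \<open>auto simp: top_unique\<close>)
  qed
  moreover have "(\<Sum>r. ennreal (logpow k (x * first_weights e r))) = ennreal (first_gen_sum k x (first_weights e))"
    unfolding first_gen_sum_def by (intro suminf_ennreal2 logpow_nonneg sum)
  moreover have "first_gen_sum k x (first_weights e) \<ge> 0"
    unfolding first_gen_sum_def by (intro suminf_nonneg logpow_nonneg sum)
  ultimately show ?thesis by simp
qed

context gem_occupancy
begin

lemma env_first_weights: "first_weights (env \<omega>) = P [] \<omega>"
  by (simp add: first_weights_def env_def)

text \<open>The triangle inequality along the chain from the number of occupied boxes over its conditional mean
and the number of heavy boxes to the sum over the first generation.\<close>

lemma occupied_vs_first_gen_sum:
  assumes \<alpha>: "\<alpha> > 0" and n: "n > 1" and k: "k > 0" "4 * real k \<le> ln (real n)"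
  shows "(\<integral>\<^sup>+\<omega>. ennreal \<bar>normaliser \<alpha> (ln n) k * (real (occupied n X (Suc k) \<omega>) - first_gen_sum k n (P [] \<omega>))\<bar> \<partial>M)
    \<le> ennreal (9 * sqrt (\<alpha> / ln n))"
proof -
  define L where "L = ln (real n)"
  define c where "c = normaliser \<alpha> L k"
  define s where "s = sqrt (\<alpha> / L)"
  define x where "x = real n"
  have n0: "n > 0" and L: "L > 0" and x: "x > 0" "x \<ge> 1" "ln x = L" using n by (auto simp: L_def x_def)
  note nl = \<alpha> L x(2,3)
  have c0: "c \<ge> 0" unfolding c_def by (rule normaliser_nonneg[OF nl])
  have s: "s > 0" "s\<^sup>2 = \<alpha> / L" using \<alpha> L by (auto simp: s_def)
  have sqrt9: "sqrt 9 = 3" by (rule real_sqrt_unique) auto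
  have kL: "4 * real k \<le> L" "2 * real k \<le> L" using k by (auto simp: L_def)
  let ?K = "\<lambda>\<omega>. real (occupied n X (Suc k) \<omega>)"
  let ?R = "\<lambda>\<omega>. enn2real (occ_mean (Suc k) (env \<omega>))"
  let ?N = "\<lambda>\<omega>. enn2real (tree_sum count_fn (Suc k) x (env \<omega>))"
  let ?Y = "\<lambda>\<omega>. enn2real (first_gen_mean count_fn k x (first_weights (env \<omega>)))"
  note [measurable] = occupied_measurable
  have cmult: "(\<integral>\<^sup>+\<omega>. ennreal ((c * f \<omega>)\<^sup>2) \<partial>M) \<le> ennreal b"
    if [measurable]: "f \<in> borel_measurable M" and "(\<integral>\<^sup>+\<omega>. ennreal ((f \<omega>)\<^sup>2) \<partial>M) \<le> ennreal a" "c\<^sup>2 * a \<le> b" for f a b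
  proof -
    have "(\<integral>\<^sup>+\<omega>. ennreal ((c * f \<omega>)\<^sup>2) \<partial>M) = ennreal (c\<^sup>2) * (\<integral>\<^sup>+\<omega>. ennreal ((f \<omega>)\<^sup>2) \<partial>M)"
      by (subst nn_integral_cmult[symmetric]) (auto simp: power_mult_distrib ennreal_mult)
    also have "\<dots> \<le> ennreal (c\<^sup>2) * ennreal a" using that by (intro mult_left_mono) auto
    also have "\<dots> = ennreal (c\<^sup>2 * a)" by (simp add: ennreal_mult')
    also have "\<dots> \<le> ennreal b" using that by (intro ennreal_leI)
    finally show ?thesis .
  qed
  have 1: "(\<integral>\<^sup>+\<omega>. ennreal \<bar>c * ?K \<omega> - c * ?R \<omega>\<bar> \<partial>M) \<le> ennreal (3 * s)"
  proof -
    have "(\<integral>\<^sup>+\<omega>. ennreal ((?K \<omega> - ?R \<omega>)\<^sup>2) \<partial>M) \<le> (\<integral>\<^sup>+e. occ_mean (Suc k) e \<partial>env_law)"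
      by (rule occupied_vs_conditional_mean[OF n0])
    also have "\<dots> \<le> ennreal (logpow (Suc k) x + 2 * small_or_log k x)"
      unfolding x_def using n0 by (intro occupied_mean_vs_count(2)) auto
    finally have sq: "(\<integral>\<^sup>+\<omega>. ennreal ((c * (?K \<omega> - ?R \<omega>))\<^sup>2) \<partial>M) \<le> ennreal (9 * (\<alpha> / L))"
    proof (rule cmult[rotated])
      have "c\<^sup>2 * (logpow (Suc k) x + 2 * small_or_log k x) \<le> 5 * (\<alpha> / L)"
        unfolding c_def by (rule occ_mean_scaled[OF nl k(1) kL(2)])
      also have "\<dots> \<le> 9 * (\<alpha> / L)" using \<alpha> L by (intro mult_right_mono) auto
      finally show "c\<^sup>2 * (logpow (Suc k) x + 2 * small_or_log k x) \<le> 9 * (\<alpha> / L)" .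
    qed measurable
    have "(\<lambda>\<omega>. c * (?K \<omega> - ?R \<omega>)) \<in> borel_measurable M" by measurable
    hence "(\<integral>\<^sup>+\<omega>. ennreal \<bar>c * (?K \<omega> - ?R \<omega>)\<bar> \<partial>M) \<le> ennreal (sqrt (9 * (\<alpha> / L)))"
      by (rule nn_integral_abs_le_sqrt[OF _ _ sq]) (use \<alpha> L in simp)
    thus ?thesis by (simp only: right_diff_distrib real_sqrt_mult s_def[symmetric] sqrt9)
  qed
  have 2: "(\<integral>\<^sup>+\<omega>. ennreal \<bar>c * ?R \<omega> - c * ?N \<omega>\<bar> \<partial>M) \<le> ennreal (4 * s)"
  proof -
    have "(\<integral>\<^sup>+\<omega>. ennreal \<bar>c * ?R \<omega> - c * ?N \<omega>\<bar> \<partial>M) = ennreal c * (\<integral>\<^sup>+\<omega>. ennreal \<bar>?R \<omega> - ?N \<omega>\<bar> \<partial>M)"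
      using c0 by (subst nn_integral_cmult[symmetric]) (auto simp: right_diff_distrib[symmetric] abs_mult ennreal_mult)
    also have "(\<integral>\<^sup>+\<omega>. ennreal \<bar>?R \<omega> - ?N \<omega>\<bar> \<partial>M) = (\<integral>\<^sup>+e. ennreal \<bar>enn2real (occ_mean (Suc k) e) - enn2real (tree_sum count_fn (Suc k) x e)\<bar> \<partial>env_law)"
      by (rule nn_integral_env) measurable
    also have "\<dots> \<le> ennreal (2 * small_or_log k x)"
      unfolding x_def using n0 by (intro occupied_mean_vs_count(1)) auto
    also have "ennreal c * ennreal (2 * small_or_log k x) = ennreal (c * (2 * small_or_log k x))"
      using c0 by (simp add: ennreal_mult')
    also have "\<dots> \<le> ennreal (4 * s)"
    proof (rule ennreal_leI)
      have "c * (2 * small_or_log k x) \<le> c * (2 * (2 * logpow k x))"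
        using small_or_log_le[OF nl kL(2)] c0 by (intro mult_left_mono) auto
      also have "\<dots> = 4 * s" using normaliser_logpow[OF nl, of k] by (simp add: c_def s_def)
      finally show "c * (2 * small_or_log k x) \<le> 4 * s" .
    qed
    finally show ?thesis by (simp add: mult_left_mono)
  qed
  have 3: "(\<integral>\<^sup>+\<omega>. ennreal \<bar>c * ?N \<omega> - c * ?Y \<omega>\<bar> \<partial>M) \<le> ennreal (2 * s)"
  proof -
    have "(\<integral>\<^sup>+\<omega>. ennreal ((?N \<omega> - ?Y \<omega>)\<^sup>2) \<partial>M) = (\<integral>\<^sup>+e. ennreal ((enn2real (tree_sum count_fn (Suc k) x e) - enn2real (first_gen_mean count_fn k x (first_weights e)))\<^sup>2) \<partial>env_law)"
      by (rule nn_integral_env) measurable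
    also have "\<dots> \<le> ennreal (\<Sum>q<k. real ((2 * q) choose q) * logpow (Suc (k + q)) x)"
      by (rule count_vs_first_gen_mean[OF x(1)])
    finally have sq: "(\<integral>\<^sup>+\<omega>. ennreal ((c * (?N \<omega> - ?Y \<omega>))\<^sup>2) \<partial>M) \<le> ennreal (4 * (\<alpha> / L))"
    proof (rule cmult[rotated])
      have "c\<^sup>2 * (\<Sum>q<k. real ((2 * q) choose q) * logpow (Suc (k + q)) x) \<le> 2 * (\<alpha> / L)"
        unfolding c_def by (rule first_gen_error_scaled[OF nl k(1) kL(1)])
      also have "\<dots> \<le> 4 * (\<alpha> / L)" using \<alpha> L by (intro mult_right_mono) auto
      finally show "c\<^sup>2 * (\<Sum>q<k. real ((2 * q) choose q) * logpow (Suc (k + q)) x) \<le> 4 * (\<alpha> / L)" .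
    qed measurable
    have "(\<lambda>\<omega>. c * (?N \<omega> - ?Y \<omega>)) \<in> borel_measurable M" by measurable
    hence "(\<integral>\<^sup>+\<omega>. ennreal \<bar>c * (?N \<omega> - ?Y \<omega>)\<bar> \<partial>M) \<le> ennreal (sqrt (4 * (\<alpha> / L)))"
      by (rule nn_integral_abs_le_sqrt[OF _ _ sq]) (use \<alpha> L in simp)
    thus ?thesis by (simp only: right_diff_distrib real_sqrt_mult s_def[symmetric] real_sqrt_four)
  qed
  have m: "(\<lambda>\<omega>. c * ?K \<omega>) \<in> borel_measurable M" "(\<lambda>\<omega>. c * ?R \<omega>) \<in> borel_measurable M"
    "(\<lambda>\<omega>. c * ?N \<omega>) \<in> borel_measurable M" "(\<lambda>\<omega>. c * ?Y \<omega>) \<in> borel_measurable M"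
    by measurable
  have "(\<integral>\<^sup>+\<omega>. ennreal \<bar>c * ?K \<omega> - c * ?Y \<omega>\<bar> \<partial>M) \<le> ennreal (3 * s + 4 * s + 2 * s)"
    using s by (intro nn_integral_abs_triangle[OF m(1,3,4) nn_integral_abs_triangle[OF m(1,2,3) 1 2] 3]) auto
  also have "(\<integral>\<^sup>+\<omega>. ennreal \<bar>c * ?K \<omega> - c * ?Y \<omega>\<bar> \<partial>M) = (\<integral>\<^sup>+\<omega>. ennreal \<bar>c * (?K \<omega> - first_gen_sum k x (P [] \<omega>))\<bar> \<partial>M)"
  proof (rule nn_integral_cong_AE)
    show "AE \<omega> in M. ennreal \<bar>c * ?K \<omega> - c * ?Y \<omega>\<bar> = ennreal \<bar>c * (?K \<omega> - first_gen_sum k x (P [] \<omega>))\<bar>"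
      using AE_total_env
    proof eventually_elim
      case (elim \<omega>)
      hence "?Y \<omega> = first_gen_sum k x (P [] \<omega>)"
        using first_gen_mean_count_fn[OF _ x(1), of "env \<omega>" k] by (simp add: total_env_def env_first_weights)
      thus ?case by (simp only: right_diff_distrib)
    qed
  qed
  finally show ?thesis by (simp add: c_def s_def L_def x_def)
qed

end

section \<open>Convergence\<close>

lemma nn_integral_abs_sum_le:
  fixes h :: "'i \<Rightarrow> 'a \<Rightarrow> real"
  assumes "finite U" and [measurable]: "\<And>u. u \<in> U \<Longrightarrow> h u \<in> borel_measurable M"
    and le: "\<And>u. u \<in> U \<Longrightarrow> (\<integral>\<^sup>+\<omega>. ennreal \<bar>h u \<omega>\<bar> \<partial>M) \<le> ennreal e" and "e \<ge> 0"
  shows "(\<integral>\<^sup>+\<omega>. ennreal \<bar>\<Sum>u\<in>U. c u * h u \<omega>\<bar> \<partial>M) \<le> ennreal ((\<Sum>u\<in>U. \<bar>c u\<bar>) * e)"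
proof -
  have "(\<integral>\<^sup>+\<omega>. ennreal \<bar>\<Sum>u\<in>U. c u * h u \<omega>\<bar> \<partial>M) \<le> (\<integral>\<^sup>+\<omega>. (\<Sum>u\<in>U. ennreal \<bar>c u\<bar> * ennreal \<bar>h u \<omega>\<bar>) \<partial>M)"
  proof (intro nn_integral_mono)
    fix \<omega>
    have "\<bar>\<Sum>u\<in>U. c u * h u \<omega>\<bar> \<le> (\<Sum>u\<in>U. \<bar>c u\<bar> * \<bar>h u \<omega>\<bar>)"
      using sum_abs[of "\<lambda>u. c u * h u \<omega>" U] by (simp add: abs_mult)
    hence "ennreal \<bar>\<Sum>u\<in>U. c u * h u \<omega>\<bar> \<le> ennreal (\<Sum>u\<in>U. \<bar>c u\<bar> * \<bar>h u \<omega>\<bar>)" by (rule ennreal_leI)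
    also have "\<dots> = (\<Sum>u\<in>U. ennreal \<bar>c u\<bar> * ennreal \<bar>h u \<omega>\<bar>)"
      by (subst sum_ennreal[symmetric]) (auto simp: ennreal_mult)
    finally show "ennreal \<bar>\<Sum>u\<in>U. c u * h u \<omega>\<bar> \<le> (\<Sum>u\<in>U. ennreal \<bar>c u\<bar> * ennreal \<bar>h u \<omega>\<bar>)" .
  qed
  also have "\<dots> = (\<Sum>u\<in>U. ennreal \<bar>c u\<bar> * (\<integral>\<^sup>+\<omega>. ennreal \<bar>h u \<omega>\<bar> \<partial>M))"
    by (subst nn_integral_sum, measurable) (intro sum.cong refl nn_integral_cmult, measurable)
  also have "\<dots> \<le> (\<Sum>u\<in>U. ennreal \<bar>c u\<bar> * ennreal e)"
    using le by (intro sum_mono mult_left_mono) auto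
  also have "\<dots> = ennreal ((\<Sum>u\<in>U. \<bar>c u\<bar>) * e)"
    using \<open>e \<ge> 0\<close> by (simp add: sum_distrib_right[symmetric] ennreal_mult sum_ennreal sum_nonneg)
  finally show ?thesis .
qed

lemma renewal_sum_linear:
  assumes "finite I" "\<And>i. i \<in> I \<Longrightarrow> summable (\<lambda>r. f i (x * (\<Prod>q<Suc r. w q)))"
  shows "renewal_sum (\<lambda>z. \<Sum>i\<in>I. b i * f i z) x w = (\<Sum>i\<in>I. b i * renewal_sum (f i) x w)"
  unfolding renewal_sum_def using assms
  by (subst suminf_sum) (auto intro!: summable_mult sum.cong suminf_mult simp del: prod.lessThan_Suc)

lemma renewal_char_of_logpows:
  fixes b :: "'i \<Rightarrow> real"
  assumes I: "finite I" and k: "\<And>i. i \<in> I \<Longrightarrow> k i > 0" and x: "x > 0"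
  shows "(\<integral>w. iexp (\<Sum>i\<in>I. b i * (renewal_sum (logpow (k i)) x w - l i)) \<partial>unif_seq)
    = exp (integral {0..x} (char_exponent_density (\<lambda>z. \<Sum>i\<in>I. b i * logpow (k i) z)) - \<i> * of_real (\<Sum>i\<in>I. b i * l i))"
proof -
  define H where "H = (\<lambda>z. \<Sum>i\<in>I. b i * logpow (k i) z)"
  have cont: "continuous_on UNIV H"
    unfolding H_def using k by (intro continuous_intros logpow_continuous)
  have H0: "H z = 0" if "z \<le> 1" for z
    unfolding H_def using k that by (intro sum.neutral) (auto simp: logpow_def)
  have Hc: "\<bar>H z\<bar> \<le> (\<Sum>i\<in>I. \<bar>b i\<bar>) * z" if "z > 0" for z
  proof -
    have "\<bar>H z\<bar> \<le> (\<Sum>i\<in>I. \<bar>b i * logpow (k i) z\<bar>)" unfolding H_def by (rule sum_abs)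
    also have "\<dots> \<le> (\<Sum>i\<in>I. \<bar>b i\<bar> * z)"
      using logpow_le[OF that] logpow_nonneg by (intro sum_mono) (auto simp: abs_mult intro!: mult_left_mono)
    finally show ?thesis by (simp add: sum_distrib_right)
  qed
  have sm: "AE w in unif_seq. \<forall>i\<in>I. summable (\<lambda>r. logpow (k i) (x * (\<Prod>q<Suc r. w q)))"
    using I
  proof (intro AE_finite_allI)
    fix i
    show "AE w in unif_seq. summable (\<lambda>r. logpow (k i) (x * (\<Prod>q<Suc r. w q)))"
      by (rule AE_summable_renewal_sum[of _ 1]) (use logpow_le logpow_nonneg x in auto)
  qed
  have Hm [measurable]: "H \<in> borel_measurable borel" using cont by (rule borel_measurable_continuous_onI)
  have "(\<integral>w. iexp (\<Sum>i\<in>I. b i * (renewal_sum (logpow (k i)) x w - l i)) \<partial>unif_seq)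
      = (\<integral>w. iexp (- (\<Sum>i\<in>I. b i * l i)) * iexp (renewal_sum H x w) \<partial>unif_seq)"
  proof (rule Bochner_Integration.integral_cong_AE)
    show "AE w in unif_seq. iexp (\<Sum>i\<in>I. b i * (renewal_sum (logpow (k i)) x w - l i)) = iexp (- (\<Sum>i\<in>I. b i * l i)) * iexp (renewal_sum H x w)"
      using sm
    proof eventually_elim
      case (elim w)
      have "renewal_sum H x w = (\<Sum>i\<in>I. b i * renewal_sum (logpow (k i)) x w)"
        unfolding H_def using elim I by (intro renewal_sum_linear) auto
      hence "(\<Sum>i\<in>I. b i * (renewal_sum (logpow (k i)) x w - l i)) = - (\<Sum>i\<in>I. b i * l i) + renewal_sum H x w"
        by (simp add: right_diff_distrib sum_subtractf)
      thus ?case by (simp only: of_real_add distrib_left exp_add)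
    qed
  qed measurable
  also have "\<dots> = iexp (- (\<Sum>i\<in>I. b i * l i)) * renewal_char H x"
    unfolding renewal_char_def by simp
  also have "renewal_char H x = poisson_char H x"
    by (rule renewal_char_eq_poisson_char[OF cont H0 Hc x])
  finally show ?thesis
    unfolding poisson_char_def H_def[symmetric] by (simp add: exp_add[symmetric] algebra_simps)
qed

context gem_occupancy
begin

text \<open>Only laws matter from here on: \<open>P []\<close> has the law of \<open>gem w\<close>, so the chain is continued on the space of
sequences of uniform variables. The constant is \<open>9 + 2\<close>, from the reduction to the first generation
and from the replacement of the GEM weights.\<close>

lemma char_approx:
  fixes c :: "'i \<Rightarrow> real" and k :: "'i \<Rightarrow> nat"
  assumes U: "finite U" and \<alpha>: "\<alpha> > 0" and n: "n > 1"
    and k: "\<And>u. u \<in> U \<Longrightarrow> k u > 0" "\<And>u. u \<in> U \<Longrightarrow> 4 * real (k u) \<le> ln (real n)"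
  defines "a \<equiv> \<lambda>u. normaliser \<alpha> (ln n) (k u)"
  shows "norm ((\<integral>\<omega>. iexp (\<Sum>u\<in>U. c u * (a u * (real (occupied n X (Suc (k u)) \<omega>) - logpow (Suc (k u)) n))) \<partial>M)
      - exp (integral {0..real n} (char_exponent_density (\<lambda>z. \<Sum>u\<in>U. (c u * a u) * logpow (k u) z))
             - \<i> * of_real (\<Sum>u\<in>U. (c u * a u) * logpow (Suc (k u)) n)))
    \<le> 11 * (\<Sum>u\<in>U. \<bar>c u\<bar>) * sqrt (\<alpha> / ln n)"
proof -
  define s where "s = sqrt (\<alpha> / ln n)"
  define C where "C = (\<Sum>u\<in>U. \<bar>c u\<bar>)"
  have n0: "real n > 0" "real n \<ge> 1" "ln (real n) > 0" using n by auto
  have s: "s \<ge> 0" using \<alpha> n0 by (auto simp: s_def)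
  have C: "C \<ge> 0" by (auto simp: C_def intro: sum_nonneg)
  have a0: "a u \<ge> 0" for u unfolding a_def by (rule normaliser_nonneg[OF \<alpha> n0(3) n0(2) refl])
  define Z where "Z = (\<lambda>\<omega>. \<Sum>u\<in>U. c u * (a u * (real (occupied n X (Suc (k u)) \<omega>) - logpow (Suc (k u)) n)))"
  define Y where "Y = (\<lambda>p. \<Sum>u\<in>U. c u * (a u * (first_gen_sum (k u) n p - logpow (Suc (k u)) n)))"
  define W where "W = (\<lambda>w. \<Sum>u\<in>U. (c u * a u) * (renewal_sum (logpow (k u)) n w - logpow (Suc (k u)) n))"
  note [measurable] = occupied_measurable
  have [measurable]: "Z \<in> borel_measurable M" unfolding Z_def by measurable
  have [measurable]: "Y \<in> borel_measurable seq_space" unfolding Y_def by measurable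
  have [measurable]: "W \<in> borel_measurable unif_seq" unfolding W_def by measurable
  have [measurable]: "(\<lambda>\<omega>. Y (P [] \<omega>)) \<in> borel_measurable M" by (rule measurable_compose[OF P_measurable]) measurable
  have [measurable]: "(\<lambda>w. Y (gem w)) \<in> borel_measurable unif_seq" by measurable
  have 1: "(\<integral>\<^sup>+\<omega>. ennreal \<bar>Z \<omega> - Y (P [] \<omega>)\<bar> \<partial>M) \<le> ennreal (C * (9 * s))"
  proof -
    have "Z \<omega> - Y (P [] \<omega>) = (\<Sum>u\<in>U. c u * (a u * (real (occupied n X (Suc (k u)) \<omega>) - first_gen_sum (k u) n (P [] \<omega>))))" for \<omega>
      unfolding Z_def Y_def sum_subtractf[symmetric] by (intro sum.cong refl) (simp add: algebra_simps)
    moreover have "(\<lambda>\<omega>. a u * (real (occupied n X (Suc (k u)) \<omega>) - first_gen_sum (k u) n (P [] \<omega>))) \<in> borel_measurable M" for u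
      by (intro borel_measurable_times borel_measurable_diff borel_measurable_const occupied_measurable measurable_compose[OF P_measurable first_gen_sum_measurable])
    ultimately show ?thesis unfolding C_def
      using occupied_vs_first_gen_sum[OF \<alpha> n k] U s by (simp only:) (intro nn_integral_abs_sum_le, auto simp: a_def s_def)
  qed
  have 2: "(\<integral>\<^sup>+w. ennreal \<bar>Y (gem w) - W w\<bar> \<partial>unif_seq) \<le> ennreal (C * (2 * s))"
  proof -
    have eq: "Y (gem w) - W w = (\<Sum>u\<in>U. c u * (a u * (first_gen_sum (k u) n (gem w) - renewal_sum (logpow (k u)) n w)))" for w
      unfolding Y_def W_def sum_subtractf[symmetric] by (intro sum.cong refl) (simp add: algebra_simps)
    have le: "(\<integral>\<^sup>+w. ennreal \<bar>a u * (first_gen_sum (k u) n (gem w) - renewal_sum (logpow (k u)) n w)\<bar> \<partial>unif_seq) \<le> ennreal (2 * s)" for u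
    proof -
      have "(\<integral>\<^sup>+w. ennreal \<bar>a u * (first_gen_sum (k u) n (gem w) - renewal_sum (logpow (k u)) n w)\<bar> \<partial>unif_seq)
        = (\<integral>\<^sup>+w. ennreal (a u) * ennreal \<bar>renewal_sum (logpow (k u)) n w - first_gen_sum (k u) n (gem w)\<bar> \<partial>unif_seq)"
        using a0 by (intro nn_integral_cong) (simp add: abs_mult ennreal_mult abs_minus_commute)
      also have "\<dots> = ennreal (a u) * (\<integral>\<^sup>+w. ennreal \<bar>renewal_sum (logpow (k u)) n w - first_gen_sum (k u) n (gem w)\<bar> \<partial>unif_seq)"
        by (rule nn_integral_cmult) measurable
      also have "\<dots> \<le> ennreal (a u) * ennreal (2 * logpow (k u) n)"
        unfolding first_gen_sum_def
        by (intro mult_left_mono nn_integral_gem_vs_renewal_sum[where c = 1])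
           (use logpow_nonneg logpow_le logpow_mono n0 in auto)
      also have "\<dots> = ennreal (a u * (2 * logpow (k u) n))" using a0 by (simp add: ennreal_mult')
      also have "a u * (2 * logpow (k u) n) = 2 * s"
        using normaliser_logpow[OF \<alpha> n0(3) n0(2) refl, of "k u"] by (simp add: a_def s_def)
      finally show ?thesis .
    qed
    show ?thesis unfolding eq C_def
    proof (rule nn_integral_abs_sum_le[OF U _ le])
      show "(\<lambda>w. a u * (first_gen_sum (k u) n (gem w) - renewal_sum (logpow (k u)) n w)) \<in> borel_measurable unif_seq" for u
        by measurable
    qed (use s in auto)
  qed
  have law: "(\<integral>\<omega>. iexp (Y (P [] \<omega>)) \<partial>M) = (\<integral>w. iexp (Y (gem w)) \<partial>unif_seq)"
  proof -
    have "(\<integral>\<omega>. iexp (Y (P [] \<omega>)) \<partial>M) = (\<integral>p. iexp (Y p) \<partial>distr M seq_space (P []))"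
      by (rule integral_distr[symmetric]) measurable
    also have "\<dots> = (\<integral>p. iexp (Y p) \<partial>distr unif_seq seq_space gem)" by (simp only: P_law GEM01_eq)
    also have "\<dots> = (\<integral>w. iexp (Y (gem w)) \<partial>unif_seq)" by (rule integral_distr) measurable
    finally show ?thesis .
  qed
  have 3: "(\<integral>w. iexp (W w) \<partial>unif_seq) = exp (integral {0..real n} (char_exponent_density (\<lambda>z. \<Sum>u\<in>U. (c u * a u) * logpow (k u) z))
             - \<i> * of_real (\<Sum>u\<in>U. (c u * a u) * logpow (Suc (k u)) n))"
    unfolding W_def using k(1) n0 U by (intro renewal_char_of_logpows) auto
  have "ennreal (norm ((\<integral>\<omega>. iexp (Z \<omega>) \<partial>M) - (\<integral>\<omega>. iexp (Y (P [] \<omega>)) \<partial>M))) \<le> ennreal (C * (9 * s))"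
    by (rule order.trans[OF char_diff_le 1]) measurable
  hence d1: "norm ((\<integral>\<omega>. iexp (Z \<omega>) \<partial>M) - (\<integral>\<omega>. iexp (Y (P [] \<omega>)) \<partial>M)) \<le> C * (9 * s)"
    using C s by (simp add: ennreal_le_iff)
  have "ennreal (norm ((\<integral>w. iexp (Y (gem w)) \<partial>unif_seq) - (\<integral>w. iexp (W w) \<partial>unif_seq))) \<le> ennreal (C * (2 * s))"
    by (rule order.trans[OF prob_space.char_diff_le[OF unif_seq.P.prob_space_axioms] 2]) measurable
  hence d2: "norm ((\<integral>w. iexp (Y (gem w)) \<partial>unif_seq) - (\<integral>w. iexp (W w) \<partial>unif_seq)) \<le> C * (2 * s)"
    using C s by (simp add: ennreal_le_iff)
  have "norm ((\<integral>\<omega>. iexp (Z \<omega>) \<partial>M) - (\<integral>w. iexp (W w) \<partial>unif_seq)) \<le> C * (9 * s) + C * (2 * s)"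
    using d1 d2 unfolding law by (rule norm_diff_triangle_le)
  thus ?thesis unfolding 3 Z_def C_def s_def by (simp add: algebra_simps)
qed

end

lemma floor_mult_ratio_tendsto:
  fixes j :: "nat \<Rightarrow> real"
  assumes j: "filterlim j at_top sequentially" and u: "u > 0"
  shows "(\<lambda>n. real_of_int \<lfloor>j n * u\<rfloor> / j n) \<longlonglongrightarrow> u"
proof (rule LIM_zero_cancel, rule Lim_null_comparison)
  show "\<forall>\<^sub>F n in sequentially. norm (real_of_int \<lfloor>j n * u\<rfloor> / j n - u) \<le> inverse (j n)"
    using filterlim_at_top_dense[THEN iffD1, OF j, rule_format, of 0]
  proof eventually_elim
    case (elim n)
    have "real_of_int \<lfloor>j n * u\<rfloor> / j n - u = (real_of_int \<lfloor>j n * u\<rfloor> - j n * u) / j n"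
      using elim by (simp add: field_simps)
    moreover have "\<bar>real_of_int \<lfloor>j n * u\<rfloor> - j n * u\<bar> \<le> 1" by linarith
    ultimately show ?case using elim by (simp add: inverse_eq_divide divide_right_mono)
  qed
  show "(\<lambda>n. inverse (j n)) \<longlonglongrightarrow> 0" by (rule tendsto_inverse_0_at_top[OF j])
qed

context
  fixes j :: "nat \<Rightarrow> real"
  assumes j_at_top: "filterlim j at_top sequentially"
    and j_small: "j \<in> o(\<lambda>n. ln (real n))"
begin

lemma eventually_generation:
  assumes u: "u > 0"
  shows "\<forall>\<^sub>F n in sequentially. nat \<lfloor>j n * u\<rfloor> \<ge> 2 \<and> 4 * real (nat \<lfloor>j n * u\<rfloor>) \<le> ln (real n) \<and> j n \<ge> 1 \<and> n > 1"
proof -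
  have "\<forall>\<^sub>F n in sequentially. norm (j n) \<le> (1 / (4 * u)) * norm (ln (real n))"
    using j_small u by (intro landau_o.smallD) auto
  moreover have "\<forall>\<^sub>F n in sequentially. j n \<ge> max 1 (2 / u)"
    using j_at_top unfolding filterlim_at_top by (rule spec)
  ultimately show ?thesis using eventually_gt_at_top[of 1]
  proof eventually_elim
    case (elim n)
    have jn: "j n \<ge> 1" "j n * u \<ge> 2" using elim(2) u by (auto simp: field_simps)
    have "ln (real n) > 0" using elim(3) by simp
    hence "4 * (j n * u) \<le> ln (real n)" using elim(1) jn u by (simp add: field_simps)
    moreover have "real (nat \<lfloor>j n * u\<rfloor>) \<le> j n * u" using jn by linarith
    moreover have "nat \<lfloor>j n * u\<rfloor> \<ge> 2" using jn(2) by linarith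
    ultimately show ?case using jn elim(3) by linarith
  qed
qed

lemma floor_over_log_tendsto: "(\<lambda>n. real_of_int \<lfloor>j n\<rfloor> / ln (real n)) \<longlonglongrightarrow> 0"
proof (rule Lim_null_comparison)
  show "(\<lambda>n. j n / ln (real n)) \<longlonglongrightarrow> 0" using j_small by (rule smalloD_tendsto)
  show "\<forall>\<^sub>F n in sequentially. norm (real_of_int \<lfloor>j n\<rfloor> / ln (real n)) \<le> j n / ln (real n)"
    using eventually_generation[of 1]
  proof (rule eventually_mono)
    fix n assume "nat \<lfloor>j n * 1\<rfloor> \<ge> 2 \<and> 4 * real (nat \<lfloor>j n * 1\<rfloor>) \<le> ln (real n) \<and> j n \<ge> 1 \<and> n > 1"
    hence "ln (real n) > 0" "0 \<le> real_of_int \<lfloor>j n\<rfloor>" "real_of_int \<lfloor>j n\<rfloor> \<le> j n" by auto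
    thus "norm (real_of_int \<lfloor>j n\<rfloor> / ln (real n)) \<le> j n / ln (real n)"
      by (simp add: divide_right_mono)
  qed simp
qed

text \<open>The denominator is \<open>\<lfloor>j\<^sub>n u\<rfloor> + \<lfloor>j\<^sub>n v\<rfloor> - 1\<close> for large \<open>n\<close>.\<close>

lemma covariance_tendsto:
  assumes u: "u > 0" and v: "v > 0"
  shows "(\<lambda>n. real_of_int \<lfloor>j n\<rfloor> / real (Suc ((nat \<lfloor>j n * u\<rfloor> - 1) + (nat \<lfloor>j n * v\<rfloor> - 1)))) \<longlonglongrightarrow> 1 / (u + v)"
proof -
  have A: "(\<lambda>n. (real_of_int \<lfloor>j n * 1\<rfloor> / j n) / (real_of_int \<lfloor>j n * u\<rfloor> / j n + real_of_int \<lfloor>j n * v\<rfloor> / j n - inverse (j n))) \<longlonglongrightarrow> 1 / (u + v - 0)"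
    using u v by (intro tendsto_intros floor_mult_ratio_tendsto j_at_top tendsto_inverse_0_at_top) auto
  have E: "\<forall>\<^sub>F n in sequentially. (real_of_int \<lfloor>j n * 1\<rfloor> / j n) / (real_of_int \<lfloor>j n * u\<rfloor> / j n + real_of_int \<lfloor>j n * v\<rfloor> / j n - inverse (j n))
      = real_of_int \<lfloor>j n\<rfloor> / real (Suc ((nat \<lfloor>j n * u\<rfloor> - 1) + (nat \<lfloor>j n * v\<rfloor> - 1)))"
    using eventually_generation[OF u] eventually_generation[OF v]
  proof eventually_elim
    case (elim n)
    have "real (Suc ((nat \<lfloor>j n * u\<rfloor> - 1) + (nat \<lfloor>j n * v\<rfloor> - 1))) = real_of_int \<lfloor>j n * u\<rfloor> + real_of_int \<lfloor>j n * v\<rfloor> - 1"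
      using elim by linarith
    moreover have "(real_of_int \<lfloor>j n * u\<rfloor> / j n + real_of_int \<lfloor>j n * v\<rfloor> / j n - inverse (j n)) = (real_of_int \<lfloor>j n * u\<rfloor> + real_of_int \<lfloor>j n * v\<rfloor> - 1) / j n"
      by (simp add: add_divide_distrib diff_divide_distrib inverse_eq_divide)
    ultimately show ?case using elim by simp
  qed
  show ?thesis using iffD1[OF tendsto_cong[OF E] A] by (simp only: diff_zero)
qed

lemma scaled_occupancy_eq:
  assumes "nat \<lfloor>j n * u\<rfloor> \<ge> 2" "n > 1"
  defines "k \<equiv> nat \<lfloor>j n * u\<rfloor> - 1"
  shows "scaled_occupancy j X n u \<omega> =
    normaliser (real_of_int \<lfloor>j n\<rfloor>) (ln n) k * (real (occupied n (X n) (Suc k) \<omega>) - logpow (Suc k) n)"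
proof -
  have m: "nat \<lfloor>j n * u\<rfloor> = Suc k" using assms by simp
  have L: "ln (real n) > 0" using assms by simp
  have "real (Suc k) - 1 / 2 = real k + 1 / 2" by simp
  hence "ln (real n) powr (real (Suc k) - 1 / 2) = ln (real n) powr (real k + 1 / 2)" by (simp only:)
  also have "\<dots> = ln (real n) ^ k * sqrt (ln (real n))"
    using L by (simp only: powr_add powr_realpow powr_half_sqrt)
  finally show ?thesis
    using assms(2) unfolding scaled_occupancy_def m Let_def
    by (simp add: normaliser_def logpow_def mult_ac del: fact_Suc of_nat_Suc power_Suc)
qed

text \<open>The exponent \<open>T\<close> is asymptotic to \<open>- S2 / 2\<close>, where \<open>S2\<close> is the quadratic form of \<open>normaliser_pair\<close> and
converges to the quadratic form of the limit process.\<close>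

lemma scaled_occupancy_char_tendsto:
  fixes c :: "real \<Rightarrow> real"
  assumes occ: "\<And>n. gem_occupancy M P n (X n)" and U: "finite U" "U \<subseteq> {0<..}"
  shows "(\<lambda>n. \<integral>\<omega>. iexp (\<Sum>u\<in>U. c u * scaled_occupancy j X n u \<omega>) \<partial>M)
    \<longlonglongrightarrow> exp (- (\<Sum>u\<in>U. \<Sum>v\<in>U. c u * c v / (u + v)) / 2)"
proof -
  define \<alpha> where "\<alpha> = (\<lambda>n. real_of_int \<lfloor>j n\<rfloor>)"
  define k where "k = (\<lambda>n u. nat \<lfloor>j n * u\<rfloor> - 1)"
  define a where "a = (\<lambda>n u. normaliser (\<alpha> n) (ln (real n)) (k n u))"
  define s where "s = (\<lambda>n. sqrt (\<alpha> n / ln (real n)))"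
  define C where "C = (\<Sum>u\<in>U. \<bar>c u\<bar>)"
  define V where "V = (\<Sum>u\<in>U. \<Sum>v\<in>U. c u * c v / (u + v))"
  define S2 where "S2 = (\<lambda>n. \<Sum>u\<in>U. \<Sum>v\<in>U. c u * c v * (\<alpha> n / real (Suc (k n u + k n v))))"
  define T where "T = (\<lambda>n. integral {0..real n} (char_exponent_density (\<lambda>z. \<Sum>u\<in>U. (c u * a n u) * logpow (k n u) z))
             - \<i> * of_real (\<Sum>u\<in>U. (c u * a n u) * logpow (Suc (k n u)) n))"
  have upos: "u > 0" if "u \<in> U" for u using U that by auto
  have s0: "s \<longlonglongrightarrow> 0"
    using tendsto_real_sqrt[OF floor_over_log_tendsto] by (simp add: s_def \<alpha>_def)
  have S2_lim: "S2 \<longlonglongrightarrow> V"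
  proof -
    have "S2 \<longlonglongrightarrow> (\<Sum>u\<in>U. \<Sum>v\<in>U. c u * c v * (1 / (u + v)))"
      unfolding S2_def \<alpha>_def k_def
      by (intro tendsto_sum tendsto_mult tendsto_const covariance_tendsto upos)
    thus ?thesis by (simp add: V_def)
  qed
  have ev: "\<forall>\<^sub>F n in sequentially. (\<forall>u\<in>U. nat \<lfloor>j n * u\<rfloor> \<ge> 2 \<and> 4 * real (nat \<lfloor>j n * u\<rfloor>) \<le> ln (real n) \<and> j n \<ge> 1 \<and> n > 1) \<and> j n \<ge> 1 \<and> n > 1"
    using U(1) eventually_generation[OF upos] eventually_generation[of 1]
    by (intro eventually_conj eventually_ball_finite) (auto elim: eventually_mono)
  have main: "\<forall>\<^sub>F n in sequentially.
      norm ((\<integral>\<omega>. iexp (\<Sum>u\<in>U. c u * scaled_occupancy j X n u \<omega>) \<partial>M) - exp (T n)) \<le> 11 * C * s n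
      \<and> norm (T n + of_real (S2 n / 2)) \<le> (C * s n) / 6 * S2 n"
    using ev
  proof eventually_elim
    case (elim n)
    interpret gem_occupancy M P n "X n" by (rule occ)
    have \<alpha>: "\<alpha> n > 0" using elim by (simp add: \<alpha>_def)
    have n: "n > 1" "real n \<ge> 1" "ln (real n) > 0" using elim by auto
    have k: "k n u > 0" "4 * real (k n u) \<le> ln (real n)" if "u \<in> U" for u
    proof -
      have m: "nat \<lfloor>j n * u\<rfloor> \<ge> 2" "4 * real (nat \<lfloor>j n * u\<rfloor>) \<le> ln (real n)"
        using elim that by blast+
      show "k n u > 0" using m(1) unfolding k_def by linarith
      have "real (k n u) \<le> real (nat \<lfloor>j n * u\<rfloor>)" unfolding k_def by (rule of_nat_mono) (rule diff_le_self)
      thus "4 * real (k n u) \<le> ln (real n)" using m(2) by linarith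
    qed
    note nl = \<alpha> n(3,2) refl
    have "scaled_occupancy j X n u \<omega> = a n u * (real (occupied n (X n) (Suc (k n u)) \<omega>) - logpow (Suc (k n u)) n)" if "u \<in> U" for u \<omega>
      unfolding a_def k_def \<alpha>_def using elim that by (intro scaled_occupancy_eq) auto
    hence "(\<Sum>u\<in>U. c u * scaled_occupancy j X n u \<omega>) = (\<Sum>u\<in>U. c u * (a n u * (real (occupied n (X n) (Suc (k n u)) \<omega>) - logpow (Suc (k n u)) n)))" for \<omega>
      by (intro sum.cong) auto
    hence 1: "norm ((\<integral>\<omega>. iexp (\<Sum>u\<in>U. c u * scaled_occupancy j X n u \<omega>) \<partial>M) - exp (T n)) \<le> 11 * C * s n"
      using char_approx[OF U(1) \<alpha> n(1) k, where c = c] unfolding T_def a_def C_def s_def by simp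
    have S2: "(\<Sum>u\<in>U. \<Sum>v\<in>U. (c u * a n u) * (c v * a n v) * (real ((k n u + k n v) choose k n u) * logpow (Suc (k n u + k n v)) n)) = S2 n"
      unfolding S2_def
    proof (intro sum.cong refl)
      fix u v
      have "(c u * a n u) * (c v * a n v) * (real ((k n u + k n v) choose k n u) * logpow (Suc (k n u + k n v)) n)
        = c u * c v * (a n u * a n v * (real ((k n u + k n v) choose k n u) * logpow (Suc (k n u + k n v)) n))" by (simp only: mult_ac)
      also have "\<dots> = c u * c v * (\<alpha> n / real (Suc (k n u + k n v)))"
        unfolding a_def by (simp only: normaliser_pair[OF nl])
      finally show "(c u * a n u) * (c v * a n v) * (real ((k n u + k n v) choose k n u) * logpow (Suc (k n u + k n v)) n)
        = c u * c v * (\<alpha> n / real (Suc (k n u + k n v)))" .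
    qed
    have B: "(\<Sum>u\<in>U. \<bar>c u * a n u\<bar> * logpow (k n u) n) = C * s n"
      unfolding C_def s_def sum_distrib_right
    proof (intro sum.cong refl)
      fix u
      have "a n u * logpow (k n u) n = sqrt (\<alpha> n / ln (real n))" unfolding a_def by (rule normaliser_logpow[OF nl])
      moreover have "a n u \<ge> 0" unfolding a_def by (rule normaliser_nonneg[OF nl])
      ultimately show "\<bar>c u * a n u\<bar> * logpow (k n u) n = \<bar>c u\<bar> * sqrt (\<alpha> n / ln (real n))"
        by (simp add: abs_mult)
    qed
    have 2: "norm (T n + of_real (S2 n / 2)) \<le> (C * s n) / 6 * S2 n"
      using poisson_exponent_approx[where I = U and k = "k n" and b = "\<lambda>u. c u * a n u" and x = "real n", OF U(1) k(1) n(2)]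
      unfolding S2 B T_def .
    show ?case using 1 2 by blast
  qed
  have T: "T \<longlonglongrightarrow> - of_real V / 2"
  proof -
    have "(\<lambda>n. (C * s n) / 6 * S2 n) \<longlonglongrightarrow> (C * 0) / 6 * V"
      by (intro tendsto_intros s0 S2_lim) auto
    hence "(\<lambda>n. (C * s n) / 6 * S2 n) \<longlonglongrightarrow> 0" by simp
    hence "(\<lambda>n. T n + of_real (S2 n / 2)) \<longlonglongrightarrow> 0"
      by (rule Lim_null_comparison[rotated]) (use main in \<open>auto elim: eventually_mono\<close>)
    moreover have "(\<lambda>n. complex_of_real (S2 n / 2)) \<longlonglongrightarrow> of_real (V / 2)"
      by (intro tendsto_intros S2_lim) auto
    ultimately have "(\<lambda>n. (T n + of_real (S2 n / 2)) - of_real (S2 n / 2)) \<longlonglongrightarrow> 0 - of_real (V / 2)"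
      by (rule tendsto_diff)
    thus ?thesis by simp
  qed
  have "(\<lambda>n. 11 * C * s n) \<longlonglongrightarrow> 11 * C * 0" by (intro tendsto_intros s0)
  hence "(\<lambda>n. 11 * C * s n) \<longlonglongrightarrow> 0" by simp
  hence "(\<lambda>n. (\<integral>\<omega>. iexp (\<Sum>u\<in>U. c u * scaled_occupancy j X n u \<omega>) \<partial>M) - exp (T n)) \<longlonglongrightarrow> 0"
    by (rule Lim_null_comparison[rotated]) (use main in \<open>auto elim: eventually_mono\<close>)
  from tendsto_add[OF this tendsto_exp[OF T]]
  have "(\<lambda>n. \<integral>\<omega>. iexp (\<Sum>u\<in>U. c u * scaled_occupancy j X n u \<omega>) \<partial>M) \<longlonglongrightarrow> exp (- of_real V / 2)" by simp
  moreover have "exp (- of_real V / 2) = complex_of_real (exp (- V / 2))"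
    by (simp add: exp_of_real[symmetric])
  ultimately show ?thesis by (simp only: V_def)
qed

end

theorem theorem2p1:
  fixes M :: "'a measure" and N :: "'b measure"
    and P :: "nat list \<Rightarrow> 'a \<Rightarrow> nat \<Rightarrow> real"
    and X :: "nat \<Rightarrow> nat \<Rightarrow> nat \<Rightarrow> 'a \<Rightarrow> nat list"
    and B :: "real \<Rightarrow> 'b \<Rightarrow> real"
    and j :: "nat \<Rightarrow> real"
  assumes scheme: "\<And>n. nested_occupancy M GEM01 P n (X n)"
    and j_pos: "\<And>n. n \<ge> 1 \<Longrightarrow> j n > 0"
    and j_at_top: "filterlim j at_top sequentially"
    and j_small: "j \<in> o(\<lambda>n. ln (real n))"
    and brownian: "standard_brownian_motion N B"
  shows "fdd_converges {0<..} M (scaled_occupancy j X) N (exp_stieltjes B)"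
proof -
  have occ: "gem_occupancy M P n (X n)" for n
    using scheme by (simp add: gem_occupancy_def)
  interpret occ0: gem_occupancy M P 0 "X 0" by (rule occ)
  interpret B: standard_brownian_motion N B by (rule brownian)
  show ?thesis
  proof (rule fdd_converges_if_chars_converge)
    show "prob_space M" by (rule occ0.prob_space_axioms)
    show "prob_space N" by (rule B.prob_space_axioms)
    show "scaled_occupancy j X n u \<in> borel_measurable M" for n u
      using gem_occupancy.occupied_measurable[OF occ, of n]
      unfolding scaled_occupancy_def[abs_def] Let_def by measurable
    show "exp_stieltjes B u \<in> borel_measurable N" for u by (rule B.exp_stieltjes_measurable)
    fix U :: "real set" and c assume U: "finite U" "U \<subseteq> {0<..}"
    show "(\<lambda>n. \<integral>\<omega>. iexp (\<Sum>u\<in>U. c u * scaled_occupancy j X n u \<omega>) \<partial>M)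
      \<longlonglongrightarrow> (\<integral>\<omega>. iexp (\<Sum>u\<in>U. c u * exp_stieltjes B u \<omega>) \<partial>N)"
      unfolding B.char_exp_stieltjes[OF U] by (rule scaled_occupancy_char_tendsto[OF j_at_top j_small occ U])
  qed
qed

end
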